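(* Let $d\in\{1,2,3\}$, $\nu>0$. Consider the following assumptions. (1) $m_j\in \mathcal W_2^{\nu+d/2}(\mathcal S)$ for $j=1,\ldots,p$, and $M_n$ has rank $p$ for all $n\ge p$. (2) $\Omega_\beta$ is symmetric positive semidefinite; $\pi(\theta|\alpha)$ is a proper density in $\theta\in(0,\infty)$, continuously differentiable in $\theta$, continuous in $\alpha$, finite for all $\theta,\alpha\in(0,\infty)$, not depending on $n$, with $\pi(\theta_0|\alpha)>0$ for all $\alpha>0$. (3) There exist positive constants $C_{\pi,1},C_{\pi,2},C_{\pi,3}$ (which may depend on $\nu,d,T,\alpha_0,\theta_0$) with $C_{\pi,1}+C_{\pi,2}<1/2$ and $C_{\pi,3}<1$ such that for all sufficiently large $n$, $$\sup_{\alpha\in[\underline\alpha_n,\overline\alpha_n]}\ \sup_{\theta\in(\theta_0/2,2\theta_0)}\Big|\frac{\partial\log\pi(\theta|\alpha)}{\partial\theta}\Big|\le n^{C_{\pi,1}},\quad \sup_{\alpha\in[\underline\alpha_n,\overline\alpha_n]}\ \sup_{\theta\in(\theta_0/2,2\theta_0)}\frac{\pi(\theta|\alpha)}{\pi(\theta_0|\alpha)}\le n^{C_{\pi,2}},\quad \inf_{\alpha\in[\underline\alpha_n,\overline\alpha_n]}\log\pi(\theta_0|\alpha)\ge -n^{C_{\pi,3}}.$$ (4) $\pi(\alpha)$ is a proper continuous density on $(0,\infty)$ not depending on $n$, $\pi(\alpha_0)>0$, $\int_0^\infty\pi(\theta_0|\alpha)\pi(\alpha)d\alpha<\infty$, and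 there exist positive constants $\underline{c_\pi}<(\nu+d/2)\underline\kappa$ and $\overline{c_\pi}<(\nu+d/2)\overline\kappa$ such that for all sufficiently large $n$, $$\max\Big\{\int_0^{\underline\alpha_n}\alpha^{-n(\nu+d/2)}\pi(\alpha)d\alpha,\ \int_0^{\underline\alpha_n}\alpha^{-n(\nu+d/2)}\pi(\theta_0|\alpha)\pi(\alpha)d\alpha\Big\}\le\exp(\underline{c_\pi}\,n\log n),$$ $$\max\Big\{\int_{\overline\alpha_n}^\infty\alpha^{n(\nu+d/2)}\pi(\alpha)d\alpha,\ \int_{\overline\alpha_n}^\infty\alpha^{n(\nu+d/2)}\pi(\theta_0|\alpha)\pi(\alpha)d\alpha\Big\}\le\exp(\overline{c_\pi}\,n\log n).$$ Then: (i) Under (1) and (2), for any fixed $\alpha>0$, as $n\to\infty$, almost surely $P_{(\beta_0,\sigma_0^2,\alpha_0)}$, $$\Pi\Big[\sup_{s^*\in\mathcal S\setminus\mathcal S_n}\Big|\frac{\mathrm v_n(s^*;\sigma^2,\alpha)}{\mathrm v_n(s^*;\theta_0/\alpha^{2\nu},\alpha)}-1\Big|>7n^{-1/2}\log n\ \Big|\ Y_n,\alpha\Big]\to0 .$$ (ii) Under (1), (2), (3) and (4), as $n\to\infty$, almost surely $P_{(\beta_0,\sigma_0^2,\alpha_0)}$, $$\Pi\Big[\sup_{s^*\in\mathcal S\setminus\mathcal S_n}\Big|\frac{\mathrm v_n(s^*;\sigma^2,\alpha)}{\mathrm v_n(s^*;\theta_0/\alpha^{2\nu},\alpha)}-1\Big|>7n^{-1/2}\log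 n\ \Big|\ Y_n\Big]\to0 .$$
   Context: Setup. $0<T<\infty$, $\mathcal S=[0,T]^d$, $\nu>0$ is known, $p\ge 1$ is fixed, and $m=(m_1,\ldots,m_p)^\top$ are known functions on $\mathcal S$. For $\alpha>0$ the Matérn correlation function is $K_{\alpha,\nu}(x)=\frac{2^{1-\nu}}{\Gamma(\nu)}(\alpha\|x\|)^{\nu}\mathcal K_\nu(\alpha\|x\|)$ with $K_{\alpha,\nu}(0)=1$, where $\mathcal K_\nu$ is the modified Bessel function of the second kind. The true process is $Y(s)=m(s)^\top\beta_0+X(s)$, $s\in\mathcal S$, where $X$ is a mean-zero Gaussian process with covariance $\sigma_0^2K_{\alpha_0,\nu}(s-t)$; $\beta_0\in\mathbb R^p$, $\sigma_0^2>0$, $\alpha_0>0$ are the fixed true values, $P_{(\beta_0,\sigma_0^2,\alpha_0)}$ is the law of $Y$, and $\theta_0=\sigma_0^2\alpha_0^{2\nu}$. For each $n$, $\mathcal S_n=\{s_1,\ldots,s_n\}\subset\mathcal S$ consists of $n$ distinct points (otherwise arbitrary), $Y_n=(Y(s_1),\ldots,Y(s_n))^\top$, $M_n$ is the $n\times p$ matrix with rows $m(s_i)^\top$, and $R_\alpha$ is the $n\times n$ matrix with entries $K_{\alpha,\nu}(s_i-s_j)$. $\Omega_\beta$ is a fixed symmetric positive semidefinite $p\times p$ matrix, the scaled precision of the prior $\beta|\sigma^2,\alpha\sim\mathcal N(0_p,\sigma^2\Omega_\beta^{-1})$ ($\Omega_\beta=0$ means the flat prior). The restricted log-likelihood (with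 $\beta$ integrated out) is $$\mathcal L_n(\sigma^2,\alpha)=-\tfrac{1}{2\sigma^2}Y_n^\top Q_\alpha Y_n-\tfrac{n-p}{2}\log\sigma^2-\tfrac12\log|R_\alpha|-\tfrac12\log|M_n^\top R_\alpha^{-1}M_n+\Omega_\beta|,$$ $Q_\alpha=R_\alpha^{-1}-R_\alpha^{-1}M_n(M_n^\top R_\alpha^{-1}M_n+\Omega_\beta)^{-1}M_n^\top R_\alpha^{-1}$. With $\theta=\sigma^2\alpha^{2\nu}$, the prior of $(\theta,\alpha)$ has density $\pi(\theta|\alpha)\pi(\alpha)$. $\Pi(\cdot|Y_n)$ is the posterior under which $(\theta,\alpha)$ has density proportional to $\exp\{\mathcal L_n(\theta/\alpha^{2\nu},\alpha)\}\pi(\theta|\alpha)\pi(\alpha)$; $\Pi(\cdot|Y_n,\alpha)$ is the conditional posterior for given $\alpha$, under which $\theta$ has density proportional to $\exp\{\mathcal L_n(\theta/\alpha^{2\nu},\alpha)\}\pi(\theta|\alpha)$; in both cases $\sigma^2=\theta/\alpha^{2\nu}$. Predictive variance: for $s^*\in\mathcal S$, $r_\alpha(s^* )=(K_{\alpha,\nu}(s_1-s^* ),\ldots,K_{\alpha,\nu}(s_n-s^* ))^\top$, $b_\alpha(s^* )=m(s^* )-M_n^\top R_\alpha^{-1}r_\alpha(s^* )$, and $$\mathrm v_n(s^*;\sigma^2,\alpha)=\sigma^2\{1-r_\alpha(s^* )^\top R_\alpha^{-1}r_\alpha(s^* )\}+\sigma^2 b_\alpha(s^* )^\top(M_n^\top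 R_\alpha^{-1}M_n+\Omega_\beta)^{-1}b_\alpha(s^* ).$$ Constants: $\underline\alpha_n=n^{-\underline\kappa}$, $\overline\alpha_n=n^{\overline\kappa}$, with $$\underline\kappa=\tfrac12\min\Big\{\tfrac{0.9}{(2d+0.94)(8\nu+3d-0.9)},\tfrac{1}{4(3\nu+d)},0.01\Big\},\qquad \overline\kappa=\tfrac12\min\Big\{\tfrac{0.9}{(2d+0.94)(8\nu+5d+0.9)},\tfrac{1}{2(2\nu+d)},0.01\Big\}.$$ $\mathcal W_2^{k}(\mathcal S)$ is the $L_2$-Sobolev space of order $k$ on $\mathcal S$: for integer $k$, functions whose partial derivatives of order $\le k$ lie in $L_2(\mathcal S)$; for general real $k>0$, restrictions to $\mathcal S$ of $g\in L_2(\mathbb R^d)$ with $\int(1+\|\omega\|^2)^k|\widehat g(\omega)|^2d\omega<\infty$. *)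

theory Defs
  imports
    "HOL-Probability.Probability"
    "Jordan_Normal_Form.Determinant"
    "Jordan_Normal_Form.Gauss_Jordan_Elimination"
    "Jordan_Normal_Form.DL_Rank"
begin

definition cube :: "real \<Rightarrow> (real ^ 'd) set" where
  "cube T = {x. \<forall>i. 0 \<le> vec_nth x i \<and> vec_nth x i \<le> T}"

section \<open>Matern correlation\<close>

(* Schlaefli's integral, valid for every real order nu and every x > 0. *)
definition bessel_K :: "real \<Rightarrow> real \<Rightarrow> real" where
  "bessel_K \<nu> x = (LBINT t:{0..}. exp (- x * cosh t) * cosh (\<nu> * t))"

definition matern :: "real \<Rightarrow> real \<Rightarrow> real ^ 'd \<Rightarrow> real" where
  "matern \<nu> \<alpha> x =
     (if x = 0 then 1
      else 2 powr (1 - \<nu>) / Gamma \<nu> * (\<alpha> * norm x) powr \<nu> * bessel_K \<nu> (\<alpha> * norm x))"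

section \<open>Sobolev spaces of real order\<close>

definition fourier_trunc :: "real \<Rightarrow> (real ^ 'd \<Rightarrow> real) \<Rightarrow> real ^ 'd \<Rightarrow> complex" where
  "fourier_trunc R g \<omega> =
     (LINT x:cball 0 R|lborel. cis (- inner \<omega> x) * complex_of_real (g x))"

(* The Fourier transform on L2 need not be an absolutely convergent integral; it is the
   L2 limit of the integrals over growing balls. *)
definition has_L2_fourier :: "(real ^ 'd \<Rightarrow> real) \<Rightarrow> (real ^ 'd \<Rightarrow> complex) \<Rightarrow> bool" where
  "has_L2_fourier g G \<longleftrightarrow>
     g \<in> borel_measurable borel \<and> integrable lborel (\<lambda>x. (g x)\<^sup>2) \<and>
     G \<in> borel_measurable borel \<and> integrable lborel (\<lambda>\<omega>. (cmod (G \<omega>))\<^sup>2) \<and>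
     ((\<lambda>R. \<integral>\<^sup>+\<omega>. ennreal ((cmod (fourier_trunc R g \<omega> - G \<omega>))\<^sup>2) \<partial>lborel) \<longlongrightarrow> 0) at_top"

(* Members are functions, not classes: g may be altered on a null set, so membership is
   invariant under modification on null sets (within Borel functions). *)
definition sobolev_W2 :: "real \<Rightarrow> (real ^ 'd) set \<Rightarrow> (real ^ 'd \<Rightarrow> real) set" where
  "sobolev_W2 k S = {f. \<exists>g G. has_L2_fourier g G \<and>
     integrable lborel (\<lambda>\<omega>. (1 + (norm \<omega>)\<^sup>2) powr k * (cmod (G \<omega>))\<^sup>2) \<and>
     (\<forall>x\<in>S. f x = g x)}"

section \<open>Gaussian processes\<close>

(* Degenerate normal distributions (point masses) are included. *)
definition normal_rv :: "'a measure \<Rightarrow> ('a \<Rightarrow> real) \<Rightarrow> bool" where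
  "normal_rv M Z \<longleftrightarrow>
     (\<exists>\<mu>. AE \<omega> in M. Z \<omega> = \<mu>) \<or>
     (\<exists>\<mu> \<sigma>. 0 < \<sigma> \<and> distributed M lborel Z (\<lambda>x. ennreal (normal_density \<mu> \<sigma> x)))"

definition gaussian_process :: "'a measure \<Rightarrow> 'i set \<Rightarrow> ('i \<Rightarrow> 'a \<Rightarrow> real) \<Rightarrow> bool" where
  "gaussian_process M I X \<longleftrightarrow>
     prob_space M \<and>
     (\<forall>t\<in>I. X t \<in> borel_measurable M) \<and>
     (\<forall>F a. finite F \<and> F \<subseteq> I \<longrightarrow> normal_rv M (\<lambda>\<omega>. \<Sum>t\<in>F. a t * X t \<omega>))"

definition centered_gp ::
  "'a measure \<Rightarrow> 'i set \<Rightarrow> ('i \<Rightarrow> 'a \<Rightarrow> real) \<Rightarrow> ('i \<Rightarrow> 'i \<Rightarrow> real) \<Rightarrow> bool" where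
  "centered_gp M I X k \<longleftrightarrow>
     gaussian_process M I X \<and>
     (\<forall>t\<in>I. prob_space.expectation M (X t) = 0) \<and>
     (\<forall>t\<in>I. \<forall>u\<in>I. prob_space.expectation M (\<lambda>\<omega>. X t \<omega> * X u \<omega>) = k t u)"

section \<open>Regression, restricted likelihood and predictive variance\<close>

(* Below, s lists the n sampling points as s 0, ..., s (n - 1). *)

definition reg_vec :: "nat \<Rightarrow> (nat \<Rightarrow> 'x \<Rightarrow> real) \<Rightarrow> 'x \<Rightarrow> real Matrix.vec" where
  "reg_vec p m t = Matrix.vec p (\<lambda>j. m j t)"

definition design_mat ::
  "nat \<Rightarrow> (nat \<Rightarrow> 'x \<Rightarrow> real) \<Rightarrow> (nat \<Rightarrow> 'x) \<Rightarrow> nat \<Rightarrow> real Matrix.mat" where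
  "design_mat p m s n = Matrix.mat n p (\<lambda>(i, j). m j (s i))"

definition corr_mat :: "real \<Rightarrow> (nat \<Rightarrow> real ^ 'd) \<Rightarrow> nat \<Rightarrow> real \<Rightarrow> real Matrix.mat" where
  "corr_mat \<nu> s n \<alpha> = Matrix.mat n n (\<lambda>(i, j). matern \<nu> \<alpha> (s i - s j))"

definition corr_vec ::
  "real \<Rightarrow> (nat \<Rightarrow> real ^ 'd) \<Rightarrow> nat \<Rightarrow> real \<Rightarrow> real ^ 'd \<Rightarrow> real Matrix.vec" where
  "corr_vec \<nu> s n \<alpha> t = Matrix.vec n (\<lambda>i. matern \<nu> \<alpha> (s i - t))"

definition minv :: "real Matrix.mat \<Rightarrow> real Matrix.mat" where
  "minv A = the (mat_inverse A)"

definition quad_form :: "real Matrix.mat \<Rightarrow> real Matrix.vec \<Rightarrow> real" where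
  "quad_form A v = scalar_prod v (A *\<^sub>v v)"

definition sym_psd :: "nat \<Rightarrow> real Matrix.mat \<Rightarrow> bool" where
  "sym_psd p A \<longleftrightarrow> A \<in> carrier_mat p p \<and> transpose_mat A = A \<and>
     (\<forall>v\<in>carrier_vec p. 0 \<le> quad_form A v)"

definition gls_mat :: "nat \<Rightarrow> (nat \<Rightarrow> real ^ 'd \<Rightarrow> real) \<Rightarrow> real Matrix.mat \<Rightarrow> real \<Rightarrow>
    (nat \<Rightarrow> real ^ 'd) \<Rightarrow> nat \<Rightarrow> real \<Rightarrow> real Matrix.mat" where
  "gls_mat p m \<Omega> \<nu> s n \<alpha> =
     transpose_mat (design_mat p m s n) * minv (corr_mat \<nu> s n \<alpha>) * design_mat p m s n + \<Omega>"

definition Q_mat :: "nat \<Rightarrow> (nat \<Rightarrow> real ^ 'd \<Rightarrow> real) \<Rightarrow> real Matrix.mat \<Rightarrow> real \<Rightarrow>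
    (nat \<Rightarrow> real ^ 'd) \<Rightarrow> nat \<Rightarrow> real \<Rightarrow> real Matrix.mat" where
  "Q_mat p m \<Omega> \<nu> s n \<alpha> =
     (let Ri = minv (corr_mat \<nu> s n \<alpha>); D = design_mat p m s n
      in Ri - Ri * D * minv (gls_mat p m \<Omega> \<nu> s n \<alpha>) * transpose_mat D * Ri)"

(* The argument v is the variance parameter sigma^2, and y is the vector of observations. *)
definition restricted_loglik :: "nat \<Rightarrow> (nat \<Rightarrow> real ^ 'd \<Rightarrow> real) \<Rightarrow> real Matrix.mat \<Rightarrow> real \<Rightarrow>
    (nat \<Rightarrow> real ^ 'd) \<Rightarrow> nat \<Rightarrow> real Matrix.vec \<Rightarrow> real \<Rightarrow> real \<Rightarrow> real" where
  "restricted_loglik p m \<Omega> \<nu> s n y v \<alpha> =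
     - (1 / (2 * v)) * quad_form (Q_mat p m \<Omega> \<nu> s n \<alpha>) y
     - (real n - real p) / 2 * ln v
     - 1 / 2 * ln (Determinant.det (corr_mat \<nu> s n \<alpha>))
     - 1 / 2 * ln (Determinant.det (gls_mat p m \<Omega> \<nu> s n \<alpha>))"

definition pred_var :: "nat \<Rightarrow> (nat \<Rightarrow> real ^ 'd \<Rightarrow> real) \<Rightarrow> real Matrix.mat \<Rightarrow> real \<Rightarrow>
    (nat \<Rightarrow> real ^ 'd) \<Rightarrow> nat \<Rightarrow> real \<Rightarrow> real \<Rightarrow> real ^ 'd \<Rightarrow> real" where
  "pred_var p m \<Omega> \<nu> s n v \<alpha> t =
     (let Ri = minv (corr_mat \<nu> s n \<alpha>);
          r = corr_vec \<nu> s n \<alpha> t;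
          b = reg_vec p m t - transpose_mat (design_mat p m s n) *\<^sub>v (Ri *\<^sub>v r)
      in v * (1 - quad_form Ri r) + v * quad_form (minv (gls_mat p m \<Omega> \<nu> s n \<alpha>)) b)"

(* The supremum is taken in the extended reals, so it is meaningful without a boundedness
   proof. *)
definition pred_var_dev :: "nat \<Rightarrow> (nat \<Rightarrow> real ^ 'd \<Rightarrow> real) \<Rightarrow> real Matrix.mat \<Rightarrow> real \<Rightarrow> real \<Rightarrow>
    real \<Rightarrow> (nat \<Rightarrow> real ^ 'd) \<Rightarrow> nat \<Rightarrow> real \<Rightarrow> real \<Rightarrow> ereal" where
  "pred_var_dev p m \<Omega> \<nu> T \<theta>0 s n \<theta> \<alpha> =
     (SUP t\<in>cube T - s ` {..<n}.
        ereal \<bar>pred_var p m \<Omega> \<nu> s n (\<theta> / \<alpha> powr (2 * \<nu>)) \<alpha> t /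
               pred_var p m \<Omega> \<nu> s n (\<theta>0 / \<alpha> powr (2 * \<nu>)) \<alpha> t - 1\<bar>)"

section \<open>Posterior distributions\<close>

(* A probability measure whenever f has integral in (0, infinity). *)
definition density_proportional :: "('b::euclidean_space \<Rightarrow> ennreal) \<Rightarrow> 'b measure" where
  "density_proportional f = density lborel (\<lambda>x. f x / (\<integral>\<^sup>+z. f z \<partial>lborel))"

(* Prior densities: prior_th theta alpha is the conditional density of theta given alpha,
   prior_al is the density of alpha. *)
definition posterior_given_alpha :: "nat \<Rightarrow> (nat \<Rightarrow> real ^ 'd \<Rightarrow> real) \<Rightarrow> real Matrix.mat \<Rightarrow> real \<Rightarrow>
    (real \<Rightarrow> real \<Rightarrow> real) \<Rightarrow> (nat \<Rightarrow> real ^ 'd) \<Rightarrow> nat \<Rightarrow> real Matrix.vec \<Rightarrow> real \<Rightarrow> real measure" where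
  "posterior_given_alpha p m \<Omega> \<nu> prior_th s n y \<alpha> =
     density_proportional (\<lambda>\<theta>. indicator {0<..} \<theta> *
       ennreal (exp (restricted_loglik p m \<Omega> \<nu> s n y (\<theta> / \<alpha> powr (2 * \<nu>)) \<alpha>) * prior_th \<theta> \<alpha>))"

definition posterior :: "nat \<Rightarrow> (nat \<Rightarrow> real ^ 'd \<Rightarrow> real) \<Rightarrow> real Matrix.mat \<Rightarrow> real \<Rightarrow>
    (real \<Rightarrow> real \<Rightarrow> real) \<Rightarrow> (real \<Rightarrow> real) \<Rightarrow> (nat \<Rightarrow> real ^ 'd) \<Rightarrow> nat \<Rightarrow> real Matrix.vec \<Rightarrow>
    (real \<times> real) measure" where
  "posterior p m \<Omega> \<nu> prior_th prior_al s n y =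
     density_proportional (\<lambda>(\<theta>, \<alpha>). indicator ({0<..} \<times> {0<..}) (\<theta>, \<alpha>) *
       ennreal (exp (restricted_loglik p m \<Omega> \<nu> s n y (\<theta> / \<alpha> powr (2 * \<nu>)) \<alpha>) *
                prior_th \<theta> \<alpha> * prior_al \<alpha>))"

section \<open>Conditions on regressors and priors\<close>

definition kappa_lo :: "real \<Rightarrow> real \<Rightarrow> real" where
  "kappa_lo d \<nu> = 1 / 2 * Min {0.9 / ((2 * d + 0.94) * (8 * \<nu> + 3 * d - 0.9)),
                               1 / (4 * (3 * \<nu> + d)), 0.01}"

definition kappa_hi :: "real \<Rightarrow> real \<Rightarrow> real" where
  "kappa_hi d \<nu> = 1 / 2 * Min {0.9 / ((2 * d + 0.94) * (8 * \<nu> + 5 * d + 0.9)),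
                               1 / (2 * (2 * \<nu> + d)), 0.01}"

definition alpha_lo :: "real \<Rightarrow> real \<Rightarrow> nat \<Rightarrow> real" where
  "alpha_lo d \<nu> n = real n powr (- kappa_lo d \<nu>)"

definition alpha_hi :: "real \<Rightarrow> real \<Rightarrow> nat \<Rightarrow> real" where
  "alpha_hi d \<nu> n = real n powr kappa_hi d \<nu>"

(* Since nu + d/2 > d/2, a Sobolev class of this order has a unique continuous
   representative; continuity selects it, so that the values at the sampling points
   are well defined.  The sampling points form a triangular array s n 0, ..., s n (n - 1). *)
definition regressor_cond :: "nat \<Rightarrow> (nat \<Rightarrow> real ^ 'd \<Rightarrow> real) \<Rightarrow> real \<Rightarrow> real \<Rightarrow>
    (nat \<Rightarrow> nat \<Rightarrow> real ^ 'd) \<Rightarrow> bool" where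
  "regressor_cond p m \<nu> T s \<longleftrightarrow>
     (\<forall>j<p. m j \<in> sobolev_W2 (\<nu> + real CARD('d) / 2) (cube T) \<and> continuous_on (cube T) (m j)) \<and>
     (\<forall>n\<ge>p. vec_space.rank n (design_mat p m (s n) n) = p)"

definition prior_cond :: "nat \<Rightarrow> real Matrix.mat \<Rightarrow> real \<Rightarrow> (real \<Rightarrow> real \<Rightarrow> real) \<Rightarrow> bool" where
  "prior_cond p \<Omega> \<theta>0 prior_th \<longleftrightarrow>
     sym_psd p \<Omega> \<and>
     (\<forall>\<alpha>>0. (\<forall>\<theta>>0. 0 \<le> prior_th \<theta> \<alpha>) \<and>
        (\<integral>\<^sup>+\<theta>\<in>{0<..}. ennreal (prior_th \<theta> \<alpha>) \<partial>lborel) = 1 \<and>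
        (\<forall>\<theta>>0. (\<lambda>t. prior_th t \<alpha>) field_differentiable (at \<theta>)) \<and>
        continuous_on {0<..} (deriv (\<lambda>t. prior_th t \<alpha>)) \<and>
        0 < prior_th \<theta>0 \<alpha>) \<and>
     (\<forall>\<theta>>0. continuous_on {0<..} (\<lambda>\<alpha>. prior_th \<theta> \<alpha>))"

(* No junk value enters through ln 0: the first bound at every point where prior_th is
   positive, together with prior_cond, already forces prior_th > 0 on the whole range. *)
definition prior_growth_cond :: "real \<Rightarrow> real \<Rightarrow> real \<Rightarrow> (real \<Rightarrow> real \<Rightarrow> real) \<Rightarrow> bool" where
  "prior_growth_cond d \<nu> \<theta>0 prior_th \<longleftrightarrow>
     (\<exists>C1 C2 C3. 0 < C1 \<and> 0 < C2 \<and> 0 < C3 \<and> C1 + C2 < 1 / 2 \<and> C3 < 1 \<and>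
       (\<forall>\<^sub>F n in sequentially.
          (SUP \<alpha>\<in>{alpha_lo d \<nu> n..alpha_hi d \<nu> n}. SUP \<theta>\<in>{\<theta>0 / 2<..<2 * \<theta>0}.
             ereal \<bar>deriv (\<lambda>t. ln (prior_th t \<alpha>)) \<theta>\<bar>) \<le> ereal (real n powr C1) \<and>
          (SUP \<alpha>\<in>{alpha_lo d \<nu> n..alpha_hi d \<nu> n}. SUP \<theta>\<in>{\<theta>0 / 2<..<2 * \<theta>0}.
             ereal (prior_th \<theta> \<alpha> / prior_th \<theta>0 \<alpha>)) \<le> ereal (real n powr C2) \<and>
          (INF \<alpha>\<in>{alpha_lo d \<nu> n..alpha_hi d \<nu> n}. ereal (ln (prior_th \<theta>0 \<alpha>)))
             \<ge> ereal (- (real n powr C3))))"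

definition prior_tail_cond :: "real \<Rightarrow> real \<Rightarrow> real \<Rightarrow> real \<Rightarrow> (real \<Rightarrow> real \<Rightarrow> real) \<Rightarrow>
    (real \<Rightarrow> real) \<Rightarrow> bool" where
  "prior_tail_cond d \<nu> \<theta>0 \<alpha>0 prior_th prior_al \<longleftrightarrow>
     (\<forall>\<alpha>>0. 0 \<le> prior_al \<alpha>) \<and> continuous_on {0<..} prior_al \<and>
     (\<integral>\<^sup>+\<alpha>\<in>{0<..}. ennreal (prior_al \<alpha>) \<partial>lborel) = 1 \<and>
     0 < prior_al \<alpha>0 \<and>
     (\<integral>\<^sup>+\<alpha>\<in>{0<..}. ennreal (prior_th \<theta>0 \<alpha> * prior_al \<alpha>) \<partial>lborel) < \<infinity> \<and>
     (\<exists>c_lo c_hi. 0 < c_lo \<and> c_lo < (\<nu> + d / 2) * kappa_lo d \<nu> \<and>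
        0 < c_hi \<and> c_hi < (\<nu> + d / 2) * kappa_hi d \<nu> \<and>
        (\<forall>\<^sub>F n in sequentially.
          max (\<integral>\<^sup>+\<alpha>\<in>{0<..alpha_lo d \<nu> n}.
                 ennreal (\<alpha> powr (- real n * (\<nu> + d / 2)) * prior_al \<alpha>) \<partial>lborel)
              (\<integral>\<^sup>+\<alpha>\<in>{0<..alpha_lo d \<nu> n}.
                 ennreal (\<alpha> powr (- real n * (\<nu> + d / 2)) * prior_th \<theta>0 \<alpha> * prior_al \<alpha>) \<partial>lborel)
            \<le> ennreal (exp (c_lo * real n * ln (real n))) \<and>
          max (\<integral>\<^sup>+\<alpha>\<in>{alpha_hi d \<nu> n..}.
                 ennreal (\<alpha> powr (real n * (\<nu> + d / 2)) * prior_al \<alpha>) \<partial>lborel)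
              (\<integral>\<^sup>+\<alpha>\<in>{alpha_hi d \<nu> n..}.
                 ennreal (\<alpha> powr (real n * (\<nu> + d / 2)) * prior_th \<theta>0 \<alpha> * prior_al \<alpha>) \<partial>lborel)
            \<le> ennreal (exp (c_hi * real n * ln (real n)))))"

end

theory Submission
  imports Defs "HOL-Real_Asymp.Real_Asymp"
begin

text \<open>The predictive variance is linear in \<open>\<sigma>\<^sup>2\<close>, so its relative deviation is \<open>\<bar>\<theta> / \<theta>0 - 1\<bar>\<close>
  at every new point, and the claim is a contraction rate for the posterior of \<open>\<theta>\<close>.  Given
  \<open>\<alpha>\<close>, the restricted likelihood is an inverse gamma kernel in \<open>\<theta>\<close> centred at \<open>rss \<alpha> / (n - p)\<close>.
  At \<open>\<alpha>0\<close> this is an average of squared independent Gaussians up to \<open>p\<close> degrees of freedom.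
  The spectral densities, rescaled by \<open>\<alpha> powr (2 * \<nu>)\<close>, are monotone in \<open>\<alpha>\<close> and differ
  relatively by \<open>O(1 / \<bar>\<omega>\<bar>\<^sup>2)\<close>.  Hence \<open>rss\<close> is monotone, and its change between \<open>\<alpha>0\<close> and the ends
  of the range is an energy of the Gaussian weights that splits at a frequency \<open>W = n powr (1 / 3)\<close>:
  above it the factor \<open>1 / W\<^sup>2\<close> helps, below it a Paley--Wiener type bound for the evaluation of
  trigonometric polynomials bounds every coefficient variance.  Outside the range, monotonicity
  bounds the likelihood by its value at the end of the range times a power of \<open>\<alpha>\<close>, which
  the prior tails absorb.\<close>

section \<open>Positive definite matrices\<close>

text \<open>The sampling points are arbitrary, so no rate for eigenvalues or fill distances is
  available. Estimates are therefore relative: matrices are compared with \<open>K \<alpha>0\<close>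
  in the Loewner order, and the evaluation bound for trigonometric polynomials is uniform in n and
  in the points. The likelihood must be controlled for all \<alpha> in a growing range at once; as
  \<open>rss\<close> and both determinants are monotone in \<alpha>, bounds at \<alpha>0 and at the
  two ends suffice. The error allowed in \<open>rss\<close> is of order sqrt n * ln n. Concentration
  at \<alpha>0 with failure probability of order 1/n^2 costs sqrt (n * ln n). The frequency split
  costs W * ln n + n / W^2, whence W = n^(1/3), times a comparison factor of order n^(1/8) at most,
  because the exponents kappa are small; and 1/3 + 1/8 < 1/2. The threshold 7 \<delta> exceeds the
  relative centring error 11/10 \<delta> by so much that the kernel falls by exp (- 3/2 * N *
  \<delta>^2), roughly exp (- 3/2 * (ln n)^2). This beats every power of n, in particular the factor
  N lost when the normaliser is bounded below on an interval of length \<theta>0 / N.\<close>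

abbreviation (input) sprod :: "real Matrix.vec \<Rightarrow> real Matrix.vec \<Rightarrow> real" where
  "sprod \<equiv> scalar_prod"

abbreviation (input) mdet :: "real Matrix.mat \<Rightarrow> real" where
  "mdet \<equiv> Determinant.det"

text \<open>Dimension and symmetry belong to the notion: the matrix type fixes no size, and
  \<open>quad_form\<close> sees only the symmetric part of a matrix.\<close>

definition spd :: "nat \<Rightarrow> real Matrix.mat \<Rightarrow> bool" where
  "spd n A \<longleftrightarrow> A \<in> carrier_mat n n \<and> transpose_mat A = A \<and>
     (\<forall>v\<in>carrier_vec n. v \<noteq> 0\<^sub>v n \<longrightarrow> 0 < quad_form A v)"

lemma sprod_mult_mat_vec:
  fixes A :: "real Matrix.mat"
  assumes "A \<in> carrier_mat m n" "x \<in> carrier_vec n" "y \<in> carrier_vec m"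
  shows "sprod y (A *\<^sub>v x) = sprod (transpose_mat A *\<^sub>v y) x"
  using transpose_vec_mult_scalar[OF assms] by simp

lemma sprod_sym:
  assumes "A \<in> carrier_mat n n" "transpose_mat A = A" "x \<in> carrier_vec n" "y \<in> carrier_vec n"
  shows "sprod x (A *\<^sub>v y) = sprod y (A *\<^sub>v x)"
  using sprod_mult_mat_vec[OF assms(1,4,3)] assms
  by (metis comm_scalar_prod mult_mat_vec_carrier)

section \<open>Expansion of quadratic forms\<close>

lemma quad_form_conv_sum:
  assumes "A \<in> carrier_mat n n" "v \<in> carrier_vec n"
  shows "quad_form A v = (\<Sum>i<n. \<Sum>j<n. vec_index v i * vec_index v j * A $$ (i, j))"
  using assms unfolding quad_form_def scalar_prod_def
  by (auto simp: scalar_prod_def sum_distrib_left atLeast0LessThan mult_ac intro!: sum.cong)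

text \<open>Symmetry merges the two cross terms. The scalar \<open>c\<close> is explicit because it
  is the free parameter when a square is completed (c = -1) or a cross term is weighted (c = -
  L).\<close>

lemma quad_form_add_vec:
  assumes A: "A \<in> carrier_mat n n" "transpose_mat A = A" and x: "x \<in> carrier_vec n"
    and y: "y \<in> carrier_vec n"
  shows "quad_form A (x + c \<cdot>\<^sub>v y) = quad_form A x + 2 * c * sprod x (A *\<^sub>v y) + c\<^sup>2 * quad_form A y"
proof -
  have [simp]: "A *\<^sub>v x \<in> carrier_vec n" "A *\<^sub>v y \<in> carrier_vec n" using A x y by auto
  have e: "A *\<^sub>v (x + c \<cdot>\<^sub>v y) = A *\<^sub>v x + c \<cdot>\<^sub>v (A *\<^sub>v y)"
    using A x y by (simp add: mult_add_distrib_mat_vec[of _ n n] mult_mat_vec[of _ n n])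
  show ?thesis
    unfolding quad_form_def e using A x y sprod_sym[OF A x y]
    by (simp add: add_scalar_prod_distrib[of _ n] scalar_prod_add_distrib[of _ n]
        smult_scalar_prod_distrib[of _ n] scalar_prod_smult_distrib[of _ n] power2_eq_square algebra_simps)
qed

lemma quad_form_smult_vec:
  assumes "A \<in> carrier_mat n n" "x \<in> carrier_vec n"
  shows "quad_form A (c \<cdot>\<^sub>v x) = c\<^sup>2 * quad_form A x"
  using assms unfolding quad_form_def
  by (simp add: mult_mat_vec[of _ n n] power2_eq_square)

lemma quad_form_smult_mat:
  assumes "A \<in> carrier_mat n n" "x \<in> carrier_vec n"
  shows "quad_form (c \<cdot>\<^sub>m A) x = c * quad_form A x"
  unfolding quad_form_conv_sum[OF smult_carrier_mat[OF assms(1)] assms(2)] quad_form_conv_sum[OF assms]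
  using assms(1) by (auto simp: sum_distrib_left mult_ac intro!: sum.cong)

lemma quad_form_add_mat:
  assumes "A \<in> carrier_mat n n" "B \<in> carrier_mat n n" "x \<in> carrier_vec n"
  shows "quad_form (A + B) x = quad_form A x + quad_form B x"
  unfolding quad_form_conv_sum[OF add_carrier_mat[OF assms(2)] assms(3)]
    quad_form_conv_sum[OF assms(1,3)] quad_form_conv_sum[OF assms(2,3)] sum.distrib[symmetric]
  using assms(1,2) by (intro sum.cong) (auto simp: ring_distribs)

lemma quad_form_zero [simp]:
  "A \<in> carrier_mat n n \<Longrightarrow> quad_form A (0\<^sub>v n) = 0"
  unfolding quad_form_def by (metis mult_mat_vec_carrier scalar_prod_left_zero zero_carrier_vec)

lemma quad_form_congruence:
  assumes "A \<in> carrier_mat n n" "U \<in> carrier_mat n k" "x \<in> carrier_vec k"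
  shows "quad_form (transpose_mat U * A * U) x = quad_form A (U *\<^sub>v x)"
proof -
  have "(transpose_mat U * A * U) *\<^sub>v x = transpose_mat U *\<^sub>v (A *\<^sub>v (U *\<^sub>v x))"
    using assms by (smt (verit) assoc_mult_mat_vec mult_carrier_mat mult_mat_vec_carrier transpose_carrier_mat)
  then show ?thesis unfolding quad_form_def
    using sprod_mult_mat_vec[of "transpose_mat U" k n "A *\<^sub>v (U *\<^sub>v x)" x] assms by simp
qed

section \<open>Inverses of positive definite matrices and their quadratic forms\<close>

lemma spdD:
  assumes "spd n A"
  shows "A \<in> carrier_mat n n" "transpose_mat A = A"
    "\<And>v. v \<in> carrier_vec n \<Longrightarrow> v \<noteq> 0\<^sub>v n \<Longrightarrow> 0 < quad_form A v"
    "\<And>v. v \<in> carrier_vec n \<Longrightarrow> 0 \<le> quad_form A v"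
proof -
  show A: "A \<in> carrier_mat n n" "transpose_mat A = A"
    "\<And>v. v \<in> carrier_vec n \<Longrightarrow> v \<noteq> 0\<^sub>v n \<Longrightarrow> 0 < quad_form A v"
    using assms unfolding spd_def by auto
  show "0 \<le> quad_form A v" if "v \<in> carrier_vec n" for v
    using A(3)[OF that] quad_form_zero[OF A(1)] by (cases "v = 0\<^sub>v n") auto
qed

text \<open>\<open>minv\<close> unwraps an option, so nothing is known about it until
  \<open>mat_inverse\<close> succeeds; a nonzero determinant makes the matrix a unit of the matrix
  ring, which is the criterion for success.\<close>

lemma minv_inverse:
  assumes A: "A \<in> carrier_mat n n" and d: "mdet A \<noteq> 0"
  shows "minv A \<in> carrier_mat n n" "A * minv A = 1\<^sub>m n" "minv A * A = 1\<^sub>m n"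
proof -
  have "A \<in> Units (ring_mat TYPE(real) n ())" by (rule det_non_zero_imp_unit[OF A d])
  then obtain B where B: "mat_inverse A = Some B"
    using mat_inverse(1)[OF A, where b = "()"] by (cases "mat_inverse A") auto
  from mat_inverse(2)[OF A B] B
  show "minv A \<in> carrier_mat n n" "A * minv A = 1\<^sub>m n" "minv A * A = 1\<^sub>m n"
    by (auto simp: minv_def)
qed

lemma minv_unique:
  assumes A: "A \<in> carrier_mat n n" and B: "B \<in> carrier_mat n n" and AB: "A * B = 1\<^sub>m n"
  shows "minv A = B"
proof -
  have "mdet A * mdet B = 1" using det_mult[OF A B] AB by simp
  then have "mdet A \<noteq> 0" by auto
  note i = minv_inverse[OF A this]
  have "minv A = minv A * (A * B)" using AB i by simp
  also have "\<dots> = B" using i A B by (simp flip: assoc_mult_mat)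
  finally show ?thesis .
qed

lemma spd_det_nonzero:
  assumes "spd n A"
  shows "mdet A \<noteq> 0"
proof
  assume "mdet A = 0"
  then obtain v where "v \<in> carrier_vec n" "v \<noteq> 0\<^sub>v n" "A *\<^sub>v v = 0\<^sub>v n"
    using det_0_iff_vec_prod_zero[OF spdD(1)[OF assms]] by auto
  then show False using spdD(3)[OF assms, of v] by (simp add: quad_form_def)
qed

lemma spd_minv:
  assumes "spd n A"
  shows "minv A \<in> carrier_mat n n" "A * minv A = 1\<^sub>m n" "minv A * A = 1\<^sub>m n"
  using minv_inverse[OF spdD(1)[OF assms] spd_det_nonzero[OF assms]] .

lemma spd_minv_mult_vec:
  assumes "spd n A" "x \<in> carrier_vec n"
  shows "A *\<^sub>v (minv A *\<^sub>v x) = x" "minv A *\<^sub>v (A *\<^sub>v x) = x"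
  using spd_minv[OF assms(1)] spdD(1)[OF assms(1)] assms(2)
  by (metis assoc_mult_mat_vec one_mult_mat_vec)+

lemma spd_minv_sym:
  assumes "spd n A"
  shows "transpose_mat (minv A) = minv A"
proof -
  note i = spd_minv[OF assms] and A = spdD(1,2)[OF assms]
  have "A * transpose_mat (minv A) = transpose_mat (minv A * A)"
    using i A by (metis transpose_mult)
  also have "\<dots> = 1\<^sub>m n" using i by simp
  finally have "A * transpose_mat (minv A) = 1\<^sub>m n" .
  from minv_unique[OF A(1) _ this] i show ?thesis by simp
qed

lemma quad_form_minv_conv:
  assumes "spd n A" "y \<in> carrier_vec n"
  shows "quad_form (minv A) y = quad_form A (minv A *\<^sub>v y)"
  using assms spd_minv[OF assms(1)] spd_minv_mult_vec[OF assms] unfolding quad_form_def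
  by (metis comm_scalar_prod mult_mat_vec_carrier)

lemma spd_minv_spd:
  assumes "spd n A"
  shows "spd n (minv A)"
  unfolding spd_def
proof (intro conjI ballI impI)
  show "minv A \<in> carrier_mat n n" "transpose_mat (minv A) = minv A"
    using spd_minv(1)[OF assms] spd_minv_sym[OF assms] by auto
  fix v :: "real Matrix.vec" assume v: "v \<in> carrier_vec n" "v \<noteq> 0\<^sub>v n"
  have "minv A *\<^sub>v v \<noteq> 0\<^sub>v n"
  proof
    assume "minv A *\<^sub>v v = 0\<^sub>v n"
    then have "v = A *\<^sub>v 0\<^sub>v n" using spd_minv_mult_vec[OF assms v(1)] by simp
    also have "\<dots> = 0\<^sub>v n" using spdD(1)[OF assms] by (intro eq_vecI) auto
    finally show False using v by simp
  qed
  then show "0 < quad_form (minv A) v"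
    using quad_form_minv_conv[OF assms v(1)] spdD(3)[OF assms] spd_minv(1)[OF assms] v by simp
qed

text \<open>The Fenchel dual of a positive definite quadratic form.\<close>

lemma quad_form_minv_ge:
  assumes K: "spd n K" and x: "x \<in> carrier_vec n" and y: "y \<in> carrier_vec n"
  shows "2 * sprod x y - quad_form K x \<le> quad_form (minv K) y"
proof -
  let ?z = "minv K *\<^sub>v y"
  have z: "?z \<in> carrier_vec n" using spd_minv[OF K] y by simp
  have "0 \<le> quad_form K (x + (-1) \<cdot>\<^sub>v ?z)" by (intro spdD(4)[OF K]) (use x z in auto)
  also have "\<dots> = quad_form K x - 2 * sprod x y + quad_form (minv K) y"
    using quad_form_add_vec[OF spdD(1,2)[OF K] x z, of "-1"] spd_minv_mult_vec[OF K y]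
      quad_form_minv_conv[OF K y] by simp
  finally show ?thesis by simp
qed

lemma quad_form_minv_eq:
  assumes K: "spd n K" and y: "y \<in> carrier_vec n"
  shows "quad_form (minv K) y = 2 * sprod (minv K *\<^sub>v y) y - quad_form K (minv K *\<^sub>v y)"
  using quad_form_minv_conv[OF K y] spd_minv_mult_vec[OF K y] spd_minv(1)[OF K] y
  unfolding quad_form_def by (metis add_diff_cancel comm_scalar_prod mult_2 mult_mat_vec_carrier)

text \<open>The maximum in the dual form is attained at the inverse applied to \<open>y\<close>, so
  a bound over all test vectors passes to the inverse form. Inverses are bounded in this way below,
  without being computed.\<close>

lemma quad_form_minv_le:
  assumes K: "spd n K" and y: "y \<in> carrier_vec n"
    and le: "\<And>x. x \<in> carrier_vec n \<Longrightarrow> 2 * sprod x y - quad_form K x \<le> c"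
  shows "quad_form (minv K) y \<le> c"
  using quad_form_minv_eq[OF K y] le[of "minv K *\<^sub>v y"] spd_minv(1)[OF K] y by simp

text \<open>Inserting \<open>x\<close> divided by \<open>c\<close> as test vector into the dual form
  of \<open>A\<close> turns the scaled comparison of the forms into the reversed comparison of the
  inverses.\<close>

lemma quad_form_minv_antimono:
  assumes A: "spd n A" and B: "spd n B" and c: "0 < c"
    and le: "\<And>x. x \<in> carrier_vec n \<Longrightarrow> quad_form A x \<le> c * quad_form B x"
    and y: "y \<in> carrier_vec n"
  shows "quad_form (minv B) y \<le> c * quad_form (minv A) y"
proof (rule quad_form_minv_le[OF B y])
  fix x :: "real Matrix.vec" assume x: "x \<in> carrier_vec n"
  have "2 * sprod ((1/c) \<cdot>\<^sub>v x) y - quad_form A ((1/c) \<cdot>\<^sub>v x) \<le> quad_form (minv A) y"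
    by (rule quad_form_minv_ge[OF A]) (use x y in auto)
  then have "2 * sprod x y / c - quad_form A x / c\<^sup>2 \<le> quad_form (minv A) y"
    using quad_form_smult_vec[OF spdD(1)[OF A] x, of "1/c"] smult_scalar_prod_distrib[OF x y, of "1/c"]
    by (simp add: power_divide)
  moreover have "quad_form A x / c\<^sup>2 \<le> quad_form B x / c"
    using le[OF x] c by (simp add: field_simps power2_eq_square)
  ultimately have "(2 * sprod x y - quad_form B x) / c \<le> quad_form (minv A) y"
    by (simp add: diff_divide_distrib)
  then show "2 * sprod x y - quad_form B x \<le> c * quad_form (minv A) y"
    using c by (simp add: field_simps)
qed

text \<open>\<open>u\<close> maximises the dual form of \<open>B\<close> and serves as a test vector
  for that of \<open>A\<close>; the linear terms cancel. So the difference of the inverses is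
  bounded, with constant 1, by the difference of the matrices at one vector that depends on the
  reference matrix \<open>B\<close> alone.\<close>

lemma quad_form_minv_diff_le_of_le:
  assumes A: "spd n A" and B: "spd n B" and y: "y \<in> carrier_vec n"
  defines "u \<equiv> minv B *\<^sub>v y"
  shows "quad_form (minv B) y - quad_form (minv A) y \<le> quad_form A u - quad_form B u"
proof -
  have u: "u \<in> carrier_vec n" using spd_minv[OF B] y by (simp add: u_def)
  have "2 * sprod u y - quad_form A u \<le> quad_form (minv A) y" by (rule quad_form_minv_ge[OF A u y])
  moreover have "quad_form (minv B) y = 2 * sprod u y - quad_form B u"
    using quad_form_minv_eq[OF B y] by (simp add: u_def)
  ultimately show ?thesis by simp
qed

text \<open>Here the sign is unfavourable: \<open>u\<close> is not the maximiser for
  \<open>A\<close>, and moving from \<open>u\<close> to the maximiser gains a second order term. The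
  comparison of \<open>B\<close> with L times \<open>A\<close> absorbs it at the price of the factor
  1 + L, and the bound still involves the single reference vector \<open>u\<close>.\<close>

lemma quad_form_minv_diff_le_of_ge:
  assumes A: "spd n A" and B: "spd n B" and y: "y \<in> carrier_vec n" and L: "0 < L"
    and AB: "\<And>x. x \<in> carrier_vec n \<Longrightarrow> quad_form A x \<le> quad_form B x"
    and BA: "\<And>x. x \<in> carrier_vec n \<Longrightarrow> quad_form B x \<le> L * quad_form A x"
  defines "u \<equiv> minv B *\<^sub>v y"
  shows "quad_form (minv A) y - quad_form (minv B) y \<le> (1 + L) * (quad_form B u - quad_form A u)"
proof -
  have u: "u \<in> carrier_vec n" using spd_minv[OF B] y by (simp add: u_def)
  note cA = spdD(1,2)[OF A] and cB = spdD(1,2)[OF B]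
  have yu: "y = B *\<^sub>v u" using spd_minv_mult_vec[OF B y] by (simp add: u_def)
  have "quad_form (minv A) y \<le> quad_form B u + (1 + L) * (quad_form B u - quad_form A u)"
  proof (rule quad_form_minv_le[OF A y])
    fix x :: "real Matrix.vec" assume x: "x \<in> carrier_vec n"
    define h where "h = x + (-1) \<cdot>\<^sub>v u"
    have h: "h \<in> carrier_vec n" using x u by (simp add: h_def)
    have xh: "x = u + 1 \<cdot>\<^sub>v h" using x u by (auto simp: h_def)
    let ?D = "\<lambda>v. quad_form B v - quad_form A v"
    \<comment> \<open>Nonnegativity of B - A at h - L u bounds the cross term by diagonal terms. The
      weight L is chosen so that, after \<open>?D h\<close> is replaced by L times the form of
      \<open>A\<close> at \<open>h\<close>, division by L leaves exactly the form of
      \<open>A\<close> that is available.\<close>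
    have "0 \<le> ?D (h + (-L) \<cdot>\<^sub>v u)" using AB[of "h + (-L) \<cdot>\<^sub>v u"] h u by auto
    also have "\<dots> = ?D h - 2 * L * (sprod h (B *\<^sub>v u) - sprod h (A *\<^sub>v u)) + L\<^sup>2 * ?D u"
      by (simp add: quad_form_add_vec[OF cA h u] quad_form_add_vec[OF cB h u] algebra_simps)
    finally have "2 * L * (sprod h (B *\<^sub>v u) - sprod h (A *\<^sub>v u)) \<le> ?D h + L\<^sup>2 * ?D u" by simp
    moreover have "?D h \<le> L * quad_form A h" using BA[OF h] spdD(4)[OF A h] by simp
    ultimately have "L * (2 * (sprod h (B *\<^sub>v u) - sprod h (A *\<^sub>v u))) \<le> L * (quad_form A h + L * ?D u)"
      by (simp add: algebra_simps power2_eq_square)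
    then have *: "2 * (sprod h (B *\<^sub>v u) - sprod h (A *\<^sub>v u)) \<le> quad_form A h + L * ?D u"
      using L by simp
    have "sprod x y = quad_form B u + sprod h (B *\<^sub>v u)"
      unfolding xh yu quad_form_def using u h cB by (simp add: add_scalar_prod_distrib[of _ n])
    moreover have "quad_form A x = quad_form A u + 2 * sprod h (A *\<^sub>v u) + quad_form A h"
      unfolding xh quad_form_add_vec[OF cA u h] using sprod_sym[OF cA u h] by simp
    ultimately show "2 * sprod x y - quad_form A x \<le> quad_form B u + (1 + L) * ?D u"
      using * by (simp add: algebra_simps)
  qed
  moreover have "quad_form (minv B) y = quad_form B u"
    using quad_form_minv_conv[OF B y] by (simp add: u_def)
  ultimately show ?thesis by simp
qed

section \<open>Bordered matrices, Cholesky factors and determinants\<close>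

definition extend_vec :: "nat \<Rightarrow> real Matrix.vec \<Rightarrow> real \<Rightarrow> real Matrix.vec" where
  "extend_vec n x t = Matrix.vec (Suc n) (\<lambda>i. if i < n then vec_index x i else t)"

lemma quad_form_extend_vec:
  assumes K: "K \<in> carrier_mat (Suc n) (Suc n)" "transpose_mat K = K" and x: "x \<in> carrier_vec n"
  shows "quad_form K (extend_vec n x t) =
    quad_form (Matrix.mat n n (\<lambda>ij. K $$ ij)) x +
    2 * t * sprod x (Matrix.vec n (\<lambda>i. K $$ (i, n))) + t\<^sup>2 * K $$ (n, n)"
proof -
  have sym: "K $$ (n, j) = K $$ (j, n)" if "j < n" for j
    using K that by (metis carrier_matD index_transpose_mat(1) less_Suc_eq)
  have "quad_form K (extend_vec n x t) =
     (\<Sum>i<n. \<Sum>j<n. vec_index x i * vec_index x j * K $$ (i, j)) +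
     (\<Sum>i<n. vec_index x i * t * K $$ (i, n)) +
     (\<Sum>j<n. t * vec_index x j * K $$ (n, j)) + t * t * K $$ (n, n)"
    by (subst quad_form_conv_sum[OF K(1)])
       (auto simp: extend_vec_def sum.distrib less_Suc_eq intro!: sum.cong)
  also have "(\<Sum>j<n. t * vec_index x j * K $$ (n, j)) = (\<Sum>i<n. vec_index x i * t * K $$ (i, n))"
    by (intro sum.cong) (auto simp: sym)
  also have "\<dots> = t * sprod x (Matrix.vec n (\<lambda>i. K $$ (i, n)))"
    using x by (auto simp: scalar_prod_def sum_distrib_left atLeast0LessThan intro!: sum.cong)
  also have "(\<Sum>i<n. \<Sum>j<n. vec_index x i * vec_index x j * K $$ (i, j)) =
      quad_form (Matrix.mat n n (\<lambda>ij. K $$ ij)) x"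
    using x by (subst quad_form_conv_sum) (auto intro!: sum.cong)
  finally show ?thesis by (simp add: power2_eq_square)
qed

lemma spd_leading_block:
  assumes "spd (Suc n) K"
  shows "spd n (Matrix.mat n n (\<lambda>ij. K $$ ij))"
  unfolding spd_def
proof (intro conjI ballI impI)
  note K = spdD(1,2)[OF assms]
  show "transpose_mat (Matrix.mat n n (\<lambda>ij. K $$ ij)) = Matrix.mat n n (\<lambda>ij. K $$ ij)"
  proof (rule eq_matI)
    fix i j assume "i < dim_row (Matrix.mat n n (\<lambda>ij. K $$ ij))" "j < dim_col (Matrix.mat n n (\<lambda>ij. K $$ ij))"
    then have "i < n" "j < n" by auto
    then show "transpose_mat (Matrix.mat n n (\<lambda>ij. K $$ ij)) $$ (i, j) = Matrix.mat n n (\<lambda>ij. K $$ ij) $$ (i, j)"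
      using K by (auto, metis carrier_matD index_transpose_mat(1) less_SucI)
  qed auto
  fix v :: "real Matrix.vec" assume v: "v \<in> carrier_vec n" "v \<noteq> 0\<^sub>v n"
  then obtain i where i: "i < n" "vec_index v i \<noteq> 0" by (auto simp: vec_eq_iff)
  have "extend_vec n v 0 \<noteq> 0\<^sub>v (Suc n)"
    using i by (auto simp: vec_eq_iff extend_vec_def less_Suc_eq)
  then have "0 < quad_form K (extend_vec n v 0)"
    by (intro spdD(3)[OF assms]) (auto simp: extend_vec_def)
  then show "0 < quad_form (Matrix.mat n n (\<lambda>ij. K $$ ij)) v"
    by (simp add: quad_form_extend_vec[OF K v(1)])
qed auto

text \<open>Induction on the dimension by bordering: the new row of the factor solves a triangular
  system, and the new pivot is the square root of the Schur complement, which is positive because it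
  is the value of the form of \<open>K\<close> at one test vector.\<close>

lemma cholesky:
  assumes "spd n K"
  shows "\<exists>L\<in>carrier_mat n n. (\<forall>i<n. 0 < L $$ (i, i)) \<and> (\<forall>i j. i < j \<longrightarrow> j < n \<longrightarrow> L $$ (i, j) = 0) \<and>
    K = L * transpose_mat L"
  using assms
proof (induction n arbitrary: K)
  case 0
  then show ?case by (intro bexI[of _ K]) (auto simp: spd_def)
next
  case (Suc n)
  note K = spdD(1,2)[OF Suc.prems]
  define A where "A = Matrix.mat n n (\<lambda>ij. K $$ ij)"
  define b where "b = Matrix.vec n (\<lambda>i. K $$ (i, n))"
  have b: "b \<in> carrier_vec n" by (simp add: b_def)
  from Suc.IH[OF spd_leading_block[OF Suc.prems]] obtain L where
    L: "L \<in> carrier_mat n n" and Lp: "\<And>i. i < n \<Longrightarrow> 0 < L $$ (i, i)"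
    and Lt: "\<And>i j. i < j \<Longrightarrow> j < n \<Longrightarrow> L $$ (i, j) = 0" and AL: "A = L * transpose_mat L"
    unfolding A_def by blast
  have detL: "mdet L \<noteq> 0"
    using det_lower_triangular[OF Lt L] Lp L
    by (auto simp: prod_list_diag_prod less_imp_neq[symmetric])
  define l where "l = minv L *\<^sub>v b"
  have l: "l \<in> carrier_vec n" using minv_inverse[OF L detL] b by (simp add: l_def)
  have Ll: "L *\<^sub>v l = b" unfolding l_def
    using minv_inverse[OF L detL] b L by (metis assoc_mult_mat_vec one_mult_mat_vec)
  have detLt: "mdet (transpose_mat L) \<noteq> 0" using detL det_transpose[OF L] by simp
  \<comment> \<open>\<open>x\<close> solves A x = b, so at (x, -1) the form of \<open>K\<close>
    reduces to the Schur complement \<open>K $$ (n, n) - sprod l l\<close>.\<close>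
  define x where "x = minv (transpose_mat L) *\<^sub>v l"
  have Lt': "transpose_mat L \<in> carrier_mat n n" using L by simp
  have x: "x \<in> carrier_vec n" using minv_inverse[OF Lt' detLt] l by (simp add: x_def)
  have Lx: "transpose_mat L *\<^sub>v x = l" unfolding x_def
    using minv_inverse[OF Lt' detLt] l Lt' by (metis assoc_mult_mat_vec one_mult_mat_vec)
  have bx: "sprod x b = sprod l l"
    using sprod_mult_mat_vec[OF L l x] Lx Ll by simp
  have "quad_form A x = sprod l l"
  proof -
    have "A *\<^sub>v x = b" unfolding AL using L x Lx Ll by (simp add: assoc_mult_mat_vec[of _ n n _ n])
    then show ?thesis unfolding quad_form_def using bx by simp
  qed
  moreover have "0 < quad_form K (extend_vec n x (-1))"
    by (intro spdD(3)[OF Suc.prems]) (auto simp: extend_vec_def vec_eq_iff)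
  ultimately have pos: "0 < K $$ (n, n) - sprod l l"
    using quad_form_extend_vec[OF K x, of "-1"] bx by (simp add: A_def b_def)
  define c where "c = sqrt (K $$ (n, n) - sprod l l)"
  have c: "0 < c" "c * c = K $$ (n, n) - sprod l l" using pos by (simp_all add: c_def)
  define L' where "L' = Matrix.mat (Suc n) (Suc n) (\<lambda>(i, j).
     if i < n \<and> j < n then L $$ (i, j) else if i = n \<and> j < n then vec_index l j
     else if i = n \<and> j = n then c else 0)"
  have entry: "(\<Sum>k<n. L $$ (i, k) * L $$ (j, k)) = K $$ (i, j)" if "i < n" "j < n" for i j
  proof -
    have "K $$ (i, j) = (L * transpose_mat L) $$ (i, j)" using that by (simp add: A_def flip: AL)
    then show ?thesis using that L by (simp add: scalar_prod_def atLeast0LessThan)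
  qed
  have entry_b: "(\<Sum>k<n. L $$ (i, k) * vec_index l k) = K $$ (i, n)" if "i < n" for i
  proof -
    have "K $$ (i, n) = vec_index (L *\<^sub>v l) i" unfolding Ll using that by (simp add: b_def)
    then show ?thesis using that L l by (simp add: scalar_prod_def atLeast0LessThan)
  qed
  have ll: "(\<Sum>k<n. vec_index l k * vec_index l k) = sprod l l"
    using l by (simp add: scalar_prod_def atLeast0LessThan)
  have sym: "K $$ (n, j) = K $$ (j, n)" if "j < n" for j
    using K that by (metis carrier_matD index_transpose_mat(1) less_Suc_eq)
  have "K = L' * transpose_mat L'"
  proof (rule eq_matI)
    fix i j assume "i < dim_row (L' * transpose_mat L')" "j < dim_col (L' * transpose_mat L')"
    then have ij: "i < Suc n" "j < Suc n" by (auto simp: L'_def)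
    then have "(L' * transpose_mat L') $$ (i, j) =
       (\<Sum>k<n. L' $$ (i, k) * L' $$ (j, k)) + L' $$ (i, n) * L' $$ (j, n)"
      by (simp add: L'_def scalar_prod_def atLeast0LessThan)
    also have "\<dots> = K $$ (i, j)"
    proof -
      consider "i < n" "j < n" | "i < n" "j = n" | "i = n" "j < n" | "i = n" "j = n"
        using ij by linarith
      then show ?thesis
      proof cases
        case 1 then show ?thesis by (simp add: L'_def entry)
      next
        case 2 then show ?thesis by (simp add: L'_def entry_b)
      next
        case 3
        then show ?thesis using entry_b[of j] by (simp add: L'_def sym mult.commute)
      next
        case 4 then show ?thesis by (simp add: L'_def ll c)
      qed
    qed
    finally show "K $$ (i, j) = (L' * transpose_mat L') $$ (i, j)" ..
  qed (use K in \<open>auto simp: L'_def\<close>)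
  moreover have "L' \<in> carrier_mat (Suc n) (Suc n)" "\<forall>i<Suc n. 0 < L' $$ (i, i)"
    "\<forall>i j. i < j \<longrightarrow> j < Suc n \<longrightarrow> L' $$ (i, j) = 0"
    using Lp Lt c by (auto simp: L'_def less_Suc_eq)
  ultimately show ?case by blast
qed

lemma spd_det_pos:
  assumes "spd n K"
  shows "0 < mdet K"
proof -
  obtain L where L: "L \<in> carrier_mat n n" "K = L * transpose_mat L"
    using cholesky[OF assms] by blast
  then have "mdet K = (mdet L)\<^sup>2"
    by (simp add: det_mult[of _ n] det_transpose[OF L(1)] power2_eq_square)
  then show ?thesis using spd_det_nonzero[OF assms] by simp
qed

text \<open>The determinant is the product of the squared pivots of the Cholesky factor, while a
  diagonal entry of \<open>K\<close> is the squared length of a whole row of that factor.\<close>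

lemma hadamard_inequality:
  assumes "spd n K"
  shows "mdet K \<le> (\<Prod>i<n. K $$ (i, i))"
proof -
  from cholesky[OF assms] obtain L where
    L: "L \<in> carrier_mat n n" and Lp: "\<And>i. i < n \<Longrightarrow> 0 < L $$ (i, i)"
    and Lt: "\<And>i j. i < j \<Longrightarrow> j < n \<Longrightarrow> L $$ (i, j) = 0" and K: "K = L * transpose_mat L" by blast
  have "mdet K = (mdet L)\<^sup>2"
    unfolding K by (simp add: det_mult[OF L] L det_transpose[OF L] power2_eq_square)
  also have "mdet L = (\<Prod>i<n. L $$ (i, i))"
    using det_lower_triangular[OF Lt L] L by (simp add: prod_list_diag_prod atLeast0LessThan)
  also have "\<dots>\<^sup>2 = (\<Prod>i<n. (L $$ (i, i))\<^sup>2)" by (simp add: prod_power_distrib)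
  also have "\<dots> \<le> (\<Prod>i<n. K $$ (i, i))"
  proof (rule prod_mono, intro conjI)
    fix i assume i: "i \<in> {..<n}"
    have "K $$ (i, i) = (\<Sum>k<n. (L $$ (i, k))\<^sup>2)"
      unfolding K using i L by (simp add: scalar_prod_def atLeast0LessThan power2_eq_square)
    then show "(L $$ (i, i))\<^sup>2 \<le> K $$ (i, i)" using i member_le_sum[of i "{..<n}" "\<lambda>k. (L $$ (i, k))\<^sup>2"] by simp
  qed auto
  finally show ?thesis .
qed

lemma spd_congruence:
  assumes A: "spd n A" and U: "U \<in> carrier_mat n k"
    and inj: "\<And>v. v \<in> carrier_vec k \<Longrightarrow> U *\<^sub>v v = 0\<^sub>v n \<Longrightarrow> v = 0\<^sub>v k"
  shows "spd k (transpose_mat U * A * U)"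
  unfolding spd_def
proof (intro conjI ballI impI)
  note cA = spdD(1,2)[OF A]
  show "transpose_mat U * A * U \<in> carrier_mat k k" using cA U by simp
  have "transpose_mat (transpose_mat U * A * U) = transpose_mat U * transpose_mat (transpose_mat U * A)"
    using transpose_mult[of "transpose_mat U * A" k n U k] cA U by simp
  also have "transpose_mat (transpose_mat U * A) = A * U"
    using transpose_mult[of "transpose_mat U" k n A n] cA U by simp
  finally show "transpose_mat (transpose_mat U * A * U) = transpose_mat U * A * U"
    using cA U by (simp add: assoc_mult_mat[of _ k n _ n _ k])
  fix v :: "real Matrix.vec" assume v: "v \<in> carrier_vec k" "v \<noteq> 0\<^sub>v k"
  then show "0 < quad_form (transpose_mat U * A * U) v"
    unfolding quad_form_congruence[OF cA(1) U v(1)]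
    by (intro spdD(3)[OF A]) (use U inj in auto)
qed

text \<open>The columns of the inverse transposed Cholesky factor are orthonormal for the form of
  \<open>B\<close>. In these coordinates the inverse form is a sum of squares, and the determinant
  ratio is bounded by Hadamard's inequality followed by x \<le> exp (x - 1), which replaces the
  log-determinant by a trace. For a centred Gaussian vector with covariance \<open>B\<close> the
  coordinates are standard normal and uncorrelated.\<close>

lemma orthonormal_frame:
  assumes B: "spd n B"
  obtains U where "U \<in> carrier_mat n n" "transpose_mat U * B * U = 1\<^sub>m n"
    "\<And>y. y \<in> carrier_vec n \<Longrightarrow> quad_form (minv B) y = (\<Sum>k<n. (sprod (Matrix.col U k) y)\<^sup>2)"
    "\<And>k. k < n \<Longrightarrow> quad_form B (Matrix.col U k) = 1"
    "\<And>A. spd n A \<Longrightarrow> mdet A \<le>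
       mdet B * exp (\<Sum>k<n. quad_form A (Matrix.col U k) - 1)"
proof -
  note cB = spdD(1,2)[OF B]
  from cholesky[OF B] obtain L where
    L: "L \<in> carrier_mat n n" and BL: "B = L * transpose_mat L" by blast
  have dL: "mdet L \<noteq> 0"
    using spd_det_nonzero[OF B] unfolding BL by (auto simp: det_mult[OF L] L)
  note iL = minv_inverse[OF L dL]
  define U where "U = transpose_mat (minv L)"
  have U: "U \<in> carrier_mat n n" using iL by (simp add: U_def)
  have LtU: "transpose_mat L * U = 1\<^sub>m n"
    unfolding U_def using transpose_mult[OF iL(1) L] iL by simp
  have "transpose_mat U * B * U = minv L * (L * transpose_mat L) * U" by (simp add: U_def BL)
  also have "\<dots> = (minv L * L) * (transpose_mat L * U)"
    using iL(1) L U by (simp add: assoc_mult_mat[of _ n n _ n _ n])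
  finally have UBU: "transpose_mat U * B * U = 1\<^sub>m n" using iL LtU by simp
  \<comment> \<open>A one-sided inverse of a square matrix is two-sided; rotating the factors of the
    orthonormality relation identifies the inverse of \<open>B\<close> with U times its
    transpose.\<close>
  have "U * (transpose_mat U * B) = 1\<^sub>m n"
    by (rule mat_mult_left_right_inverse[OF _ U UBU]) (use U cB in simp)
  then have "(U * transpose_mat U) * B = 1\<^sub>m n" using U cB by (simp add: assoc_mult_mat[of _ n n _ n _ n])
  then have "B * (U * transpose_mat U) = 1\<^sub>m n"
    using mat_mult_left_right_inverse[of "U * transpose_mat U" n B] U cB by simp
  then have mB: "minv B = U * transpose_mat U" using minv_unique[OF cB(1)] U by simp
  have 1: "quad_form (minv B) y = (\<Sum>k<n. (sprod (Matrix.col U k) y)\<^sup>2)" if y: "y \<in> carrier_vec n" for y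
  proof -
    have "quad_form (minv B) y = sprod y (U *\<^sub>v (transpose_mat U *\<^sub>v y))"
      unfolding quad_form_def mB using U y by (simp add: assoc_mult_mat_vec[of _ n n _ n])
    also have "\<dots> = sprod (transpose_mat U *\<^sub>v y) (transpose_mat U *\<^sub>v y)"
      by (rule sprod_mult_mat_vec[OF U]) (use U y in auto)
    also have "\<dots> = (\<Sum>k<n. (sprod (Matrix.col U k) y)\<^sup>2)"
      using U y by (simp add: scalar_prod_def[of "transpose_mat U *\<^sub>v y"] atLeast0LessThan power2_eq_square)
    finally show ?thesis .
  qed
  have diag: "(transpose_mat U * A * U) $$ (k, k) = quad_form A (Matrix.col U k)"
    if "A \<in> carrier_mat n n" "k < n" for A k
  proof -
    have "transpose_mat U * A * U = transpose_mat U * (A * U)"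
      using that U by (simp add: assoc_mult_mat[of _ n n _ n _ n])
    then show ?thesis using that U
      by (simp add: quad_form_def col_mult2[OF that(1) U that(2)])
  qed
  have 2: "quad_form B (Matrix.col U k) = 1" if "k < n" for k
    using diag[OF cB(1) that] UBU that by simp
  have dU: "mdet B * (mdet U)\<^sup>2 = 1"
  proof -
    have "mdet (transpose_mat U * B * U) = 1" by (simp add: UBU)
    then show ?thesis using U cB
      by (simp add: det_mult[of _ n] det_transpose[OF U] power2_eq_square mult_ac)
  qed
  have 3: "mdet A \<le> mdet B * exp (\<Sum>k<n. quad_form A (Matrix.col U k) - 1)"
    if A: "spd n A" for A
  proof -
    note cA = spdD(1,2)[OF A]
    let ?C = "transpose_mat U * A * U"
    have "spd n ?C"
    proof (rule spd_congruence[OF A U])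
      fix v :: "real Matrix.vec" assume v: "v \<in> carrier_vec n" "U *\<^sub>v v = 0\<^sub>v n"
      have "v = (transpose_mat L * U) *\<^sub>v v" using LtU v by simp
      also have "\<dots> = transpose_mat L *\<^sub>v 0\<^sub>v n" using L U v by (simp add: assoc_mult_mat_vec[of _ n n _ n])
      also have "\<dots> = 0\<^sub>v n" using L by (intro eq_vecI) auto
      finally show "v = 0\<^sub>v n" .
    qed
    have "mdet A = mdet B * (mdet A * (mdet U)\<^sup>2)"
      using dU by (simp add: mult_ac)
    also have "mdet A * (mdet U)\<^sup>2 = mdet ?C"
      using U cA by (simp add: det_mult[of _ n] det_transpose[OF U] power2_eq_square mult_ac)
    also have "\<dots> \<le> (\<Prod>k<n. ?C $$ (k, k))" by (rule hadamard_inequality) fact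
    also have "\<dots> = (\<Prod>k<n. quad_form A (Matrix.col U k))" by (intro prod.cong) (auto simp: diag[OF cA(1)])
    also have "\<dots> \<le> (\<Prod>k<n. exp (quad_form A (Matrix.col U k) - 1))"
    proof (rule prod_mono, intro conjI)
      fix k assume "k \<in> {..<n}"
      show "0 \<le> quad_form A (Matrix.col U k)" by (intro spdD(4)[OF A]) (use U \<open>k \<in> _\<close> in auto)
      show "quad_form A (Matrix.col U k) \<le> exp (quad_form A (Matrix.col U k) - 1)"
        using exp_ge_add_one_self[of "quad_form A (Matrix.col U k) - 1"] by simp
    qed
    also have "\<dots> = exp (\<Sum>k<n. quad_form A (Matrix.col U k) - 1)" by (simp add: exp_sum)
    finally show ?thesis using spd_det_pos[OF B] by (simp add: mult_left_mono)
  qed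
  show thesis using that[OF U UBU 1 2 3] .
qed

text \<open>In the orthonormal frame of \<open>B\<close> the diagonal of \<open>A\<close> is at most
  1, so the trace exponent is nonpositive.\<close>

lemma spd_det_mono:
  assumes A: "spd n A" and B: "spd n B"
    and le: "\<And>x. x \<in> carrier_vec n \<Longrightarrow> quad_form A x \<le> quad_form B x"
  shows "mdet A \<le> mdet B"
proof -
  obtain U where U: "U \<in> carrier_mat n n" and 1: "\<And>k. k < n \<Longrightarrow> quad_form B (Matrix.col U k) = 1"
    and d: "mdet A \<le> mdet B * exp (\<Sum>k<n. quad_form A (Matrix.col U k) - 1)"
    using orthonormal_frame[OF B] A by metis
  have "(\<Sum>k<n. quad_form A (Matrix.col U k) - 1) \<le> 0"
  proof (rule sum_nonpos)
    fix k assume "k \<in> {..<n}"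
    then show "quad_form A (Matrix.col U k) - 1 \<le> 0" using le[of "Matrix.col U k"] 1 U by simp
  qed
  then have "exp (\<Sum>k<n. quad_form A (Matrix.col U k) - 1) \<le> 1" by simp
  then have "mdet B * exp (\<Sum>k<n. quad_form A (Matrix.col U k) - 1) \<le> mdet B * 1"
    using spd_det_pos[OF B] by (intro mult_left_mono) auto
  with d show ?thesis by simp
qed

lemma spd_smult:
  assumes "spd n A" "0 < c"
  shows "spd n (c \<cdot>\<^sub>m A)"
  unfolding spd_def
proof (intro conjI ballI impI)
  note cA = spdD(1,2)[OF assms(1)]
  show "c \<cdot>\<^sub>m A \<in> carrier_mat n n" using cA by simp
  have "transpose_mat (c \<cdot>\<^sub>m A) = c \<cdot>\<^sub>m transpose_mat A" by (intro eq_matI) auto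
  then show "transpose_mat (c \<cdot>\<^sub>m A) = c \<cdot>\<^sub>m A" using cA by simp
  show "0 < quad_form (c \<cdot>\<^sub>m A) v" if "v \<in> carrier_vec n" "v \<noteq> 0\<^sub>v n" for v
    using spdD(3)[OF assms(1) that] assms(2) by (simp add: quad_form_smult_mat[OF cA(1) that(1)])
qed

lemma minv_smult:
  assumes A: "spd n A" and c: "c \<noteq> 0"
  shows "minv (c \<cdot>\<^sub>m A) = (1 / c) \<cdot>\<^sub>m minv A"
proof (rule minv_unique)
  show "c \<cdot>\<^sub>m A \<in> carrier_mat n n" "(1 / c) \<cdot>\<^sub>m minv A \<in> carrier_mat n n"
    using spdD(1)[OF A] spd_minv(1)[OF A] by auto
  show "c \<cdot>\<^sub>m A * ((1 / c) \<cdot>\<^sub>m minv A) = 1\<^sub>m n"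
    using spdD(1)[OF A] spd_minv(1,2)[OF A] c
    by (simp add: mult_smult_assoc_mat[of _ n n _ n] mult_smult_distrib[of _ n n _ n])
       (intro eq_matI; simp)
qed

section \<open>Generalised least squares\<close>

text \<open>Rank is counted on the set of columns, so the columns must first be shown distinct: a
  maximal independent set of columns has \<open>p\<close> elements, which a repetition among
  \<open>p\<close> columns would exclude. Injectivity is the form in which full rank is used
  below.\<close>

lemma full_column_rank_inj:
  fixes D :: "real Matrix.mat"
  assumes D: "D \<in> carrier_mat n p" and r: "vec_space.rank n D = p"
    and v: "v \<in> carrier_vec p" "D *\<^sub>v v = 0\<^sub>v n"
  shows "v = 0\<^sub>v p"
proof (rule ccontr)
  assume nz: "v \<noteq> 0\<^sub>v p"
  interpret vec_space "TYPE(real)" n .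
  have dist: "distinct (cols D)"
  proof (rule card_distinct)
    obtain S where S: "maximal S (\<lambda>T. T \<subseteq> set (cols D) \<and> lin_indpt T)"
      using maximal_exists[of "(\<lambda>T. T \<subseteq> set (cols D) \<and> lin_indpt T)" "card (set (cols D))" "{}"]
      by (meson List.finite_set card_mono empty_iff empty_subsetI finite_lin_indpt2 rev_finite_subset)
    then have "card S \<le> card (set (cols D))" by (simp add: card_mono maximal_def)
    moreover have "card S = p" using rank_card_indpt[OF D S] r by simp
    moreover have "card (set (cols D)) \<le> length (cols D)" by (rule card_length)
    ultimately show "card (set (cols D)) = length (cols D)" using D by simp
  qed
  show False using lin_depI[OF D v(1) nz v(2) dist] full_rank_lin_indpt[OF D r dist] by simp
qed

text \<open>Posterior precision of the regression coefficients up to the variance factor. The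
  covariance is an argument, so that the same facts serve for correlation matrices and for their
  rescalings.\<close>

definition gls :: "real Matrix.mat \<Rightarrow> real Matrix.mat \<Rightarrow> real Matrix.mat \<Rightarrow> real Matrix.mat" where
  "gls K D \<Omega> = transpose_mat D * minv K * D + \<Omega>"

definition gls_residual_mat :: "real Matrix.mat \<Rightarrow> real Matrix.mat \<Rightarrow> real Matrix.mat \<Rightarrow> real Matrix.mat" where
  "gls_residual_mat K D \<Omega> = minv K - minv K * D * minv (gls K D \<Omega>) * transpose_mat D * minv K"

section \<open>Penalised least squares for one covariance matrix\<close>

context
  fixes n p :: nat and K D \<Omega> :: "real Matrix.mat"
  assumes K: "spd n K" and D: "D \<in> carrier_mat n p" and \<Omega>: "sym_psd p \<Omega>"
    and inj: "\<And>v. v \<in> carrier_vec p \<Longrightarrow> D *\<^sub>v v = 0\<^sub>v n \<Longrightarrow> v = 0\<^sub>v p"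
begin

lemma gls_carrier: "gls K D \<Omega> \<in> carrier_mat p p"
  using D \<Omega> spd_minv[OF K] by (auto simp: gls_def sym_psd_def)

lemma quad_form_gls:
  assumes "b \<in> carrier_vec p"
  shows "quad_form (gls K D \<Omega>) b = quad_form (minv K) (D *\<^sub>v b) + quad_form \<Omega> b"
  unfolding gls_def using spd_minv[OF K] D \<Omega> assms
  by (subst quad_form_add_mat[of _ p]) (auto simp: sym_psd_def quad_form_congruence[of _ n _ p] simp del: assoc_mult_mat)

lemma spd_gls: "spd p (gls K D \<Omega>)"
  unfolding spd_def
proof (intro conjI ballI impI)
  have 1: "spd p (transpose_mat D * minv K * D)"
    by (rule spd_congruence[OF spd_minv_spd[OF K] D inj])
  have "transpose_mat (gls K D \<Omega>) = transpose_mat (transpose_mat D * minv K * D) + transpose_mat \<Omega>"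
    unfolding gls_def using spdD(1)[OF 1] \<Omega> by (intro transpose_add) (auto simp: sym_psd_def)
  then show "transpose_mat (gls K D \<Omega>) = gls K D \<Omega>"
    using spdD(2)[OF 1] \<Omega> by (simp add: gls_def sym_psd_def)
  show "0 < quad_form (gls K D \<Omega>) v" if v: "v \<in> carrier_vec p" "v \<noteq> 0\<^sub>v p" for v
  proof -
    have "0 < quad_form (transpose_mat D * minv K * D) v" by (rule spdD(3)[OF 1 v])
    moreover have "0 \<le> quad_form \<Omega> v" using \<Omega> v by (auto simp: sym_psd_def)
    ultimately show ?thesis unfolding gls_def using spdD(1)[OF 1] \<Omega> v
      by (subst quad_form_add_mat[of _ p]) (auto simp: sym_psd_def)
  qed
qed (rule gls_carrier)

text \<open>In this form the subtracted term is an inverse form of the precision matrix, so the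
  duality for inverse forms applies to it.\<close>

lemma quad_form_gls_residual_mat:
  assumes y: "y \<in> carrier_vec n"
  shows "quad_form (gls_residual_mat K D \<Omega>) y =
    quad_form (minv K) y - quad_form (minv (gls K D \<Omega>)) (transpose_mat D *\<^sub>v (minv K *\<^sub>v y))"
proof -
  let ?G = "minv (gls K D \<Omega>)" and ?z = "transpose_mat D *\<^sub>v (minv K *\<^sub>v y)"
  have Ki: "minv K \<in> carrier_mat n n" "transpose_mat (minv K) = minv K"
    using spd_minv(1)[OF K] spd_minv_sym[OF K] by auto
  have G: "?G \<in> carrier_mat p p" using spd_minv(1)[OF spd_gls] .
  have z: "?z \<in> carrier_vec p" using D Ki y by simp
  let ?H = "minv K * D * ?G * transpose_mat D * minv K"
  have KD: "minv K * D \<in> carrier_mat n p" "minv K * D * ?G \<in> carrier_mat n p"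
    "minv K * D * ?G * transpose_mat D \<in> carrier_mat n n"
    using Ki D G by auto
  have H: "?H \<in> carrier_mat n n" using mult_carrier_mat[OF KD(3) Ki(1)] .
  have y': "minv K *\<^sub>v y \<in> carrier_vec n" using Ki y by simp
  have "?H *\<^sub>v y = (minv K * D * ?G * transpose_mat D) *\<^sub>v (minv K *\<^sub>v y)"
    by (rule assoc_mult_mat_vec[OF KD(3) Ki(1) y])
  also have "\<dots> = (minv K * D * ?G) *\<^sub>v ?z"
    by (rule assoc_mult_mat_vec[OF KD(2) _ y']) (use D in simp)
  also have "\<dots> = (minv K * D) *\<^sub>v (?G *\<^sub>v ?z)" by (rule assoc_mult_mat_vec[OF KD(1) G z])
  also have "\<dots> = minv K *\<^sub>v (D *\<^sub>v (?G *\<^sub>v ?z))"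
    by (rule assoc_mult_mat_vec[OF Ki(1) D]) (use G z in simp)
  finally have "?H *\<^sub>v y = minv K *\<^sub>v (D *\<^sub>v (?G *\<^sub>v ?z))" .
  then have "sprod y (?H *\<^sub>v y) = sprod y (minv K *\<^sub>v (D *\<^sub>v (?G *\<^sub>v ?z)))" by simp
  also have "\<dots> = sprod (minv K *\<^sub>v y) (D *\<^sub>v (?G *\<^sub>v ?z))"
    using sprod_mult_mat_vec[OF Ki(1), of "D *\<^sub>v (?G *\<^sub>v ?z)" y] D G z y by (simp add: Ki(2))
  also have "\<dots> = sprod ?z (?G *\<^sub>v ?z)"
    by (rule sprod_mult_mat_vec[OF D]) (use D G z y Ki in auto)
  finally have "sprod y (?H *\<^sub>v y) = quad_form ?G ?z" by (simp add: quad_form_def)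
  moreover have "(minv K - ?H) *\<^sub>v y = minv K *\<^sub>v y - ?H *\<^sub>v y"
    by (rule minus_mult_distrib_mat_vec[OF Ki(1) H y])
  ultimately show ?thesis unfolding gls_residual_mat_def quad_form_def
    using Ki H y by (simp add: scalar_prod_minus_distrib[of _ n] del: assoc_mult_mat)
qed

lemma quad_form_minv_residual:
  assumes y: "y \<in> carrier_vec n" and b: "b \<in> carrier_vec p"
  shows "quad_form (minv K) (y + (-1) \<cdot>\<^sub>v (D *\<^sub>v b)) =
    quad_form (minv K) y - 2 * sprod b (transpose_mat D *\<^sub>v (minv K *\<^sub>v y)) + quad_form (minv K) (D *\<^sub>v b)"
proof -
  have Ki: "minv K \<in> carrier_mat n n" "transpose_mat (minv K) = minv K"
    using spd_minv(1)[OF K] spd_minv_sym[OF K] by auto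
  have Db: "D *\<^sub>v b \<in> carrier_vec n" using D b by simp
  have "sprod y (minv K *\<^sub>v (D *\<^sub>v b)) = sprod (minv K *\<^sub>v y) (D *\<^sub>v b)"
    using sprod_mult_mat_vec[OF Ki(1) Db y] by (simp add: Ki(2))
  also have "\<dots> = sprod (transpose_mat D *\<^sub>v (minv K *\<^sub>v y)) b"
    by (rule sprod_mult_mat_vec[OF D b]) (use Ki y in auto)
  also have "\<dots> = sprod b (transpose_mat D *\<^sub>v (minv K *\<^sub>v y))"
    by (rule comm_scalar_prod[of _ p]) (use D Ki y b in auto)
  finally show ?thesis using quad_form_add_vec[OF Ki y Db, of "-1"] by simp
qed

text \<open>The residual form is the minimum over \<open>b\<close> of the penalised sum of squares,
  by duality for the precision matrix. Every choice of coefficients therefore gives an upper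
  bound.\<close>

lemma gls_residual_le:
  assumes y: "y \<in> carrier_vec n" and b: "b \<in> carrier_vec p"
  shows "quad_form (gls_residual_mat K D \<Omega>) y \<le>
    quad_form (minv K) (y + (-1) \<cdot>\<^sub>v (D *\<^sub>v b)) + quad_form \<Omega> b"
  using quad_form_minv_ge[OF spd_gls b, of "transpose_mat D *\<^sub>v (minv K *\<^sub>v y)"]
    D spd_minv(1)[OF K] y
  by (simp add: quad_form_minv_residual[OF y b] quad_form_gls_residual_mat[OF y] quad_form_gls[OF b])

text \<open>The minimiser is the posterior mean of the coefficients, the point of equality in the
  duality.\<close>

lemma gls_residual_attained:
  assumes y: "y \<in> carrier_vec n"
  shows "\<exists>b\<in>carrier_vec p. quad_form (gls_residual_mat K D \<Omega>) y =
    quad_form (minv K) (y + (-1) \<cdot>\<^sub>v (D *\<^sub>v b)) + quad_form \<Omega> b"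
proof -
  let ?z = "transpose_mat D *\<^sub>v (minv K *\<^sub>v y)"
  let ?b = "minv (gls K D \<Omega>) *\<^sub>v ?z"
  have z: "?z \<in> carrier_vec p" using D spd_minv(1)[OF K] y by simp
  have b: "?b \<in> carrier_vec p" using spd_minv(1)[OF spd_gls] z by simp
  show ?thesis using quad_form_minv_eq[OF spd_gls z]
    by (intro bexI[OF _ b]) (simp add: quad_form_minv_residual[OF y b] quad_form_gls_residual_mat[OF y]
      quad_form_gls[OF b])
qed

text \<open>A lower bound free of the true coefficients \<open>b0\<close>: the penalty of the
  minimiser is dropped, the shift by \<open>b0\<close> is absorbed into the fitted coefficients, and
  the remaining unpenalised fit to the noise \<open>x\<close> is replaced by its maximum, which
  carries only \<open>p\<close> degrees of freedom.\<close>

lemma gls_residual_ge: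
  assumes x: "x \<in> carrier_vec n" and b0: "b0 \<in> carrier_vec p"
  shows "quad_form (minv K) x
      - quad_form (minv (transpose_mat D * minv K * D)) (transpose_mat D *\<^sub>v (minv K *\<^sub>v x))
    \<le> quad_form (gls_residual_mat K D \<Omega>) (D *\<^sub>v b0 + x)"
proof -
  have y: "D *\<^sub>v b0 + x \<in> carrier_vec n" using D x b0 by simp
  obtain b where b: "b \<in> carrier_vec p"
    and eq: "quad_form (gls_residual_mat K D \<Omega>) (D *\<^sub>v b0 + x) =
      quad_form (minv K) (D *\<^sub>v b0 + x + (-1) \<cdot>\<^sub>v (D *\<^sub>v b)) + quad_form \<Omega> b"
    using gls_residual_attained[OF y] by blast
  define h where "h = b + (-1) \<cdot>\<^sub>v b0"
  have h: "h \<in> carrier_vec p" using b b0 by (simp add: h_def)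
  have "D *\<^sub>v h = D *\<^sub>v b + (-1) \<cdot>\<^sub>v (D *\<^sub>v b0)"
    unfolding h_def using D b b0 by (simp add: mult_add_distrib_mat_vec[of _ n p] mult_mat_vec[of _ n p])
  then have e: "D *\<^sub>v b0 + x + (-1) \<cdot>\<^sub>v (D *\<^sub>v b) = x + (-1) \<cdot>\<^sub>v (D *\<^sub>v h)"
    using D b b0 x by (intro eq_vecI) (auto simp: algebra_simps)
  have s: "spd p (transpose_mat D * minv K * D)"
    by (rule spd_congruence[OF spd_minv_spd[OF K] D inj])
  have "2 * sprod h (transpose_mat D *\<^sub>v (minv K *\<^sub>v x)) - quad_form (transpose_mat D * minv K * D) h
      \<le> quad_form (minv (transpose_mat D * minv K * D)) (transpose_mat D *\<^sub>v (minv K *\<^sub>v x))"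
    by (rule quad_form_minv_ge[OF s h]) (use D x spd_minv(1)[OF K] in simp)
  moreover have "0 \<le> quad_form \<Omega> b" using \<Omega> b by (auto simp: sym_psd_def)
  ultimately show ?thesis
    unfolding eq e quad_form_minv_residual[OF x h]
    using quad_form_congruence[OF spd_minv(1)[OF K] D h] by simp
qed

end

section \<open>Matern covariances as Gaussian mixtures\<close>

no_notation Matrix.scalar_prod (infix "\<bullet>" 70)

section \<open>Fourier transforms of Gaussian kernels\<close>

lemma lborel_prod_integral:
  fixes f :: "'b::euclidean_space \<Rightarrow> real \<Rightarrow> complex"
  assumes "\<And>b. b \<in> Basis \<Longrightarrow> integrable lborel (f b)"
  shows "integrable lborel (\<lambda>x. \<Prod>b\<in>Basis. f b (x \<bullet> b))"
    "(LINT x|lborel. (\<Prod>b\<in>Basis. f b (x \<bullet> b))) = (\<Prod>b\<in>Basis. LINT t|lborel. f b t)"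
proof -
  interpret product_sigma_finite "\<lambda>b::'b. lborel :: real measure" ..
  have [measurable]: "f b \<in> borel_measurable borel" if "b \<in> Basis" for b
    using assms[OF that] by auto
  have m1: "(\<lambda>f. \<Sum>b\<in>Basis. f b *\<^sub>R b) \<in> (\<Pi>\<^sub>M b\<in>Basis. lborel) \<rightarrow>\<^sub>M (borel :: 'b measure)"
    by measurable
  have m2: "(\<lambda>x. \<Prod>b\<in>Basis. f b (x \<bullet> b)) \<in> borel_measurable (borel :: 'b measure)"
    by measurable
  have eq: "(\<Prod>b\<in>Basis. f b ((\<Sum>i\<in>Basis. y i *\<^sub>R i) \<bullet> b)) = (\<Prod>b\<in>Basis. f b (y b))" for y :: "'b \<Rightarrow> real"
    by (intro prod.cong refl) simp
  have i: "integrable (\<Pi>\<^sub>M b\<in>(Basis :: 'b set). lborel) (\<lambda>x. \<Prod>b\<in>Basis. f b (x b))"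
    by (rule product_integrable_prod) (use assms in auto)
  show "integrable lborel (\<lambda>x. \<Prod>b\<in>Basis. f b (x \<bullet> b))"
    unfolding lborel_eq[where 'a = 'b] using i by (subst integrable_distr_eq[OF m1 m2]) (simp add: eq)
  show "(LINT x|lborel. (\<Prod>b\<in>Basis. f b (x \<bullet> b))) = (\<Prod>b\<in>Basis. LINT t|lborel. f b t)"
    unfolding lborel_eq[where 'a = 'b]
    by (subst integral_distr[OF m1 m2]) (simp add: eq product_integral_prod assms)
qed

text \<open>The centred normal density with variance 1 / (2 w) in every coordinate, read as a
  spectral density: its Fourier transform is exp (- |x|^2 / (4 w)) with constant 1.\<close>

definition gauss_kernel :: "real \<Rightarrow> 'b::euclidean_space \<Rightarrow> real" where
  "gauss_kernel w x = (w / pi) powr (real DIM('b) / 2) * exp (- w * (norm x)\<^sup>2)"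

lemma gauss_kernel_nonneg: "0 \<le> gauss_kernel w x"
  by (simp add: gauss_kernel_def)

lemma gauss_kernel_measurable [measurable]: "gauss_kernel w \<in> borel_measurable borel"
  unfolding gauss_kernel_def by measurable

lemma gauss_kernel_prod:
  fixes x :: "'b::euclidean_space"
  assumes "0 < w"
  shows "gauss_kernel w x = (\<Prod>b\<in>Basis. sqrt (w / pi) * exp (- w * (x \<bullet> b)\<^sup>2))"
proof -
  have "(norm x)\<^sup>2 = (\<Sum>b\<in>Basis. (x \<bullet> b)\<^sup>2)"
    unfolding power2_norm_eq_inner by (subst euclidean_inner) (simp add: power2_eq_square)
  then have "- w * (norm x)\<^sup>2 = (\<Sum>b\<in>Basis. - w * (x \<bullet> b)\<^sup>2)" by (simp add: sum_distrib_left)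
  then have "exp (- w * (norm x)\<^sup>2) = (\<Prod>b\<in>Basis. exp (- w * (x \<bullet> b)\<^sup>2))"
    by (simp only: exp_sum[OF finite_Basis])
  moreover have "(w / pi) powr (real DIM('b) / 2) = ((w / pi) powr (1 / 2)) powr real DIM('b)"
    by (simp add: powr_powr)
  then have "(w / pi) powr (real DIM('b) / 2) = (\<Prod>b\<in>(Basis :: 'b set). sqrt (w / pi))"
    using assms by (simp add: powr_half_sqrt powr_realpow)
  ultimately show ?thesis by (simp add: gauss_kernel_def prod.distrib)
qed

text \<open>The characteristic function of the standard normal law, rescaled by
  \<open>sqrt (2 * w)\<close>.\<close>

lemma gauss_fourier_1d:
  fixes y w :: real
  assumes w: "0 < w"
  shows "integrable lborel (\<lambda>t. complex_of_real (sqrt (w / pi) * exp (- w * t\<^sup>2)) * cis (t * y))"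
    "(LINT t|lborel. complex_of_real (sqrt (w / pi) * exp (- w * t\<^sup>2)) * cis (t * y)) =
      complex_of_real (exp (- y\<^sup>2 / (4 * w)))"
proof -
  define c where "c = sqrt (2 * w)"
  have c: "c > 0" "c\<^sup>2 = 2 * w" using w by (auto simp: c_def)
  define g where "g = (\<lambda>x. std_normal_density x *\<^sub>R iexp ((y / c) * x))"
  have int: "integrable lborel g"
    unfolding g_def
    by (rule Bochner_Integration.integrable_bound[OF integrable_normal_density[of 1 0]])
       (auto simp: norm_mult)
  have val: "(LINT x|lborel. g x) = complex_of_real (exp (- ((y / c)\<^sup>2) / 2))"
    using fun_cong[OF char_std_normal_distribution, of "y / c"]
    unfolding char_def g_def by (subst (asm) integral_density) auto
  have e: "c *\<^sub>R g (0 + c * t) = complex_of_real (sqrt (w / pi) * exp (- w * t\<^sup>2)) * cis (t * y)" for t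
  proof -
    have "c * std_normal_density (c * t) = sqrt (w / pi) * exp (- w * t\<^sup>2)"
      using c w by (simp add: std_normal_density_def power_mult_distrib real_sqrt_divide real_sqrt_mult c_def)
    then have "complex_of_real c * complex_of_real (std_normal_density (c * t)) =
        complex_of_real (sqrt (w / pi) * exp (- w * t\<^sup>2))" by (metis of_real_mult)
    moreover have "exp (\<i> * complex_of_real (y / c * (c * t))) = cis (t * y)"
      using c by (simp add: cis_conv_exp mult_ac)
    ultimately show ?thesis
      by (simp add: g_def scaleR_conv_of_real del: of_real_mult times_divide_eq_left flip: mult.assoc)
  qed
  show "integrable lborel (\<lambda>t. complex_of_real (sqrt (w / pi) * exp (- w * t\<^sup>2)) * cis (t * y))"
    using integrable_scaleR_right[OF lborel_integrable_real_affine[OF int, of c 0], of c] c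
    unfolding e by auto
  have "(LINT x|lborel. g x) = \<bar>c\<bar> *\<^sub>R (LINT x|lborel. g (0 + c * x))"
    by (rule lborel_integral_real_affine) (use c in auto)
  also have "\<dots> = (LINT x|lborel. c *\<^sub>R g (0 + c * x))" using c by simp
  finally have "(LINT x|lborel. c *\<^sub>R g (0 + c * x)) = complex_of_real (exp (- ((y / c)\<^sup>2) / 2))"
    using val by simp
  then show "(LINT t|lborel. complex_of_real (sqrt (w / pi) * exp (- w * t\<^sup>2)) * cis (t * y)) =
      complex_of_real (exp (- y\<^sup>2 / (4 * w)))"
    unfolding e using c by (simp add: power_divide)
qed

lemma cis_sum: "finite A \<Longrightarrow> cis (\<Sum>a\<in>A. f a) = (\<Prod>a\<in>A. cis (f a))"
  by (induction rule: finite_induct) (auto simp flip: cis_mult)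

lemma gauss_fourier:
  fixes x :: "'b::euclidean_space"
  assumes w: "0 < w"
  shows "integrable lborel (\<lambda>\<omega>. complex_of_real (gauss_kernel w \<omega>) * cis (\<omega> \<bullet> x))"
    "(LINT \<omega>|lborel. complex_of_real (gauss_kernel w \<omega>) * cis (\<omega> \<bullet> x)) =
      complex_of_real (exp (- (norm x)\<^sup>2 / (4 * w)))"
proof -
  let ?f = "\<lambda>b t. complex_of_real (sqrt (w / pi) * exp (- w * t\<^sup>2)) * cis (t * (x \<bullet> b))"
  have e: "complex_of_real (gauss_kernel w \<omega>) * cis (\<omega> \<bullet> x) = (\<Prod>b\<in>Basis. ?f b (\<omega> \<bullet> b))" for \<omega> :: 'b
    unfolding gauss_kernel_prod[OF w] by (subst euclidean_inner) (simp add: cis_sum prod.distrib)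
  show "integrable lborel (\<lambda>\<omega>. complex_of_real (gauss_kernel w \<omega>) * cis (\<omega> \<bullet> x))"
    unfolding e by (rule lborel_prod_integral) (rule gauss_fourier_1d[OF w])
  have "(norm x)\<^sup>2 = (\<Sum>b\<in>Basis. (x \<bullet> b)\<^sup>2)"
    unfolding power2_norm_eq_inner by (subst euclidean_inner) (simp add: power2_eq_square)
  then have "- (norm x)\<^sup>2 / (4 * w) = (\<Sum>b\<in>Basis. - (x \<bullet> b)\<^sup>2 / (4 * w))"
    by (simp add: sum_divide_distrib sum_negf)
  then have p: "exp (- (norm x)\<^sup>2 / (4 * w)) = (\<Prod>b\<in>Basis. exp (- (x \<bullet> b)\<^sup>2 / (4 * w)))"
    by (simp only: exp_sum[OF finite_Basis])
  show "(LINT \<omega>|lborel. complex_of_real (gauss_kernel w \<omega>) * cis (\<omega> \<bullet> x)) =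
      complex_of_real (exp (- (norm x)\<^sup>2 / (4 * w)))"
    unfolding e lborel_prod_integral(2)[of ?f, OF gauss_fourier_1d(1)[OF w]]
    unfolding gauss_fourier_1d(2)[OF w] p by simp
qed

text \<open>Fourier transform of the measure with mass \<open>a i\<close> at the point
  \<open>s i\<close>. Its squared modulus, integrated against a spectral density, is the quadratic
  form of the covariance at the points.\<close>

definition trig_poly :: "nat \<Rightarrow> (nat \<Rightarrow> 'b::euclidean_space) \<Rightarrow> (nat \<Rightarrow> real) \<Rightarrow> 'b \<Rightarrow> complex" where
  "trig_poly n s a \<omega> = (\<Sum>i<n. complex_of_real (a i) * cis (\<omega> \<bullet> s i))"

abbreviation (input) trig_power :: "nat \<Rightarrow> (nat \<Rightarrow> 'b::euclidean_space) \<Rightarrow> real Matrix.vec \<Rightarrow> 'b \<Rightarrow> real" where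
  "trig_power n s v \<omega> \<equiv> (cmod (trig_poly n s (vec_index v) \<omega>))\<^sup>2"

lemma trig_poly_measurable [measurable]: "trig_poly n s a \<in> borel_measurable borel"
  unfolding trig_poly_def by (intro borel_measurable_continuous_onI) (intro continuous_intros)

lemma cmod_trig_poly_square:
  "(cmod (trig_poly n s a \<omega>))\<^sup>2 = (\<Sum>i<n. \<Sum>j<n. a i * a j * cos (\<omega> \<bullet> (s i - s j)))"
proof -
  have "(cmod (trig_poly n s a \<omega>))\<^sup>2 = Re (trig_poly n s a \<omega> * cnj (trig_poly n s a \<omega>))"
    by (simp add: complex_mult_cnj cmod_power2)
  also have "trig_poly n s a \<omega> * cnj (trig_poly n s a \<omega>) =
     (\<Sum>i<n. \<Sum>j<n. complex_of_real (a i * a j) * cis (\<omega> \<bullet> (s i - s j)))"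
  proof -
    have "complex_of_real (a i) * cis (\<omega> \<bullet> s i) * (complex_of_real (a j) * cis (- (\<omega> \<bullet> s j))) =
      complex_of_real (a i * a j) * cis (\<omega> \<bullet> (s i - s j))" for i j
      using cis_mult[of "\<omega> \<bullet> s i" "- (\<omega> \<bullet> s j)"]
      by (simp add: inner_diff_right mult_ac)
    then show ?thesis by (simp only: trig_poly_def sum_product cis_cnj cnj_sum complex_cnj_mult
      complex_cnj_complex_of_real)
  qed
  finally show ?thesis by simp
qed

lemma cmod_trig_poly_square':
  "(cmod (trig_poly n s a \<omega>))\<^sup>2 =
    (\<Sum>i<n. a i * cos (\<omega> \<bullet> s i))\<^sup>2 + (\<Sum>i<n. a i * sin (\<omega> \<bullet> s i))\<^sup>2"
  by (simp add: trig_poly_def cmod_power2)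

text \<open>Expand the squared modulus into cosines of differences of points and integrate each of
  them.\<close>

lemma gauss_quad_form_integral:
  fixes s :: "nat \<Rightarrow> 'b::euclidean_space"
  assumes w: "0 < w"
  shows "integrable lborel (\<lambda>\<omega>. (cmod (trig_poly n s a \<omega>))\<^sup>2 * gauss_kernel w \<omega>)"
    "(LINT \<omega>|lborel. (cmod (trig_poly n s a \<omega>))\<^sup>2 * gauss_kernel w \<omega>) =
    (\<Sum>i<n. \<Sum>j<n. a i * a j * exp (- (norm (s i - s j))\<^sup>2 / (4 * w)))"
proof -
  let ?g = "gauss_kernel w :: 'b \<Rightarrow> real"
  have 1: "integrable lborel (\<lambda>\<omega>. ?g \<omega> * cos (\<omega> \<bullet> x))" for x :: 'b
    using integrable_Re[OF gauss_fourier(1)[OF w, of x]] by simp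
  have 2: "(LINT \<omega>|lborel. ?g \<omega> * cos (\<omega> \<bullet> x)) = exp (- (norm x)\<^sup>2 / (4 * w))" for x :: 'b
    using integral_Re[OF gauss_fourier(1)[OF w, of x]] gauss_fourier(2)[OF w, of x] by simp
  have e: "(cmod (trig_poly n s a \<omega>))\<^sup>2 * ?g \<omega> =
      (\<Sum>i<n. \<Sum>j<n. (a i * a j) * (?g \<omega> * cos (\<omega> \<bullet> (s i - s j))))" for \<omega>
    unfolding cmod_trig_poly_square sum_distrib_right by (intro sum.cong) (auto simp: mult_ac)
  show "integrable lborel (\<lambda>\<omega>. (cmod (trig_poly n s a \<omega>))\<^sup>2 * ?g \<omega>)"
    unfolding e by (intro Bochner_Integration.integrable_sum integrable_mult_right 1)
  show "(LINT \<omega>|lborel. (cmod (trig_poly n s a \<omega>))\<^sup>2 * ?g \<omega>) =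
      (\<Sum>i<n. \<Sum>j<n. a i * a j * exp (- (norm (s i - s j))\<^sup>2 / (4 * w)))"
    unfolding e by (simp add: Bochner_Integration.integral_sum 1 2)
qed

lemma gauss_quad_form:
  fixes s :: "nat \<Rightarrow> 'b::euclidean_space"
  assumes w: "0 < w"
  shows "(\<integral>\<^sup>+\<omega>. ennreal ((cmod (trig_poly n s a \<omega>))\<^sup>2 * gauss_kernel w \<omega>) \<partial>lborel) =
    ennreal (\<Sum>i<n. \<Sum>j<n. a i * a j * exp (- (norm (s i - s j))\<^sup>2 / (4 * w)))"
  unfolding gauss_quad_form_integral(2)[OF w, symmetric]
  by (rule nn_integral_eq_integral[OF gauss_quad_form_integral(1)[OF w]]) (simp add: gauss_kernel_nonneg)

section \<open>The Matern function as a Gamma mixture of Gaussians\<close>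

lemma exp_substitution:
  fixes f :: "real \<Rightarrow> real"
  assumes [measurable]: "f \<in> borel_measurable borel" and nn: "\<And>w. 0 < w \<Longrightarrow> 0 \<le> f w"
    and int: "set_integrable lborel {0<..} f" and c: "0 < c"
  shows "integrable lborel (\<lambda>t. c * exp t * f (c * exp t))"
    "(LINT t|lborel. c * exp t * f (c * exp t)) = (LINT w:{0<..}|lborel. f w)"
proof -
  let ?g = "\<lambda>t. c * exp t"
  have im: "?g ` UNIV = {0<..}"
  proof (intro equalityI subsetI)
    fix w :: real assume "w \<in> {0<..}"
    then have "w = ?g (ln (w / c))" using c by simp
    then show "w \<in> ?g ` UNIV" by blast
  qed (use c in auto)
  have "f absolutely_integrable_on {0<..}"
    using set_borel_integral_eq_integral(1)[OF int] nn by (intro nonnegative_absolutely_integrable_1) auto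
  moreover have "(\<lambda>t. \<bar>?g t\<bar> * f (?g t)) absolutely_integrable_on UNIV \<and>
      integral UNIV (\<lambda>t. \<bar>?g t\<bar> * f (?g t)) = integral {0<..} f
    \<longleftrightarrow> f absolutely_integrable_on (?g ` UNIV) \<and> integral (?g ` UNIV) f = integral {0<..} f"
    by (rule has_absolute_integral_change_of_variables_1')
       (use c in \<open>auto intro!: derivative_eq_intros injI\<close>)
  ultimately have *: "(\<lambda>t. ?g t * f (?g t)) absolutely_integrable_on UNIV"
    "integral UNIV (\<lambda>t. ?g t * f (?g t)) = integral {0<..} f"
    unfolding im using c by (simp_all add: abs_mult)
  have "integrable lebesgue (\<lambda>t. ?g t * f (?g t))"
    using *(1) by (simp add: set_integrable_def)
  then show int': "integrable lborel (\<lambda>t. ?g t * f (?g t))"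
    by (subst (asm) integrable_completion) auto
  have "(LINT t|lborel. ?g t * f (?g t)) = integral UNIV (\<lambda>t. ?g t * f (?g t))"
    using set_borel_integral_eq_integral(2)[of UNIV "\<lambda>t. ?g t * f (?g t)"] int'
    by (simp add: set_integrable_def set_lebesgue_integral_def)
  then show "(LINT t|lborel. ?g t * f (?g t)) = (LINT w:{0<..}|lborel. f w)"
    using *(2) set_borel_integral_eq_integral(2)[OF int] by simp
qed

text \<open>Euler's integral after scaling. It is used twice: for the total mass of the mixing
  density and for the spectral density of the mixture.\<close>

lemma nn_integral_Gamma_scaled:
  assumes z: "0 < z" and b: "0 < b"
  shows "(\<integral>\<^sup>+w\<in>{0<..}. ennreal (w powr (z - 1) * exp (- b * w)) \<partial>lborel) = ennreal (Gamma z * b powr (- z))"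
proof -
  have "ennreal (Gamma z) = (\<integral>\<^sup>+t. ennreal (indicator {0..} t * t powr (z - 1) / exp t) \<partial>lborel)"
    by (rule Gamma_conv_nn_integral_real[OF z])
  also have "\<dots> = ennreal \<bar>b\<bar> * (\<integral>\<^sup>+w. ennreal (indicator {0..} (0 + b * w) * (0 + b * w) powr (z - 1) / exp (0 + b * w)) \<partial>lborel)"
    by (rule nn_integral_real_affine) (use b in auto)
  also have "(\<integral>\<^sup>+w. ennreal (indicator {0..} (0 + b * w) * (0 + b * w) powr (z - 1) / exp (0 + b * w)) \<partial>lborel)
     = (\<integral>\<^sup>+w. ennreal (b powr (z - 1)) * (ennreal (w powr (z - 1) * exp (- b * w)) * indicator {0<..} w) \<partial>lborel)"
  proof (rule nn_integral_cong_AE)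
    show "AE w in lborel. ennreal (indicator {0..} (0 + b * w) * (0 + b * w) powr (z - 1) / exp (0 + b * w)) =
        ennreal (b powr (z - 1)) * (ennreal (w powr (z - 1) * exp (- b * w)) * indicator {0<..} w)"
      using AE_lborel_singleton[of 0]
    proof eventually_elim
      case (elim w)
      consider "w < 0" | "w > 0" using elim by linarith
      then show ?case
      proof cases
        case 1 then show ?thesis using b by (simp add: indicator_def zero_le_mult_iff)
      next
        case 2 then show ?thesis using b
          by (simp add: indicator_def powr_mult exp_minus divide_inverse mult_ac flip: ennreal_mult')
      qed
    qed
  qed
  also have "\<dots> = ennreal (b powr (z - 1)) * (\<integral>\<^sup>+w\<in>{0<..}. ennreal (w powr (z - 1) * exp (- b * w)) \<partial>lborel)"
    by (rule nn_integral_cmult) measurable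
  finally have "ennreal (Gamma z) = ennreal (b powr z) *
      (\<integral>\<^sup>+w\<in>{0<..}. ennreal (w powr (z - 1) * exp (- b * w)) \<partial>lborel)"
    using b by (simp add: mult.assoc[symmetric] powr_mult_base flip: ennreal_mult')
  then have "ennreal (b powr (- z)) * ennreal (Gamma z) = ennreal (b powr (- z)) * ennreal (b powr z) *
      (\<integral>\<^sup>+w\<in>{0<..}. ennreal (w powr (z - 1) * exp (- b * w)) \<partial>lborel)"
    by (simp add: mult.assoc)
  also have "ennreal (b powr (- z)) * ennreal (b powr z) = 1"
    using b by (simp add: powr_minus field_simps flip: ennreal_mult')
  finally show ?thesis by (simp add: ennreal_mult'' mult.commute)
qed

text \<open>Folding the line onto the half line turns exp (\<nu> t) into 2 cosh (\<nu> t) against an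
  even factor and so meets the integral that defines \<open>bessel_K\<close>.\<close>

lemma set_integral_half_line_symmetrize:
  fixes h :: "real \<Rightarrow> real"
  assumes "integrable lborel h"
  shows "(LINT t|lborel. h t) = (LINT t:{0..}|lborel. h t + h (- t))"
proof -
  have m: "h \<in> borel_measurable borel" using assms by auto
  have 1: "set_integrable lborel {0..} h" unfolding set_integrable_def
    using integrable_mult_indicator[OF _ assms, of "{0..}"] by simp
  have int': "integrable lborel (\<lambda>t. h (- t))"
    using lborel_integrable_real_affine[OF assms, of "-1" 0] by simp
  have 2: "set_integrable lborel {0..} (\<lambda>t. h (- t))" unfolding set_integrable_def
    using integrable_mult_indicator[OF _ int', of "{0..}"] by simp
  have i3: "integrable lborel (\<lambda>t. indicator {..0} t * h t)"
    using integrable_mult_indicator[OF _ assms, of "{..0}"] by simp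
  have "(LINT t:{0..}|lborel. h (- t)) = (LINT t|lborel. indicator {..0} (0 + (-1) * t) * h (0 + (-1) * t))"
    unfolding set_lebesgue_integral_def by (intro Bochner_Integration.integral_cong) (auto simp: indicator_def)
  also have "\<dots> = (LINT t|lborel. indicator {..0} t * h t)"
    by (subst lborel_integral_real_affine[of "-1" "\<lambda>t. indicator {..0} t * h t" 0]) simp_all
  finally have "(LINT t:{0..}|lborel. h t + h (- t)) =
      (LINT t|lborel. indicator {0..} t * h t) + (LINT t|lborel. indicator {..0} t * h t)"
    using set_integral_add(2)[OF 1 2] by (simp add: set_lebesgue_integral_def)
  also have "\<dots> = (LINT t|lborel. indicator {0..} t * h t + indicator {..0} t * h t)"
    using 1 i3 by (simp add: set_integrable_def)
  also have "\<dots> = (LINT t|lborel. h t)"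
  proof (rule integral_cong_AE)
    show "AE t in lborel. indicator {0..} t * h t + indicator {..0} t * h t = h t"
      using AE_lborel_singleton[of 0] by eventually_elim (auto simp: indicator_def)
  qed (use m in auto)
  finally show ?thesis ..
qed

text \<open>The Gamma density with shape \<nu> and rate \<alpha>^2, without its factor \<alpha>^(2
  \<nu>). Mixing Gaussian kernels with it yields the Matern function already divided by \<alpha>^(2
  \<nu>).\<close>

definition matern_mix :: "real \<Rightarrow> real \<Rightarrow> real \<Rightarrow> real" where
  "matern_mix \<nu> \<alpha> w = indicator {0<..} w * (w powr (\<nu> - 1) * exp (- \<alpha>\<^sup>2 * w)) / Gamma \<nu>"

lemma matern_mix_measurable [measurable]: "matern_mix \<nu> \<alpha> \<in> borel_measurable borel"
  unfolding matern_mix_def by measurable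

lemma matern_mix_nonneg: "0 < \<nu> \<Longrightarrow> 0 \<le> matern_mix \<nu> \<alpha> w"
  by (simp add: matern_mix_def Gamma_real_pos less_imp_le)

lemma nn_integral_matern_mix:
  assumes "0 < \<nu>" "0 < \<alpha>"
  shows "(\<integral>\<^sup>+w. ennreal (matern_mix \<nu> \<alpha> w) \<partial>lborel) = ennreal (\<alpha> powr (- (2 * \<nu>)))"
proof -
  have "(\<integral>\<^sup>+w. ennreal (matern_mix \<nu> \<alpha> w) \<partial>lborel) =
    (\<integral>\<^sup>+w. ennreal (1 / Gamma \<nu>) * (ennreal (w powr (\<nu> - 1) * exp (- \<alpha>\<^sup>2 * w)) * indicator {0<..} w) \<partial>lborel)"
    using Gamma_real_pos[OF assms(1)]
    by (intro nn_integral_cong) (simp add: matern_mix_def indicator_def flip: ennreal_mult')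
  also have "\<dots> = ennreal (1 / Gamma \<nu>) * ennreal (Gamma \<nu> * (\<alpha>\<^sup>2) powr (- \<nu>))"
    using nn_integral_Gamma_scaled[of \<nu> "\<alpha>\<^sup>2"] assms by (subst nn_integral_cmult) simp_all
  also have "(\<alpha>\<^sup>2) powr (- \<nu>) = \<alpha> powr (- (2 * \<nu>))"
    using assms by (simp add: powr_powr flip: powr_numeral)
  finally show ?thesis using Gamma_real_pos[OF assms(1)] by (simp flip: ennreal_mult')
qed

lemma integrable_matern_mix:
  assumes "0 < \<nu>" "0 < \<alpha>" "0 \<le> r"
  shows "integrable lborel (\<lambda>w. matern_mix \<nu> \<alpha> w * exp (- r / (4 * w)))"
proof (rule Bochner_Integration.integrable_bound)
  show "integrable lborel (matern_mix \<nu> \<alpha>)"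
    by (rule integrableI_nonneg) (use assms in \<open>auto simp: matern_mix_nonneg nn_integral_matern_mix\<close>)
  show "AE w in lborel. norm (matern_mix \<nu> \<alpha> w * exp (- r / (4 * w))) \<le> norm (matern_mix \<nu> \<alpha> w)"
  proof (rule AE_I2)
    fix w
    show "norm (matern_mix \<nu> \<alpha> w * exp (- r / (4 * w))) \<le> norm (matern_mix \<nu> \<alpha> w)"
    proof (cases "0 < w")
      case True
      then have "exp (- r / (4 * w)) \<le> 1" using assms by simp
      then show ?thesis using matern_mix_nonneg[OF assms(1), of \<alpha> w]
        by (simp add: abs_mult mult_left_le)
    qed (simp add: matern_mix_def)
  qed
qed auto

text \<open>At x = 0 this is the total mass of the mixing density. Otherwise an exponential
  substitution turns the exponent \<alpha>^2 w + r^2 / (4 w) into \<alpha> r cosh t, and folding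
  gives Schlaefli's integral.\<close>

lemma matern_mixture:
  fixes x :: "real ^ 'd"
  assumes \<nu>: "0 < \<nu>" and \<alpha>: "0 < \<alpha>"
  shows "(LINT w|lborel. matern_mix \<nu> \<alpha> w * exp (- (norm x)\<^sup>2 / (4 * w))) = \<alpha> powr (- (2 * \<nu>)) * matern \<nu> \<alpha> x"
proof (cases "x = 0")
  case True
  have "(LINT w|lborel. matern_mix \<nu> \<alpha> w) = \<alpha> powr (- (2 * \<nu>))"
    by (rule integral_eq_nn_integral[THEN trans])
       (use assms in \<open>auto simp: matern_mix_nonneg nn_integral_matern_mix\<close>)
  then show ?thesis using True by (simp add: matern_def)
next
  case False
  define r where "r = norm x"
  have r: "0 < r" using False by (simp add: r_def)
  define f where "f = (\<lambda>w. w powr (\<nu> - 1) * exp (- \<alpha>\<^sup>2 * w) * exp (- r\<^sup>2 / (4 * w)))"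
  have [measurable]: "f \<in> borel_measurable borel" unfolding f_def by measurable
  have G: "Gamma \<nu> > 0" using \<nu> by (rule Gamma_real_pos)
  have e: "indicator {0<..} w *\<^sub>R f w = Gamma \<nu> * (matern_mix \<nu> \<alpha> w * exp (- r\<^sup>2 / (4 * w)))" for w
    using G by (simp add: f_def matern_mix_def)
  have int: "set_integrable lborel {0<..} f"
    unfolding set_integrable_def e using assms by (intro integrable_mult_right integrable_matern_mix) auto
  \<comment> \<open>Minimiser of \<alpha>^2 w + r^2 / (4 w): substituting w = c exp t with this
    \<open>c\<close> makes the exponent even in t.\<close>
  define c where "c = r / (2 * \<alpha>)"
  have c: "0 < c" using r \<alpha> by (simp add: c_def)
  have sub: "c * exp t * f (c * exp t) = c powr \<nu> * (exp (- (\<alpha> * r) * cosh t) * exp (\<nu> * t))" for t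
  proof -
    have "c * exp t * (c * exp t) powr (\<nu> - 1) = (c * exp t) powr \<nu>"
      using c powr_mult_base[of "c * exp t" "\<nu> - 1"] by simp
    also have "\<dots> = c powr \<nu> * exp (\<nu> * t)"
      using c by (simp add: powr_mult) (simp add: powr_def mult.commute)
    finally have 1: "c * exp t * (c * exp t) powr (\<nu> - 1) = c powr \<nu> * exp (\<nu> * t)" .
    have "- \<alpha>\<^sup>2 * (c * exp t) + - r\<^sup>2 / (4 * (c * exp t)) = - (\<alpha> * r) * cosh t"
      using r \<alpha> by (simp add: c_def cosh_field_def exp_minus field_simps power2_eq_square)
    then have 2: "exp (- \<alpha>\<^sup>2 * (c * exp t)) * exp (- r\<^sup>2 / (4 * (c * exp t))) = exp (- (\<alpha> * r) * cosh t)"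
      by (simp only: exp_add[symmetric])
    have "c * exp t * f (c * exp t) = (c * exp t * (c * exp t) powr (\<nu> - 1)) *
        (exp (- \<alpha>\<^sup>2 * (c * exp t)) * exp (- r\<^sup>2 / (4 * (c * exp t))))"
      by (simp only: f_def mult.assoc)
    also have "\<dots> = (c powr \<nu> * exp (\<nu> * t)) * exp (- (\<alpha> * r) * cosh t)" by (simp only: 1 2)
    finally show ?thesis by (simp only: mult_ac)
  qed
  note S = exp_substitution[OF _ _ int c, unfolded sub]
  have nn: "0 \<le> f w" for w by (simp add: f_def)
  have int2: "integrable lborel (\<lambda>t. exp (- (\<alpha> * r) * cosh t) * exp (\<nu> * t))"
    using S(1) nn c by simp
  have "(LINT t|lborel. exp (- (\<alpha> * r) * cosh t) * exp (\<nu> * t)) =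
     (LINT t:{0..}|lborel. 2 * (exp (- (\<alpha> * r) * cosh t) * cosh (\<nu> * t)))"
  proof -
    have "exp (- (\<alpha> * r) * cosh t) * exp (\<nu> * t) + exp (- (\<alpha> * r) * cosh (- t)) * exp (\<nu> * - t) =
        2 * (exp (- (\<alpha> * r) * cosh t) * cosh (\<nu> * t))" for t
    proof -
      have "exp (\<nu> * t) + exp (\<nu> * - t) = 2 * cosh (\<nu> * t)" by (simp add: cosh_field_def)
      then have "E * exp (\<nu> * t) + E * exp (\<nu> * - t) = 2 * (E * cosh (\<nu> * t))" for E
        by (simp flip: distrib_left)
      then show ?thesis by simp
    qed
    then show ?thesis by (simp only: set_integral_half_line_symmetrize[OF int2])
  qed
  also have "\<dots> = 2 * bessel_K \<nu> (\<alpha> * r)"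
    unfolding bessel_K_def by (simp only: set_integral_mult_right)
  finally have K: "(LINT w:{0<..}|lborel. f w) = c powr \<nu> * (2 * bessel_K \<nu> (\<alpha> * r))"
    using S(2) nn by simp
  have "(LINT w|lborel. matern_mix \<nu> \<alpha> w * exp (- r\<^sup>2 / (4 * w))) = (LINT w:{0<..}|lborel. f w) / Gamma \<nu>"
    unfolding set_lebesgue_integral_def e using G by simp
  moreover have "(LINT w:{0<..}|lborel. f w) / Gamma \<nu> = \<alpha> powr (- (2 * \<nu>)) * (2 powr (1 - \<nu>) / Gamma \<nu> * (\<alpha> * r) powr \<nu> * bessel_K \<nu> (\<alpha> * r))"
  proof -
    have c': "c powr \<nu> = r powr \<nu> / (2 powr \<nu> * \<alpha> powr \<nu>)"
      using r \<alpha> by (simp add: c_def powr_divide powr_mult)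
    have "\<alpha> powr (- (2 * \<nu>)) * \<alpha> powr \<nu> = \<alpha> powr (- \<nu>)" by (simp flip: powr_add)
    then have a': "\<alpha> powr (- (2 * \<nu>)) * \<alpha> powr \<nu> = 1 / \<alpha> powr \<nu>" by (simp add: powr_minus_divide)
    have t': "2 powr (1 - \<nu>) = 2 / 2 powr \<nu>" by (simp add: powr_diff)
    have m': "(\<alpha> * r) powr \<nu> = \<alpha> powr \<nu> * r powr \<nu>" using r \<alpha> by (simp add: powr_mult)
    have "\<alpha> powr (- (2 * \<nu>)) * (2 / 2 powr \<nu> / Gamma \<nu> * (\<alpha> powr \<nu> * r powr \<nu>) * bessel_K \<nu> (\<alpha> * r)) =
       (\<alpha> powr (- (2 * \<nu>)) * \<alpha> powr \<nu>) * (2 / 2 powr \<nu> * r powr \<nu> * bessel_K \<nu> (\<alpha> * r) / Gamma \<nu>)"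
      by (simp only: divide_inverse mult_ac)
    also have "\<dots> = r powr \<nu> / (2 powr \<nu> * \<alpha> powr \<nu>) * (2 * bessel_K \<nu> (\<alpha> * r)) / Gamma \<nu>"
      unfolding a' by (simp only: divide_inverse mult_ac inverse_mult_distrib mult_1_left)
    finally show ?thesis unfolding K t' m' c' by (rule sym)
  qed
  moreover have "matern \<nu> \<alpha> x = 2 powr (1 - \<nu>) / Gamma \<nu> * (\<alpha> * r) powr \<nu> * bessel_K \<nu> (\<alpha> * r)"
    using False by (simp add: matern_def r_def)
  ultimately show ?thesis unfolding r_def[symmetric] by simp
qed

text \<open>Rescaled so that matrices with the same microergodic parameter become comparable.\<close>

definition scaled_corr_mat :: "real \<Rightarrow> (nat \<Rightarrow> real ^ 'd) \<Rightarrow> nat \<Rightarrow> real \<Rightarrow> real Matrix.mat" where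
  "scaled_corr_mat \<nu> s n \<alpha> = \<alpha> powr (- (2 * \<nu>)) \<cdot>\<^sub>m corr_mat \<nu> s n \<alpha>"

text \<open>Spectral density of the rescaled Matern covariance. The usual prefactor \<alpha>^(2
  \<nu>) is cancelled by the rescaling, so \<alpha> survives only in the base of the power;
  monotonicity in \<alpha> and the common behaviour at high frequencies rest on this.\<close>

definition spec_dens :: "real \<Rightarrow> real \<Rightarrow> 'b::euclidean_space \<Rightarrow> real" where
  "spec_dens \<nu> \<alpha> \<omega> = Gamma (\<nu> + DIM('b) / 2) / (Gamma \<nu> * pi powr (DIM('b) / 2)) *
     (\<alpha>\<^sup>2 + (norm \<omega>)\<^sup>2) powr (- (\<nu> + DIM('b) / 2))"

lemma spec_dens_measurable [measurable]: "spec_dens \<nu> \<alpha> \<in> borel_measurable borel"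
  unfolding spec_dens_def by measurable

lemma spec_dens_pos:
  fixes \<omega> :: "'b::euclidean_space"
  assumes "0 < \<nu>" "0 < \<alpha>"
  shows "0 < spec_dens \<nu> \<alpha> \<omega>"
proof -
  have "0 < \<alpha>\<^sup>2 + (norm \<omega>)\<^sup>2" using assms by (simp add: add_pos_nonneg)
  then show ?thesis unfolding spec_dens_def using assms by (auto intro!: mult_pos_pos divide_pos_pos Gamma_real_pos)
qed

section \<open>Spectral representation and strict positivity\<close>

lemma corr_mat_carrier [simp]: "corr_mat \<nu> s n \<alpha> \<in> carrier_mat n n"
  by (simp add: corr_mat_def)

lemma scaled_corr_mat_carrier [simp]: "scaled_corr_mat \<nu> s n \<alpha> \<in> carrier_mat n n"
  by (simp add: scaled_corr_mat_def)

lemma matern_minus: "matern \<nu> \<alpha> (x - y) = matern \<nu> \<alpha> (y - x)"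
  by (simp add: matern_def norm_minus_commute)

lemma scaled_corr_mat_sym: "transpose_mat (scaled_corr_mat \<nu> s n \<alpha>) = scaled_corr_mat \<nu> s n \<alpha>"
  by (intro eq_matI) (auto simp: scaled_corr_mat_def corr_mat_def matern_minus)

text \<open>Mixing the Gaussian spectral densities over w is again a Gamma integral, now with shape
  \<nu> + d/2 and rate \<alpha>^2 + |\<omega>|^2.\<close>

lemma nn_integral_mix_gauss:
  fixes \<omega> :: "'b::euclidean_space"
  assumes "0 < \<nu>" "0 < \<alpha>"
  shows "(\<integral>\<^sup>+w. ennreal (matern_mix \<nu> \<alpha> w * gauss_kernel w \<omega>) \<partial>lborel) = ennreal (spec_dens \<nu> \<alpha> \<omega>)"
proof -
  let ?h = "real DIM('b) / 2"
  let ?b = "\<alpha>\<^sup>2 + (norm \<omega>)\<^sup>2"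
  have b: "0 < ?b" using assms by (simp add: add_pos_nonneg)
  have G: "0 < Gamma \<nu>" using assms by (simp add: Gamma_real_pos)
  have "ennreal (matern_mix \<nu> \<alpha> w * gauss_kernel w \<omega>) = ennreal (1 / (Gamma \<nu> * pi powr ?h)) *
      (ennreal (w powr ((\<nu> + ?h) - 1) * exp (- ?b * w)) * indicator {0<..} w)" for w
  proof (cases "0 < w")
    case True
    have "w powr ((\<nu> + ?h) - 1) = w powr (\<nu> - 1) * w powr ?h"
      by (simp add: algebra_simps flip: powr_add)
    moreover have "exp (- ?b * w) = exp (- \<alpha>\<^sup>2 * w) * exp (- w * (norm \<omega>)\<^sup>2)"
      by (simp add: algebra_simps flip: exp_add)
    ultimately have "matern_mix \<nu> \<alpha> w * gauss_kernel w \<omega> =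
        (1 / (Gamma \<nu> * pi powr ?h)) * (w powr ((\<nu> + ?h) - 1) * exp (- ?b * w))"
      using True by (simp add: matern_mix_def gauss_kernel_def powr_divide)
    also have "ennreal \<dots> = ennreal (1 / (Gamma \<nu> * pi powr ?h)) *
        ennreal (w powr ((\<nu> + ?h) - 1) * exp (- ?b * w))"
      by (rule ennreal_mult') (use G in simp)
    finally show ?thesis using True by simp
  qed (simp add: matern_mix_def)
  then have "(\<integral>\<^sup>+w. ennreal (matern_mix \<nu> \<alpha> w * gauss_kernel w \<omega>) \<partial>lborel) =
      ennreal (1 / (Gamma \<nu> * pi powr ?h)) *
      (\<integral>\<^sup>+w\<in>{0<..}. ennreal (w powr ((\<nu> + ?h) - 1) * exp (- ?b * w)) \<partial>lborel)"
    by (simp add: nn_integral_cmult)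
  also have "\<dots> = ennreal (1 / (Gamma \<nu> * pi powr ?h)) * ennreal (Gamma (\<nu> + ?h) * ?b powr (- (\<nu> + ?h)))"
    using assms by (subst nn_integral_Gamma_scaled[OF _ b]) (auto intro: add_pos_nonneg)
  also have "\<dots> = ennreal (spec_dens \<nu> \<alpha> \<omega>)"
    using G by (subst ennreal_mult'[symmetric]) (auto simp: spec_dens_def)
  finally show ?thesis .
qed

text \<open>Bochner's representation of the Matern form, inherited from that of the Gaussian
  kernels: the mixture over w is exchanged with the integral over frequencies by Tonelli.\<close>

lemma quad_form_scaled_corr_mat:
  fixes s :: "nat \<Rightarrow> real ^ 'd"
  assumes "0 < \<nu>" "0 < \<alpha>" and v: "v \<in> carrier_vec n"
  shows "ennreal (quad_form (scaled_corr_mat \<nu> s n \<alpha>) v) =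
    (\<integral>\<^sup>+\<omega>. ennreal (trig_power n s v \<omega> * spec_dens \<nu> \<alpha> \<omega>) \<partial>lborel)"
    "0 \<le> quad_form (scaled_corr_mat \<nu> s n \<alpha>) v"
proof -
  let ?a = "vec_index v"
  define q where "q w = (\<Sum>i<n. \<Sum>j<n. ?a i * ?a j * exp (- (norm (s i - s j))\<^sup>2 / (4 * w)))" for w
  have [measurable]: "q \<in> borel_measurable borel" unfolding q_def by measurable
  have q: "(\<integral>\<^sup>+\<omega>. ennreal ((cmod (trig_poly n s ?a \<omega>))\<^sup>2 * gauss_kernel w \<omega>) \<partial>lborel) = ennreal (q w)"
    if "0 < w" for w unfolding q_def by (rule gauss_quad_form[OF that])
  have qe: "matern_mix \<nu> \<alpha> w * q w = (\<Sum>i<n. \<Sum>j<n. (?a i * ?a j) * (matern_mix \<nu> \<alpha> w *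
      exp (- (norm (s i - s j))\<^sup>2 / (4 * w))))" for w
    unfolding q_def sum_distrib_left by (intro sum.cong) (auto simp: mult_ac)
  have int: "integrable lborel (\<lambda>w. matern_mix \<nu> \<alpha> w * q w)"
    unfolding qe by (intro Bochner_Integration.integrable_sum integrable_mult_right integrable_matern_mix)
      (use assms in auto)
  have val: "(LINT w|lborel. matern_mix \<nu> \<alpha> w * q w) = quad_form (scaled_corr_mat \<nu> s n \<alpha>) v"
  proof -
    have i: "integrable lborel (\<lambda>w. (?a i * ?a j) * (matern_mix \<nu> \<alpha> w * exp (- (norm (s i - s j))\<^sup>2 / (4 * w))))" for i j
      by (intro integrable_mult_right integrable_matern_mix) (use assms in auto)
    have "(LINT w|lborel. matern_mix \<nu> \<alpha> w * q w) = (\<Sum>i<n. \<Sum>j<n. (?a i * ?a j) *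
        (\<alpha> powr (- (2 * \<nu>)) * matern \<nu> \<alpha> (s i - s j)))"
      unfolding qe by (subst Bochner_Integration.integral_sum, intro Bochner_Integration.integrable_sum i)
        (simp only: Bochner_Integration.integral_sum[OF i] integral_mult_right_zero matern_mixture[OF assms(1,2)])
    also have "\<dots> = quad_form (scaled_corr_mat \<nu> s n \<alpha>) v"
      unfolding quad_form_conv_sum[OF scaled_corr_mat_carrier v]
      by (intro sum.cong) (auto simp: scaled_corr_mat_def corr_mat_def)
    finally show ?thesis .
  qed
  \<comment> \<open>For w > 0 the factor \<open>q w\<close> is a Gaussian Gram form; for other w it
    is a meaningless value, removed by the indicator in \<open>matern_mix\<close>.\<close>
  have nn: "0 \<le> matern_mix \<nu> \<alpha> w * q w" for w
  proof (cases "0 < w")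
    case True
    have "(LINT \<omega>|lborel. (cmod (trig_poly n s ?a \<omega>))\<^sup>2 * gauss_kernel w \<omega>) = q w"
      using gauss_quad_form_integral[OF True, of n s ?a] by (simp add: q_def)
    moreover have "0 \<le> (LINT \<omega>|lborel. (cmod (trig_poly n s ?a \<omega>))\<^sup>2 * gauss_kernel w \<omega>)"
      by (intro integral_nonneg_AE) (auto simp: gauss_kernel_nonneg)
    ultimately show ?thesis using matern_mix_nonneg[OF assms(1)] by simp
  qed (simp add: matern_mix_def)
  show "0 \<le> quad_form (scaled_corr_mat \<nu> s n \<alpha>) v"
    unfolding val[symmetric] by (intro integral_nonneg_AE) (auto simp: nn)
  have "ennreal (quad_form (scaled_corr_mat \<nu> s n \<alpha>) v) = (\<integral>\<^sup>+w. ennreal (matern_mix \<nu> \<alpha> w * q w) \<partial>lborel)"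
    unfolding val[symmetric] by (rule nn_integral_eq_integral[symmetric]) (use int nn in auto)
  also have "\<dots> = (\<integral>\<^sup>+w. (\<integral>\<^sup>+\<omega>. ennreal (matern_mix \<nu> \<alpha> w) *
      ennreal ((cmod (trig_poly n s ?a \<omega>))\<^sup>2 * gauss_kernel w \<omega>) \<partial>lborel) \<partial>lborel)"
  proof (intro nn_integral_cong)
    fix w
    show "ennreal (matern_mix \<nu> \<alpha> w * q w) = (\<integral>\<^sup>+\<omega>. ennreal (matern_mix \<nu> \<alpha> w) *
      ennreal ((cmod (trig_poly n s ?a \<omega>))\<^sup>2 * gauss_kernel w \<omega>) \<partial>lborel)"
    proof (cases "0 < w")
      case True
      have "(\<integral>\<^sup>+\<omega>. ennreal (matern_mix \<nu> \<alpha> w) *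
          ennreal ((cmod (trig_poly n s ?a \<omega>))\<^sup>2 * gauss_kernel w \<omega>) \<partial>lborel) =
          ennreal (matern_mix \<nu> \<alpha> w) * ennreal (q w)"
        by (subst nn_integral_cmult) (simp_all only: q[OF True], measurable)
      then show ?thesis using ennreal_mult'[OF matern_mix_nonneg[OF assms(1), of \<alpha> w], of "q w"] by simp
    qed (simp add: matern_mix_def)
  qed
  also have "\<dots> = (\<integral>\<^sup>+\<omega>. (\<integral>\<^sup>+w. ennreal (matern_mix \<nu> \<alpha> w) *
      ennreal ((cmod (trig_poly n s ?a \<omega>))\<^sup>2 * gauss_kernel w \<omega>) \<partial>lborel) \<partial>lborel)"
  proof (rule lborel_pair.Fubini')
    show "(\<lambda>(\<omega>, w). ennreal (matern_mix \<nu> \<alpha> w) *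
      ennreal ((cmod (trig_poly n s ?a \<omega>))\<^sup>2 * gauss_kernel w \<omega>)) \<in> borel_measurable (lborel \<Otimes>\<^sub>M lborel)"
      unfolding gauss_kernel_def by measurable
  qed
  also have "\<dots> = (\<integral>\<^sup>+\<omega>. ennreal ((cmod (trig_poly n s ?a \<omega>))\<^sup>2) *
     (\<integral>\<^sup>+w. ennreal (matern_mix \<nu> \<alpha> w * gauss_kernel w \<omega>) \<partial>lborel) \<partial>lborel)"
  proof (intro nn_integral_cong)
    fix \<omega> :: "real ^ 'd"
    have "(\<lambda>w. gauss_kernel w \<omega>) \<in> borel_measurable borel" unfolding gauss_kernel_def by measurable
    note [measurable] = this
    have "(\<integral>\<^sup>+w. ennreal (matern_mix \<nu> \<alpha> w) * ennreal ((cmod (trig_poly n s ?a \<omega>))\<^sup>2 * gauss_kernel w \<omega>) \<partial>lborel)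
      = (\<integral>\<^sup>+w. ennreal ((cmod (trig_poly n s ?a \<omega>))\<^sup>2) * ennreal (matern_mix \<nu> \<alpha> w * gauss_kernel w \<omega>) \<partial>lborel)"
      using matern_mix_nonneg[OF assms(1), of \<alpha>]
      by (intro nn_integral_cong) (simp add: gauss_kernel_nonneg mult_ac flip: ennreal_mult)
    then show "(\<integral>\<^sup>+w. ennreal (matern_mix \<nu> \<alpha> w) * ennreal ((cmod (trig_poly n s ?a \<omega>))\<^sup>2 * gauss_kernel w \<omega>) \<partial>lborel)
      = ennreal ((cmod (trig_poly n s ?a \<omega>))\<^sup>2) * (\<integral>\<^sup>+w. ennreal (matern_mix \<nu> \<alpha> w * gauss_kernel w \<omega>) \<partial>lborel)"
      by (simp add: nn_integral_cmult)
  qed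
  also have "\<dots> = (\<integral>\<^sup>+\<omega>. ennreal ((cmod (trig_poly n s ?a \<omega>))\<^sup>2 * spec_dens \<nu> \<alpha> \<omega>) \<partial>lborel)"
    by (intro nn_integral_cong) (simp add: nn_integral_mix_gauss[OF assms(1,2)] ennreal_mult')
  finally show "ennreal (quad_form (scaled_corr_mat \<nu> s n \<alpha>) v) =
    (\<integral>\<^sup>+\<omega>. ennreal ((cmod (trig_poly n s ?a \<omega>))\<^sup>2 * spec_dens \<nu> \<alpha> \<omega>) \<partial>lborel)" .
qed

lemma quad_form_scaled_corr_mat_integral:
  fixes s :: "nat \<Rightarrow> real ^ 'd"
  assumes "0 < \<nu>" "0 < \<alpha>" and v: "v \<in> carrier_vec n"
  shows "integrable lborel (\<lambda>\<omega>. trig_power n s v \<omega> * spec_dens \<nu> \<alpha> \<omega>)"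
    "quad_form (scaled_corr_mat \<nu> s n \<alpha>) v =
      (LINT \<omega>|lborel. trig_power n s v \<omega> * spec_dens \<nu> \<alpha> \<omega>)"
proof -
  note Q = quad_form_scaled_corr_mat[OF assms, of s]
  show "integrable lborel (\<lambda>\<omega>. trig_power n s v \<omega> * spec_dens \<nu> \<alpha> \<omega>)"
  proof (rule integrableI_nonneg)
    show "AE \<omega> in lborel. 0 \<le> trig_power n s v \<omega> * spec_dens \<nu> \<alpha> \<omega>"
      using spec_dens_pos[OF assms(1,2), THEN less_imp_le] by (intro AE_I2 mult_nonneg_nonneg) auto
    show "(\<integral>\<^sup>+\<omega>. ennreal (trig_power n s v \<omega> * spec_dens \<nu> \<alpha> \<omega>) \<partial>lborel) < \<infinity>"
      unfolding Q(1)[symmetric] by simp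
  qed measurable
  have "(LINT \<omega>|lborel. trig_power n s v \<omega> * spec_dens \<nu> \<alpha> \<omega>) =
      enn2real (\<integral>\<^sup>+\<omega>. ennreal (trig_power n s v \<omega> * spec_dens \<nu> \<alpha> \<omega>) \<partial>lborel)"
    using spec_dens_pos[OF assms(1,2), THEN less_imp_le]
    by (intro integral_eq_nn_integral AE_I2 mult_nonneg_nonneg) auto
  then show "quad_form (scaled_corr_mat \<nu> s n \<alpha>) v =
      (LINT \<omega>|lborel. trig_power n s v \<omega> * spec_dens \<nu> \<alpha> \<omega>)"
    unfolding Q(1)[symmetric] using Q(2) by simp
qed

text \<open>As w tends to 0 the Gaussian correlation of two distinct points vanishes, so the Gram
  matrix tends to the identity.\<close>

lemma gauss_gram_tendsto:
  fixes s :: "nat \<Rightarrow> 'b::euclidean_space"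
  assumes "inj_on s {..<n}"
  shows "((\<lambda>w. \<Sum>i<n. \<Sum>j<n. a i * a j * exp (- (norm (s i - s j))\<^sup>2 / (4 * w))) \<longlongrightarrow> (\<Sum>i<n. (a i)\<^sup>2)) (at_right 0)"
proof -
  have 1: "((\<lambda>w. exp (- r / (4 * w))) \<longlongrightarrow> 0) (at_right (0::real))" if "0 < r" for r :: real
  proof -
    have "filterlim (\<lambda>w::real. - (r / 4) * inverse w) at_bot (at_right 0)"
      using that filterlim_inverse_at_top_right
      by (intro filterlim_tendsto_neg_mult_at_bot[OF tendsto_const]) auto
    then have "((\<lambda>w. exp (- (r / 4) * inverse w)) \<longlongrightarrow> 0) (at_right (0::real))"
      by (rule filterlim_compose[OF exp_at_bot])
    moreover have "- (r / 4) * inverse w = - r / (4 * w)" for w by (simp add: field_simps)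
    ultimately show ?thesis by (simp only:)
  qed
  have "((\<lambda>w. \<Sum>i<n. \<Sum>j<n. a i * a j * exp (- (norm (s i - s j))\<^sup>2 / (4 * w))) \<longlongrightarrow>
      (\<Sum>i<n. \<Sum>j<n. a i * a j * (if i = j then 1 else 0))) (at_right 0)"
  proof (intro tendsto_sum tendsto_mult tendsto_const)
    fix i j assume ij: "i \<in> {..<n}" "j \<in> {..<n}"
    show "((\<lambda>w. exp (- (norm (s i - s j))\<^sup>2 / (4 * w))) \<longlongrightarrow> (if i = j then 1 else 0)) (at_right 0)"
    proof (cases "i = j")
      case False
      then have "s i \<noteq> s j" using assms ij by (auto dest: inj_onD)
      then show ?thesis using 1[of "(norm (s i - s j))\<^sup>2"] False by simp
    qed simp
  qed
  also have "(\<Sum>i<n. \<Sum>j<n. a i * a j * (if i = j then 1 else 0)) = (\<Sum>i<n. (a i)\<^sup>2)"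
    by (simp add: if_distrib power2_eq_square cong: if_cong)
  finally show ?thesis .
qed

text \<open>If the form vanished at v, the positive spectral density would force the trigonometric
  polynomial to vanish almost everywhere. Then all its Gaussian Gram forms vanish as well, while
  their limit as w tends to 0 is the squared length of v.\<close>

lemma spd_scaled_corr_mat:
  fixes s :: "nat \<Rightarrow> real ^ 'd"
  assumes "0 < \<nu>" "0 < \<alpha>" and inj: "inj_on s {..<n}"
  shows "spd n (scaled_corr_mat \<nu> s n \<alpha>)"
  unfolding spd_def
proof (intro conjI ballI impI)
  fix v :: "real Matrix.vec" assume v: "v \<in> carrier_vec n" "v \<noteq> 0\<^sub>v n"
  let ?A = "trig_poly n s (vec_index v)"
  show "0 < quad_form (scaled_corr_mat \<nu> s n \<alpha>) v"
  proof (rule ccontr)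
    assume "\<not> 0 < quad_form (scaled_corr_mat \<nu> s n \<alpha>) v"
    then have "(\<integral>\<^sup>+\<omega>. ennreal ((cmod (?A \<omega>))\<^sup>2 * spec_dens \<nu> \<alpha> \<omega>) \<partial>lborel) = 0"
      using quad_form_scaled_corr_mat[OF assms(1,2) v(1), of s] by simp
    then have "AE \<omega> in lborel. ennreal ((cmod (?A \<omega>))\<^sup>2 * spec_dens \<nu> \<alpha> \<omega>) = 0"
      by (subst (asm) nn_integral_0_iff_AE) auto
    then have z: "AE \<omega> in lborel. ?A \<omega> = 0"
    proof eventually_elim
      case (elim \<omega>)
      then show ?case using spec_dens_pos[OF assms(1,2), of \<omega>]
        by (simp add: ennreal_eq_0_iff mult_le_0_iff)
    qed
    have "(\<Sum>i<n. \<Sum>j<n. vec_index v i * vec_index v j * exp (- (norm (s i - s j))\<^sup>2 / (4 * w))) = 0" if "0 < w" for w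
    proof -
      have "(LINT \<omega>|lborel. (cmod (?A \<omega>))\<^sup>2 * gauss_kernel w \<omega>) = 0"
        by (rule integral_eq_zero_AE) (use z in eventually_elim, simp)
      then show ?thesis using gauss_quad_form_integral(2)[OF that, of n s "vec_index v"] by simp
    qed
    then have "eventually (\<lambda>w. (\<Sum>i<n. \<Sum>j<n. vec_index v i * vec_index v j * exp (- (norm (s i - s j))\<^sup>2 / (4 * w))) = 0)
        (at_right (0::real))"
      by (auto simp: eventually_at_filter)
    from tendsto_cong[OF this] gauss_gram_tendsto[OF inj, of "vec_index v"]
    have "((\<lambda>w::real. 0::real) \<longlongrightarrow> (\<Sum>i<n. (vec_index v i)\<^sup>2)) (at_right 0)" by blast
    from tendsto_unique[OF trivial_limit_at_right_real this tendsto_const]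
    have "(\<Sum>i<n. (vec_index v i)\<^sup>2) = 0" .
    then have "\<forall>i<n. vec_index v i = 0" by (simp add: sum_nonneg_eq_0_iff)
    then show False using v by (auto simp: vec_eq_iff)
  qed
qed (simp_all add: scaled_corr_mat_sym)

text \<open>All three bounds follow from \<alpha> entering through \<alpha>^2 + |\<omega>|^2 alone.
  The third makes the common high-frequency behaviour quantitative; its constant depends on the
  larger parameter \<beta>, so it stays bounded when \<alpha> tends to 0.\<close>

lemma spec_dens_mono:
  fixes \<omega> :: "'b::euclidean_space" and \<nu> \<alpha> \<beta> :: real
  assumes "0 < \<nu>" "0 < \<alpha>" "\<alpha> \<le> \<beta>"
  shows "spec_dens \<nu> \<beta> \<omega> \<le> spec_dens \<nu> \<alpha> \<omega>"
    "spec_dens \<nu> \<alpha> \<omega> \<le> (\<beta> / \<alpha>) powr (2 * \<nu> + DIM('b)) * spec_dens \<nu> \<beta> \<omega>"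
    "spec_dens \<nu> \<alpha> \<omega> - spec_dens \<nu> \<beta> \<omega> \<le>
      spec_dens \<nu> \<alpha> \<omega> * (2 * max 1 ((\<nu> + DIM('b) / 2) * \<beta>\<^sup>2)) / (1 + (norm \<omega>)\<^sup>2)"
proof -
  define t where "t = (norm \<omega>)\<^sup>2"
  define k where "k = \<nu> + DIM('b) / 2"
  define C where "C = Gamma k / (Gamma \<nu> * pi powr (DIM('b) / 2))"
  have k: "0 < k" using assms by (simp add: k_def add_pos_nonneg)
  have C: "0 < C" using assms k by (simp add: C_def Gamma_real_pos)
  have t: "0 \<le> t" by (simp add: t_def)
  have f: "spec_dens \<nu> \<gamma> \<omega> = C * (\<gamma>\<^sup>2 + t) powr (- k)" for \<gamma>
    by (simp add: spec_dens_def C_def k_def t_def)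
  have p: "0 < \<alpha>\<^sup>2 + t" "0 < \<beta>\<^sup>2 + t" using assms t by (auto intro: add_pos_nonneg)
  have sq: "\<alpha>\<^sup>2 \<le> \<beta>\<^sup>2" using assms by (simp add: power_mono)
  show "spec_dens \<nu> \<beta> \<omega> \<le> spec_dens \<nu> \<alpha> \<omega>"
    unfolding f using C p sq k by (intro mult_left_mono powr_mono2') auto
  have r: "(\<beta>\<^sup>2 + t) / (\<alpha>\<^sup>2 + t) \<le> (\<beta> / \<alpha>)\<^sup>2"
    using assms p sq t by (simp add: power_divide divide_simps) (simp add: algebra_simps mult_left_mono)
  have e: "(\<alpha>\<^sup>2 + t) powr (- k) = ((\<beta>\<^sup>2 + t) / (\<alpha>\<^sup>2 + t)) powr k * (\<beta>\<^sup>2 + t) powr (- k)"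
    using p by (simp add: powr_divide powr_minus field_simps)
  have "((\<beta>\<^sup>2 + t) / (\<alpha>\<^sup>2 + t)) powr k \<le> ((\<beta> / \<alpha>)\<^sup>2) powr k"
    using p k r by (intro powr_mono2) auto
  also have "\<dots> = (\<beta> / \<alpha>) powr (2 * \<nu> + DIM('b))"
    using assms by (simp add: k_def powr_powr algebra_simps flip: powr_numeral)
  finally show "spec_dens \<nu> \<alpha> \<omega> \<le> (\<beta> / \<alpha>) powr (2 * \<nu> + DIM('b)) * spec_dens \<nu> \<beta> \<omega>"
    unfolding f e using C by (simp add: mult_left_mono mult_right_mono mult.left_commute)
  \<comment> \<open>Relative increment of the base. Near frequency 0 it can be of order \<beta>^2 /
    \<alpha>^2, so the relative decrease is bounded by 1 for |\<omega>| \<le> 1 and by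
    \<open>k * x\<close> beyond.\<close>
  define x where "x = (\<beta>\<^sup>2 - \<alpha>\<^sup>2) / (\<alpha>\<^sup>2 + t)"
  have x: "0 \<le> x" using p sq by (simp add: x_def)
  have "(\<beta>\<^sup>2 + t) powr (- k) = (1 + x) powr (- k) * (\<alpha>\<^sup>2 + t) powr (- k)"
  proof -
    have "\<beta>\<^sup>2 + t = (1 + x) * (\<alpha>\<^sup>2 + t)" using p by (simp add: x_def field_simps)
    then show ?thesis using x p by (simp add: powr_mult)
  qed
  then have d: "spec_dens \<nu> \<alpha> \<omega> - spec_dens \<nu> \<beta> \<omega> = spec_dens \<nu> \<alpha> \<omega> * (1 - (1 + x) powr (- k))"
    unfolding f by (simp add: algebra_simps)
  have "1 - (1 + x) powr (- k) \<le> k * x"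
  proof -
    have "1 - k * ln (1 + x) \<le> exp (- k * ln (1 + x))" using exp_ge_add_one_self[of "- k * ln (1 + x)"] by simp
    also have "\<dots> = (1 + x) powr (- k)" using x by (simp add: powr_def)
    finally have "1 - (1 + x) powr (- k) \<le> k * ln (1 + x)" by simp
    also have "\<dots> \<le> k * x" using k x ln_add_one_self_le_self[OF x] by (simp add: mult_left_mono)
    finally show ?thesis .
  qed
  moreover have "1 - (1 + x) powr (- k) \<le> 1" by simp
  ultimately have m: "1 - (1 + x) powr (- k) \<le> min 1 (k * x)" by simp
  have "min 1 (k * x) \<le> 2 * max 1 (k * \<beta>\<^sup>2) / (1 + t)"
  proof (cases "t \<le> 1")
    case True
    have "min 1 (k * x) * (1 + t) \<le> 1 * 2" using True t x k by (intro mult_mono) auto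
    also have "\<dots> \<le> 2 * max 1 (k * \<beta>\<^sup>2)" by simp
    finally show ?thesis using t by (simp add: pos_le_divide_eq)
  next
    case False
    have "x \<le> \<beta>\<^sup>2 / t" unfolding x_def using False assms by (intro frac_le) auto
    then have "k * x \<le> k * \<beta>\<^sup>2 / t" using k by (simp add: mult_left_mono flip: times_divide_eq_right)
    also have "\<dots> \<le> max 1 (k * \<beta>\<^sup>2) / t" using False by (intro divide_right_mono) auto
    also have "\<dots> \<le> 2 * max 1 (k * \<beta>\<^sup>2) / (1 + t)"
    proof -
      have "max 1 (k * \<beta>\<^sup>2) * (1 + t) \<le> max 1 (k * \<beta>\<^sup>2) * (2 * t)"
        using False by (intro mult_left_mono) auto
      then show ?thesis using False by (simp add: divide_simps mult_ac)
    qed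
    finally show ?thesis by simp
  qed
  with m have "1 - (1 + x) powr (- k) \<le> 2 * max 1 (k * \<beta>\<^sup>2) / (1 + t)" by (rule order_trans)
  then have "spec_dens \<nu> \<alpha> \<omega> * (1 - (1 + x) powr (- k)) \<le> spec_dens \<nu> \<alpha> \<omega> * (2 * max 1 (k * \<beta>\<^sup>2) / (1 + t))"
    using spec_dens_pos[OF assms(1,2), of \<omega>] by (intro mult_left_mono) auto
  then show "spec_dens \<nu> \<alpha> \<omega> - spec_dens \<nu> \<beta> \<omega> \<le>
      spec_dens \<nu> \<alpha> \<omega> * (2 * max 1 ((\<nu> + DIM('b) / 2) * \<beta>\<^sup>2)) / (1 + (norm \<omega>)\<^sup>2)"
    unfolding d by (simp add: k_def t_def)
qed

text \<open>The pointwise comparison of spectral densities, integrated against the squared modulus.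
  The comparison constant is independent of n and of the points.\<close>

lemma scaled_corr_mat_loewner:
  fixes s :: "nat \<Rightarrow> real ^ 'd"
  assumes "0 < \<nu>" "0 < \<alpha>" "\<alpha> \<le> \<beta>" and v: "v \<in> carrier_vec n"
  shows "quad_form (scaled_corr_mat \<nu> s n \<beta>) v \<le> quad_form (scaled_corr_mat \<nu> s n \<alpha>) v"
    "quad_form (scaled_corr_mat \<nu> s n \<alpha>) v \<le>
      (\<beta> / \<alpha>) powr (2 * \<nu> + CARD('d)) * quad_form (scaled_corr_mat \<nu> s n \<beta>) v"
proof -
  have b: "0 < \<beta>" using assms by simp
  note A = quad_form_scaled_corr_mat_integral[OF assms(1,2) v, of s]
  note B = quad_form_scaled_corr_mat_integral[OF assms(1) b v, of s]
  note m = spec_dens_mono[OF assms(1-3), where ?'b = "real ^ 'd", unfolded DIM_cart DIM_real mult_1_right]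
  show "quad_form (scaled_corr_mat \<nu> s n \<beta>) v \<le> quad_form (scaled_corr_mat \<nu> s n \<alpha>) v"
    unfolding A(2) B(2) using A(1) B(1) m(1) by (intro integral_mono) (auto intro: mult_left_mono)
  show "quad_form (scaled_corr_mat \<nu> s n \<alpha>) v \<le>
      (\<beta> / \<alpha>) powr (2 * \<nu> + CARD('d)) * quad_form (scaled_corr_mat \<nu> s n \<beta>) v"
    unfolding A(2) B(2) integral_mult_right_zero[symmetric]
  proof (intro integral_mono)
    fix \<omega> :: "real ^ 'd"
    show "trig_power n s v \<omega> * spec_dens \<nu> \<alpha> \<omega> \<le> (\<beta> / \<alpha>) powr (2 * \<nu> + CARD('d)) *
        (trig_power n s v \<omega> * spec_dens \<nu> \<beta> \<omega>)"
      using mult_left_mono[OF m(2)[of \<omega>], of "trig_power n s v \<omega>"] by (simp add: mult_ac)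
  qed (use A(1) B(1) in auto)
qed

text \<open>For d \<le> 3 one has 1 / (1 + |\<omega>|^2) \<le> (1 + |\<omega>|^2)^(-d/3), which is
  at most the product of |\<omega>_b|^(-2/3) over the coordinates. Each factor integrates to 6
  W^(1/3), and three of them give 216 W. This is where the dimension bound enters; a cube is used
  because the integral then factorises.\<close>

lemma nn_integral_cube_inverse_quadratic:
  fixes W :: real
  assumes d: "DIM('b::euclidean_space) \<le> 3" and W: "1 \<le> W"
  shows "(\<integral>\<^sup>+\<omega>. ennreal (1 / (1 + (norm (\<omega>::'b::euclidean_space))\<^sup>2)) * indicator {\<omega>. \<forall>b\<in>Basis. \<bar>\<omega> \<bullet> b\<bar> \<le> W} \<omega> \<partial>lborel)
    \<le> ennreal (216 * W)"
proof -
  define f :: "real \<Rightarrow> ennreal" where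
    "f = (\<lambda>t. ennreal (\<bar>t\<bar> powr (- (2 / 3))) * indicator {-W..W} t)"
  have f[measurable]: "f \<in> borel_measurable borel" unfolding f_def by measurable
  have half: "(\<integral>\<^sup>+t. ennreal (t powr (- (2 / 3))) * indicator {0..W} t \<partial>lborel) = ennreal (3 * W powr (1 / 3))"
  proof -
    have "((\<lambda>t. t powr (- (2 / 3))) has_integral (W powr (- (2 / 3) + 1) / (- (2 / 3) + 1))) {0..W}"
      by (rule has_integral_powr_from_0) (use W in auto)
    then have "((\<lambda>t. t powr (- (2 / 3))) has_integral (3 * W powr (1 / 3))) {0..W}"
      by (simp add: mult.commute)
    from nn_integral_has_integral_lebesgue'[OF _ this] show ?thesis by simp
  qed
  have f1: "(\<integral>\<^sup>+t. f t \<partial>lborel) \<le> ennreal (6 * W powr (1 / 3))"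
  proof -
    have "(\<integral>\<^sup>+t. f t \<partial>lborel) \<le> (\<integral>\<^sup>+t. ennreal (t powr (- (2 / 3))) * indicator {0..W} t +
        ennreal ((- t) powr (- (2 / 3))) * indicator {0..W} (- t) \<partial>lborel)"
      by (intro nn_integral_mono) (auto simp: f_def indicator_def abs_if)
    also have "\<dots> = (\<integral>\<^sup>+t. ennreal (t powr (- (2 / 3))) * indicator {0..W} t \<partial>lborel) +
        (\<integral>\<^sup>+t. ennreal ((- t) powr (- (2 / 3))) * indicator {0..W} (- t) \<partial>lborel)"
      by (rule nn_integral_add) measurable
    also have "(\<integral>\<^sup>+t. ennreal ((- t) powr (- (2 / 3))) * indicator {0..W} (- t) \<partial>lborel) =
        (\<integral>\<^sup>+t. ennreal (t powr (- (2 / 3))) * indicator {0..W} t \<partial>lborel)"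
      by (subst nn_integral_real_affine[of "\<lambda>t. ennreal (t powr (- (2 / 3))) * indicator {0..W} t" "-1" 0]) simp_all
    finally show ?thesis unfolding half using W by (simp flip: ennreal_plus)
  qed
  have "ennreal (1 / (1 + (norm \<omega>)\<^sup>2)) * indicator {\<omega>. \<forall>b\<in>Basis. \<bar>\<omega> \<bullet> b\<bar> \<le> W} \<omega> \<le> (\<Prod>b\<in>Basis. f (\<omega> \<bullet> b))"
    if nz: "\<forall>b\<in>Basis. \<omega> \<bullet> b \<noteq> 0" for \<omega> :: 'b
  proof (cases "\<forall>b\<in>Basis. \<bar>\<omega> \<bullet> b\<bar> \<le> W")
    case True
    let ?N = "1 + (norm \<omega>)\<^sup>2"
    have N: "1 \<le> ?N" by simp
    have "(\<Prod>b\<in>(Basis::'b set). ?N powr (- (1 / 3))) \<le> (\<Prod>b\<in>Basis. \<bar>\<omega> \<bullet> b\<bar> powr (- (2 / 3)))"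
    proof (intro prod_mono conjI)
      fix b :: 'b assume b: "b \<in> Basis"
      have "\<bar>\<omega> \<bullet> b\<bar>\<^sup>2 \<le> (norm \<omega>)\<^sup>2" using Basis_le_norm[OF b, of \<omega>] by (intro power_mono) auto
      then have "\<bar>\<omega> \<bullet> b\<bar>\<^sup>2 \<le> ?N" by simp
      then have "?N powr (- (1 / 3)) \<le> (\<bar>\<omega> \<bullet> b\<bar>\<^sup>2) powr (- (1 / 3))"
        using nz b by (intro powr_mono2') auto
      also have "\<bar>\<omega> \<bullet> b\<bar>\<^sup>2 = \<bar>\<omega> \<bullet> b\<bar> powr 2" using nz b by (simp only: powr_numeral abs_ge_zero)
      also have "(\<bar>\<omega> \<bullet> b\<bar> powr 2) powr (- (1 / 3)) = \<bar>\<omega> \<bullet> b\<bar> powr (- (2 / 3))"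
        unfolding powr_powr by simp
      finally show "?N powr (- (1 / 3)) \<le> \<bar>\<omega> \<bullet> b\<bar> powr (- (2 / 3))" .
    qed auto
    moreover have "(\<Prod>b\<in>(Basis::'b set). ?N powr (- (1 / 3))) = ?N powr (- (real DIM('b) / 3))"
    proof -
      have "?N \<noteq> 0" using N by linarith
      then have "0 < ?N powr (- (1 / 3))" by simp
      then have "(?N powr (- (1 / 3))) ^ DIM('b) = (?N powr (- (1 / 3))) powr real DIM('b)"
        by (simp only: powr_realpow)
      then show ?thesis by (simp only: prod_constant powr_powr) simp
    qed
    moreover have "1 / ?N \<le> ?N powr (- (real DIM('b) / 3))"
    proof -
      have "1 / ?N = ?N powr (-1)" using N by (simp add: powr_minus_divide)
      also have "\<dots> \<le> ?N powr (- (real DIM('b) / 3))" using d by (intro powr_mono N) simp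
      finally show ?thesis .
    qed
    ultimately have "1 / ?N \<le> (\<Prod>b\<in>Basis. \<bar>\<omega> \<bullet> b\<bar> powr (- (2 / 3)))" by linarith
    then have "ennreal (1 / ?N) \<le> (\<Prod>b\<in>Basis. ennreal (\<bar>\<omega> \<bullet> b\<bar> powr (- (2 / 3))))"
      by (simp add: prod_ennreal ennreal_leI)
    also have "\<dots> = (\<Prod>b\<in>Basis. f (\<omega> \<bullet> b))"
      using True by (intro prod.cong) (auto simp: f_def indicator_def abs_le_iff)
    finally show ?thesis using True by simp
  qed simp
  \<comment> \<open>Where a coordinate vanishes, \<open>powr\<close> has the value 0 and the product
    bound fails; these hyperplanes are null sets.\<close>
  moreover have "AE \<omega> in lborel. \<forall>b\<in>Basis. (\<omega>::'b) \<bullet> b \<noteq> 0"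
  proof (rule AE_finite_allI)
    fix b :: 'b assume b: "b \<in> Basis"
    have "{x. b \<bullet> x = 0} \<in> null_sets lebesgue"
      using b by (intro negligible_iff_null_sets[THEN iffD1] negligible_hyperplane) auto
    then have "AE \<omega> in lebesgue. b \<bullet> \<omega> \<noteq> 0"
      by (auto dest!: AE_not_in)
    then show "AE \<omega> in lborel. \<omega> \<bullet> b \<noteq> 0"
      by (auto simp: AE_completion_iff inner_commute)
  qed simp
  ultimately have "(\<integral>\<^sup>+\<omega>. ennreal (1 / (1 + (norm (\<omega>::'b::euclidean_space))\<^sup>2)) * indicator {\<omega>. \<forall>b\<in>Basis. \<bar>\<omega> \<bullet> b\<bar> \<le> W} \<omega> \<partial>lborel)
      \<le> (\<integral>\<^sup>+\<omega>. (\<Prod>b\<in>Basis. f ((\<omega>::'b) \<bullet> b)) \<partial>lborel)"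
    by (intro nn_integral_mono_AE) auto
  also have "\<dots> = (\<Prod>b\<in>(Basis::'b set). \<integral>\<^sup>+t. f t \<partial>lborel)"
    by (rule nn_integral_lborel_prod) auto
  also have "\<dots> \<le> (\<Prod>b\<in>(Basis::'b set). ennreal (6 * W powr (1 / 3)))"
    unfolding prod_constant by (intro power_mono f1) simp
  also have "\<dots> = ennreal ((6 * W powr (1 / 3)) ^ DIM('b))"
    by (simp add: ennreal_power)
  also have "\<dots> \<le> ennreal ((6 * W powr (1 / 3)) ^ 3)"
  proof (intro ennreal_leI power_increasing d)
    have "1 \<le> W powr (1 / 3)" using W by (simp add: ge_one_powr_ge_zero)
    then show "1 \<le> 6 * W powr (1 / 3)" by simp
  qed
  also have "(6 * W powr (1 / 3)) ^ 3 = 216 * W"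
  proof -
    have "(W powr (1 / 3)) ^ 3 = (W powr (1 / 3)) powr real 3" using W by (intro powr_realpow[symmetric]) simp
    then show ?thesis using W by (simp add: power_mult_distrib powr_powr)
  qed
  finally show ?thesis .
qed

section \<open>Evaluation of band-limited trigonometric polynomials\<close>

text \<open>A compactly supported law whose characteristic function decays like an arbitrary power:
  the sum of \<open>k\<close> independent uniform variables. Levy's inversion formula then reads off a
  rapidly decaying function whose Fourier transform equals \<open>1\<close> on a prescribed interval.\<close>

lemma uniform_char_bound:
  defines "U \<equiv> density lborel (\<lambda>x. ennreal (indicator {-1..1} x / 2))"
  shows "real_distribution U" "AE x in U. \<bar>x\<bar> \<le> 1" "t \<noteq> 0 \<Longrightarrow> cmod (char U t) \<le> 1 / \<bar>t\<bar>"
proof -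
  have "prob_space U"
  proof
    have "ennreal (indicator {-1..1} x / 2) = ennreal (1 / 2) * indicator {-1..1} x" for x :: real
      by (simp split: split_indicator)
    then have "emeasure U (space U) = (\<integral>\<^sup>+x. ennreal (1 / 2) * indicator {-1..1::real} x \<partial>lborel)"
      unfolding U_def by (subst emeasure_density) auto
    also have "\<dots> = ennreal (1 / 2) * ennreal 2" by (subst nn_integral_cmult_indicator) auto
    also have "\<dots> = 1" by (subst ennreal_mult[symmetric]) auto
    finally show "emeasure U (space U) = 1" .
  qed
  then show "real_distribution U"
    by (simp add: real_distribution_def real_distribution_axioms_def U_def)
  show "AE x in U. \<bar>x\<bar> \<le> 1" unfolding U_def by (subst AE_density) (auto simp: indicator_def split: if_splits)
  assume t: "t \<noteq> 0"
  have "char U t = (CLBINT x. (indicator {-1..1} x / 2) *\<^sub>R iexp (t * x))"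
    unfolding char_def U_def by (subst integral_density) auto
  also have "\<dots> = (CLBINT x. (1 / 2) * (indicator {-1..1} x *\<^sub>R iexp (t * x)))"
    by (intro Bochner_Integration.integral_cong) (auto simp: scaleR_conv_of_real)
  also have "\<dots> = (1 / 2) * (CLBINT x:{-1..1}. iexp (t * x))"
    unfolding set_lebesgue_integral_def by (rule integral_mult_right_zero)
  also have "(CLBINT x:{-1..1}. iexp (t * x)) = (CLBINT x=ereal (-1)..ereal 1. iexp (t * x))"
    by (subst interval_integral_Icc) auto
  also have "\<dots> = (- \<i> / t) * iexp (t * 1) - (- \<i> / t) * iexp (t * (-1))"
    by (rule interval_integral_FTC_finite)
       (use t in \<open>auto intro!: derivative_eq_intros continuous_intros simp: has_vector_derivative_complex_iff Re_exp Im_exp field_simps\<close>)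
  finally have "char U t = (1 / 2) * ((- \<i> / t) * iexp (t * 1) - (- \<i> / t) * iexp (t * (-1)))" .
  moreover have "cmod ((- \<i> / t) * iexp (t * 1) - (- \<i> / t) * iexp (t * (-1))) \<le>
      cmod ((- \<i> / t) * iexp (t * 1)) + cmod ((- \<i> / t) * iexp (t * (-1)))"
    by (rule norm_triangle_ineq4)
  moreover have "\<dots> = 2 / \<bar>t\<bar>"
    by (simp only: norm_mult norm_exp_i_times norm_divide) simp
  ultimately have "cmod (char U t) \<le> (1 / 2) * (2 / \<bar>t\<bar>)" by (simp only: norm_mult) simp
  then show "cmod (char U t) \<le> 1 / \<bar>t\<bar>" by simp
qed

text \<open>Adding one more independent uniform variable enlarges the support radius by 1 and
  contributes a factor 1 / |t| to the characteristic function. The induction starts at the point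
  mass in 0.\<close>

lemma compact_law_char_decay:
  "\<exists>M. real_distribution M \<and> (AE x in M. \<bar>x\<bar> \<le> real k) \<and> (\<forall>t. t \<noteq> 0 \<longrightarrow> cmod (char M t) \<le> 1 / \<bar>t\<bar> ^ k)"
proof (induction k)
  case 0
  have r: "real_distribution (return borel 0)"
    by (simp add: real_distribution_def real_distribution_axioms_def prob_space_return)
  then show ?case using real_distribution.cmod_char_le_1[OF r]
    by (intro exI[of _ "return borel 0"]) (auto simp: AE_return)
next
  case (Suc k)
  then obtain M where M: "real_distribution M" "AE x in M. \<bar>x\<bar> \<le> real k"
    "\<And>t. t \<noteq> 0 \<Longrightarrow> cmod (char M t) \<le> 1 / \<bar>t\<bar> ^ k" by blast
  define U where "U = density lborel (\<lambda>x. ennreal (indicator {-1..1::real} x / 2))"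
  note U = uniform_char_bound[folded U_def]
  interpret M: real_distribution M by fact
  interpret U: real_distribution U by fact
  interpret P: pair_prob_space M U ..
  define N where "N = distr (M \<Otimes>\<^sub>M U) borel (\<lambda>z. fst z + snd z)"
  have N: "real_distribution N" unfolding N_def by (rule P.real_distribution_distr) measurable
  have f: "distr (M \<Otimes>\<^sub>M U) borel fst = M"
  proof (rule measure_eqI)
    fix A assume "A \<in> sets (distr (M \<Otimes>\<^sub>M U) borel fst)"
    then have A: "A \<in> sets borel" by simp
    have "emeasure (distr (M \<Otimes>\<^sub>M U) borel fst) A = emeasure (M \<Otimes>\<^sub>M U) (A \<times> space U)"
      using A by (subst emeasure_distr) (auto simp: space_pair_measure intro!: arg_cong[where f = "emeasure _"])
    also have "\<dots> = emeasure M A * emeasure U (space U)"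
      by (rule U.emeasure_pair_measure_Times) (use A in auto)
    finally show "emeasure (distr (M \<Otimes>\<^sub>M U) borel fst) A = emeasure M A" using U.emeasure_space_1 by simp
  qed simp
  have s: "distr (M \<Otimes>\<^sub>M U) borel snd = U"
  proof (rule measure_eqI)
    fix A assume "A \<in> sets (distr (M \<Otimes>\<^sub>M U) borel snd)"
    then have A: "A \<in> sets borel" by simp
    have "emeasure (distr (M \<Otimes>\<^sub>M U) borel snd) A = emeasure (M \<Otimes>\<^sub>M U) (space M \<times> A)"
      using A by (subst emeasure_distr) (auto simp: space_pair_measure intro!: arg_cong[where f = "emeasure _"])
    also have "\<dots> = emeasure M (space M) * emeasure U A"
      by (rule U.emeasure_pair_measure_Times) (use A in auto)
    finally show "emeasure (distr (M \<Otimes>\<^sub>M U) borel snd) A = emeasure U A" using M.emeasure_space_1 by simp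
  qed simp
  have ind: "P.indep_var borel fst borel snd"
    unfolding P.indep_var_distribution_eq f s
    by (auto intro!: measurable_compose[OF measurable_fst] measurable_compose[OF measurable_snd]
        distr_id2[symmetric] sets_pair_measure_cong)
  have c: "char N t = char M t * char U t" for t
    unfolding N_def using P.char_distr_add[OF ind, of t] by (simp only: f s)
  have "AE x in N. \<bar>x\<bar> \<le> real (Suc k)"
  proof -
    have "AE z in M \<Otimes>\<^sub>M U. \<bar>fst z\<bar> \<le> real k"
      using M(2) by (subst (asm) f[symmetric]) (subst (asm) AE_distr_iff; simp)
    moreover have "AE z in M \<Otimes>\<^sub>M U. \<bar>snd z\<bar> \<le> 1"
      using U(2) by (subst (asm) s[symmetric]) (subst (asm) AE_distr_iff; simp)
    ultimately have "AE z in M \<Otimes>\<^sub>M U. \<bar>fst z + snd z\<bar> \<le> real (Suc k)"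
      by eventually_elim auto
    then show ?thesis unfolding N_def by (subst AE_distr_iff) auto
  qed
  moreover have "cmod (char N t) \<le> 1 / \<bar>t\<bar> ^ Suc k" if "t \<noteq> 0" for t
  proof -
    have "cmod (char N t) \<le> (1 / \<bar>t\<bar> ^ k) * (1 / \<bar>t\<bar>)"
      unfolding c norm_mult using M(3)[OF that] U(3)[OF that] by (intro mult_mono) auto
    then show ?thesis by (simp add: mult.commute)
  qed
  ultimately show ?case using N by blast
qed

lemma integrable_inverse_one_plus_square: "integrable lborel (\<lambda>t::real. 1 / (1 + t\<^sup>2))"
  using integrable_inverse_1_plus_square
  by (simp add: set_integrable_def inverse_eq_divide)

text \<open>The Fourier transform of the window at x is the mass that \<open>M\<close> gives to the
  interval (x - L, x + L], which is 1 as long as the interval contains the support of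
  \<open>M\<close>. In the decay, the sine quotient accounts for one power of |t| and
  \<open>char M\<close> for the other 2 j + 1.\<close>

lemma fourier_window_1d:
  fixes T :: real
  assumes T: "0 \<le> T"
  shows "\<exists>\<psi> :: real \<Rightarrow> complex. \<exists>C. \<psi> \<in> borel_measurable borel \<and> (\<forall>t. cmod (\<psi> t) \<le> C / (1 + t\<^sup>2) ^ Suc j) \<and>
    (\<forall>x. integrable lborel (\<lambda>t. \<psi> t * cis (- (t * x)))) \<and>
    (\<forall>x. \<bar>x\<bar> \<le> T \<longrightarrow> (LINT t|lborel. \<psi> t * cis (- (t * x))) = 1)"
proof -
  obtain M where M: "real_distribution M" "AE x in M. \<bar>x\<bar> \<le> real (2 * j + 1)"
    "\<And>t. t \<noteq> 0 \<Longrightarrow> cmod (char M t) \<le> 1 / \<bar>t\<bar> ^ (2 * j + 1)" using compact_law_char_decay by blast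
  interpret M: real_distribution M by fact
  \<comment> \<open>|x| \<le> T and the support radius 2 j + 1 have to fit; the extra 1 puts both
    end points strictly outside the support, so that they carry no mass, as Levy's formula
    demands.\<close>
  define L where "L = T + real (2 * j + 1) + 1"
  have L: "1 \<le> L" using T by (simp add: L_def)
  \<comment> \<open>At t = 0 the quotient is 0 by the convention for division rather than its limit;
    a single point does not affect the integrals.\<close>
  define \<psi> where "\<psi> = (\<lambda>t. complex_of_real (2 * sin (L * t) / t / (2 * pi)) * char M t)"
  have m: "\<psi> \<in> borel_measurable borel" unfolding \<psi>_def by measurable
  define C where "C = L * 2 ^ Suc j"
  have bound: "cmod (\<psi> t) \<le> C / (1 + t\<^sup>2) ^ Suc j" for t
  proof (cases "\<bar>t\<bar> \<le> 1")
    case True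
    have "cmod (\<psi> t) \<le> L"
    proof (cases "t = 0")
      case False
      have "\<bar>sin (L * t)\<bar> \<le> L * \<bar>t\<bar>" using abs_sin_x_le_abs_x[of "L * t"] L by (simp add: abs_mult)
      then have "\<bar>2 * sin (L * t) / t / (2 * pi)\<bar> \<le> L / pi" using False by (simp add: abs_mult divide_simps mult_ac)
      also have "\<dots> \<le> L / 1" using L pi_gt3 by (intro divide_left_mono) auto
      finally have "\<bar>2 * sin (L * t) / t / (2 * pi)\<bar> * cmod (char M t) \<le> L * 1"
        using M.cmod_char_le_1 L by (intro mult_mono) auto
      then show ?thesis by (simp add: \<psi>_def norm_mult del: of_real_mult of_real_divide)
    qed (use L in \<open>simp add: \<psi>_def\<close>)
    moreover have "(1 + t\<^sup>2) ^ Suc j \<le> 2 ^ Suc j"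
      using True by (intro power_mono) (auto simp: abs_square_le_1)
    then have "L * (1 + t\<^sup>2) ^ Suc j \<le> C" unfolding C_def using L by (intro mult_left_mono) auto
    then have "L \<le> C / (1 + t\<^sup>2) ^ Suc j" by (simp add: pos_le_divide_eq add_pos_nonneg)
    ultimately show ?thesis by (rule order_trans)
  next
    case False
    have "\<bar>2 * sin (L * t) / t / (2 * pi)\<bar> \<le> 1 / \<bar>t\<bar>"
    proof -
      have "\<bar>2 * sin (L * t) / t / (2 * pi)\<bar> = \<bar>sin (L * t)\<bar> / pi / \<bar>t\<bar>" by (simp add: abs_mult)
      also have "\<bar>sin (L * t)\<bar> \<le> pi" using pi_gt3 abs_sin_le_one[of "L * t"] by linarith
      then have "\<bar>sin (L * t)\<bar> / pi / \<bar>t\<bar> \<le> 1 / \<bar>t\<bar>" by (intro divide_right_mono) auto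
      finally show ?thesis .
    qed
    then have "cmod (\<psi> t) \<le> (1 / \<bar>t\<bar>) * (1 / \<bar>t\<bar> ^ (2 * j + 1))"
      unfolding \<psi>_def norm_mult norm_of_real using M(3)[of t] False by (intro mult_mono) auto
    also have "\<dots> = 1 / \<bar>t\<bar> ^ (2 * Suc j)" by simp
    also have "\<dots> = 1 / (t\<^sup>2) ^ Suc j" by (simp only: power_mult power2_abs)
    also have "\<dots> \<le> 2 ^ Suc j / (1 + t\<^sup>2) ^ Suc j"
    proof -
      have "1 \<le> t\<^sup>2" using False abs_le_square_iff[of 1 t] by simp
      then have "(1 + t\<^sup>2) ^ Suc j \<le> (2 * t\<^sup>2) ^ Suc j" by (intro power_mono) auto
      then have "(1 + t\<^sup>2) ^ Suc j \<le> 2 ^ Suc j * (t\<^sup>2) ^ Suc j" by (simp only: power_mult_distrib)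
      moreover have "0 < (t\<^sup>2) ^ Suc j" using False by auto
      moreover have "0 < (1 + t\<^sup>2) ^ Suc j" by (simp add: add_pos_nonneg)
      ultimately show ?thesis by (simp add: divide_simps del: power_Suc)
    qed
    also have "\<dots> \<le> C / (1 + t\<^sup>2) ^ Suc j"
      unfolding C_def using L by (intro divide_right_mono) auto
    finally show ?thesis .
  qed
  have int: "integrable lborel (\<lambda>t. \<psi> t * cis (- (t * x)))" for x
  proof (rule Bochner_Integration.integrable_bound)
    show "integrable lborel (\<lambda>t. C * (1 / (1 + t\<^sup>2)))"
      by (intro integrable_mult_right integrable_inverse_one_plus_square)
    show "(\<lambda>t. \<psi> t * cis (- (t * x))) \<in> borel_measurable lborel"
    proof -
      have "(\<lambda>t. cis (- (t * x))) \<in> borel_measurable borel"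
        by (intro borel_measurable_continuous_onI continuous_intros)
      from borel_measurable_times[OF m this] show ?thesis by simp
    qed
    have "C / (1 + t\<^sup>2) ^ Suc j \<le> C * (1 / (1 + t\<^sup>2))" for t
    proof -
      have "(1 + t\<^sup>2) ^ 1 \<le> (1 + t\<^sup>2) ^ Suc j" by (intro power_increasing) auto
      then have "C / (1 + t\<^sup>2) ^ Suc j \<le> C / (1 + t\<^sup>2)" using L
        by (intro divide_left_mono) (auto simp: C_def add_pos_nonneg)
      then show ?thesis by simp
    qed
    then show "AE t in lborel. norm (\<psi> t * cis (- (t * x))) \<le> norm (C * (1 / (1 + t\<^sup>2)))"
      using order_trans[OF bound] L by (intro AE_I2) (auto simp: norm_mult C_def abs_mult)
  qed
  have "(LINT t|lborel. \<psi> t * cis (- (t * x))) = 1" if x: "\<bar>x\<bar> \<le> T" for x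
  proof -
    let ?a = "x - L" and ?b = "x + L"
    have null: "measure M {c} = 0" if "real (2 * j + 1) < \<bar>c\<bar>" for c
    proof -
      have "AE y in M. y \<notin> {c}" using M(2) by eventually_elim (use that in auto)
      then have "{c} \<in> null_sets M" by (subst (asm) AE_iff_null_sets[symmetric]) auto
      then show ?thesis by (simp add: measure_eq_0_null_sets)
    qed
    have "measure M {?a<..?b} = 1"
    proof (rule M.prob_eq_1[THEN iffD2])
      show "AE y in M. y \<in> {?a<..?b}" using M(2) by eventually_elim (use x in \<open>auto simp: L_def\<close>)
    qed simp
    moreover have "(\<lambda>R. 1 / (2 * pi) * (CLBINT t=-R..R. (iexp (-(t * ?a)) - iexp (-(t * ?b))) / (\<i> * t) * char M t))
        \<longlonglongrightarrow> measure M {?a<..?b}"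
      by (rule M.Levy_Inversion) (use x L T in \<open>auto intro!: null simp: L_def\<close>)
    moreover have "(\<lambda>R. 1 / (2 * pi) * (CLBINT t=-R..R. (iexp (-(t * ?a)) - iexp (-(t * ?b))) / (\<i> * t) * char M t))
      = (\<lambda>R. CLBINT t. indicator {-real R<..<real R} t *\<^sub>R (\<psi> t * cis (- (t * x))))"
    proof (intro ext)
      fix R :: nat
      have e: "1 / (2 * pi) * ((iexp (-(t * ?a)) - iexp (-(t * ?b))) / (\<i> * t) * char M t) = \<psi> t * cis (- (t * x))" for t
      proof -
        have "iexp (-(t * ?a)) - iexp (-(t * ?b)) = cis (- (t * x)) * (cis (L * t) - cis (- (L * t)))"
          by (simp only: cis_conv_exp[symmetric] right_diff_distrib cis_mult)
             (simp add: algebra_simps)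
        also have "cis (L * t) - cis (- (L * t)) = 2 * \<i> * sin (L * t)"
          by (simp add: complex_eq_iff)
        finally have "iexp (-(t * ?a)) - iexp (-(t * ?b)) = cis (- (t * x)) * (2 * \<i> * sin (L * t))" .
        then show ?thesis by (simp only: \<psi>_def) (simp add: mult_ac)
      qed
      have "1 / (2 * pi) * (CLBINT t=- ereal (real R)..ereal (real R). (iexp (-(t * ?a)) - iexp (-(t * ?b))) / (\<i> * t) * char M t) =
          (CLBINT t=- ereal (real R)..ereal (real R). \<psi> t * cis (- (t * x)))"
        unfolding e[symmetric] by (simp only: interval_lebesgue_integral_mult_right)
      also have "\<dots> = (CLBINT t:{-real R<..<real R}. \<psi> t * cis (- (t * x)))"
        unfolding uminus_ereal.simps by (subst interval_integral_Ioo) auto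
      finally show "1 / (2 * pi) * (CLBINT t=- ereal (real R)..ereal (real R). (iexp (-(t * ?a)) - iexp (-(t * ?b))) / (\<i> * t) * char M t) =
          (CLBINT t. indicator {-real R<..<real R} t *\<^sub>R (\<psi> t * cis (- (t * x))))"
        by (simp add: set_lebesgue_integral_def)
    qed
    ultimately have "(\<lambda>R. CLBINT t. indicator {-real R<..<real R} t *\<^sub>R (\<psi> t * cis (- (t * x)))) \<longlonglongrightarrow> 1"
      by simp
    \<comment> \<open>Levy's formula yields a limit of integrals over (-R, R); absolute
      integrability of the window identifies it with the Lebesgue integral.\<close>
    moreover have "(\<lambda>R. CLBINT t. indicator {-real R<..<real R} t *\<^sub>R (\<psi> t * cis (- (t * x)))) \<longlonglongrightarrow>
        (CLBINT t. \<psi> t * cis (- (t * x)))"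
    proof (rule integral_dominated_convergence)
      show "integrable lborel (\<lambda>t. norm (\<psi> t * cis (- (t * x))))" using int by (rule integrable_norm)
      show "AE t in lborel. (\<lambda>R. indicator {-real R<..<real R} t *\<^sub>R (\<psi> t * cis (- (t * x)))) \<longlonglongrightarrow> \<psi> t * cis (- (t * x))"
      proof (rule AE_I2)
        fix t :: real
        obtain n where "\<bar>t\<bar> < real n" using reals_Archimedean2 by blast
        then have "eventually (\<lambda>R. indicator {-real R<..<real R} t *\<^sub>R (\<psi> t * cis (- (t * x))) = \<psi> t * cis (- (t * x))) sequentially"
          by (intro eventually_sequentiallyI[of n]) (auto simp: indicator_def)
        then show "(\<lambda>R. indicator {-real R<..<real R} t *\<^sub>R (\<psi> t * cis (- (t * x)))) \<longlonglongrightarrow> \<psi> t * cis (- (t * x))"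
          by (rule tendsto_eventually)
      qed
    qed (use int[of x] in \<open>auto simp: indicator_def intro!: AE_I2\<close>)
    ultimately show ?thesis by (rule LIMSEQ_unique[symmetric])
  qed
  with m bound int show ?thesis by blast
qed

text \<open>Dominates the radial weight 1 + |\<eta>|^2 by a product over the coordinates, so that
  weighted integrals of a tensor product factorise.\<close>

lemma one_plus_sum_le_prod:
  fixes a :: "'i \<Rightarrow> real"
  assumes "finite I" "\<And>i. i \<in> I \<Longrightarrow> 0 \<le> a i"
  shows "1 + sum a I \<le> (\<Prod>i\<in>I. 1 + a i)"
  using assms
proof (induction rule: finite_induct)
  case (insert x F)
  have "1 + sum a (insert x F) \<le> (1 + a x) * (1 + sum a F)"
    using insert.hyps insert.prems by (simp add: algebra_simps sum_nonneg)
  also have "\<dots> \<le> (1 + a x) * (\<Prod>i\<in>F. 1 + a i)"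
    using insert by (intro mult_left_mono) auto
  finally show ?case using insert.hyps by simp
qed simp

text \<open>Tensor product of one-dimensional windows. With j the ceiling of \<open>q\<close>,
  squaring the window and multiplying by (1 + t^2)^q still leaves at least the integrable decay 1 /
  (1 + t^2) in each coordinate.\<close>

lemma fourier_window:
  fixes T q :: real
  assumes T: "0 \<le> T" and q: "0 \<le> q"
  shows "\<exists>\<psi> :: 'b::euclidean_space \<Rightarrow> complex. \<exists>C. \<psi> \<in> borel_measurable borel \<and> 0 \<le> C \<and>
    (\<integral>\<^sup>+\<eta>. ennreal ((cmod (\<psi> \<eta>))\<^sup>2 * (1 + (norm \<eta>)\<^sup>2) powr q) \<partial>lborel) \<le> ennreal C \<and>
    (\<forall>x. integrable lborel (\<lambda>\<eta>. \<psi> \<eta> * cis (- (\<eta> \<bullet> x)))) \<and>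
    (\<forall>x. (\<forall>b\<in>Basis. \<bar>x \<bullet> b\<bar> \<le> T) \<longrightarrow> (LINT \<eta>|lborel. \<psi> \<eta> * cis (- (\<eta> \<bullet> x))) = 1)"
proof -
  define j where "j = nat \<lceil>q\<rceil>"
  have j: "q \<le> real j" by (simp add: j_def real_nat_ceiling_ge)
  obtain \<phi> :: "real \<Rightarrow> complex" and C where \<phi>[measurable]: "\<phi> \<in> borel_measurable borel"
    and b: "\<And>t. cmod (\<phi> t) \<le> C / (1 + t\<^sup>2) ^ Suc j"
    and int: "\<And>x. integrable lborel (\<lambda>t. \<phi> t * cis (- (t * x)))"
    and one: "\<And>x. \<bar>x\<bar> \<le> T \<Longrightarrow> (LINT t|lborel. \<phi> t * cis (- (t * x))) = 1"
    using fourier_window_1d[OF T, of j] by blast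
  define \<psi> where "\<psi> = (\<lambda>\<eta>::'b. \<Prod>b\<in>Basis. \<phi> (\<eta> \<bullet> b))"
  have m: "\<psi> \<in> borel_measurable borel" unfolding \<psi>_def by measurable
  have e: "\<psi> \<eta> * cis (- (\<eta> \<bullet> x)) = (\<Prod>b\<in>Basis. \<phi> (\<eta> \<bullet> b) * cis (- ((\<eta> \<bullet> b) * (x \<bullet> b))))" for \<eta> x
  proof -
    have "- (\<eta> \<bullet> x) = (\<Sum>b\<in>Basis. - ((\<eta> \<bullet> b) * (x \<bullet> b)))" by (subst euclidean_inner) (simp add: sum_negf)
    then show ?thesis by (simp add: \<psi>_def prod.distrib cis_sum)
  qed
  have i: "integrable lborel (\<lambda>\<eta>. \<psi> \<eta> * cis (- (\<eta> \<bullet> x)))" for x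
    unfolding e by (rule lborel_prod_integral(1)[of "\<lambda>b t. \<phi> t * cis (- (t * (x \<bullet> b)))"]) (rule int)
  have o: "(LINT \<eta>|lborel. \<psi> \<eta> * cis (- (\<eta> \<bullet> x))) = 1" if "\<forall>b\<in>Basis. \<bar>x \<bullet> b\<bar> \<le> T" for x
    unfolding e lborel_prod_integral(2)[of "\<lambda>b t. \<phi> t * cis (- (t * (x \<bullet> b)))", OF int]
    using that by (simp add: one)
  define g where "g = (\<lambda>t::real. (cmod (\<phi> t))\<^sup>2 * (1 + t\<^sup>2) powr q)"
  have g[measurable]: "g \<in> borel_measurable borel" unfolding g_def by measurable
  have gb: "g t \<le> C\<^sup>2 * (1 / (1 + t\<^sup>2))" for t
  proof -
    have p: "1 \<le> 1 + t\<^sup>2" by simp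
    have "(cmod (\<phi> t))\<^sup>2 \<le> (C / (1 + t\<^sup>2) ^ Suc j)\<^sup>2" using b[of t] by (intro power_mono) auto
    moreover have "(1 + t\<^sup>2) powr q \<le> (1 + t\<^sup>2) ^ j"
      using powr_mono[OF j p] p by (simp add: powr_realpow)
    ultimately have "g t \<le> (C / (1 + t\<^sup>2) ^ Suc j)\<^sup>2 * (1 + t\<^sup>2) ^ j"
      unfolding g_def by (intro mult_mono) auto
    also have "\<dots> = C\<^sup>2 * (1 / ((1 + t\<^sup>2) ^ Suc (Suc j)))"
      using p by (simp add: power_divide divide_simps power2_eq_square)
    also have "\<dots> \<le> C\<^sup>2 * (1 / (1 + t\<^sup>2))"
      using p power_increasing[of 1 "Suc (Suc j)" "1 + t\<^sup>2"]
      by (intro mult_left_mono frac_le) (auto simp: add_pos_nonneg simp del: power_Suc)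
    finally show ?thesis .
  qed
  have "(\<integral>\<^sup>+t. ennreal (g t) \<partial>lborel) < \<infinity>"
  proof -
    have "integrable lborel (\<lambda>t. C\<^sup>2 * (1 / (1 + t\<^sup>2)))"
      by (intro integrable_mult_right integrable_inverse_one_plus_square)
    then have "integrable lborel g"
    proof (rule Bochner_Integration.integrable_bound)
      show "AE t in lborel. norm (g t) \<le> norm (C\<^sup>2 * (1 / (1 + t\<^sup>2)))"
        using gb by (intro AE_I2) (auto simp: g_def intro: order_trans[OF _ abs_ge_self])
    qed simp
    then have "(\<integral>\<^sup>+t. ennreal (norm (g t)) \<partial>lborel) < \<infinity>" by (simp add: integrable_iff_bounded)
    then show ?thesis by (simp add: g_def)
  qed
  then obtain D where D: "0 \<le> D" "(\<integral>\<^sup>+t. ennreal (g t) \<partial>lborel) = ennreal D"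
    by (metis ennreal_cases infinity_ennreal_def less_irrefl)
  have "(\<integral>\<^sup>+\<eta>. ennreal ((cmod (\<psi> \<eta>))\<^sup>2 * (1 + (norm \<eta>)\<^sup>2) powr q) \<partial>lborel) \<le>
      (\<integral>\<^sup>+\<eta>. (\<Prod>b\<in>Basis. ennreal (g ((\<eta>::'b) \<bullet> b))) \<partial>lborel)"
  proof (rule nn_integral_mono)
    fix \<eta> :: 'b
    have "(norm \<eta>)\<^sup>2 = (\<Sum>b\<in>Basis. (\<eta> \<bullet> b)\<^sup>2)"
      unfolding power2_norm_eq_inner by (subst euclidean_inner) (simp add: power2_eq_square)
    then have "1 + (norm \<eta>)\<^sup>2 \<le> (\<Prod>b\<in>Basis. 1 + (\<eta> \<bullet> b)\<^sup>2)"
      using one_plus_sum_le_prod[of Basis "\<lambda>b. (\<eta> \<bullet> b)\<^sup>2"] by simp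
    then have "(1 + (norm \<eta>)\<^sup>2) powr q \<le> (\<Prod>b\<in>Basis. 1 + (\<eta> \<bullet> b)\<^sup>2) powr q"
      using q by (intro powr_mono2) auto
    also have "\<dots> = (\<Prod>b\<in>Basis. (1 + (\<eta> \<bullet> b)\<^sup>2) powr q)"
      by (rule prod_powr_distrib)
    finally have "(cmod (\<psi> \<eta>))\<^sup>2 * (1 + (norm \<eta>)\<^sup>2) powr q \<le> (cmod (\<psi> \<eta>))\<^sup>2 * (\<Prod>b\<in>Basis. (1 + (\<eta> \<bullet> b)\<^sup>2) powr q)"
      by (intro mult_left_mono) auto
    also have "\<dots> = (\<Prod>b\<in>Basis. g (\<eta> \<bullet> b))"
      by (simp add: \<psi>_def g_def prod.distrib prod_norm[symmetric] prod_power_distrib)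
    finally show "ennreal ((cmod (\<psi> \<eta>))\<^sup>2 * (1 + (norm \<eta>)\<^sup>2) powr q) \<le> (\<Prod>b\<in>Basis. ennreal (g (\<eta> \<bullet> b)))"
      by (subst prod_ennreal) (auto simp: g_def intro!: ennreal_leI)
  qed
  also have "\<dots> = (\<Prod>b\<in>(Basis::'b set). \<integral>\<^sup>+t. ennreal (g t) \<partial>lborel)"
    by (rule nn_integral_lborel_prod) auto
  also have "\<dots> = ennreal (D ^ DIM('b))" using D by (simp add: ennreal_power)
  finally show ?thesis using m i o D(1) by (intro exI[of _ \<psi>] exI[of _ "D ^ DIM('b)"]) auto
qed

text \<open>Point evaluation of a trigonometric polynomial with bounded frequencies is controlled by its
  weighted \<open>L\<^sup>2\<close> norm with the correct dependence on the evaluation point: such a polynomial is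
  reproduced by convolution with the window.\<close>

lemma trig_poly_evaluation_bound:
  fixes T \<nu> \<alpha> :: real
  assumes T: "0 \<le> T" and \<nu>: "0 < \<nu>" and \<alpha>: "0 < \<alpha>"
  shows "\<exists>C>0. \<forall>n (s :: nat \<Rightarrow> real ^ 'd) v \<omega>. (\<forall>i<n. s i \<in> cube T) \<longrightarrow> v \<in> carrier_vec n \<longrightarrow>
    trig_power n s v \<omega> * spec_dens \<nu> \<alpha> \<omega> \<le> C * quad_form (scaled_corr_mat \<nu> s n \<alpha>) v"
proof -
  define q where "q = \<nu> + real CARD('d) / 2"
  have q: "0 < q" using \<nu> by (simp add: q_def add_pos_nonneg)
  obtain \<psi> :: "real ^ 'd \<Rightarrow> complex" and C where \<psi>[measurable]: "\<psi> \<in> borel_measurable borel"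
    and C: "0 \<le> C" "(\<integral>\<^sup>+\<eta>. ennreal ((cmod (\<psi> \<eta>))\<^sup>2 * (1 + (norm \<eta>)\<^sup>2) powr q) \<partial>lborel) \<le> ennreal C"
    and int: "\<And>x. integrable lborel (\<lambda>\<eta>. \<psi> \<eta> * cis (- (\<eta> \<bullet> x)))"
    and one: "\<And>x. \<forall>b\<in>Basis. \<bar>x \<bullet> b\<bar> \<le> T \<Longrightarrow> (LINT \<eta>|lborel. \<psi> \<eta> * cis (- (\<eta> \<bullet> x))) = 1"
    using fourier_window[OF T less_imp_le[OF q]] by blast
  \<comment> \<open>Chosen so that m \<ge> 1 and m \<alpha>^2 \<ge> 1, which lets \<alpha>^2 be
    traded against 1 in the ratio bound.\<close>
  define m where "m = max 1 (1 / \<alpha>\<^sup>2)"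
  have m: "1 \<le> m" "1 \<le> m * \<alpha>\<^sup>2" using \<alpha> by (auto simp: m_def max_def field_simps)
  \<comment> \<open>The summand 1 only makes the constant strictly positive.\<close>
  define B where "B = (2 * m) powr q * C + 1"
  let ?f = "spec_dens \<nu> \<alpha> :: real ^ 'd \<Rightarrow> real"
  note fpos = spec_dens_pos[OF \<nu> \<alpha>]
  \<comment> \<open>An inequality of Peetre type: shifting the argument of the spectral density by
    \<eta> costs at most a power of 1 + |\<eta>|^2, which the window integrates.\<close>
  have ratio: "?f \<omega> / ?f (\<omega> - \<eta>) \<le> (2 * m) powr q * (1 + (norm \<eta>)\<^sup>2) powr q" for \<omega> \<eta>
  proof -
    define c where "c = Gamma q / (Gamma \<nu> * pi powr (real CARD('d) / 2))"
    have c: "0 < c" using q \<nu> by (simp add: c_def Gamma_real_pos)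
    have f: "?f \<xi> = c * (\<alpha>\<^sup>2 + (norm \<xi>)\<^sup>2) powr (- q)" for \<xi> by (simp add: spec_dens_def q_def c_def)
    have p: "0 < \<alpha>\<^sup>2 + (norm \<xi>)\<^sup>2" for \<xi> :: "real ^ 'd" using \<alpha> by (simp add: add_pos_nonneg)
    have "(norm (\<omega> - \<eta>))\<^sup>2 \<le> 2 * (norm \<omega>)\<^sup>2 + 2 * (norm \<eta>)\<^sup>2"
    proof -
      have "(norm (\<omega> - \<eta>))\<^sup>2 \<le> (norm \<omega> + norm \<eta>)\<^sup>2" by (intro power_mono norm_triangle_ineq4) auto
      also have "\<dots> \<le> 2 * (norm \<omega>)\<^sup>2 + 2 * (norm \<eta>)\<^sup>2"
        using sum_squares_bound[of "norm \<omega>" "norm \<eta>"] by (simp add: power2_sum)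
      finally show ?thesis .
    qed
    also have "2 * (norm \<eta>)\<^sup>2 \<le> 2 * (m * \<alpha>\<^sup>2) * (norm \<eta>)\<^sup>2" using m by (intro mult_right_mono) auto
    finally have "\<alpha>\<^sup>2 + (norm (\<omega> - \<eta>))\<^sup>2 \<le> \<alpha>\<^sup>2 + (2 * (norm \<omega>)\<^sup>2 + 2 * (m * \<alpha>\<^sup>2) * (norm \<eta>)\<^sup>2)" by simp
    also have "\<dots> \<le> (2 * m) * (\<alpha>\<^sup>2 + (norm \<omega>)\<^sup>2) * (1 + (norm \<eta>)\<^sup>2)"
    proof -
      have "\<alpha>\<^sup>2 \<le> 2 * m * \<alpha>\<^sup>2" "2 * (norm \<omega>)\<^sup>2 \<le> 2 * m * (norm \<omega>)\<^sup>2"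
        using m mult_right_mono[of 1 "2 * m" "\<alpha>\<^sup>2"] mult_right_mono[of 2 "2 * m" "(norm \<omega>)\<^sup>2"] by auto
      moreover have "0 \<le> 2 * m * (norm \<omega>)\<^sup>2 * (norm \<eta>)\<^sup>2" using m by simp
      ultimately show ?thesis by (simp add: algebra_simps)
    qed
    finally have "(\<alpha>\<^sup>2 + (norm (\<omega> - \<eta>))\<^sup>2) powr q \<le> ((2 * m) * (\<alpha>\<^sup>2 + (norm \<omega>)\<^sup>2) * (1 + (norm \<eta>)\<^sup>2)) powr q"
      using q p[of "\<omega> - \<eta>"] by (intro powr_mono2) auto
    also have "\<dots> = (2 * m) powr q * (\<alpha>\<^sup>2 + (norm \<omega>)\<^sup>2) powr q * (1 + (norm \<eta>)\<^sup>2) powr q"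
      using m p by (simp add: powr_mult less_imp_le)
    finally have k: "(\<alpha>\<^sup>2 + (norm (\<omega> - \<eta>))\<^sup>2) powr q \<le>
      (2 * m) powr q * (1 + (norm \<eta>)\<^sup>2) powr q * (\<alpha>\<^sup>2 + (norm \<omega>)\<^sup>2) powr q" by (simp only: mult_ac)
    have "?f \<omega> / ?f (\<omega> - \<eta>) = (\<alpha>\<^sup>2 + (norm (\<omega> - \<eta>))\<^sup>2) powr q / (\<alpha>\<^sup>2 + (norm \<omega>)\<^sup>2) powr q"
      unfolding f using c p[of \<omega>] p[of "\<omega> - \<eta>"] by (simp add: powr_minus_divide)
    also have "\<dots> \<le> (2 * m) powr q * (1 + (norm \<eta>)\<^sup>2) powr q"
      using k p[of \<omega>] by (subst pos_divide_le_eq) auto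
    finally show ?thesis .
  qed
  have main: "trig_power n s v \<omega> * ?f \<omega> \<le> B * quad_form (scaled_corr_mat \<nu> s n \<alpha>) v"
    if s: "\<forall>i<n. s i \<in> cube T" and v: "v \<in> carrier_vec n" for n s v \<omega>
  proof -
    let ?A = "trig_poly n s (vec_index v)" and ?Q = "quad_form (scaled_corr_mat \<nu> s n \<alpha>) v"
    have Q: "0 \<le> ?Q" by (rule quad_form_scaled_corr_mat(2)[OF \<nu> \<alpha> v])
    have Ae: "\<psi> \<eta> * ?A (\<omega> - \<eta>) = (\<Sum>i<n. (complex_of_real (vec_index v i) * cis (\<omega> \<bullet> s i)) * (\<psi> \<eta> * cis (- (\<eta> \<bullet> s i))))" for \<eta>
    proof -
      have "cis ((\<omega> - \<eta>) \<bullet> s i) = cis (\<omega> \<bullet> s i) * cis (- (\<eta> \<bullet> s i))" for i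
        by (simp only: cis_mult inner_diff_left) simp
      then show ?thesis by (simp add: trig_poly_def sum_distrib_left mult_ac)
    qed
    have Ai: "integrable lborel (\<lambda>\<eta>. \<psi> \<eta> * ?A (\<omega> - \<eta>))"
      unfolding Ae by (intro Bochner_Integration.integrable_sum integrable_mult_right int)
    have si: "\<forall>b\<in>Basis. \<bar>s i \<bullet> b\<bar> \<le> T" if "i < n" for i
      using s that T by (auto simp: cube_def Basis_vec_def inner_axis)
    \<comment> \<open>Reproduction: at every sampling point the window transforms to 1, so
      convolution with \<psi> fixes the polynomial.\<close>
    have A: "(LINT \<eta>|lborel. \<psi> \<eta> * ?A (\<omega> - \<eta>)) = ?A \<omega>"
      unfolding Ae using int one[OF si] by (subst Bochner_Integration.integral_sum) (auto simp: trig_poly_def)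
    have "ennreal (cmod (?A \<omega>)) \<le> (\<integral>\<^sup>+\<eta>. ennreal (cmod (\<psi> \<eta> * ?A (\<omega> - \<eta>))) \<partial>lborel)"
      unfolding A[symmetric] using integral_norm_bound_ennreal[OF Ai] by simp
    \<comment> \<open>Set up for Cauchy-Schwarz with the root of the spectral density at \<omega> -
      \<eta>: one factor becomes the covariance form, the other is finite by the ratio
      bound.\<close>
    also have "\<dots> = (\<integral>\<^sup>+\<eta>. ennreal (cmod (\<psi> \<eta>) / sqrt (?f (\<omega> - \<eta>))) * ennreal (cmod (?A (\<omega> - \<eta>)) * sqrt (?f (\<omega> - \<eta>))) \<partial>lborel)"
    proof (intro nn_integral_cong)
      fix \<eta>
      have p: "0 < sqrt (?f (\<omega> - \<eta>))" using fpos by simp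
      then have "cmod (\<psi> \<eta> * ?A (\<omega> - \<eta>)) = cmod (\<psi> \<eta>) / sqrt (?f (\<omega> - \<eta>)) * (cmod (?A (\<omega> - \<eta>)) * sqrt (?f (\<omega> - \<eta>)))"
        by (simp add: norm_mult)
      then show "ennreal (cmod (\<psi> \<eta> * ?A (\<omega> - \<eta>))) = ennreal (cmod (\<psi> \<eta>) / sqrt (?f (\<omega> - \<eta>))) *
          ennreal (cmod (?A (\<omega> - \<eta>)) * sqrt (?f (\<omega> - \<eta>)))"
        using p by (simp only: ennreal_mult[symmetric] divide_nonneg_nonneg mult_nonneg_nonneg norm_ge_zero less_imp_le)
    qed
    finally have "(ennreal (cmod (?A \<omega>)))\<^sup>2 \<le> \<dots>\<^sup>2" by (intro power_mono) auto
    also have "\<dots> \<le> (\<integral>\<^sup>+\<eta>. (ennreal (cmod (\<psi> \<eta>) / sqrt (?f (\<omega> - \<eta>))))\<^sup>2 \<partial>lborel) *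
        (\<integral>\<^sup>+\<eta>. (ennreal (cmod (?A (\<omega> - \<eta>)) * sqrt (?f (\<omega> - \<eta>))))\<^sup>2 \<partial>lborel)"
      by (rule Cauchy_Schwarz_nn_integral) measurable
    also have "(\<integral>\<^sup>+\<eta>. (ennreal (cmod (?A (\<omega> - \<eta>)) * sqrt (?f (\<omega> - \<eta>))))\<^sup>2 \<partial>lborel) =
        (\<integral>\<^sup>+\<eta>. ennreal ((cmod (?A (\<omega> - \<eta>)))\<^sup>2 * ?f (\<omega> - \<eta>)) \<partial>lborel)"
    proof (intro nn_integral_cong)
      fix \<eta>
      have p: "0 \<le> ?f (\<omega> - \<eta>)" using fpos by (rule less_imp_le)
      then show "(ennreal (cmod (?A (\<omega> - \<eta>)) * sqrt (?f (\<omega> - \<eta>))))\<^sup>2 = ennreal ((cmod (?A (\<omega> - \<eta>)))\<^sup>2 * ?f (\<omega> - \<eta>))"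
        by (subst ennreal_power) (simp_all add: power_mult_distrib)
    qed
    also have "\<dots> = (\<integral>\<^sup>+\<eta>. ennreal ((cmod (?A \<eta>))\<^sup>2 * ?f \<eta>) \<partial>lborel)"
    proof -
      have "(\<integral>\<^sup>+\<eta>. ennreal ((cmod (?A \<eta>))\<^sup>2 * ?f \<eta>) \<partial>(distr lborel borel (\<lambda>\<eta>. \<omega> + (-1) *\<^sub>R \<eta>))) =
          (\<integral>\<^sup>+\<eta>. ennreal ((cmod (?A (\<omega> + (-1) *\<^sub>R \<eta>)))\<^sup>2 * ?f (\<omega> + (-1) *\<^sub>R \<eta>)) \<partial>lborel)"
        by (rule nn_integral_distr) measurable
      moreover have "distr lborel borel (\<lambda>\<eta>. \<omega> + (-1) *\<^sub>R \<eta>) = (lborel :: (real ^ 'd) measure)"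
        using lborel_affine[of "-1" \<omega>] by (simp add: density_1)
      ultimately show ?thesis by simp
    qed
    also have "\<dots> = ennreal ?Q" by (rule quad_form_scaled_corr_mat(1)[OF \<nu> \<alpha> v, symmetric])
    also have "(\<integral>\<^sup>+\<eta>. (ennreal (cmod (\<psi> \<eta>) / sqrt (?f (\<omega> - \<eta>))))\<^sup>2 \<partial>lborel) \<le>
        (\<integral>\<^sup>+\<eta>. ennreal ((2 * m) powr q / ?f \<omega>) * ennreal ((cmod (\<psi> \<eta>))\<^sup>2 * (1 + (norm \<eta>)\<^sup>2) powr q) \<partial>lborel)"
    proof (rule nn_integral_mono)
      fix \<eta>
      have "(cmod (\<psi> \<eta>))\<^sup>2 / ?f (\<omega> - \<eta>) = (cmod (\<psi> \<eta>))\<^sup>2 * (?f \<omega> / ?f (\<omega> - \<eta>)) / ?f \<omega>"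
        using fpos[of \<omega>] by simp
      also have "\<dots> \<le> (cmod (\<psi> \<eta>))\<^sup>2 * ((2 * m) powr q * (1 + (norm \<eta>)\<^sup>2) powr q) / ?f \<omega>"
        using ratio[of \<omega> \<eta>] fpos[of \<omega>] by (intro divide_right_mono mult_left_mono) auto
      finally have "ennreal ((cmod (\<psi> \<eta>))\<^sup>2 / ?f (\<omega> - \<eta>)) \<le>
         ennreal ((2 * m) powr q / ?f \<omega> * ((cmod (\<psi> \<eta>))\<^sup>2 * (1 + (norm \<eta>)\<^sup>2) powr q))"
        by (intro ennreal_leI) (simp add: mult_ac)
      also have "\<dots> = ennreal ((2 * m) powr q / ?f \<omega>) * ennreal ((cmod (\<psi> \<eta>))\<^sup>2 * (1 + (norm \<eta>)\<^sup>2) powr q)"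
        by (rule ennreal_mult') (use fpos[of \<omega>] in simp)
      also have "ennreal ((cmod (\<psi> \<eta>))\<^sup>2 / ?f (\<omega> - \<eta>)) = (ennreal (cmod (\<psi> \<eta>) / sqrt (?f (\<omega> - \<eta>))))\<^sup>2"
        using fpos[of "\<omega> - \<eta>"] by (subst ennreal_power) (simp_all add: power_divide)
      finally show "(ennreal (cmod (\<psi> \<eta>) / sqrt (?f (\<omega> - \<eta>))))\<^sup>2 \<le>
          ennreal ((2 * m) powr q / ?f \<omega>) * ennreal ((cmod (\<psi> \<eta>))\<^sup>2 * (1 + (norm \<eta>)\<^sup>2) powr q)" .
    qed
    also have "\<dots> = ennreal ((2 * m) powr q / ?f \<omega>) * (\<integral>\<^sup>+\<eta>. ennreal ((cmod (\<psi> \<eta>))\<^sup>2 * (1 + (norm \<eta>)\<^sup>2) powr q) \<partial>lborel)"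
      by (rule nn_integral_cmult) measurable
    also have "\<dots> \<le> ennreal ((2 * m) powr q / ?f \<omega>) * ennreal C" by (intro mult_left_mono C) auto
    finally have "(ennreal (cmod (?A \<omega>)))\<^sup>2 \<le> ennreal ((2 * m) powr q / ?f \<omega>) * ennreal C * ennreal ?Q"
      by (simp add: mult_right_mono)
    also have "ennreal ((2 * m) powr q / ?f \<omega>) * ennreal C * ennreal ?Q = ennreal ((2 * m) powr q / ?f \<omega> * C * ?Q)"
      unfolding ennreal_mult''[OF Q] ennreal_mult''[OF C(1)] ..
    also have "(ennreal (cmod (?A \<omega>)))\<^sup>2 = ennreal ((cmod (?A \<omega>))\<^sup>2)"
      by (rule ennreal_power) simp
    finally have "ennreal ((cmod (?A \<omega>))\<^sup>2) \<le> ennreal ((2 * m) powr q / ?f \<omega> * C * ?Q)" .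
    then have "(cmod (?A \<omega>))\<^sup>2 \<le> (2 * m) powr q / ?f \<omega> * C * ?Q"
      using fpos[of \<omega>] C(1) Q by (subst (asm) ennreal_le_iff) (auto intro!: mult_nonneg_nonneg simp: less_imp_le)
    then have "(cmod (?A \<omega>))\<^sup>2 * ?f \<omega> \<le> (2 * m) powr q * C * ?Q"
      using mult_right_mono[OF _ less_imp_le[OF fpos[of \<omega>]], of _ "(2 * m) powr q / ?f \<omega> * C * ?Q"] fpos[of \<omega>] by simp
    also have "\<dots> \<le> B * ?Q" unfolding B_def using Q by (intro mult_right_mono) auto
    finally show ?thesis .
  qed
  have "0 < B" unfolding B_def using C by (intro add_nonneg_pos mult_nonneg_nonneg) auto
  with main show ?thesis by blast
qed

section \<open>Gaussian concentration\<close>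

lemma prob_space_std_normal: "prob_space std_normal_distribution"
  by (rule prob_space_normal_density) simp

lemma std_normal_second_moment:
  "integrable std_normal_distribution (\<lambda>x. x\<^sup>2)" "(LINT x|std_normal_distribution. x\<^sup>2) = 1"
  "integrable std_normal_distribution (\<lambda>x. x)" "(LINT x|std_normal_distribution. x) = 0"
proof -
  have 2: "has_bochner_integral lborel (\<lambda>x. std_normal_density x * x\<^sup>2) 1"
    using normal_moment_even[of 1 0 1] by simp
  have 1: "has_bochner_integral lborel (\<lambda>x. std_normal_density x * x) 0"
    using normal_moment_odd[of 1 0 0] by simp
  show "integrable std_normal_distribution (\<lambda>x. x\<^sup>2)"
    by (subst integrable_density) (use 2 in \<open>auto simp: has_bochner_integral_iff\<close>)
  show "(LINT x|std_normal_distribution. x\<^sup>2) = 1"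
    by (subst integral_density) (use 2 in \<open>auto simp: has_bochner_integral_iff\<close>)
  show "integrable std_normal_distribution (\<lambda>x. x)"
    by (subst integrable_density) (use 1 in \<open>auto simp: has_bochner_integral_iff\<close>)
  show "(LINT x|std_normal_distribution. x) = 0"
    by (subst integral_density) (use 1 in \<open>auto simp: has_bochner_integral_iff\<close>)
qed

text \<open>Point masses and proper normal laws are both affine images of the standard normal law,
  the former with \<sigma> = 0. This removes the case distinction from what follows.\<close>

lemma normal_rv_cases:
  assumes M: "prob_space M" and W[measurable]: "W \<in> borel_measurable M" and n: "normal_rv M W"
  obtains \<mu> \<sigma> where "0 \<le> \<sigma>" "distr M borel W = distr std_normal_distribution borel (\<lambda>x. \<mu> + \<sigma> * x)"
proof -
  interpret prob_space M by fact
  interpret N: prob_space std_normal_distribution by (rule prob_space_std_normal)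
  from n consider \<mu> where "AE \<omega> in M. W \<omega> = \<mu>" |
    \<mu> \<sigma> where "0 < \<sigma>" "distributed M lborel W (\<lambda>x. ennreal (normal_density \<mu> \<sigma> x))"
    unfolding normal_rv_def by blast
  then show thesis
  proof cases
    case 1
    have "distr M borel W = distr M borel (\<lambda>_. \<mu>)" using 1 by (intro distr_cong_AE) auto
    also have "\<dots> = return borel \<mu>" by (rule distr_const) simp
    also have "\<dots> = distr std_normal_distribution borel (\<lambda>x. \<mu> + 0 * x)" by (simp add: N.distr_const)
    finally show thesis by (intro that[of 0 \<mu>]) auto
  next
    case 2
    have "distributed M lborel (\<lambda>x. (W x - \<mu>) / \<sigma>) std_normal_density"
      using normal_standard_normal_convert[OF 2(1), THEN iffD1, OF 2(2)] .
    then have d: "distr M lborel (\<lambda>x. (W x - \<mu>) / \<sigma>) = std_normal_distribution"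
      by (rule distributed_distr_eq_density)
    have "distr M borel W = distr M borel ((\<lambda>x. \<mu> + \<sigma> * x) \<circ> (\<lambda>x. (W x - \<mu>) / \<sigma>))"
      using 2 by (simp add: comp_def)
    also have "\<dots> = distr (distr M lborel (\<lambda>x. (W x - \<mu>) / \<sigma>)) borel (\<lambda>x. \<mu> + \<sigma> * x)"
      by (rule distr_distr[symmetric]) auto
    finally show thesis using 2 unfolding d by (intro that[of \<sigma> \<mu>]) auto
  qed
qed

lemma normal_rv_square_integrable:
  assumes M: "prob_space M" and W[measurable]: "W \<in> borel_measurable M" and n: "normal_rv M W"
  shows "integrable M (\<lambda>\<omega>. (W \<omega>)\<^sup>2)"
proof -
  interpret N: prob_space std_normal_distribution by (rule prob_space_std_normal)
  from normal_rv_cases[OF assms] obtain \<mu> \<sigma> where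
    d: "distr M borel W = distr std_normal_distribution borel (\<lambda>x. \<mu> + \<sigma> * x)" by metis
  have "integrable std_normal_distribution (\<lambda>x. \<mu>\<^sup>2 + 2 * \<mu> * \<sigma> * x + \<sigma>\<^sup>2 * x\<^sup>2)"
    by (intro Bochner_Integration.integrable_add integrable_mult_right std_normal_second_moment) simp
  then have "integrable std_normal_distribution (\<lambda>x. (\<mu> + \<sigma> * x)\<^sup>2)"
    by (rule Bochner_Integration.integrable_cong[THEN iffD1, rotated 2])
       (auto simp: power2_sum power_mult_distrib)
  then have "integrable (distr std_normal_distribution borel (\<lambda>x. \<mu> + \<sigma> * x)) (\<lambda>x. x\<^sup>2)"
    by (subst integrable_distr_eq) auto
  then show ?thesis unfolding d[symmetric] by (subst (asm) integrable_distr_eq) auto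
qed

text \<open>Mean and variance determine the parameters of the affine representation; degenerate
  variables are covered by v = 0.\<close>

lemma centered_normal_distr:
  assumes M: "prob_space M" and W[measurable]: "W \<in> borel_measurable M" and n: "normal_rv M W"
    and mean: "(LINT \<omega>|M. W \<omega>) = 0" and var: "(LINT \<omega>|M. (W \<omega>)\<^sup>2) = v"
  shows "distr M borel W = distr std_normal_distribution borel (\<lambda>x. sqrt v * x)"
proof -
  interpret N: prob_space std_normal_distribution by (rule prob_space_std_normal)
  from normal_rv_cases[OF M W n] obtain \<mu> \<sigma> where \<sigma>: "0 \<le> \<sigma>"
    and d: "distr M borel W = distr std_normal_distribution borel (\<lambda>x. \<mu> + \<sigma> * x)" by metis
  have tr: "(LINT \<omega>|M. g (W \<omega>)) = (LINT x|std_normal_distribution. g (\<mu> + \<sigma> * x))"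
    if [measurable]: "g \<in> borel_measurable borel" for g :: "real \<Rightarrow> real"
    using integral_distr[of W M borel g] integral_distr[of "\<lambda>x. \<mu> + \<sigma> * x" std_normal_distribution borel g]
    by (simp add: d)
  have "(LINT x|std_normal_distribution. \<mu> + \<sigma> * x) = \<mu>"
    using std_normal_second_moment(3,4) N.prob_space by simp
  moreover have "(LINT \<omega>|M. W \<omega>) = (LINT x|std_normal_distribution. \<mu> + \<sigma> * x)" by (rule tr) simp
  ultimately have \<mu>: "\<mu> = 0" using mean by linarith
  have "(LINT \<omega>|M. (W \<omega>)\<^sup>2) = (LINT x|std_normal_distribution. (\<mu> + \<sigma> * x)\<^sup>2)" by (rule tr) simp
  also have "\<dots> = (LINT x|std_normal_distribution. \<sigma>\<^sup>2 * x\<^sup>2)"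
    by (intro Bochner_Integration.integral_cong) (auto simp: \<mu> power_mult_distrib)
  also have "\<dots> = \<sigma>\<^sup>2" by (simp add: std_normal_second_moment(2))
  finally have "v = \<sigma>\<^sup>2" using var by linarith
  then show ?thesis using d \<mu> \<sigma> by simp
qed

lemma nn_integral_std_normal_exp:
  "(\<integral>\<^sup>+x. ennreal (exp (c * x)) \<partial>std_normal_distribution) = ennreal (exp (c\<^sup>2 / 2))"
proof -
  have "(\<integral>\<^sup>+x. ennreal (exp (c * x)) \<partial>std_normal_distribution) =
      (\<integral>\<^sup>+x. ennreal (std_normal_density x) * ennreal (exp (c * x)) \<partial>lborel)"
    by (rule nn_integral_density) auto
  also have "\<dots> = (\<integral>\<^sup>+x. ennreal (exp (c\<^sup>2 / 2)) * ennreal (normal_density c 1 x) \<partial>lborel)"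
  proof (intro nn_integral_cong)
    fix x
    have "std_normal_density x * exp (c * x) = exp (c\<^sup>2 / 2) * normal_density c 1 x"
      by (simp add: normal_density_def field_simps power2_eq_square flip: exp_add)
    then show "ennreal (std_normal_density x) * ennreal (exp (c * x)) = ennreal (exp (c\<^sup>2 / 2)) * ennreal (normal_density c 1 x)"
      by (simp flip: ennreal_mult')
  qed
  also have "\<dots> = ennreal (exp (c\<^sup>2 / 2)) * (\<integral>\<^sup>+x. ennreal (normal_density c 1 x) \<partial>lborel)"
    by (rule nn_integral_cmult) auto
  also have "(\<integral>\<^sup>+x. ennreal (normal_density c 1 x) \<partial>lborel) = 1"
    by (subst nn_integral_eq_integral) auto
  finally show ?thesis by simp
qed

text \<open>The tilted density is \<sigma> times a centred normal density with variance 1 / (1 - 2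
  t).\<close>

lemma nn_integral_std_normal_exp_square:
  fixes t :: real
  assumes t: "t < 1 / 2"
  shows "(\<integral>\<^sup>+x. ennreal (exp (t * x\<^sup>2)) \<partial>std_normal_distribution) = ennreal ((1 - 2 * t) powr (- (1 / 2)))"
proof -
  define \<sigma> where "\<sigma> = (1 - 2 * t) powr (- (1 / 2))"
  have \<sigma>: "0 < \<sigma>" "\<sigma>\<^sup>2 = 1 / (1 - 2 * t)"
    using t by (auto simp: \<sigma>_def powr_minus powr_half_sqrt inverse_eq_divide power_divide)
  have "(\<integral>\<^sup>+x. ennreal (exp (t * x\<^sup>2)) \<partial>std_normal_distribution) =
      (\<integral>\<^sup>+x. ennreal (std_normal_density x) * ennreal (exp (t * x\<^sup>2)) \<partial>lborel)"
    by (rule nn_integral_density) auto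
  also have "\<dots> = (\<integral>\<^sup>+x. ennreal \<sigma> * ennreal (normal_density 0 \<sigma> x) \<partial>lborel)"
  proof (intro nn_integral_cong)
    fix x
    have "normal_density 0 \<sigma> x = 1 / (sqrt (2 * pi) * \<sigma>) * exp (- (x\<^sup>2 * (1 - 2 * t)) / 2)"
    proof -
      have "sqrt (2 * pi * \<sigma>\<^sup>2) = sqrt (2 * pi) * \<sigma>" using \<sigma>(1) by (simp add: real_sqrt_mult)
      moreover have "- (x - 0)\<^sup>2 / (2 * \<sigma>\<^sup>2) = - (x\<^sup>2 * (1 - 2 * t)) / 2" by (simp add: \<sigma>(2))
      ultimately show ?thesis by (simp only: normal_density_def)
    qed
    moreover have "exp (- (x\<^sup>2 * (1 - 2 * t)) / 2) = exp (- x\<^sup>2 / 2) * exp (t * x\<^sup>2)"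
      by (simp add: field_simps flip: exp_add)
    ultimately have "std_normal_density x * exp (t * x\<^sup>2) = \<sigma> * normal_density 0 \<sigma> x"
      using \<sigma>(1) by (simp add: normal_density_def)
    then show "ennreal (std_normal_density x) * ennreal (exp (t * x\<^sup>2)) = ennreal \<sigma> * ennreal (normal_density 0 \<sigma> x)"
      using \<sigma>(1) by (simp flip: ennreal_mult')
  qed
  also have "\<dots> = ennreal \<sigma> * (\<integral>\<^sup>+x. ennreal (normal_density 0 \<sigma> x) \<partial>lborel)"
    by (rule nn_integral_cmult) auto
  also have "(\<integral>\<^sup>+x. ennreal (normal_density 0 \<sigma> x) \<partial>lborel) = 1"
    using \<sigma>(1) by (subst nn_integral_eq_integral) auto
  finally show ?thesis by (simp add: \<sigma>_def)
qed

text \<open>The exact value (1 - 2 c v)^(-1/2) is at most sqrt 2; the rounded bound 2 is the moment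
  condition of the averaging lemma below.\<close>

lemma centered_normal_exp_square:
  fixes v V :: real
  assumes [measurable]: "W \<in> borel_measurable M"
    and d: "distr M borel W = distr std_normal_distribution borel (\<lambda>x. sqrt v * x)"
    and v: "0 \<le> v" "c * v \<le> 1 / 4" "0 \<le> c"
  shows "(\<integral>\<^sup>+\<omega>. ennreal (exp (c * (W \<omega>)\<^sup>2)) \<partial>M) \<le> 2"
proof -
  have "(\<integral>\<^sup>+\<omega>. ennreal (exp (c * (W \<omega>)\<^sup>2)) \<partial>M) = (\<integral>\<^sup>+x. ennreal (exp (c * x\<^sup>2)) \<partial>distr M borel W)"
    by (subst nn_integral_distr) auto
  also have "\<dots> = (\<integral>\<^sup>+x. ennreal (exp ((c * v) * x\<^sup>2)) \<partial>std_normal_distribution)"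
    unfolding d using v by (subst nn_integral_distr) (auto simp: power_mult_distrib mult_ac)
  also have "\<dots> = ennreal ((1 - 2 * (c * v)) powr (- (1 / 2)))"
    by (rule nn_integral_std_normal_exp_square) (use v in linarith)
  also have "\<dots> \<le> ennreal 2"
  proof (rule ennreal_leI)
    have "(1 - 2 * (c * v)) powr (- (1 / 2)) \<le> (1 / 4) powr (- (1 / 2))"
      using v by (intro powr_mono2') auto
    also have "(1 / 4 :: real) powr (- (1 / 2)) = 2"
      by (simp add: powr_minus powr_half_sqrt real_sqrt_divide)
    finally show "(1 - 2 * (c * v)) powr (- (1 / 2)) \<le> 2" .
  qed
  finally show ?thesis by simp
qed

text \<open>Jensen's inequality for the exponential makes an average of squares of Gaussian variables,
  whatever their dependence, as concentrated as a single one.\<close>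

lemma weighted_average_tail:
  fixes H :: "'b \<Rightarrow> 'a \<Rightarrow> real"
  assumes M: "prob_space M" and \<mu>: "sigma_finite_measure \<mu>"
    and m: "emeasure \<mu> (space \<mu>) \<le> ennreal m" "0 < m"
    and H[measurable]: "case_prod H \<in> borel_measurable (\<mu> \<Otimes>\<^sub>M M)" and H0: "\<And>b \<omega>. 0 \<le> H b \<omega>"
    and E: "\<And>b. (\<integral>\<^sup>+\<omega>. ennreal (exp (H b \<omega>)) \<partial>M) \<le> 2"
    and W[measurable]: "W \<in> borel_measurable M"
    and le: "\<And>\<omega>. \<omega> \<in> space M \<Longrightarrow> ennreal (W \<omega>) \<le> (\<integral>\<^sup>+b. ennreal (H b \<omega>) \<partial>\<mu>)"
    and u: "0 \<le> u"
  shows "measure M {\<omega>\<in>space M. W \<omega> \<ge> m * u} \<le> 3 * exp (- u)"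
proof -
  interpret prob_space M by fact
  interpret S: sigma_finite_measure \<mu> by fact
  interpret P: pair_sigma_finite \<mu> M ..
  have [measurable]: "(\<lambda>b. H b \<omega>) \<in> borel_measurable \<mu>" if "\<omega> \<in> space M" for \<omega>
    using measurable_compose[OF measurable_Pair2'[OF that] H] by simp
  \<comment> \<open>Jensen's inequality for a measure of mass at most \<open>m\<close>: the missing
    mass behaves as if \<open>H\<close> were 0 there, which costs at most the additive
    \<open>m\<close>.\<close>
  have key: "ennreal (m * exp (W \<omega> / m)) \<le> ennreal m + (\<integral>\<^sup>+b. ennreal (exp (H b \<omega>)) \<partial>\<mu>)"
    if \<omega>: "\<omega> \<in> space M" for \<omega>
  proof (cases "W \<omega> \<le> 0")
    case True
    then have "m * exp (W \<omega> / m) \<le> m" using m(2) by (simp add: divide_nonpos_pos)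
    then have "ennreal (m * exp (W \<omega> / m)) \<le> ennreal m" by (rule ennreal_leI)
    then show ?thesis by (simp add: add_increasing2)
  next
    case False
    define c where "c = W \<omega> / m"
    have c: "0 < c" using False m(2) by (simp add: c_def)
    \<comment> \<open>The tangent of exp at c = W / m, with the negative terms moved across so that
      it can be integrated in \<open>ennreal\<close>.\<close>
    have pt: "ennreal (exp c) * ennreal (H b \<omega>) + ennreal (exp c) \<le> ennreal (exp (H b \<omega>)) + ennreal (exp c * c)" for b
    proof -
      have "exp c * (1 + (H b \<omega> - c)) \<le> exp c * exp (H b \<omega> - c)"
        using exp_ge_add_one_self[of "H b \<omega> - c"] by (intro mult_left_mono) auto
      also have "\<dots> = exp (H b \<omega>)" by (simp flip: exp_add)
      finally have "exp c * H b \<omega> + exp c \<le> exp (H b \<omega>) + exp c * c" by (simp add: algebra_simps)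
      then have "ennreal (exp c * H b \<omega> + exp c) \<le> ennreal (exp (H b \<omega>) + exp c * c)" by (rule ennreal_leI)
      then show ?thesis using H0[of b \<omega>] c by (simp add: ennreal_plus ennreal_mult')
    qed
    obtain e where e: "emeasure \<mu> (space \<mu>) = ennreal e" "0 \<le> e" "e \<le> m"
      using m by (cases "emeasure \<mu> (space \<mu>)") (auto simp: top_unique)
    have "ennreal (exp c) * ennreal (W \<omega>) + ennreal (exp c) * ennreal e
        \<le> ennreal (exp c) * (\<integral>\<^sup>+b. ennreal (H b \<omega>) \<partial>\<mu>) + ennreal (exp c) * ennreal e"
      by (intro add_right_mono mult_left_mono le \<omega>) auto
    also have "\<dots> = (\<integral>\<^sup>+b. ennreal (exp c) * ennreal (H b \<omega>) + ennreal (exp c) \<partial>\<mu>)"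
      using \<omega> e by (simp add: nn_integral_add nn_integral_cmult)
    also have "\<dots> \<le> (\<integral>\<^sup>+b. ennreal (exp (H b \<omega>)) + ennreal (exp c * c) \<partial>\<mu>)"
      by (intro nn_integral_mono pt)
    also have "\<dots> = (\<integral>\<^sup>+b. ennreal (exp (H b \<omega>)) \<partial>\<mu>) + ennreal (exp c * c) * ennreal e"
      using \<omega> e by (simp add: nn_integral_add)
    finally have raw: "ennreal (exp c) * ennreal (W \<omega>) + ennreal (exp c) * ennreal e \<le>
        (\<integral>\<^sup>+b. ennreal (exp (H b \<omega>)) \<partial>\<mu>) + ennreal (exp c * c) * ennreal e" .
    have *: "ennreal (exp c * (c * m) + exp c * e) \<le>
        (\<integral>\<^sup>+b. ennreal (exp (H b \<omega>)) \<partial>\<mu>) + ennreal (exp c * c * e)"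
    proof -
      have "ennreal (exp c * (c * m) + exp c * e) = ennreal (exp c) * ennreal (W \<omega>) + ennreal (exp c) * ennreal e"
      proof -
        have cm: "c * m = W \<omega>" using m(2) by (simp add: c_def)
        show ?thesis unfolding cm ennreal_mult'[OF exp_ge_zero, symmetric]
          using False e by (intro ennreal_plus) auto
      qed
      moreover have "ennreal (exp c * c * e) = ennreal (exp c * c) * ennreal e"
        by (rule ennreal_mult''[OF e(2)])
      ultimately show ?thesis using raw by (simp only:)
    qed
    show ?thesis
    proof (cases "(\<integral>\<^sup>+b. ennreal (exp (H b \<omega>)) \<partial>\<mu>)")
      case (real J)
      then have "ennreal (exp c * (c * m) + exp c * e) \<le> ennreal (J + exp c * c * e)"
        using * c e by (simp add: ennreal_plus)
      then have "exp c * (c * m) + exp c * e \<le> J + exp c * c * e"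
        using real c e by (subst (asm) ennreal_le_iff) auto
      then have "exp c * (c * (m - e)) + exp c * e \<le> J" by (simp add: algebra_simps)
      \<comment> \<open>Accounts for the missing mass m - e, through exp c - 1 \<le> c exp
        c.\<close>
      moreover have "exp c * (m - e) \<le> (m - e) + exp c * (c * (m - e))"
      proof -
        have "exp c - 1 \<le> c * exp c"
        proof -
          have "1 - c \<le> exp (- c)" using exp_ge_add_one_self[of "- c"] by simp
          then have "exp c * (1 - c) \<le> exp c * exp (- c)" by (intro mult_left_mono) auto
          also have "\<dots> = 1" by (simp flip: exp_add)
          finally show ?thesis by (simp add: algebra_simps)
        qed
        then have "(exp c - 1) * (m - e) \<le> (c * exp c) * (m - e)" using e by (intro mult_right_mono) auto
        then show ?thesis by (simp add: algebra_simps)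
      qed
      ultimately have "m * exp c \<le> m + J" using e by (simp add: algebra_simps)
      then have "ennreal (m * exp c) \<le> ennreal (m + J)" by (rule ennreal_leI)
      then show ?thesis using real m(2) by (simp add: c_def ennreal_plus)
    qed simp
  qed
  have Em: "(\<integral>\<^sup>+\<omega>. (\<integral>\<^sup>+b. ennreal (exp (H b \<omega>)) \<partial>\<mu>) \<partial>M) \<le> ennreal (2 * m)"
  proof -
    have "(\<integral>\<^sup>+\<omega>. (\<integral>\<^sup>+b. ennreal (exp (H b \<omega>)) \<partial>\<mu>) \<partial>M) = (\<integral>\<^sup>+b. (\<integral>\<^sup>+\<omega>. ennreal (exp (H b \<omega>)) \<partial>M) \<partial>\<mu>)"
      by (rule P.Fubini') measurable
    also have "\<dots> \<le> (\<integral>\<^sup>+b. 2 \<partial>\<mu>)" by (intro nn_integral_mono E)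
    also have "\<dots> \<le> 2 * ennreal m" using m(1) by (simp add: mult_left_mono)
    also have "\<dots> = ennreal (2 * m)" using m(2) by (simp add: ennreal_mult)
    finally show ?thesis .
  qed
  have "(\<integral>\<^sup>+\<omega>. ennreal (m * exp (W \<omega> / m)) \<partial>M) \<le> (\<integral>\<^sup>+\<omega>. ennreal m + (\<integral>\<^sup>+b. ennreal (exp (H b \<omega>)) \<partial>\<mu>) \<partial>M)"
    by (intro nn_integral_mono key)
  also have "\<dots> = ennreal m + (\<integral>\<^sup>+\<omega>. (\<integral>\<^sup>+b. ennreal (exp (H b \<omega>)) \<partial>\<mu>) \<partial>M)"
    by (subst nn_integral_add) (auto simp: emeasure_space_1)
  also have "\<dots> \<le> ennreal m + ennreal (2 * m)" by (intro add_left_mono Em)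
  also have "\<dots> = ennreal (3 * m)" using m(2) by (simp flip: ennreal_plus)
  finally have I: "(\<integral>\<^sup>+\<omega>. ennreal (m * exp (W \<omega> / m)) \<partial>M) \<le> ennreal (3 * m)" .
  \<comment> \<open>Markov's inequality for exp (W / m), whose mean is at most 3: 1 from the
    additive term and 2 from the moment condition.\<close>
  have "ennreal (m * exp u) * emeasure M {\<omega>\<in>space M. W \<omega> \<ge> m * u} =
      (\<integral>\<^sup>+\<omega>. ennreal (m * exp u) * indicator {\<omega>\<in>space M. W \<omega> \<ge> m * u} \<omega> \<partial>M)"
    by (subst nn_integral_cmult_indicator) auto
  also have "\<dots> \<le> (\<integral>\<^sup>+\<omega>. ennreal (m * exp (W \<omega> / m)) \<partial>M)"
    using m(2) by (intro nn_integral_mono) (auto simp: indicator_def pos_le_divide_eq mult.commute intro!: ennreal_leI)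
  also have "\<dots> \<le> ennreal (3 * m)" by (rule I)
  finally have "ennreal (m * exp u * measure M {\<omega>\<in>space M. W \<omega> \<ge> m * u}) \<le> ennreal (3 * m)"
    using m(2) by (simp add: emeasure_eq_measure ennreal_mult')
  then have "m * exp u * measure M {\<omega>\<in>space M. W \<omega> \<ge> m * u} \<le> 3 * m"
    using m(2) by (subst (asm) ennreal_le_iff) auto
  then have "exp u * measure M {\<omega>\<in>space M. W \<omega> \<ge> m * u} \<le> 3"
    using m(2) by (simp add: mult.assoc mult.commute[of 3])
  then have "exp (- u) * (exp u * measure M {\<omega>\<in>space M. W \<omega> \<ge> m * u}) \<le> exp (- u) * 3"
    by (intro mult_left_mono) auto
  then show ?thesis by (simp flip: exp_add mult.assoc)
qed

lemma product_prob_space_std_normal: "product_prob_space (\<lambda>_::nat. std_normal_distribution)"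
  using prob_space_std_normal
  by (simp add: product_prob_space_def product_prob_space_axioms_def product_sigma_finite_def
      prob_space_imp_sigma_finite)

text \<open>Both exponential moments of the squared norm are computed by randomising the linear
  functional (Hubbard--Stratonovich), so that only the laws of linear combinations enter.\<close>

context
  fixes M :: "'a measure" and Z :: "nat \<Rightarrow> 'a \<Rightarrow> real" and n :: nat
  assumes M: "prob_space M" and Z[measurable]: "\<And>i. i < n \<Longrightarrow> Z i \<in> borel_measurable M"
    and lin: "\<And>a. distr M borel (\<lambda>\<omega>. \<Sum>i<n. a i * Z i \<omega>) =
      distr std_normal_distribution borel (\<lambda>x. sqrt (\<Sum>i<n. (a i)\<^sup>2) * x)"
begin

lemma std_gauss_vector_exp_moment:
  assumes t: "0 \<le> t" "t < 1 / 2"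
  shows "(\<integral>\<^sup>+\<omega>. ennreal (exp (t * (\<Sum>i<n. (Z i \<omega>)\<^sup>2))) \<partial>M) = ennreal (((1 - 2 * t) powr (- (1 / 2))) ^ n)"
proof -
  interpret prob_space M by fact
  interpret G: product_prob_space "\<lambda>_::nat. std_normal_distribution" by (rule product_prob_space_std_normal)
  define \<Gamma> where "\<Gamma> = Pi\<^sub>M {..<n} (\<lambda>_::nat. std_normal_distribution)"
  interpret \<Gamma>: prob_space \<Gamma> unfolding \<Gamma>_def by (rule prob_space_PiM) (rule prob_space_std_normal)
  interpret P: pair_sigma_finite M \<Gamma> ..
  \<comment> \<open>Since c^2 / 2 = t, exp (t |z|^2) is the moment generating function at c z of a
    standard Gaussian vector.\<close>
  define c where "c = sqrt (2 * t)"
  have c: "c\<^sup>2 = 2 * t" using t by (simp add: c_def)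
  have proj[measurable]: "(\<lambda>g. g i) \<in> borel_measurable \<Gamma>" if "i < n" for i
    using measurable_component_singleton[of i "{..<n}" "\<lambda>_::nat. std_normal_distribution"] that
    by (simp add: \<Gamma>_def cong: measurable_cong_sets)
  have lhs: "ennreal (exp (t * (\<Sum>i<n. (z i)\<^sup>2))) = (\<integral>\<^sup>+g. ennreal (exp (c * (\<Sum>i<n. g i * z i))) \<partial>\<Gamma>)" for z
  proof -
    have "(\<integral>\<^sup>+g. ennreal (exp (c * (\<Sum>i<n. g i * z i))) \<partial>\<Gamma>) =
        (\<integral>\<^sup>+g. (\<Prod>i<n. ennreal (exp ((c * z i) * g i))) \<partial>\<Gamma>)"
      by (intro nn_integral_cong) (simp add: prod_ennreal sum_distrib_left exp_sum mult_ac)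
    also have "\<dots> = (\<Prod>i<n. \<integral>\<^sup>+x. ennreal (exp ((c * z i) * x)) \<partial>std_normal_distribution)"
      unfolding \<Gamma>_def by (rule G.product_nn_integral_prod) auto
    also have "\<dots> = (\<Prod>i<n. ennreal (exp (t * (z i)\<^sup>2)))"
      unfolding nn_integral_std_normal_exp by (intro prod.cong) (auto simp: power_mult_distrib c)
    also have "\<dots> = ennreal (exp (t * (\<Sum>i<n. (z i)\<^sup>2)))"
      by (simp add: prod_ennreal sum_distrib_left exp_sum)
    finally show ?thesis ..
  qed
  have rhs: "(\<integral>\<^sup>+\<omega>. ennreal (exp (c * (\<Sum>i<n. g i * Z i \<omega>))) \<partial>M) = ennreal (exp (t * (\<Sum>i<n. (g i)\<^sup>2)))" for g
  proof -
    have "(\<integral>\<^sup>+\<omega>. ennreal (exp (c * (\<Sum>i<n. g i * Z i \<omega>))) \<partial>M) =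
        (\<integral>\<^sup>+y. ennreal (exp (c * y)) \<partial>distr M borel (\<lambda>\<omega>. \<Sum>i<n. g i * Z i \<omega>))"
      by (subst nn_integral_distr) auto
    also have "\<dots> = (\<integral>\<^sup>+x. ennreal (exp ((c * sqrt (\<Sum>i<n. (g i)\<^sup>2)) * x)) \<partial>std_normal_distribution)"
      unfolding lin by (subst nn_integral_distr) (auto simp: mult.assoc)
    also have "\<dots> = ennreal (exp (t * (\<Sum>i<n. (g i)\<^sup>2)))"
      unfolding nn_integral_std_normal_exp using c by (simp add: power_mult_distrib sum_nonneg)
    finally show ?thesis .
  qed
  have "(\<integral>\<^sup>+\<omega>. ennreal (exp (t * (\<Sum>i<n. (Z i \<omega>)\<^sup>2))) \<partial>M) =
      (\<integral>\<^sup>+\<omega>. (\<integral>\<^sup>+g. ennreal (exp (c * (\<Sum>i<n. g i * Z i \<omega>))) \<partial>\<Gamma>) \<partial>M)"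
    unfolding lhs ..
  also have "\<dots> = (\<integral>\<^sup>+g. (\<integral>\<^sup>+\<omega>. ennreal (exp (c * (\<Sum>i<n. g i * Z i \<omega>))) \<partial>M) \<partial>\<Gamma>)"
    by (rule P.Fubini'[symmetric]) measurable
  also have "\<dots> = (\<integral>\<^sup>+g. (\<Prod>i<n. ennreal (exp (t * (g i)\<^sup>2))) \<partial>\<Gamma>)"
    unfolding rhs by (intro nn_integral_cong) (simp add: prod_ennreal sum_distrib_left exp_sum)
  also have "\<dots> = (\<Prod>i<n. \<integral>\<^sup>+x. ennreal (exp (t * x\<^sup>2)) \<partial>std_normal_distribution)"
    unfolding \<Gamma>_def by (rule G.product_nn_integral_prod) auto
  also have "\<dots> = ennreal (((1 - 2 * t) powr (- (1 / 2))) ^ n)"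
    unfolding nn_integral_std_normal_exp_square[OF t(2)] by (simp add: ennreal_power)
  finally show ?thesis .
qed

text \<open>With a negative exponent the randomised functional becomes an oscillating exponential:
  characteristic functions replace moment generating functions, and Fubini is applied to a bounded
  complex integrand.\<close>

lemma std_gauss_vector_exp_moment_neg:
  assumes t: "0 \<le> t"
  shows "(\<integral>\<^sup>+\<omega>. ennreal (exp (- t * (\<Sum>i<n. (Z i \<omega>)\<^sup>2))) \<partial>M) = ennreal (((1 + 2 * t) powr (- (1 / 2))) ^ n)"
proof -
  interpret prob_space M by fact
  interpret N: prob_space std_normal_distribution by (rule prob_space_std_normal)
  interpret G: product_prob_space "\<lambda>_::nat. std_normal_distribution" by (rule product_prob_space_std_normal)
  define \<Gamma> where "\<Gamma> = Pi\<^sub>M {..<n} (\<lambda>_::nat. std_normal_distribution)"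
  interpret \<Gamma>: prob_space \<Gamma> unfolding \<Gamma>_def by (rule prob_space_PiM) (rule prob_space_std_normal)
  interpret P: pair_prob_space M \<Gamma> ..
  define c where "c = sqrt (2 * t)"
  have c: "c\<^sup>2 = 2 * t" using t by (simp add: c_def)
  have proj[measurable]: "(\<lambda>g. g i) \<in> borel_measurable \<Gamma>" if "i < n" for i
    using measurable_component_singleton[of i "{..<n}" "\<lambda>_::nat. std_normal_distribution"] that
    by (simp add: \<Gamma>_def cong: measurable_cong_sets)
  have cis_m[measurable]: "cis \<in> borel_measurable borel"
    by (intro borel_measurable_continuous_onI continuous_intros)
  have char: "(LINT x|std_normal_distribution. cis (y * x)) = complex_of_real (exp (- y\<^sup>2 / 2))" for y
    using fun_cong[OF char_std_normal_distribution, of y] by (simp add: char_def cis_conv_exp)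
  have lhs: "(LINT g|\<Gamma>. cis (c * (\<Sum>i<n. g i * z i))) = complex_of_real (exp (- t * (\<Sum>i<n. (z i)\<^sup>2)))" for z
  proof -
    have "(LINT g|\<Gamma>. cis (c * (\<Sum>i<n. g i * z i))) = (LINT g|\<Gamma>. (\<Prod>i<n. cis ((c * z i) * g i)))"
    proof (intro Bochner_Integration.integral_cong refl)
      fix g
      have "c * (\<Sum>i<n. g i * z i) = (\<Sum>i<n. (c * z i) * g i)" by (simp add: sum_distrib_left mult_ac)
      then show "cis (c * (\<Sum>i<n. g i * z i)) = (\<Prod>i<n. cis ((c * z i) * g i))"
        by (simp only: cis_sum[OF finite_lessThan])
    qed
    also have "\<dots> = (\<Prod>i<n. LINT x|std_normal_distribution. cis ((c * z i) * x))"
      unfolding \<Gamma>_def by (rule G.product_integral_prod) (auto intro!: N.integrable_const_bound[of _ 1])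
    also have "\<dots> = (\<Prod>i<n. complex_of_real (exp (- t * (z i)\<^sup>2)))"
      unfolding char by (intro prod.cong) (auto simp: power_mult_distrib c)
    also have "\<dots> = complex_of_real (\<Prod>i<n. exp (- t * (z i)\<^sup>2))" by simp
    also have "(\<Prod>i<n. exp (- t * (z i)\<^sup>2)) = exp (- t * (\<Sum>i<n. (z i)\<^sup>2))"
      by (simp only: sum_distrib_left exp_sum[OF finite_lessThan])
    finally show ?thesis .
  qed
  have rhs: "(LINT \<omega>|M. cis (c * (\<Sum>i<n. g i * Z i \<omega>))) = complex_of_real (exp (- t * (\<Sum>i<n. (g i)\<^sup>2)))" for g
  proof -
    have "(LINT \<omega>|M. cis (c * (\<Sum>i<n. g i * Z i \<omega>))) =
        (LINT y|distr M borel (\<lambda>\<omega>. \<Sum>i<n. g i * Z i \<omega>). cis (c * y))"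
      by (subst integral_distr) auto
    also have "\<dots> = (LINT x|std_normal_distribution. cis ((c * sqrt (\<Sum>i<n. (g i)\<^sup>2)) * x))"
      unfolding lin by (subst integral_distr) (auto simp: mult.assoc)
    also have "\<dots> = complex_of_real (exp (- t * (\<Sum>i<n. (g i)\<^sup>2)))"
      unfolding char using c by (simp add: power_mult_distrib sum_nonneg)
    finally show ?thesis .
  qed
  have "(LINT \<omega>|M. complex_of_real (exp (- t * (\<Sum>i<n. (Z i \<omega>)\<^sup>2)))) =
      (LINT \<omega>|M. (LINT g|\<Gamma>. cis (c * (\<Sum>i<n. g i * Z i \<omega>))))"
    unfolding lhs ..
  also have "\<dots> = (LINT g|\<Gamma>. (LINT \<omega>|M. cis (c * (\<Sum>i<n. g i * Z i \<omega>))))"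
  proof (rule P.Fubini_integral[symmetric])
    show "integrable (M \<Otimes>\<^sub>M \<Gamma>) (\<lambda>(\<omega>, g). cis (c * (\<Sum>i<n. g i * Z i \<omega>)))"
    proof (rule P.integrable_const_bound[of _ 1])
      show "(\<lambda>(\<omega>, g). cis (c * (\<Sum>i<n. g i * Z i \<omega>))) \<in> borel_measurable (M \<Otimes>\<^sub>M \<Gamma>)" by measurable
    qed (auto simp: split_beta)
  qed
  also have "\<dots> = complex_of_real (LINT g|\<Gamma>. exp (- t * (\<Sum>i<n. (g i)\<^sup>2)))"
    unfolding rhs by (rule integral_complex_of_real)
  finally have "complex_of_real (LINT \<omega>|M. exp (- t * (\<Sum>i<n. (Z i \<omega>)\<^sup>2))) =
      complex_of_real (LINT g|\<Gamma>. exp (- t * (\<Sum>i<n. (g i)\<^sup>2)))"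
    by (simp only: integral_complex_of_real)
  then have eq: "(LINT \<omega>|M. exp (- t * (\<Sum>i<n. (Z i \<omega>)\<^sup>2))) = (LINT g|\<Gamma>. exp (- t * (\<Sum>i<n. (g i)\<^sup>2)))"
    by (simp only: of_real_eq_iff)
  have "(\<integral>\<^sup>+\<omega>. ennreal (exp (- t * (\<Sum>i<n. (Z i \<omega>)\<^sup>2))) \<partial>M) = ennreal (LINT \<omega>|M. exp (- t * (\<Sum>i<n. (Z i \<omega>)\<^sup>2)))"
    using t by (intro nn_integral_eq_integral integrable_const_bound[of _ 1]) (auto simp: sum_nonneg)
  also have "\<dots> = (\<integral>\<^sup>+g. ennreal (exp (- t * (\<Sum>i<n. (g i)\<^sup>2))) \<partial>\<Gamma>)"
    unfolding eq using t
    by (intro nn_integral_eq_integral[symmetric] \<Gamma>.integrable_const_bound[of _ 1]) (auto simp: sum_nonneg)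
  also have "\<dots> = (\<integral>\<^sup>+g. (\<Prod>i<n. ennreal (exp (- t * (g i)\<^sup>2))) \<partial>\<Gamma>)"
    by (intro nn_integral_cong) (simp only: prod_ennreal exp_ge_zero sum_distrib_left exp_sum[OF finite_lessThan])
  also have "\<dots> = (\<Prod>i<n. \<integral>\<^sup>+x. ennreal (exp (- t * x\<^sup>2)) \<partial>std_normal_distribution)"
    unfolding \<Gamma>_def by (rule G.product_nn_integral_prod) auto
  also have "\<dots> = ennreal (((1 + 2 * t) powr (- (1 / 2))) ^ n)"
    using t by (subst nn_integral_std_normal_exp_square) (auto simp: ennreal_power)
  finally show ?thesis .
qed

text \<open>Chernoff bounds on both sides with t = u / 8. This t minimises - t u + 4 t^2, the upper
  tail exponent after a second order bound for the logarithm, with value - u^2 / 16; the lower tail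
  does better at the same t.\<close>

lemma std_gauss_vector_norm_concentration:
  fixes u :: real
  assumes u: "0 < u" "u \<le> 1"
  shows "measure M {\<omega>\<in>space M. \<bar>(\<Sum>i<n. (Z i \<omega>)\<^sup>2) - n\<bar> \<ge> n * u} \<le> 2 * exp (- (n * u\<^sup>2 / 16))"
proof -
  interpret prob_space M by fact
  let ?S = "\<lambda>\<omega>. \<Sum>i<n. (Z i \<omega>)\<^sup>2"
  have [measurable]: "?S \<in> borel_measurable M" by measurable
  define t where "t = u / 8"
  have t: "0 < t" "t \<le> 1 / 8" using u by (auto simp: t_def)
  have pw: "(x powr (- (1 / 2))) ^ n = exp (n * (- (1 / 2) * ln x))" if "0 < x" for x :: real
    using that by (simp add: powr_def exp_of_nat_mult[symmetric])
  have "emeasure M {\<omega>\<in>space M. ?S \<omega> \<ge> n * (1 + u)} \<le>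
      ennreal (exp (- t * (n * (1 + u)))) * (\<integral>\<^sup>+\<omega>. ennreal (exp (t * ?S \<omega>)) * indicator (space M) \<omega> \<partial>M)"
    by (rule Chernoff_ineq_nn_integral_ge) (use t in auto)
  also have "(\<integral>\<^sup>+\<omega>. ennreal (exp (t * ?S \<omega>)) * indicator (space M) \<omega> \<partial>M) =
      (\<integral>\<^sup>+\<omega>. ennreal (exp (t * ?S \<omega>)) \<partial>M)" by (intro nn_integral_cong) simp
  also have "\<dots> = ennreal (exp (n * (- (1 / 2) * ln (1 - 2 * t))))"
    using std_gauss_vector_exp_moment[of t] t pw[of "1 - 2 * t"] by simp
  also have "ennreal (exp (- t * (n * (1 + u)))) * \<dots> = ennreal (exp (n * (- t * (1 + u) - 1 / 2 * ln (1 - 2 * t))))"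
    by (simp add: algebra_simps flip: ennreal_mult' exp_add)
  also have "\<dots> \<le> ennreal (exp (n * (- (u\<^sup>2 / 16))))"
  proof -
    have "- (2 * t) - 2 * (2 * t)\<^sup>2 \<le> ln (1 - 2 * t)"
      by (rule ln_one_minus_pos_lower_bound) (use t in auto)
    then have "- t * (1 + u) - 1 / 2 * ln (1 - 2 * t) \<le> - t * u + 4 * t\<^sup>2"
      by (simp add: power_mult_distrib algebra_simps)
    also have "\<dots> = - (u\<^sup>2 / 16)" by (simp add: t_def power2_eq_square)
    finally show ?thesis by (intro ennreal_leI) (simp only: exp_le_cancel_iff, intro mult_left_mono, simp_all)
  qed
  finally have 1: "measure M {\<omega>\<in>space M. ?S \<omega> \<ge> n * (1 + u)} \<le> exp (- (n * u\<^sup>2 / 16))"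
    by (simp add: emeasure_eq_measure)
  have "emeasure M {\<omega>\<in>space M. ?S \<omega> \<le> n * (1 - u)} \<le>
      ennreal (exp (t * (n * (1 - u)))) * (\<integral>\<^sup>+\<omega>. ennreal (exp (- t * ?S \<omega>)) * indicator (space M) \<omega> \<partial>M)"
    by (rule Chernoff_ineq_nn_integral_le) (use t in auto)
  also have "(\<integral>\<^sup>+\<omega>. ennreal (exp (- t * ?S \<omega>)) * indicator (space M) \<omega> \<partial>M) =
      (\<integral>\<^sup>+\<omega>. ennreal (exp (- t * ?S \<omega>)) \<partial>M)" by (intro nn_integral_cong) simp
  also have "\<dots> = ennreal (exp (n * (- (1 / 2) * ln (1 + 2 * t))))"
    using std_gauss_vector_exp_moment_neg[of t] t pw[of "1 + 2 * t"] by simp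
  also have "ennreal (exp (t * (n * (1 - u)))) * \<dots> = ennreal (exp (n * (t * (1 - u) - 1 / 2 * ln (1 + 2 * t))))"
    by (simp add: algebra_simps flip: ennreal_mult' exp_add)
  also have "\<dots> \<le> ennreal (exp (n * (- (u\<^sup>2 / 16))))"
  proof -
    have "2 * t - (2 * t)\<^sup>2 \<le> ln (1 + 2 * t)"
      by (rule ln_one_plus_pos_lower_bound) (use t in auto)
    then have "t * (1 - u) - 1 / 2 * ln (1 + 2 * t) \<le> - t * u + 2 * t\<^sup>2"
      by (simp add: power_mult_distrib algebra_simps)
    also have "\<dots> \<le> - (u\<^sup>2 / 16)" by (simp add: t_def power2_eq_square)
    finally show ?thesis by (intro ennreal_leI) (simp only: exp_le_cancel_iff, intro mult_left_mono, simp_all)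
  qed
  finally have 2: "measure M {\<omega>\<in>space M. ?S \<omega> \<le> n * (1 - u)} \<le> exp (- (n * u\<^sup>2 / 16))"
    by (simp add: emeasure_eq_measure)
  have "measure M {\<omega>\<in>space M. \<bar>?S \<omega> - n\<bar> \<ge> n * u} \<le>
      measure M ({\<omega>\<in>space M. ?S \<omega> \<ge> n * (1 + u)} \<union> {\<omega>\<in>space M. ?S \<omega> \<le> n * (1 - u)})"
    by (intro finite_measure_mono) (auto simp: algebra_simps abs_if split: if_splits)
  also have "\<dots> \<le> measure M {\<omega>\<in>space M. ?S \<omega> \<ge> n * (1 + u)} + measure M {\<omega>\<in>space M. ?S \<omega> \<le> n * (1 - u)}"
    by (intro measure_Un_le) auto
  finally show ?thesis using 1 2 by simp
qed

end

section \<open>Residual sums of squares\<close>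

lemma gls_scale:
  assumes R: "spd n R" and D: "D \<in> carrier_mat n p" and \<Omega>: "sym_psd p \<Omega>" and c: "0 < c"
  shows "gls ((1 / c) \<cdot>\<^sub>m R) D (c \<cdot>\<^sub>m \<Omega>) = c \<cdot>\<^sub>m gls R D \<Omega>"
proof -
  note i = spd_minv[OF R]
  have DR: "transpose_mat D * minv R \<in> carrier_mat p n" using D i by simp
  have O: "\<Omega> \<in> carrier_mat p p" using \<Omega> by (simp add: sym_psd_def)
  have m: "minv ((1 / c) \<cdot>\<^sub>m R) = c \<cdot>\<^sub>m minv R" using minv_smult[OF R, of "1 / c"] c by simp
  have "transpose_mat D * (c \<cdot>\<^sub>m minv R) * D = c \<cdot>\<^sub>m (transpose_mat D * minv R * D)"
    using D i DR by (simp add: mult_smult_distrib[of _ p n _ n] mult_smult_assoc_mat[of _ p n _ p] del: assoc_mult_mat)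
  then show ?thesis unfolding gls_def m using O mult_carrier_mat[OF DR D]
    by (simp add: add_smult_distrib_left_mat[of _ p p] del: assoc_mult_mat)
qed

lemma sym_psd_smult:
  assumes "sym_psd p \<Omega>" "0 \<le> c"
  shows "sym_psd p (c \<cdot>\<^sub>m \<Omega>)"
proof -
  have "transpose_mat (c \<cdot>\<^sub>m \<Omega>) = c \<cdot>\<^sub>m transpose_mat \<Omega>" by (intro eq_matI) auto
  with assms show ?thesis by (auto simp: sym_psd_def quad_form_smult_mat)
qed

text \<open>Dividing the covariance by c and multiplying the prior precision by c is a change of the
  unit of variance. It carries results from the rescaled matrices back to correlation
  matrices.\<close>

lemma gls_residual_mat_scale:
  assumes R: "spd n R" and D: "D \<in> carrier_mat n p" and \<Omega>: "sym_psd p \<Omega>" and c: "0 < c"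
    and inj: "\<And>v. v \<in> carrier_vec p \<Longrightarrow> D *\<^sub>v v = 0\<^sub>v n \<Longrightarrow> v = 0\<^sub>v p"
    and y: "y \<in> carrier_vec n"
  shows "quad_form (gls_residual_mat ((1 / c) \<cdot>\<^sub>m R) D (c \<cdot>\<^sub>m \<Omega>)) y = c * quad_form (gls_residual_mat R D \<Omega>) y"
proof -
  note i = spd_minv[OF R]
  have R': "spd n ((1 / c) \<cdot>\<^sub>m R)" using R c by (intro spd_smult) auto
  have \<Omega>': "sym_psd p (c \<cdot>\<^sub>m \<Omega>)" using \<Omega> c by (intro sym_psd_smult) auto
  have G: "spd p (gls R D \<Omega>)" by (rule spd_gls[OF R D \<Omega> inj])
  have m: "minv ((1 / c) \<cdot>\<^sub>m R) = c \<cdot>\<^sub>m minv R" using minv_smult[OF R, of "1 / c"] c by simp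
  have z: "transpose_mat D *\<^sub>v (minv R *\<^sub>v y) \<in> carrier_vec p" using D i y by simp
  have sv: "(c \<cdot>\<^sub>m minv R) *\<^sub>v y = c \<cdot>\<^sub>v (minv R *\<^sub>v y)"
    using i y by (intro eq_vecI) (auto simp: smult_scalar_prod_distrib[of _ n])
  have "quad_form (minv (c \<cdot>\<^sub>m gls R D \<Omega>)) (c \<cdot>\<^sub>v (transpose_mat D *\<^sub>v (minv R *\<^sub>v y)))
      = c * quad_form (minv (gls R D \<Omega>)) (transpose_mat D *\<^sub>v (minv R *\<^sub>v y))"
    using c z spd_minv(1)[OF G] minv_smult[OF G, of c]
    by (simp add: quad_form_smult_mat[of _ p] quad_form_smult_vec[of _ p] power2_eq_square)
  moreover have "transpose_mat D *\<^sub>v (c \<cdot>\<^sub>v (minv R *\<^sub>v y)) = c \<cdot>\<^sub>v (transpose_mat D *\<^sub>v (minv R *\<^sub>v y))"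
    by (rule mult_mat_vec[of _ p n]) (use D i y in auto)
  moreover have "quad_form (c \<cdot>\<^sub>m minv R) y = c * quad_form (minv R) y"
    by (rule quad_form_smult_mat[OF i(1) y])
  ultimately show ?thesis
    by (simp only: quad_form_gls_residual_mat[OF R' D \<Omega>' inj y] quad_form_gls_residual_mat[OF R D \<Omega> inj y]
      gls_scale[OF R D \<Omega> c] m sv right_diff_distrib)
qed

lemma det_smult_mat:
  assumes "A \<in> carrier_mat n n"
  shows "mdet (c \<cdot>\<^sub>m A) = c ^ n * mdet (A :: real Matrix.mat)"
  using assms by (simp add: Determinant.det_smult)

text \<open>The fixed-design quantities, expressed in the microergodic scale.  Here \<open>rss \<alpha>\<close> is
  \<open>\<alpha> powr (2 * \<nu>)\<close> times the residual sum of squares of the paper, so that the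
  restricted likelihood depends on \<open>\<theta>\<close> through \<open>\<theta> powr (- (n - p) / 2) * exp (- rss \<alpha> / (2 * \<theta>))\<close>.\<close>

locale design =
  fixes n p :: nat and m :: "nat \<Rightarrow> real ^ 'd \<Rightarrow> real" and \<Omega> :: "real Matrix.mat"
    and \<nu> :: real and s :: "nat \<Rightarrow> real ^ 'd"
  assumes \<nu>: "0 < \<nu>" and inj_s: "inj_on s {..<n}" and \<Omega>: "sym_psd p \<Omega>"
    and full_rank: "vec_space.rank n (design_mat p m s n) = p"
begin

abbreviation "K \<equiv> scaled_corr_mat \<nu> s n"
abbreviation "D \<equiv> design_mat p m s n"

text \<open>The prior precision takes the factor \<alpha>^(2 \<nu>), so that \<open>info\<close> and
  \<open>rss\<close> belong to the same rescaled regression problem.\<close>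

definition info :: "real \<Rightarrow> real Matrix.mat" where
  "info \<alpha> = gls (K \<alpha>) D (\<alpha> powr (2 * \<nu>) \<cdot>\<^sub>m \<Omega>)"

definition rss :: "real Matrix.vec \<Rightarrow> real \<Rightarrow> real" where
  "rss y \<alpha> = quad_form (gls_residual_mat (K \<alpha>) D (\<alpha> powr (2 * \<nu>) \<cdot>\<^sub>m \<Omega>)) y"

definition lik_const :: "real \<Rightarrow> real" where
  "lik_const \<alpha> = mdet (K \<alpha>) powr (- (1 / 2)) * mdet (info \<alpha>) powr (- (1 / 2))"

lemma D_carrier: "D \<in> carrier_mat n p" by (simp add: design_mat_def)

lemma D_inj: "v \<in> carrier_vec p \<Longrightarrow> D *\<^sub>v v = 0\<^sub>v n \<Longrightarrow> v = 0\<^sub>v p"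
  by (rule full_column_rank_inj[OF D_carrier full_rank])

lemma spd_K: "0 < \<alpha> \<Longrightarrow> spd n (K \<alpha>)" by (rule spd_scaled_corr_mat[OF \<nu> _ inj_s])

lemma psd: "sym_psd p (\<alpha> powr (2 * \<nu>) \<cdot>\<^sub>m \<Omega>)" by (intro sym_psd_smult \<Omega>) simp

lemma spd_info: "0 < \<alpha> \<Longrightarrow> spd p (info \<alpha>)"
  unfolding info_def by (rule spd_gls[OF spd_K D_carrier psd D_inj])

lemma quad_Omega_nonneg: "b \<in> carrier_vec p \<Longrightarrow> 0 \<le> quad_form \<Omega> b"
  using \<Omega> by (auto simp: sym_psd_def)

lemma quad_scaled_Omega: "b \<in> carrier_vec p \<Longrightarrow>
    quad_form (\<alpha> powr (2 * \<nu>) \<cdot>\<^sub>m \<Omega>) b = \<alpha> powr (2 * \<nu>) * quad_form \<Omega> b"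
  using \<Omega> by (simp add: quad_form_smult_mat[of _ p] sym_psd_def)

lemma corr_mat_conv: "0 < \<alpha> \<Longrightarrow> corr_mat \<nu> s n \<alpha> = \<alpha> powr (2 * \<nu>) \<cdot>\<^sub>m K \<alpha>"
  unfolding scaled_corr_mat_def by (intro eq_matI) (auto simp: powr_minus field_simps)

lemma spd_corr_mat: "0 < \<alpha> \<Longrightarrow> spd n (corr_mat \<nu> s n \<alpha>)"
  unfolding corr_mat_conv by (intro spd_smult spd_K) auto

lemma K_conv: "K \<alpha> = (1 / \<alpha> powr (2 * \<nu>)) \<cdot>\<^sub>m corr_mat \<nu> s n \<alpha>"
  by (simp add: scaled_corr_mat_def powr_minus_divide)

lemma info_conv: "0 < \<alpha> \<Longrightarrow> info \<alpha> = \<alpha> powr (2 * \<nu>) \<cdot>\<^sub>m gls_mat p m \<Omega> \<nu> s n \<alpha>"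
  unfolding info_def K_conv gls_scale[OF spd_corr_mat D_carrier \<Omega>, of \<alpha> "\<alpha> powr (2 * \<nu>)", simplified]
  by (simp add: gls_def gls_mat_def)

lemma rss_conv:
  assumes "0 < \<alpha>" "y \<in> carrier_vec n"
  shows "rss y \<alpha> = \<alpha> powr (2 * \<nu>) * quad_form (Q_mat p m \<Omega> \<nu> s n \<alpha>) y"
proof -
  have "Q_mat p m \<Omega> \<nu> s n \<alpha> = gls_residual_mat (corr_mat \<nu> s n \<alpha>) D \<Omega>"
    by (simp add: Q_mat_def gls_residual_mat_def Let_def gls_def gls_mat_def)
  then show ?thesis
    unfolding rss_def K_conv using assms
    by (subst gls_residual_mat_scale[OF spd_corr_mat D_carrier \<Omega> _ D_inj]) auto
qed

lemma lik_const_pos: "0 < \<alpha> \<Longrightarrow> 0 < lik_const \<alpha>"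
  using spd_det_pos[OF spd_K, of \<alpha>] spd_det_pos[OF spd_info, of \<alpha>] unfolding lik_const_def
  by (intro mult_pos_pos) auto

text \<open>The powers of A = \<alpha>^(2 \<nu>) cancel: n from the correlation determinant, p from
  the precision determinant and n - p from the variance. What remains depends on \<theta> as an
  inverse gamma kernel.\<close>

lemma exp_restricted_loglik:
  assumes \<alpha>: "0 < \<alpha>" and \<theta>: "0 < \<theta>" and y: "y \<in> carrier_vec n"
  shows "exp (restricted_loglik p m \<Omega> \<nu> s n y (\<theta> / \<alpha> powr (2 * \<nu>)) \<alpha>) =
    lik_const \<alpha> * \<theta> powr (- ((real n - real p) / 2)) * exp (- rss y \<alpha> / (2 * \<theta>))"
proof -
  define A where "A = \<alpha> powr (2 * \<nu>)"
  have A: "0 < A" using \<alpha> by (simp add: A_def)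
  have G: "gls_mat p m \<Omega> \<nu> s n \<alpha> = (1 / A) \<cdot>\<^sub>m info \<alpha>"
    using A by (simp add: info_conv[OF \<alpha>] A_def[symmetric]) (intro eq_matI; simp)
  have R: "corr_mat \<nu> s n \<alpha> = A \<cdot>\<^sub>m K \<alpha>" using corr_mat_conv[OF \<alpha>] by (simp add: A_def)
  have dK: "0 < mdet (K \<alpha>)" and dI: "0 < mdet (info \<alpha>)"
    using spd_det_pos spd_K[OF \<alpha>] spd_info[OF \<alpha>] by auto
  have 1: "ln (mdet (corr_mat \<nu> s n \<alpha>)) = n * ln A + ln (mdet (K \<alpha>))"
    unfolding R det_smult_mat[OF scaled_corr_mat_carrier] using A dK by (simp add: ln_mult ln_realpow)
  have 2: "ln (mdet (gls_mat p m \<Omega> \<nu> s n \<alpha>)) = - (p * ln A) + ln (mdet (info \<alpha>))"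
    unfolding G det_smult_mat[OF spdD(1)[OF spd_info[OF \<alpha>]]] using A dI
    by (simp add: ln_mult ln_realpow ln_div power_one_over)
  have 3: "rss y \<alpha> = A * quad_form (Q_mat p m \<Omega> \<nu> s n \<alpha>) y" using rss_conv[OF \<alpha> y] by (simp add: A_def)
  have "restricted_loglik p m \<Omega> \<nu> s n y (\<theta> / A) \<alpha> =
      - (1 / 2) * ln (mdet (K \<alpha>)) - (1 / 2) * ln (mdet (info \<alpha>))
      - (real n - real p) / 2 * ln \<theta> - rss y \<alpha> / (2 * \<theta>)"
    unfolding restricted_loglik_def 1 2 3 using A \<theta> by (simp add: ln_div algebra_simps diff_divide_distrib)
  also have "exp \<dots> = exp (- (1 / 2) * ln (mdet (K \<alpha>))) * exp (- (1 / 2) * ln (mdet (info \<alpha>)))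
      * exp (- ((real n - real p) / 2) * ln \<theta>) * exp (- rss y \<alpha> / (2 * \<theta>))"
    by (simp only: exp_add[symmetric]) simp
  also have "\<dots> = lik_const \<alpha> * \<theta> powr (- ((real n - real p) / 2)) * exp (- rss y \<alpha> / (2 * \<theta>))"
    using dK dI \<theta> by (simp add: lik_const_def powr_def)
  finally show ?thesis by (simp add: A_def)
qed

text \<open>At fixed coefficients both terms of the penalised objective increase with \<alpha>, so
  evaluating one objective at the minimiser of the other orders the minima. The penalty weight grows
  only by (\<beta> / \<alpha>)^(2 \<nu>), less than the factor of the covariance part.\<close>

lemma rss_mono:
  assumes \<alpha>: "0 < \<alpha>" and \<beta>: "\<alpha> \<le> \<beta>" and y: "y \<in> carrier_vec n"
  shows "rss y \<alpha> \<le> rss y \<beta>" "rss y \<beta> \<le> (\<beta> / \<alpha>) powr (2 * \<nu> + real CARD('d)) * rss y \<alpha>"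
proof -
  have \<beta>': "0 < \<beta>" using assms by simp
  note att = gls_residual_attained[OF spd_K D_carrier psd D_inj y]
  have c: "y + (-1) \<cdot>\<^sub>v (D *\<^sub>v b) \<in> carrier_vec n" if "b \<in> carrier_vec p" for b
    using y D_carrier that by simp
  obtain b where b: "b \<in> carrier_vec p" "rss y \<beta> = quad_form (minv (K \<beta>)) (y + (-1) \<cdot>\<^sub>v (D *\<^sub>v b)) + quad_form (\<beta> powr (2 * \<nu>) \<cdot>\<^sub>m \<Omega>) b"
    using att[OF \<beta>', of \<beta>] unfolding rss_def by blast
  have "rss y \<alpha> \<le> quad_form (minv (K \<alpha>)) (y + (-1) \<cdot>\<^sub>v (D *\<^sub>v b)) + quad_form (\<alpha> powr (2 * \<nu>) \<cdot>\<^sub>m \<Omega>) b"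
    unfolding rss_def by (rule gls_residual_le[OF spd_K[OF \<alpha>] D_carrier psd _ y b(1)]) (rule D_inj)
  also have "quad_form (minv (K \<alpha>)) (y + (-1) \<cdot>\<^sub>v (D *\<^sub>v b)) \<le> 1 * quad_form (minv (K \<beta>)) (y + (-1) \<cdot>\<^sub>v (D *\<^sub>v b))"
    by (rule quad_form_minv_antimono[OF spd_K[OF \<beta>'] spd_K[OF \<alpha>]])
       (use scaled_corr_mat_loewner(1)[OF \<nu> \<alpha> \<beta>] c[OF b(1)] in auto)
  also have "quad_form (\<alpha> powr (2 * \<nu>) \<cdot>\<^sub>m \<Omega>) b \<le> quad_form (\<beta> powr (2 * \<nu>) \<cdot>\<^sub>m \<Omega>) b"
    unfolding quad_scaled_Omega[OF b(1)] using \<alpha> \<beta> \<nu> quad_Omega_nonneg[OF b(1)]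
    by (intro mult_right_mono powr_mono2) auto
  finally show "rss y \<alpha> \<le> rss y \<beta>" by (simp add: b(2))
  define L where "L = (\<beta> / \<alpha>) powr (2 * \<nu> + real CARD('d))"
  have L: "0 < L" using \<alpha> \<beta>' by (simp add: L_def)
  obtain a where a: "a \<in> carrier_vec p" "rss y \<alpha> = quad_form (minv (K \<alpha>)) (y + (-1) \<cdot>\<^sub>v (D *\<^sub>v a)) + quad_form (\<alpha> powr (2 * \<nu>) \<cdot>\<^sub>m \<Omega>) a"
    using att[OF \<alpha>, of \<alpha>] unfolding rss_def by blast
  have "rss y \<beta> \<le> quad_form (minv (K \<beta>)) (y + (-1) \<cdot>\<^sub>v (D *\<^sub>v a)) + quad_form (\<beta> powr (2 * \<nu>) \<cdot>\<^sub>m \<Omega>) a"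
    unfolding rss_def by (rule gls_residual_le[OF spd_K[OF \<beta>'] D_carrier psd _ y a(1)]) (rule D_inj)
  also have "quad_form (minv (K \<beta>)) (y + (-1) \<cdot>\<^sub>v (D *\<^sub>v a)) \<le> L * quad_form (minv (K \<alpha>)) (y + (-1) \<cdot>\<^sub>v (D *\<^sub>v a))"
    by (rule quad_form_minv_antimono[OF spd_K[OF \<alpha>] spd_K[OF \<beta>'] L])
       (use scaled_corr_mat_loewner(2)[OF \<nu> \<alpha> \<beta>] c[OF a(1)] in \<open>auto simp: L_def\<close>)
  also have "quad_form (\<beta> powr (2 * \<nu>) \<cdot>\<^sub>m \<Omega>) a \<le> L * quad_form (\<alpha> powr (2 * \<nu>) \<cdot>\<^sub>m \<Omega>) a"
  proof -
    have "\<beta> powr (2 * \<nu>) = (\<beta> / \<alpha>) powr (2 * \<nu>) * \<alpha> powr (2 * \<nu>)"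
      using \<alpha> \<beta>' by (simp add: powr_divide)
    also have "\<dots> \<le> L * \<alpha> powr (2 * \<nu>)"
      unfolding L_def using \<alpha> \<beta> by (intro mult_right_mono powr_mono) auto
    finally show ?thesis unfolding quad_scaled_Omega[OF a(1)]
      using quad_Omega_nonneg[OF a(1)] by (simp add: mult_right_mono flip: mult.assoc)
  qed
  finally show "rss y \<beta> \<le> (\<beta> / \<alpha>) powr (2 * \<nu> + real CARD('d)) * rss y \<alpha>"
    by (simp add: a(2) L_def[symmetric] distrib_left)
qed

lemma det_K_mono:
  assumes \<alpha>: "0 < \<alpha>" and \<beta>: "\<alpha> \<le> \<beta>"
  shows "mdet (K \<beta>) \<le> mdet (K \<alpha>)"
    "mdet (K \<alpha>) \<le> (\<beta> / \<alpha>) powr ((2 * \<nu> + real CARD('d)) * n) * mdet (K \<beta>)"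
proof -
  have \<beta>': "0 < \<beta>" using assms by simp
  show "mdet (K \<beta>) \<le> mdet (K \<alpha>)"
    by (rule spd_det_mono[OF spd_K[OF \<beta>'] spd_K[OF \<alpha>] scaled_corr_mat_loewner(1)[OF \<nu> \<alpha> \<beta>]])
  define L where "L = (\<beta> / \<alpha>) powr (2 * \<nu> + real CARD('d))"
  have L: "0 < L" using \<alpha> \<beta>' by (simp add: L_def)
  have "mdet (K \<alpha>) \<le> mdet (L \<cdot>\<^sub>m K \<beta>)"
    by (rule spd_det_mono[OF spd_K[OF \<alpha>] spd_smult[OF spd_K[OF \<beta>'] L]])
       (use scaled_corr_mat_loewner(2)[OF \<nu> \<alpha> \<beta>] in \<open>simp add: quad_form_smult_mat[of _ n] L_def\<close>)
  also have "\<dots> = L ^ n * mdet (K \<beta>)" by (rule det_smult_mat) simp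
  also have "L ^ n = (\<beta> / \<alpha>) powr ((2 * \<nu> + real CARD('d)) * n)"
    using L by (simp add: powr_realpow[symmetric]) (simp add: L_def powr_powr)
  finally show "mdet (K \<alpha>) \<le> (\<beta> / \<alpha>) powr ((2 * \<nu> + real CARD('d)) * n) * mdet (K \<beta>)" .
qed

text \<open>Inversion reverses the order of the covariances, so the precision increases with
  \<alpha>; having dimension p, it changes by a power with exponent proportional to p rather than
  n.\<close>

lemma det_info_mono:
  assumes \<alpha>: "0 < \<alpha>" and \<beta>: "\<alpha> \<le> \<beta>"
  shows "mdet (info \<alpha>) \<le> mdet (info \<beta>)"
    "mdet (info \<beta>) \<le> (\<beta> / \<alpha>) powr ((2 * \<nu> + real CARD('d)) * p) * mdet (info \<alpha>)"
proof -
  have \<beta>': "0 < \<beta>" using assms by simp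
  have q': "quad_form (info \<gamma>) b = quad_form (minv (K \<gamma>)) (D *\<^sub>v b) + \<gamma> powr (2 * \<nu>) * quad_form \<Omega> b"
    if "0 < \<gamma>" "b \<in> carrier_vec p" for \<gamma> b
    unfolding info_def using quad_form_gls[OF spd_K[OF that(1)] D_carrier psd D_inj that(2)] that(2)
    by (simp add: quad_scaled_Omega)
  have Db: "D *\<^sub>v b \<in> carrier_vec n" if "b \<in> carrier_vec p" for b using D_carrier that by simp
  define L where "L = (\<beta> / \<alpha>) powr (2 * \<nu> + real CARD('d))"
  have L: "0 < L" using \<alpha> \<beta>' by (simp add: L_def)
  have m1: "quad_form (info \<alpha>) b \<le> quad_form (info \<beta>) b" if b: "b \<in> carrier_vec p" for b
  proof -
    have "quad_form (minv (K \<alpha>)) (D *\<^sub>v b) \<le> 1 * quad_form (minv (K \<beta>)) (D *\<^sub>v b)"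
      by (rule quad_form_minv_antimono[OF spd_K[OF \<beta>'] spd_K[OF \<alpha>]])
         (use scaled_corr_mat_loewner(1)[OF \<nu> \<alpha> \<beta>] Db[OF b] in auto)
    moreover have "\<alpha> powr (2 * \<nu>) * quad_form \<Omega> b \<le> \<beta> powr (2 * \<nu>) * quad_form \<Omega> b"
      using \<alpha> \<beta> \<nu> quad_Omega_nonneg[OF b] by (intro mult_right_mono powr_mono2) auto
    ultimately show ?thesis unfolding q'[OF \<alpha> b] q'[OF \<beta>' b] by simp
  qed
  have m2: "quad_form (info \<beta>) b \<le> L * quad_form (info \<alpha>) b" if b: "b \<in> carrier_vec p" for b
  proof -
    have 1: "quad_form (minv (K \<beta>)) (D *\<^sub>v b) \<le> L * quad_form (minv (K \<alpha>)) (D *\<^sub>v b)"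
      by (rule quad_form_minv_antimono[OF spd_K[OF \<alpha>] spd_K[OF \<beta>'] L])
         (use scaled_corr_mat_loewner(2)[OF \<nu> \<alpha> \<beta>] Db[OF b] in \<open>auto simp: L_def\<close>)
    have "\<beta> powr (2 * \<nu>) = (\<beta> / \<alpha>) powr (2 * \<nu>) * \<alpha> powr (2 * \<nu>)"
      using \<alpha> \<beta>' by (simp add: powr_divide)
    also have "\<dots> \<le> L * \<alpha> powr (2 * \<nu>)"
      unfolding L_def using \<alpha> \<beta> by (intro mult_right_mono powr_mono) auto
    finally have "\<beta> powr (2 * \<nu>) * quad_form \<Omega> b \<le> (L * \<alpha> powr (2 * \<nu>)) * quad_form \<Omega> b"
      using quad_Omega_nonneg[OF b] by (rule mult_right_mono)
    with 1 show ?thesis unfolding q'[OF \<alpha> b] q'[OF \<beta>' b] by (simp add: distrib_left mult.assoc)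
  qed
  show "mdet (info \<alpha>) \<le> mdet (info \<beta>)"
    by (rule spd_det_mono[OF spd_info[OF \<alpha>] spd_info[OF \<beta>'] m1])
  have "mdet (info \<beta>) \<le> mdet (L \<cdot>\<^sub>m info \<alpha>)"
    by (rule spd_det_mono[OF spd_info[OF \<beta>'] spd_smult[OF spd_info[OF \<alpha>] L]])
       (use m2 spdD(1)[OF spd_info[OF \<alpha>]] in \<open>simp add: quad_form_smult_mat[of _ p]\<close>)
  also have "\<dots> = L ^ p * mdet (info \<alpha>)"
    by (rule det_smult_mat) (rule spdD(1)[OF spd_info[OF \<alpha>]])
  also have "L ^ p = (\<beta> / \<alpha>) powr ((2 * \<nu> + real CARD('d)) * p)"
    using L by (simp add: powr_realpow[symmetric]) (simp add: L_def powr_powr)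
  finally show "mdet (info \<beta>) \<le> (\<beta> / \<alpha>) powr ((2 * \<nu> + real CARD('d)) * p) * mdet (info \<alpha>)" .
qed

end

section \<open>Low and high frequencies\<close>

definition freq_box :: "real \<Rightarrow> 'b::euclidean_space set" where
  "freq_box W = {\<omega>. \<forall>b\<in>Basis. \<bar>\<omega> \<bullet> b\<bar> \<le> W}"

lemma freq_box_measurable [measurable]: "freq_box W \<in> sets borel"
proof -
  have "freq_box W = (\<Inter>b\<in>Basis. {\<omega>::'a. \<bar>\<omega> \<bullet> b\<bar> \<le> W})" by (auto simp: freq_box_def)
  moreover have "closed {\<omega>::'a. \<bar>\<omega> \<bullet> b\<bar> \<le> W}" for b
    by (intro closed_Collect_le continuous_intros)
  ultimately show ?thesis by (auto intro!: borel_closed)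
qed

lemma not_in_freq_box:
  assumes "\<omega> \<notin> freq_box W" "0 < W"
  shows "1 / (1 + (norm \<omega>)\<^sup>2) \<le> 1 / W\<^sup>2"
proof -
  obtain b where "b \<in> Basis" "W < \<bar>\<omega> \<bullet> b\<bar>" using assms by (auto simp: freq_box_def not_le)
  then have "W \<le> norm \<omega>" using Basis_le_norm[of b \<omega>] by linarith
  then have "W\<^sup>2 \<le> (norm \<omega>)\<^sup>2" using assms by (intro power_mono) auto
  then have "W\<^sup>2 \<le> 1 + (norm \<omega>)\<^sup>2" by simp
  then show ?thesis using assms by (intro divide_left_mono) (auto simp: add_pos_nonneg)
qed

context design
begin

text \<open>The true coefficients, used as a test point in the minimum, leave exactly the
  noise.\<close>

lemma rss_upper:
  assumes \<alpha>: "0 < \<alpha>" and x: "x \<in> carrier_vec n" and b: "b \<in> carrier_vec p"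
  shows "rss (D *\<^sub>v b + x) \<alpha> \<le> quad_form (minv (K \<alpha>)) x + \<alpha> powr (2 * \<nu>) * quad_form \<Omega> b"
proof -
  have y: "D *\<^sub>v b + x \<in> carrier_vec n" using D_carrier x b by simp
  have e: "D *\<^sub>v b + x + (-1) \<cdot>\<^sub>v (D *\<^sub>v b) = x" using D_carrier x b by (intro eq_vecI) auto
  have "rss (D *\<^sub>v b + x) \<alpha> \<le> quad_form (minv (K \<alpha>)) (D *\<^sub>v b + x + (-1) \<cdot>\<^sub>v (D *\<^sub>v b)) +
      quad_form (\<alpha> powr (2 * \<nu>) \<cdot>\<^sub>m \<Omega>) b"
    unfolding rss_def by (rule gls_residual_le[OF spd_K[OF \<alpha>] D_carrier psd _ y b]) (rule D_inj)
  then show ?thesis by (simp only: e quad_scaled_Omega[OF b])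
qed

definition gram :: "real \<Rightarrow> real Matrix.mat" where
  "gram \<alpha> = transpose_mat D * minv (K \<alpha>) * D"

text \<open>Squared length, in the inverse covariance, of the generalised least squares projection
  of the noise onto the regressors.\<close>

definition fitted :: "real \<Rightarrow> real Matrix.vec \<Rightarrow> real" where
  "fitted \<alpha> x = quad_form (minv (gram \<alpha>)) (transpose_mat D *\<^sub>v (minv (K \<alpha>) *\<^sub>v x))"

lemma spd_gram: "0 < \<alpha> \<Longrightarrow> spd p (gram \<alpha>)"
  unfolding gram_def by (rule spd_congruence[OF spd_minv_spd[OF spd_K] D_carrier D_inj])

lemma rss_lower:
  assumes \<alpha>: "0 < \<alpha>" and x: "x \<in> carrier_vec n" and b: "b \<in> carrier_vec p"
  shows "quad_form (minv (K \<alpha>)) x - fitted \<alpha> x \<le> rss (D *\<^sub>v b + x) \<alpha>"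
  unfolding rss_def fitted_def gram_def
  by (rule gls_residual_ge[OF spd_K[OF \<alpha>] D_carrier psd _ x b]) (rule D_inj)

text \<open>Contribution of the frequencies in the box to the covariance form of \<open>u\<close>,
  weighted by the order 1 / (1 + |\<omega>|^2) of the relative difference between spectral densities
  with different \<alpha>.\<close>

definition low_energy :: "real \<Rightarrow> real \<Rightarrow> real Matrix.vec \<Rightarrow> real" where
  "low_energy \<gamma> W u = (LINT \<omega>|lborel. indicator (freq_box W) \<omega> *
     (trig_power n s u \<omega> * spec_dens \<nu> \<gamma> \<omega> / (1 + (norm \<omega>)\<^sup>2)))"

lemma integrable_low_energy:
  assumes \<gamma>: "0 < \<gamma>" and u: "u \<in> carrier_vec n"
  shows "integrable lborel (\<lambda>\<omega>. indicator (freq_box W) \<omega> *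
     (trig_power n s u \<omega> * spec_dens \<nu> \<gamma> \<omega> / (1 + (norm \<omega>)\<^sup>2)))"
proof (rule Bochner_Integration.integrable_bound[OF quad_form_scaled_corr_mat_integral(1)[OF \<nu> \<gamma> u, of s]])
  show "AE \<omega> in lborel. norm (indicator (freq_box W) \<omega> *
     (trig_power n s u \<omega> * spec_dens \<nu> \<gamma> \<omega> / (1 + (norm \<omega>)\<^sup>2))) \<le>
     norm (trig_power n s u \<omega> * spec_dens \<nu> \<gamma> \<omega>)"
  proof (rule AE_I2)
    fix \<omega> :: "real ^ 'd"
    let ?x = "trig_power n s u \<omega> * spec_dens \<nu> \<gamma> \<omega>"
    have "0 \<le> ?x" using spec_dens_pos[OF \<nu> \<gamma>, of \<omega>] by simp
    moreover from this have "?x / (1 + (norm \<omega>)\<^sup>2) \<le> ?x / 1" by (intro divide_left_mono) (auto simp: add_pos_nonneg)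
    ultimately show "norm (indicator (freq_box W) \<omega> * (?x / (1 + (norm \<omega>)\<^sup>2))) \<le> norm ?x"
      by (auto simp: indicator_def)
  qed
qed measurable

text \<open>The difference of two rescaled covariances is a low-frequency part plus a part that is
  small relative to the reference covariance.\<close>

lemma quad_form_diff_le:
  assumes \<alpha>: "0 < \<alpha>" "\<alpha> \<le> \<beta>" and \<gamma>: "0 < \<gamma>" and u: "u \<in> carrier_vec n" and W: "0 < W"
    and L: "0 \<le> L" "\<And>\<omega> :: real ^ 'd. spec_dens \<nu> \<alpha> \<omega> \<le> L * spec_dens \<nu> \<gamma> \<omega>"
  defines "c \<equiv> 2 * max 1 ((\<nu> + CARD('d) / 2) * \<beta>\<^sup>2)"
  shows "quad_form (K \<alpha>) u - quad_form (K \<beta>) u \<le>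
    c * L * (low_energy \<gamma> W u + quad_form (K \<gamma>) u / W\<^sup>2)"
proof -
  have \<beta>: "0 < \<beta>" using \<alpha> by simp
  have c: "0 < c" by (simp add: c_def)
  let ?A = "\<lambda>\<omega>. trig_power n s u \<omega>"
  note qa = quad_form_scaled_corr_mat_integral[OF \<nu> \<alpha>(1) u, of s]
  note qb = quad_form_scaled_corr_mat_integral[OF \<nu> \<beta> u, of s]
  note qg = quad_form_scaled_corr_mat_integral[OF \<nu> \<gamma> u, of s]
  have "quad_form (K \<alpha>) u - quad_form (K \<beta>) u = (LINT \<omega>|lborel. ?A \<omega> * spec_dens \<nu> \<alpha> \<omega> - ?A \<omega> * spec_dens \<nu> \<beta> \<omega>)"
    unfolding qa(2) qb(2) using qa(1) qb(1) by simp
  also have "\<dots> \<le> (LINT \<omega>|lborel. c * L * (indicator (freq_box W) \<omega> * (?A \<omega> * spec_dens \<nu> \<gamma> \<omega> / (1 + (norm \<omega>)\<^sup>2))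
      + ?A \<omega> * spec_dens \<nu> \<gamma> \<omega> / W\<^sup>2))"
  proof (rule integral_mono)
    fix \<omega> :: "real ^ 'd"
    have f: "0 < spec_dens \<nu> \<gamma> \<omega>" by (rule spec_dens_pos[OF \<nu> \<gamma>])
    have "spec_dens \<nu> \<alpha> \<omega> - spec_dens \<nu> \<beta> \<omega> \<le> spec_dens \<nu> \<alpha> \<omega> * c / (1 + (norm \<omega>)\<^sup>2)"
      using spec_dens_mono(3)[OF \<nu> \<alpha>, of \<omega>] by (simp add: c_def)
    also have "\<dots> \<le> (L * spec_dens \<nu> \<gamma> \<omega>) * c / (1 + (norm \<omega>)\<^sup>2)"
      using L(2)[of \<omega>] c by (intro divide_right_mono mult_right_mono) auto
    finally have "?A \<omega> * (spec_dens \<nu> \<alpha> \<omega> - spec_dens \<nu> \<beta> \<omega>) \<le> ?A \<omega> * ((L * spec_dens \<nu> \<gamma> \<omega>) * c / (1 + (norm \<omega>)\<^sup>2))"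
      by (intro mult_left_mono) auto
    also have "\<dots> = c * L * (?A \<omega> * spec_dens \<nu> \<gamma> \<omega> * (1 / (1 + (norm \<omega>)\<^sup>2)))" by simp
    also have "\<dots> \<le> c * L * (indicator (freq_box W) \<omega> * (?A \<omega> * spec_dens \<nu> \<gamma> \<omega> / (1 + (norm \<omega>)\<^sup>2))
      + ?A \<omega> * spec_dens \<nu> \<gamma> \<omega> / W\<^sup>2)"
    proof (intro mult_left_mono)
      have p: "0 \<le> ?A \<omega> * spec_dens \<nu> \<gamma> \<omega>" using f by simp
      show "?A \<omega> * spec_dens \<nu> \<gamma> \<omega> * (1 / (1 + (norm \<omega>)\<^sup>2)) \<le> indicator (freq_box W) \<omega> * (?A \<omega> * spec_dens \<nu> \<gamma> \<omega> / (1 + (norm \<omega>)\<^sup>2))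
        + ?A \<omega> * spec_dens \<nu> \<gamma> \<omega> / W\<^sup>2"
      proof (cases "\<omega> \<in> freq_box W")
        case True then show ?thesis using p by simp
      next
        case False
        then show ?thesis using mult_left_mono[OF not_in_freq_box[OF False W] p] by simp
      qed
    qed (use c L in auto)
    finally show "?A \<omega> * spec_dens \<nu> \<alpha> \<omega> - ?A \<omega> * spec_dens \<nu> \<beta> \<omega> \<le>
      c * L * (indicator (freq_box W) \<omega> * (?A \<omega> * spec_dens \<nu> \<gamma> \<omega> / (1 + (norm \<omega>)\<^sup>2))
      + ?A \<omega> * spec_dens \<nu> \<gamma> \<omega> / W\<^sup>2)" by (simp add: right_diff_distrib)
  qed (use qa(1) qb(1) qg(1) integrable_low_energy[OF \<gamma> u, of W] in auto)
  also have "\<dots> = c * L * (low_energy \<gamma> W u + quad_form (K \<gamma>) u / W\<^sup>2)"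
    unfolding low_energy_def qg(2) using qg(1) integrable_low_energy[OF \<gamma> u, of W] by simp
  finally show ?thesis .
qed

end

section \<open>The Gaussian process at the sampling points\<close>

definition cos_vec :: "nat \<Rightarrow> (nat \<Rightarrow> 'b::euclidean_space) \<Rightarrow> 'b \<Rightarrow> real Matrix.vec" where
  "cos_vec n s \<omega> = Matrix.vec n (\<lambda>i. cos (\<omega> \<bullet> s i))"

definition sin_vec :: "nat \<Rightarrow> (nat \<Rightarrow> 'b::euclidean_space) \<Rightarrow> 'b \<Rightarrow> real Matrix.vec" where
  "sin_vec n s \<omega> = Matrix.vec n (\<lambda>i. sin (\<omega> \<bullet> s i))"

lemma cos_sin_vec_carrier [simp]: "cos_vec n s \<omega> \<in> carrier_vec n" "sin_vec n s \<omega> \<in> carrier_vec n"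
  by (simp_all add: cos_vec_def sin_vec_def)

lemma cmod_trig_poly_sprod:
  assumes "v \<in> carrier_vec n"
  shows "trig_power n s v \<omega> = (sprod v (cos_vec n s \<omega>))\<^sup>2 + (sprod v (sin_vec n s \<omega>))\<^sup>2"
  unfolding cmod_trig_poly_square' using assms
  by (simp add: scalar_prod_def cos_vec_def sin_vec_def atLeast0LessThan)

text \<open>The constant \<open>C\<close> of the evaluation bound is a parameter, so that one
  constant can serve every n when the locale is instantiated along a sequence of designs.\<close>

locale sampled_process = design n p m \<Omega> \<nu> s
  for n p and m :: "nat \<Rightarrow> real ^ 'd \<Rightarrow> real" and \<Omega> \<nu> and s :: "nat \<Rightarrow> real ^ 'd" +
  fixes M :: "'a measure" and X :: "real ^ 'd \<Rightarrow> 'a \<Rightarrow> real" and T \<sigma>0 \<alpha>0 \<theta>0 C :: real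
  assumes gp: "centered_gp M (cube T) X (\<lambda>t u. \<sigma>0\<^sup>2 * matern \<nu> \<alpha>0 (t - u))"
    and s_cube: "\<And>i. i < n \<Longrightarrow> s i \<in> cube T"
    and \<sigma>0: "0 < \<sigma>0" and \<alpha>0: "0 < \<alpha>0" and \<theta>0: "\<theta>0 = \<sigma>0\<^sup>2 * \<alpha>0 powr (2 * \<nu>)"
    and C: "0 < C" and eval_bound: "\<And>v \<omega>. v \<in> carrier_vec n \<Longrightarrow>
      trig_power n s v \<omega> * spec_dens \<nu> \<alpha>0 \<omega> \<le> C * quad_form (K \<alpha>0) v"
begin

definition xv :: "'a \<Rightarrow> real Matrix.vec" where "xv \<omega> = Matrix.vec n (\<lambda>i. X (s i) \<omega>)"

lemma xv_carrier [simp]: "xv \<omega> \<in> carrier_vec n" by (simp add: xv_def)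

lemma \<theta>0_pos: "0 < \<theta>0" using \<sigma>0 \<alpha>0 by (simp add: \<theta>0)

lemma prob: "prob_space M" using gp by (simp add: centered_gp_def gaussian_process_def)

lemma X_measurable: "i < n \<Longrightarrow> X (s i) \<in> borel_measurable M"
  using gp s_cube by (auto simp: centered_gp_def gaussian_process_def)

lemma sprod_xv: "v \<in> carrier_vec n \<Longrightarrow> sprod v (xv \<omega>) = (\<Sum>i<n. vec_index v i * X (s i) \<omega>)"
  by (simp add: scalar_prod_def xv_def atLeast0LessThan)

lemma sprod_xv_measurable: "v \<in> carrier_vec n \<Longrightarrow> (\<lambda>\<omega>. sprod v (xv \<omega>)) \<in> borel_measurable M"
  using X_measurable by (simp add: sprod_xv)

text \<open>Linear functionals are normal by the definition of a Gaussian process. The covariance is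
  \<theta>0 times the rescaled matrix at \<alpha>0, because \<theta>0 = \<sigma>0^2 \<alpha>0^(2
  \<nu>).\<close>

lemma linear_functional_distr:
  assumes v: "v \<in> carrier_vec n"
  shows "distr M borel (\<lambda>\<omega>. sprod v (xv \<omega>)) =
    distr std_normal_distribution borel (\<lambda>x. sqrt (\<theta>0 * quad_form (K \<alpha>0) v) * x)"
proof (rule centered_normal_distr[OF prob sprod_xv_measurable[OF v]])
  interpret prob_space M by (rule prob)
  have norm1: "normal_rv M (\<lambda>\<omega>. \<Sum>t\<in>F. a t * X t \<omega>)" if "finite F" "F \<subseteq> cube T" for F a
    using gp that by (auto simp: centered_gp_def gaussian_process_def)
  \<comment> \<open>\<open>gaussian_process\<close> sums over sets of points, so coefficients
    indexed by i are transported along the injective \<open>s\<close>.\<close>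
  define a where "a t = vec_index v (the_inv_into {..<n} s t)" for t
  have "(\<Sum>t\<in>s ` {..<n}. a t * X t \<omega>) = sprod v (xv \<omega>)" for \<omega>
    unfolding sprod_xv[OF v] using inj_s
    by (subst sum.reindex) (auto simp: a_def the_inv_into_f_f)
  then show "normal_rv M (\<lambda>\<omega>. sprod v (xv \<omega>))"
    using norm1[of "s ` {..<n}" a] s_cube by auto
  have sq: "integrable M (\<lambda>\<omega>. (X (s i) \<omega>)\<^sup>2)" if "i < n" for i
  proof -
    have "normal_rv M (X (s i))" using norm1[of "{s i}" "\<lambda>_. 1"] s_cube[OF that] by simp
    then show ?thesis by (rule normal_rv_square_integrable[OF prob X_measurable[OF that]])
  qed
  have i1: "integrable M (X (s i))" if "i < n" for i
    by (rule square_integrable_imp_integrable[OF X_measurable[OF that] sq[OF that]])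
  have i2: "integrable M (\<lambda>\<omega>. X (s i) \<omega> * X (s j) \<omega>)" if "i < n" "j < n" for i j
  proof (rule Bochner_Integration.integrable_bound)
    show "integrable M (\<lambda>\<omega>. (X (s i) \<omega>)\<^sup>2 + (X (s j) \<omega>)\<^sup>2)" using sq that by auto
    show "(\<lambda>\<omega>. X (s i) \<omega> * X (s j) \<omega>) \<in> borel_measurable M" using X_measurable that by simp
    show "AE \<omega> in M. norm (X (s i) \<omega> * X (s j) \<omega>) \<le> norm ((X (s i) \<omega>)\<^sup>2 + (X (s j) \<omega>)\<^sup>2)"
    proof (rule AE_I2)
      fix \<omega>
      have "2 * (\<bar>X (s i) \<omega>\<bar> * \<bar>X (s j) \<omega>\<bar>) \<le> (X (s i) \<omega>)\<^sup>2 + (X (s j) \<omega>)\<^sup>2"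
        using sum_squares_bound[of "\<bar>X (s i) \<omega>\<bar>" "\<bar>X (s j) \<omega>\<bar>"] by simp
      then have "\<bar>X (s i) \<omega>\<bar> * \<bar>X (s j) \<omega>\<bar> \<le> (X (s i) \<omega>)\<^sup>2 + (X (s j) \<omega>)\<^sup>2"
        using mult_nonneg_nonneg[of "\<bar>X (s i) \<omega>\<bar>" "\<bar>X (s j) \<omega>\<bar>"] by linarith
      then show "norm (X (s i) \<omega> * X (s j) \<omega>) \<le> norm ((X (s i) \<omega>)\<^sup>2 + (X (s j) \<omega>)\<^sup>2)" by (simp add: abs_mult)
    qed
  qed
  show "(LINT \<omega>|M. sprod v (xv \<omega>)) = 0"
    unfolding sprod_xv[OF v] using i1 gp s_cube
    by (subst Bochner_Integration.integral_sum) (auto simp: centered_gp_def)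
  have e: "(sprod v (xv \<omega>))\<^sup>2 = (\<Sum>i<n. \<Sum>j<n. (vec_index v i * vec_index v j) * (X (s i) \<omega> * X (s j) \<omega>))" for \<omega>
    unfolding sprod_xv[OF v] power2_eq_square sum_product by (simp add: mult_ac)
  have "(LINT \<omega>|M. (sprod v (xv \<omega>))\<^sup>2) = (\<Sum>i<n. \<Sum>j<n. LINT \<omega>|M. (vec_index v i * vec_index v j) * (X (s i) \<omega> * X (s j) \<omega>))"
    unfolding e using i2
    by (subst Bochner_Integration.integral_sum)
       (auto intro!: Bochner_Integration.integrable_sum sum.cong simp: Bochner_Integration.integral_sum)
  also have "\<dots> = (\<Sum>i<n. \<Sum>j<n. (vec_index v i * vec_index v j) * (\<sigma>0\<^sup>2 * matern \<nu> \<alpha>0 (s i - s j)))"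
    using gp s_cube by (intro sum.cong refl) (auto simp: centered_gp_def)
  also have "\<dots> = \<theta>0 * quad_form (K \<alpha>0) v"
    unfolding quad_form_conv_sum[OF scaled_corr_mat_carrier v] sum_distrib_left
    using \<alpha>0 by (intro sum.cong) (auto simp: scaled_corr_mat_def corr_mat_def \<theta>0 powr_minus field_simps)
  finally show "(LINT \<omega>|M. (sprod v (xv \<omega>))\<^sup>2) = \<theta>0 * quad_form (K \<alpha>0) v" .
qed

lemma quad_form_K_nonneg: "v \<in> carrier_vec n \<Longrightarrow> 0 \<le> quad_form (K \<alpha>0) v"
  by (rule spdD(4)[OF spd_K[OF \<alpha>0]])

text \<open>In the orthonormal frame of \<open>K \<alpha>0\<close> the scaled noise is a standard
  Gaussian vector, as the laws of its linear combinations show, and the inverse form divided by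
  \<theta>0 is its squared norm.\<close>

lemma quad_minv_concentration:
  fixes u :: real
  assumes u: "0 < u" "u \<le> 1"
  shows "measure M {\<omega>\<in>space M. \<bar>quad_form (minv (K \<alpha>0)) (xv \<omega>) / \<theta>0 - n\<bar> \<ge> n * u} \<le> 2 * exp (- (n * u\<^sup>2 / 16))"
    "(\<lambda>\<omega>. quad_form (minv (K \<alpha>0)) (xv \<omega>)) \<in> borel_measurable M"
proof -
  obtain U where U: "U \<in> carrier_mat n n" "transpose_mat U * K \<alpha>0 * U = 1\<^sub>m n"
    and q: "\<And>y. y \<in> carrier_vec n \<Longrightarrow> quad_form (minv (K \<alpha>0)) y = (\<Sum>k<n. (sprod (Matrix.col U k) y)\<^sup>2)"
    using orthonormal_frame[OF spd_K[OF \<alpha>0]] by metis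
  define Z where "Z k \<omega> = sprod (Matrix.col U k) (xv \<omega>) / sqrt \<theta>0" for k \<omega>
  have cU: "Matrix.col U k \<in> carrier_vec n" if "k < n" for k using U(1) that by simp
  have Z: "Z k \<in> borel_measurable M" if "k < n" for k
    unfolding Z_def using sprod_xv_measurable[OF cU[OF that]] by simp
  have S: "(\<Sum>k<n. (Z k \<omega>)\<^sup>2) = quad_form (minv (K \<alpha>0)) (xv \<omega>) / \<theta>0" for \<omega>
    unfolding q[OF xv_carrier] Z_def using \<theta>0_pos by (simp add: power_divide sum_divide_distrib)
  have lin: "distr M borel (\<lambda>\<omega>. \<Sum>k<n. a k * Z k \<omega>) =
      distr std_normal_distribution borel (\<lambda>x. sqrt (\<Sum>k<n. (a k)\<^sup>2) * x)" for a
  proof -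
    define av where "av = Matrix.vec n a"
    have av: "av \<in> carrier_vec n" by (simp add: av_def)
    define v where "v = (1 / sqrt \<theta>0) \<cdot>\<^sub>v (U *\<^sub>v av)"
    have Ua: "U *\<^sub>v av \<in> carrier_vec n" using U av by simp
    have v: "v \<in> carrier_vec n" using Ua by (simp add: v_def)
    have "sprod (U *\<^sub>v av) x = (\<Sum>k<n. a k * sprod (Matrix.col U k) x)" if x: "x \<in> carrier_vec n" for x
    proof -
      have "sprod (U *\<^sub>v av) x = sprod x (U *\<^sub>v av)" by (rule comm_scalar_prod[OF Ua x])
      also have "\<dots> = sprod (transpose_mat U *\<^sub>v x) av" by (rule sprod_mult_mat_vec[OF U(1) av x])
      also have "\<dots> = (\<Sum>k<n. a k * sprod (Matrix.col U k) x)"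
        unfolding scalar_prod_def[of _ av] using U(1) by (simp add: av_def atLeast0LessThan mult.commute)
      finally show ?thesis .
    qed
    then have "sprod v (xv \<omega>) = (\<Sum>k<n. a k * Z k \<omega>)" for \<omega>
      unfolding v_def Z_def using smult_scalar_prod_distrib[OF Ua xv_carrier]
      by (simp add: sum_divide_distrib)
    moreover have "\<theta>0 * quad_form (K \<alpha>0) v = (\<Sum>k<n. (a k)\<^sup>2)"
    proof -
      have "quad_form (K \<alpha>0) v = (1 / sqrt \<theta>0)\<^sup>2 * quad_form (K \<alpha>0) (U *\<^sub>v av)"
        unfolding v_def by (rule quad_form_smult_vec[OF _ Ua]) simp
      also have "quad_form (K \<alpha>0) (U *\<^sub>v av) = quad_form (1\<^sub>m n) av"
        using quad_form_congruence[OF scaled_corr_mat_carrier U(1) av, of \<nu> s \<alpha>0] U(2) by simp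
      also have "\<dots> = (\<Sum>k<n. (a k)\<^sup>2)"
        using av by (simp add: quad_form_def scalar_prod_def av_def atLeast0LessThan power2_eq_square)
      finally show ?thesis using \<theta>0_pos by (simp add: power_divide)
    qed
    ultimately show ?thesis using linear_functional_distr[OF v] by simp
  qed
  show "measure M {\<omega>\<in>space M. \<bar>quad_form (minv (K \<alpha>0)) (xv \<omega>) / \<theta>0 - n\<bar> \<ge> n * u} \<le> 2 * exp (- (n * u\<^sup>2 / 16))"
    using std_gauss_vector_norm_concentration[OF prob Z lin u] by (simp add: S)
  show "(\<lambda>\<omega>. quad_form (minv (K \<alpha>0)) (xv \<omega>)) \<in> borel_measurable M"
    using sprod_xv_measurable[OF cU] by (simp add: q)
qed

text \<open>The evaluation bound dualised: a functional dominated by evaluation at the frequency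
  \<xi> has a controlled norm in the inverse form. With Q the claimed bound and q the form at v, it
  suffices that x^2 \<le> Q q implies 2 x \<le> Q + q.\<close>

lemma quad_minv_le_of_eval:
  assumes w: "w \<in> carrier_vec n"
    and le: "\<And>v. v \<in> carrier_vec n \<Longrightarrow> (sprod v w)\<^sup>2 \<le> trig_power n s v \<xi>"
  shows "quad_form (minv (K \<alpha>0)) w \<le> C / spec_dens \<nu> \<alpha>0 \<xi>"
proof (rule quad_form_minv_le[OF spd_K[OF \<alpha>0] w])
  fix v :: "real Matrix.vec" assume v: "v \<in> carrier_vec n"
  let ?Q = "C / spec_dens \<nu> \<alpha>0 \<xi>" and ?q = "quad_form (K \<alpha>0) v"
  have f: "0 < spec_dens \<nu> \<alpha>0 \<xi>" by (rule spec_dens_pos[OF \<nu> \<alpha>0])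
  have "(sprod v w)\<^sup>2 * spec_dens \<nu> \<alpha>0 \<xi> \<le> C * ?q"
    using mult_right_mono[OF le[OF v], of "spec_dens \<nu> \<alpha>0 \<xi>"] f eval_bound[OF v, of \<xi>] by linarith
  then have 1: "(sprod v w)\<^sup>2 \<le> ?Q * ?q" using f by (simp add: pos_le_divide_eq)
  have Q: "0 < ?Q" using C f by simp
  have "0 \<le> (sprod v w - ?Q)\<^sup>2" by simp
  then have "2 * sprod v w * ?Q \<le> (sprod v w)\<^sup>2 + ?Q\<^sup>2" by (simp add: power2_diff)
  also have "\<dots> \<le> ?Q * (?q + ?Q)" using 1 by (simp add: power2_eq_square distrib_left)
  finally have "?Q * (2 * sprod v w) \<le> ?Q * (?q + ?Q)" by (simp add: mult_ac)
  then have "2 * sprod v w \<le> ?q + ?Q" by (simp only: mult_le_cancel_left_pos[OF Q])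
  then show "2 * sprod v w - ?q \<le> ?Q" by simp
qed

end

section \<open>Tail bounds for the energies of the Gaussian weights\<close>

context sampled_process
begin

text \<open>The reference vector \<open>u\<close> of the two perturbation lemmas for inverse forms.
  It is Gaussian with covariance \<theta>0 times the inverse of \<open>K \<alpha>0\<close>.\<close>

definition weights :: "'a \<Rightarrow> real Matrix.vec" where
  "weights \<omega> = minv (K \<alpha>0) *\<^sub>v xv \<omega>"

lemma weights_carrier [simp]: "weights \<omega> \<in> carrier_vec n"
  using spd_minv(1)[OF spd_K[OF \<alpha>0]] by (simp add: weights_def)

lemma sprod_weights:
  assumes w: "w \<in> carrier_vec n"
  shows "sprod (weights \<omega>) w = sprod (minv (K \<alpha>0) *\<^sub>v w) (xv \<omega>)"
proof -
  note i = spd_minv(1)[OF spd_K[OF \<alpha>0]] spd_minv_sym[OF spd_K[OF \<alpha>0]]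
  have "sprod (weights \<omega>) w = sprod w (minv (K \<alpha>0) *\<^sub>v xv \<omega>)"
    unfolding weights_def by (rule comm_scalar_prod[of _ n]) (use i w in auto)
  also have "\<dots> = sprod (transpose_mat (minv (K \<alpha>0)) *\<^sub>v w) (xv \<omega>)"
    by (rule sprod_mult_mat_vec[OF i(1) xv_carrier w])
  finally show ?thesis by (simp add: i(2))
qed

lemma weights_measurable:
  assumes "i < n"
  shows "(\<lambda>\<omega>. vec_index (weights \<omega>) i) \<in> borel_measurable M"
proof -
  note k = spd_minv(1)[OF spd_K[OF \<alpha>0]]
  have r: "Matrix.row (minv (K \<alpha>0)) i \<in> carrier_vec n" using k assms by (simp add: row_carrier_vec[of i n])
  have "vec_index (weights \<omega>) i = sprod (Matrix.row (minv (K \<alpha>0)) i) (xv \<omega>)" for \<omega>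
    unfolding weights_def using k assms by simp
  then show ?thesis using sprod_xv_measurable[OF r] by simp
qed

text \<open>Used with the cosine and the sine vector: the real and imaginary parts are treated
  separately, since the moment bound concerns squares of real normal variables.\<close>

definition partial_energy :: "real \<Rightarrow> (real ^ 'd \<Rightarrow> real Matrix.vec) \<Rightarrow> 'a \<Rightarrow> real" where
  "partial_energy W w \<omega> = (LINT \<xi>|lborel. indicator (freq_box W) \<xi> *
     ((sprod (weights \<omega>) (w \<xi>))\<^sup>2 * spec_dens \<nu> \<alpha>0 \<xi> / (1 + (norm \<xi>)\<^sup>2)))"

text \<open>At each frequency the functional has variance at most \<theta>0 C divided by the
  spectral density, so its square times that density has bounded exponential moments, and the
  average over frequencies inherits the tail of a single term. The constant 864 is 4 times 216: 4
  from the condition c v \<le> 1/4 on the moment, 216 W from the integral of the frequency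
  weight.\<close>

lemma partial_energy_tail:
  assumes d: "CARD('d) \<le> 3" and W: "1 \<le> W" and r: "0 \<le> r"
    and w: "\<And>\<xi>. w \<xi> \<in> carrier_vec n" and wm: "\<And>i. i < n \<Longrightarrow> (\<lambda>\<xi>. vec_index (w \<xi>) i) \<in> borel_measurable borel"
    and le: "\<And>v \<xi>. v \<in> carrier_vec n \<Longrightarrow> (sprod v (w \<xi>))\<^sup>2 \<le> trig_power n s v \<xi>"
  shows "measure M {\<omega>\<in>space M. partial_energy W w \<omega> \<ge> 864 * \<theta>0 * C * W * r} \<le> 3 * exp (- r)"
    "partial_energy W w \<in> borel_measurable M"
proof -
  define m where "m = 864 * \<theta>0 * C * W"
  have m: "0 < m" using \<theta>0_pos C W by (simp add: m_def)
  \<comment> \<open>Density of the averaging measure: the frequency weight times the factor 4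
    \<theta>0 C by which \<open>H\<close> is divided.\<close>
  define g where "g = (\<lambda>\<xi>::real ^ 'd. indicator (freq_box W) \<xi> * (4 * \<theta>0 * C / (1 + (norm \<xi>)\<^sup>2)))"
  have g[measurable]: "g \<in> borel_measurable borel" unfolding g_def by measurable
  have g0: "0 \<le> g \<xi>" for \<xi> using \<theta>0_pos C by (simp add: g_def add_pos_nonneg)
  define \<mu> where "\<mu> = density lborel (\<lambda>\<xi>. ennreal (g \<xi>))"
  define H where "H \<xi> \<omega> = (sprod (weights \<omega>) (w \<xi>))\<^sup>2 * (spec_dens \<nu> \<alpha>0 \<xi> / (4 * \<theta>0 * C))" for \<xi> \<omega>
  have sp: "sprod (weights \<omega>) (w \<xi>) = (\<Sum>i<n. vec_index (weights \<omega>) i * vec_index (w \<xi>) i)" for \<omega> \<xi>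
    using w[of \<xi>] by (simp add: scalar_prod_def atLeast0LessThan)
  have pm: "(\<lambda>z. vec_index (weights (snd z)) i * vec_index (w (fst z)) i) \<in> borel_measurable (N \<Otimes>\<^sub>M M)"
    if "sets N = sets borel" "i < n" for N :: "(real ^ 'd) measure" and i
  proof -
    have "(\<lambda>\<xi>. vec_index (w \<xi>) i) \<in> borel_measurable N"
      using wm[OF that(2)] that(1) by (simp cong: measurable_cong_sets)
    then show ?thesis
      using weights_measurable[OF that(2)]
      by (intro borel_measurable_times measurable_compose[OF measurable_snd] measurable_compose[OF measurable_fst]) auto
  qed
  have sm: "(\<lambda>z. sprod (weights (snd z)) (w (fst z))) \<in> borel_measurable (N \<Otimes>\<^sub>M M)"
    if "sets N = sets borel" for N :: "(real ^ 'd) measure"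
    unfolding sp using pm[OF that] by (intro borel_measurable_sum) auto
  have fm: "(\<lambda>z. spec_dens \<nu> \<alpha>0 (fst z)) \<in> borel_measurable (N \<Otimes>\<^sub>M M)"
    if "sets N = sets borel" for N :: "(real ^ 'd) measure"
    using that by (intro measurable_compose[OF measurable_fst]) (auto cong: measurable_cong_sets)
  have Hm: "case_prod H \<in> borel_measurable (N \<Otimes>\<^sub>M M)" if "sets N = sets borel" for N :: "(real ^ 'd) measure"
    unfolding H_def split_beta using sm[OF that] fm[OF that] by measurable
  have H0: "0 \<le> H \<xi> \<omega>" for \<xi> \<omega>
    using spec_dens_pos[OF \<nu> \<alpha>0, of \<xi>] \<theta>0_pos C by (simp add: H_def)
  have gH: "g \<xi> * H \<xi> \<omega> = indicator (freq_box W) \<xi> *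
     ((sprod (weights \<omega>) (w \<xi>))\<^sup>2 * spec_dens \<nu> \<alpha>0 \<xi> / (1 + (norm \<xi>)\<^sup>2))" for \<xi> \<omega>
    using \<theta>0_pos C by (simp add: g_def H_def)
  have PE: "partial_energy W w = (\<lambda>\<omega>. LINT \<xi>|lborel. g \<xi> * H \<xi> \<omega>)"
    by (simp add: fun_eq_iff partial_energy_def gH)
  have e2: "ennreal (enn2real x) \<le> x" for x by (cases x) auto
  interpret prob_space M by (rule prob)
  show PEm: "partial_energy W w \<in> borel_measurable M"
    unfolding PE
  proof (rule lborel.borel_measurable_lebesgue_integral)
    have sw: "(\<lambda>z. (snd z, fst z)) \<in> (M \<Otimes>\<^sub>M lborel) \<rightarrow>\<^sub>M (lborel \<Otimes>\<^sub>M M)" by measurable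
    have "(\<lambda>z. case_prod H (snd z, fst z)) \<in> borel_measurable (M \<Otimes>\<^sub>M lborel)"
      by (rule measurable_compose[OF sw]) (use Hm[of lborel] in simp)
    moreover have "(\<lambda>z. g (snd z)) \<in> borel_measurable (M \<Otimes>\<^sub>M lborel)" by measurable
    ultimately show "(\<lambda>(\<omega>, \<xi>). g \<xi> * H \<xi> \<omega>) \<in> borel_measurable (M \<Otimes>\<^sub>M lborel)"
      by (simp add: split_beta)
  qed
  have "measure M {\<omega>\<in>space M. partial_energy W w \<omega> \<ge> m * r} \<le> 3 * exp (- r)"
  proof (rule weighted_average_tail[OF prob, of \<mu> m H])
    show mass: "emeasure \<mu> (space \<mu>) \<le> ennreal m"
    proof -
      have "emeasure \<mu> (space \<mu>) = (\<integral>\<^sup>+\<xi>. ennreal (g \<xi>) \<partial>lborel)"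
        unfolding \<mu>_def by (subst emeasure_density) auto
      also have "\<dots> = (\<integral>\<^sup>+\<xi>. ennreal (4 * \<theta>0 * C) * (ennreal (1 / (1 + (norm \<xi>)\<^sup>2)) *
          indicator {\<omega>::real ^ 'd. \<forall>b\<in>Basis. \<bar>\<omega> \<bullet> b\<bar> \<le> W} \<xi>) \<partial>lborel)"
        using \<theta>0_pos C
        by (intro nn_integral_cong) (auto simp: g_def freq_box_def indicator_def simp flip: ennreal_mult')
      also have "\<dots> = ennreal (4 * \<theta>0 * C) * (\<integral>\<^sup>+\<xi>. ennreal (1 / (1 + (norm \<xi>)\<^sup>2)) *
          indicator {\<omega>::real ^ 'd. \<forall>b\<in>Basis. \<bar>\<omega> \<bullet> b\<bar> \<le> W} \<xi> \<partial>lborel)"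
        by (rule nn_integral_cmult)
           (use freq_box_measurable[of W, where ?'a = "real ^ 'd"] in \<open>simp add: freq_box_def\<close>)
      also have "\<dots> \<le> ennreal (4 * \<theta>0 * C) * ennreal (216 * W)"
        by (intro mult_left_mono nn_integral_cube_inverse_quadratic) (use d W in auto)
      also have "\<dots> = ennreal m"
      proof -
        have mm: "m = 4 * \<theta>0 * C * (216 * W)" by (simp add: m_def)
        show ?thesis unfolding mm by (rule ennreal_mult'[symmetric]) (use \<theta>0_pos C in simp)
      qed
      finally show ?thesis .
    qed
    have "finite_measure \<mu>"
      by (rule finite_measureI) (use mass in \<open>auto simp: top_unique\<close>)
    then show "sigma_finite_measure \<mu>" by (rule finite_measure.sigma_finite_measure)
    show "case_prod H \<in> borel_measurable (\<mu> \<Otimes>\<^sub>M M)" by (rule Hm) (simp add: \<mu>_def)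
    show "ennreal (partial_energy W w \<omega>) \<le> (\<integral>\<^sup>+\<xi>. ennreal (H \<xi> \<omega>) \<partial>\<mu>)" if \<omega>: "\<omega> \<in> space M" for \<omega>
    proof -
      have Hx[measurable]: "(\<lambda>\<xi>. H \<xi> \<omega>) \<in> borel_measurable borel"
        using measurable_compose[OF measurable_Pair2'[OF \<omega>] Hm[of borel]] by simp
      have "ennreal (partial_energy W w \<omega>) \<le> (\<integral>\<^sup>+\<xi>. ennreal (g \<xi> * H \<xi> \<omega>) \<partial>lborel)"
        unfolding PE using g0 H0
        by (subst integral_eq_nn_integral) (auto intro!: e2)
      also have "\<dots> = (\<integral>\<^sup>+\<xi>. ennreal (H \<xi> \<omega>) \<partial>\<mu>)"
        unfolding \<mu>_def using g0 by (subst nn_integral_density) (auto simp: ennreal_mult')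
      finally show ?thesis .
    qed
    show "(\<integral>\<^sup>+\<omega>. ennreal (exp (H \<xi> \<omega>)) \<partial>M) \<le> 2" for \<xi>
    proof -
      let ?v = "minv (K \<alpha>0) *\<^sub>v w \<xi>" and ?c = "spec_dens \<nu> \<alpha>0 \<xi> / (4 * \<theta>0 * C)"
      have v: "?v \<in> carrier_vec n" using spd_minv(1)[OF spd_K[OF \<alpha>0]] w by simp
      have f: "0 < spec_dens \<nu> \<alpha>0 \<xi>" by (rule spec_dens_pos[OF \<nu> \<alpha>0])
      have q: "quad_form (K \<alpha>0) ?v \<le> C / spec_dens \<nu> \<alpha>0 \<xi>"
        using quad_minv_le_of_eval[OF w le] quad_form_minv_conv[OF spd_K[OF \<alpha>0] w] by simp
      have "(\<integral>\<^sup>+\<omega>. ennreal (exp (?c * (sprod ?v (xv \<omega>))\<^sup>2)) \<partial>M) \<le> 2"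
      proof (rule centered_normal_exp_square[OF sprod_xv_measurable[OF v] linear_functional_distr[OF v]])
        show "0 \<le> \<theta>0 * quad_form (K \<alpha>0) ?v" using quad_form_K_nonneg[OF v] \<theta>0_pos by simp
        have "?c * (\<theta>0 * quad_form (K \<alpha>0) ?v) \<le> ?c * (\<theta>0 * (C / spec_dens \<nu> \<alpha>0 \<xi>))"
          using q f C \<theta>0_pos by (intro mult_left_mono) auto
        also have "\<dots> = 1 / 4" using f C \<theta>0_pos by simp
        finally show "?c * (\<theta>0 * quad_form (K \<alpha>0) ?v) \<le> 1 / 4" .
      qed (use f C \<theta>0_pos in auto)
      then show ?thesis by (simp add: H_def sprod_weights[OF w] mult.commute)
    qed
  qed (use m H0 PEm r in auto)
  then show "measure M {\<omega>\<in>space M. partial_energy W w \<omega> \<ge> 864 * \<theta>0 * C * W * r} \<le> 3 * exp (- r)"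
    by (simp add: m_def)
qed

lemma partial_energy_trig:
  assumes d: "CARD('d) \<le> 3" and W: "1 \<le> W" and r: "0 \<le> r"
  shows "measure M {\<omega>\<in>space M. partial_energy W (cos_vec n s) \<omega> \<ge> 864 * \<theta>0 * C * W * r} \<le> 3 * exp (- r)"
    "measure M {\<omega>\<in>space M. partial_energy W (sin_vec n s) \<omega> \<ge> 864 * \<theta>0 * C * W * r} \<le> 3 * exp (- r)"
    "partial_energy W (cos_vec n s) \<in> borel_measurable M" "partial_energy W (sin_vec n s) \<in> borel_measurable M"
proof -
  have mc: "(\<lambda>\<xi>. vec_index (cos_vec n s \<xi>) i) \<in> borel_measurable borel"
    and ms: "(\<lambda>\<xi>. vec_index (sin_vec n s \<xi>) i) \<in> borel_measurable borel" if "i < n" for i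
  proof -
    have e: "vec_index (cos_vec n s \<xi>) i = cos (\<xi> \<bullet> s i)" "vec_index (sin_vec n s \<xi>) i = sin (\<xi> \<bullet> s i)" for \<xi>
      using that by (simp_all add: cos_vec_def sin_vec_def)
    show "(\<lambda>\<xi>. vec_index (cos_vec n s \<xi>) i) \<in> borel_measurable borel" "(\<lambda>\<xi>. vec_index (sin_vec n s \<xi>) i) \<in> borel_measurable borel"
      unfolding e by (intro borel_measurable_continuous_onI continuous_intros)+
  qed
  have lc: "(sprod v (cos_vec n s \<xi>))\<^sup>2 \<le> trig_power n s v \<xi>"
    and ls: "(sprod v (sin_vec n s \<xi>))\<^sup>2 \<le> trig_power n s v \<xi>"
    if "v \<in> carrier_vec n" for v \<xi>
    unfolding cmod_trig_poly_sprod[OF that] by auto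
  show "measure M {\<omega>\<in>space M. partial_energy W (cos_vec n s) \<omega> \<ge> 864 * \<theta>0 * C * W * r} \<le> 3 * exp (- r)"
    by (rule partial_energy_tail(1)[OF d W r]) (use mc lc in auto)
  show "measure M {\<omega>\<in>space M. partial_energy W (sin_vec n s) \<omega> \<ge> 864 * \<theta>0 * C * W * r} \<le> 3 * exp (- r)"
    by (rule partial_energy_tail(1)[OF d W r]) (use ms ls in auto)
  show "partial_energy W (cos_vec n s) \<in> borel_measurable M"
    by (rule partial_energy_tail(2)[OF d W r]) (use mc lc in auto)
  show "partial_energy W (sin_vec n s) \<in> borel_measurable M"
    by (rule partial_energy_tail(2)[OF d W r]) (use ms ls in auto)
qed

lemma low_energy_le:
  "low_energy \<alpha>0 W (weights \<omega>) \<le> partial_energy W (cos_vec n s) \<omega> + partial_energy W (sin_vec n s) \<omega>"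
proof -
  let ?k = "\<lambda>\<xi>. indicator (freq_box W) \<xi> * (spec_dens \<nu> \<alpha>0 \<xi> / (1 + (norm \<xi>)\<^sup>2))"
  let ?c = "\<lambda>\<xi>. indicator (freq_box W) \<xi> * ((sprod (weights \<omega>) (cos_vec n s \<xi>))\<^sup>2 * spec_dens \<nu> \<alpha>0 \<xi> / (1 + (norm \<xi>)\<^sup>2))"
  let ?s = "\<lambda>\<xi>. indicator (freq_box W) \<xi> * ((sprod (weights \<omega>) (sin_vec n s \<xi>))\<^sup>2 * spec_dens \<nu> \<alpha>0 \<xi> / (1 + (norm \<xi>)\<^sup>2))"
  have sp: "sprod (weights \<omega>) (cos_vec n s \<xi>) = (\<Sum>i<n. vec_index (weights \<omega>) i * cos (\<xi> \<bullet> s i))"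
    "sprod (weights \<omega>) (sin_vec n s \<xi>) = (\<Sum>i<n. vec_index (weights \<omega>) i * sin (\<xi> \<bullet> s i))" for \<xi>
    by (simp_all add: scalar_prod_def cos_vec_def sin_vec_def atLeast0LessThan)
  have [measurable]: "(\<lambda>\<xi>. sprod (weights \<omega>) (cos_vec n s \<xi>)) \<in> borel_measurable borel"
    "(\<lambda>\<xi>. sprod (weights \<omega>) (sin_vec n s \<xi>)) \<in> borel_measurable borel"
    unfolding sp by (intro borel_measurable_continuous_onI continuous_intros)+
  have fb[measurable]: "freq_box W \<in> sets (borel :: (real ^ 'd) measure)" by (rule freq_box_measurable)
  have e: "indicator (freq_box W) \<xi> * (trig_power n s (weights \<omega>) \<xi> * spec_dens \<nu> \<alpha>0 \<xi> / (1 + (norm \<xi>)\<^sup>2)) =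
     ?c \<xi> + ?s \<xi>" for \<xi>
    unfolding cmod_trig_poly_sprod[OF weights_carrier] by (simp add: algebra_simps add_divide_distrib)
  have int: "integrable lborel (\<lambda>\<xi>. ?c \<xi> + ?s \<xi>)"
    using integrable_low_energy[OF \<alpha>0 weights_carrier[of \<omega>], of W] unfolding e .
  have nn: "0 \<le> ?c \<xi>" "0 \<le> ?s \<xi>" for \<xi>
    using spec_dens_pos[OF \<nu> \<alpha>0, of \<xi>] by (auto simp: add_pos_nonneg intro!: mult_nonneg_nonneg divide_nonneg_nonneg)
  have mc: "?c \<in> borel_measurable lborel" "?s \<in> borel_measurable lborel" by measurable
  have le: "norm (?c \<xi>) \<le> norm (?c \<xi> + ?s \<xi>)" "norm (?s \<xi>) \<le> norm (?c \<xi> + ?s \<xi>)" for \<xi>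
    using nn[of \<xi>] by (simp_all only: real_norm_def abs_of_nonneg add_nonneg_nonneg)
  have ic: "integrable lborel ?c"
    by (rule Bochner_Integration.integrable_bound[OF int mc(1) AE_I2]) (rule le)
  have isn: "integrable lborel ?s"
    by (rule Bochner_Integration.integrable_bound[OF int mc(2) AE_I2]) (rule le)
  show ?thesis unfolding low_energy_def partial_energy_def e
    by (rule eq_refl, rule Bochner_Integration.integral_add[OF ic isn])
qed

text \<open>In a frame of the Gram matrix the fit is a sum of p squares of normal variables. Their
  functionals have unit form under \<open>K a\<close>, which dominates \<open>K \<alpha>0\<close>
  for a \<le> \<alpha>0, so the variances are at most \<theta>0.\<close>

lemma fitted_tail:
  assumes a: "0 < a" "a \<le> \<alpha>0" and r: "0 \<le> r" and p: "0 < p"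
  shows "measure M {\<omega>\<in>space M. fitted a (xv \<omega>) \<ge> 4 * \<theta>0 * p * r} \<le> 3 * exp (- r)"
    "(\<lambda>\<omega>. fitted a (xv \<omega>)) \<in> borel_measurable M"
proof -
  interpret prob_space M by (rule prob)
  obtain V where V: "V \<in> carrier_mat p p"
    and q: "\<And>y. y \<in> carrier_vec p \<Longrightarrow> quad_form (minv (gram a)) y = (\<Sum>k<p. (sprod (Matrix.col V k) y)\<^sup>2)"
    and one: "\<And>k. k < p \<Longrightarrow> quad_form (gram a) (Matrix.col V k) = 1"
    using orthonormal_frame[OF spd_gram[OF a(1)]] by metis
  note Ka = spd_K[OF a(1)]
  note i = spd_minv(1)[OF Ka] spd_minv_sym[OF Ka]
  have cV: "Matrix.col V k \<in> carrier_vec p" if "k < p" for k using V that by simp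
  define g where "g k = minv (K a) *\<^sub>v (D *\<^sub>v Matrix.col V k)" for k
  have Dv: "D *\<^sub>v Matrix.col V k \<in> carrier_vec n" if "k < p" for k using D_carrier cV[OF that] by simp
  have g: "g k \<in> carrier_vec n" if "k < p" for k using i Dv[OF that] by (simp add: g_def)
  have gx: "sprod (Matrix.col V k) (transpose_mat D *\<^sub>v (minv (K a) *\<^sub>v x)) = sprod (g k) x"
    if k: "k < p" and x: "x \<in> carrier_vec n" for k x
  proof -
    have Kx: "minv (K a) *\<^sub>v x \<in> carrier_vec n" using i x by simp
    have "sprod (Matrix.col V k) (transpose_mat D *\<^sub>v (minv (K a) *\<^sub>v x)) =
        sprod (transpose_mat (transpose_mat D) *\<^sub>v Matrix.col V k) (minv (K a) *\<^sub>v x)"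
      by (rule sprod_mult_mat_vec[of _ p n]) (use D_carrier Kx cV[OF k] in auto)
    also have "\<dots> = sprod (D *\<^sub>v Matrix.col V k) (minv (K a) *\<^sub>v x)" by simp
    also have "\<dots> = sprod (transpose_mat (minv (K a)) *\<^sub>v (D *\<^sub>v Matrix.col V k)) x"
      by (rule sprod_mult_mat_vec[OF i(1) x Dv[OF k]])
    finally show ?thesis by (simp add: i(2) g_def)
  qed
  have fit: "fitted a (xv \<omega>) = (\<Sum>k<p. (sprod (g k) (xv \<omega>))\<^sup>2)" for \<omega>
  proof -
    have "transpose_mat D *\<^sub>v (minv (K a) *\<^sub>v xv \<omega>) \<in> carrier_vec p" using D_carrier i by simp
    then show ?thesis unfolding fitted_def using q gx by simp
  qed
  show fm: "(\<lambda>\<omega>. fitted a (xv \<omega>)) \<in> borel_measurable M"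
    unfolding fit using sprod_xv_measurable[OF g] by simp
  have var: "quad_form (K \<alpha>0) (g k) \<le> 1" if k: "k < p" for k
  proof -
    have "quad_form (K \<alpha>0) (g k) \<le> quad_form (K a) (g k)"
      by (rule scaled_corr_mat_loewner(1)[OF \<nu> a g[OF k]])
    also have "\<dots> = quad_form (minv (K a)) (D *\<^sub>v Matrix.col V k)"
      unfolding g_def by (rule quad_form_minv_conv[OF Ka Dv[OF k], symmetric])
    also have "\<dots> = quad_form (gram a) (Matrix.col V k)"
      unfolding gram_def by (rule quad_form_congruence[OF i(1) D_carrier cV[OF k], symmetric])
    finally show ?thesis by (simp add: one[OF k])
  qed
  define H where "H k \<omega> = (if k < p then (sprod (g k) (xv \<omega>))\<^sup>2 / (4 * \<theta>0) else 0)" for k \<omega>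
  have "measure M {\<omega>\<in>space M. fitted a (xv \<omega>) / (4 * \<theta>0) \<ge> real p * r} \<le> 3 * exp (- r)"
  proof (rule weighted_average_tail[OF prob, of "count_space {..<p}" "real p" H])
    show "sigma_finite_measure (count_space {..<p})" by (rule sigma_finite_measure_count_space_finite) simp
    show "emeasure (count_space {..<p}) (space (count_space {..<p})) \<le> ennreal (real p)"
      by (simp add: ennreal_of_nat_eq_real_of_nat)
    show "case_prod H \<in> borel_measurable (count_space {..<p} \<Otimes>\<^sub>M M)"
      unfolding H_def using sprod_xv_measurable[OF g]
      by (intro measurable_pair_measure_countable1) auto
    show "0 \<le> H k \<omega>" for k \<omega> using \<theta>0_pos by (simp add: H_def)
    show "ennreal (fitted a (xv \<omega>) / (4 * \<theta>0)) \<le> (\<integral>\<^sup>+k. ennreal (H k \<omega>) \<partial>count_space {..<p})" for \<omega>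
      using \<theta>0_pos by (simp add: nn_integral_count_space_finite fit H_def sum_divide_distrib)
    show "(\<integral>\<^sup>+\<omega>. ennreal (exp (H k \<omega>)) \<partial>M) \<le> 2" for k
    proof (cases "k < p")
      case True
      have "(\<integral>\<^sup>+\<omega>. ennreal (exp ((1 / (4 * \<theta>0)) * (sprod (g k) (xv \<omega>))\<^sup>2)) \<partial>M) \<le> 2"
        by (rule centered_normal_exp_square[OF sprod_xv_measurable[OF g[OF True]] linear_functional_distr[OF g[OF True]]])
           (use quad_form_K_nonneg[OF g[OF True]] \<theta>0_pos var[OF True] in auto)
      then show ?thesis using True by (simp add: H_def)
    qed (simp add: H_def emeasure_space_1)
  qed (use p r fm in auto)
  then show "measure M {\<omega>\<in>space M. fitted a (xv \<omega>) \<ge> 4 * \<theta>0 * p * r} \<le> 3 * exp (- r)"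
    using \<theta>0_pos by (simp add: pos_le_divide_eq mult_ac)
qed

end

section \<open>Residual sums of squares uniformly in \<alpha>\<close>

context sampled_process
begin

text \<open>By monotonicity only the two ends of the range matter. At b the true coefficients give
  an upper bound, at a removing the fit to the noise gives a lower bound, and both inverse forms are
  compared with the one at \<alpha>0 through the same weights.\<close>

lemma rss_diff_le:
  assumes ab: "0 < a" "a \<le> \<alpha>0" "\<alpha>0 \<le> b" and \<alpha>: "\<alpha> \<in> {a..b}" and \<beta>0: "\<beta>0 \<in> carrier_vec p" and W: "0 < W"
  defines "\<Lambda> \<equiv> (1 + (\<alpha>0 / a) powr (2 * \<nu> + CARD('d)) + (b / \<alpha>0) powr (2 * \<nu> + CARD('d))) *
    (2 * max 1 ((\<nu> + CARD('d) / 2) * b\<^sup>2))"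
    and "Q \<equiv> \<lambda>\<omega>. quad_form (minv (K \<alpha>0)) (xv \<omega>)"
  shows "\<bar>rss (D *\<^sub>v \<beta>0 + xv \<omega>) \<alpha> - Q \<omega>\<bar> \<le>
    \<Lambda> * (low_energy \<alpha>0 W (weights \<omega>) + Q \<omega> / W\<^sup>2) + fitted a (xv \<omega>) + b powr (2 * \<nu>) * quad_form \<Omega> \<beta>0"
proof -
  let ?y = "D *\<^sub>v \<beta>0 + xv \<omega>"
  define E where "E = low_energy \<alpha>0 W (weights \<omega>) + Q \<omega> / W\<^sup>2"
  define La where "La = (\<alpha>0 / a) powr (2 * \<nu> + CARD('d))"
  define Lb where "Lb = (b / \<alpha>0) powr (2 * \<nu> + CARD('d))"
  define c where "c = 2 * max 1 ((\<nu> + CARD('d) / 2) * b\<^sup>2)"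
  have b: "0 < b" using ab by simp
  have L: "0 < La" "0 < Lb" using ab by (auto simp: La_def Lb_def)
  have c: "0 < c" by (simp add: c_def)
  have \<Lambda>: "\<Lambda> = (1 + La + Lb) * c" by (simp add: \<Lambda>_def La_def Lb_def c_def)
  have y: "?y \<in> carrier_vec n" using D_carrier \<beta>0 by simp
  have Q: "Q \<omega> = quad_form (K \<alpha>0) (weights \<omega>)"
    unfolding Q_def weights_def by (rule quad_form_minv_conv[OF spd_K[OF \<alpha>0]]) simp
  have Q0: "0 \<le> Q \<omega>" unfolding Q by (rule quad_form_K_nonneg) simp
  have "0 \<le> low_energy \<alpha>0 W (weights \<omega>)"
    unfolding low_energy_def using less_imp_le[OF spec_dens_pos[OF \<nu> \<alpha>0]]
    by (intro integral_nonneg_AE AE_I2 mult_nonneg_nonneg divide_nonneg_nonneg) auto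
  then have E: "0 \<le> E" unfolding E_def using Q0 by simp
  have f0: "0 \<le> fitted a (xv \<omega>)"
    unfolding fitted_def
    by (rule spdD(4)[OF spd_minv_spd[OF spd_gram[OF ab(1)]]])
       (use D_carrier spd_minv(1)[OF spd_K[OF ab(1)]] in simp)
  have \<Omega>0: "0 \<le> b powr (2 * \<nu>) * quad_form \<Omega> \<beta>0" using quad_Omega_nonneg[OF \<beta>0] by simp
  have sm: "spec_dens \<nu> a \<xi> \<le> La * spec_dens \<nu> \<alpha>0 \<xi>" for \<xi> :: "real ^ 'd"
    using spec_dens_mono(2)[OF \<nu> ab(1,2), of \<xi>] by (simp add: La_def)
  \<comment> \<open>Upper end: \<open>K b\<close> lies below \<open>K \<alpha>0\<close>, the
    direction in which comparability is required and 1 + Lb is lost.\<close>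
  have "quad_form (minv (K b)) (xv \<omega>) - Q \<omega> \<le>
      (1 + Lb) * (quad_form (K \<alpha>0) (weights \<omega>) - quad_form (K b) (weights \<omega>))"
    unfolding Q_def weights_def
    by (rule quad_form_minv_diff_le_of_ge[OF spd_K[OF b] spd_K[OF \<alpha>0] xv_carrier L(2)])
       (use scaled_corr_mat_loewner[OF \<nu> \<alpha>0 ab(3)] in \<open>auto simp: Lb_def\<close>)
  also have "\<dots> \<le> (1 + Lb) * (c * 1 * E)"
    unfolding E_def Q c_def using L
    by (intro mult_left_mono quad_form_diff_le[OF \<alpha>0 ab(3) \<alpha>0 weights_carrier W]) auto
  also have "\<dots> \<le> \<Lambda> * E" unfolding \<Lambda> using E c L by (simp add: algebra_simps)
  finally have up: "quad_form (minv (K b)) (xv \<omega>) - Q \<omega> \<le> \<Lambda> * E" .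
  \<comment> \<open>Lower end: the inverse forms are compared with constant 1; the factor La comes
    from expressing the spectral density at a by the one at \<alpha>0.\<close>
  have "Q \<omega> - quad_form (minv (K a)) (xv \<omega>) \<le> quad_form (K a) (weights \<omega>) - quad_form (K \<alpha>0) (weights \<omega>)"
    unfolding Q_def weights_def by (rule quad_form_minv_diff_le_of_le[OF spd_K[OF ab(1)] spd_K[OF \<alpha>0] xv_carrier])
  also have "\<dots> \<le> 2 * max 1 ((\<nu> + CARD('d) / 2) * \<alpha>0\<^sup>2) * La * E"
    unfolding E_def Q
    by (intro quad_form_diff_le[OF ab(1,2) \<alpha>0 weights_carrier W] sm) (use L in simp)
  also have "\<dots> \<le> c * La * E"
  proof -
    have "\<alpha>0\<^sup>2 \<le> b\<^sup>2" using ab \<alpha>0 by (intro power_mono) auto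
    then have "(\<nu> + CARD('d) / 2) * \<alpha>0\<^sup>2 \<le> (\<nu> + CARD('d) / 2) * b\<^sup>2" using \<nu> by (intro mult_left_mono) auto
    then show ?thesis using E L unfolding c_def by (intro mult_right_mono) auto
  qed
  also have "\<dots> \<le> \<Lambda> * E" unfolding \<Lambda> using E c L by (simp add: algebra_simps)
  finally have lo: "Q \<omega> - quad_form (minv (K a)) (xv \<omega>) \<le> \<Lambda> * E" .
  have 1: "rss ?y \<alpha> \<le> rss ?y b" using \<alpha> ab by (intro rss_mono(1) y) auto
  have 2: "rss ?y a \<le> rss ?y \<alpha>" using \<alpha> ab by (intro rss_mono(1) y) auto
  have 3: "rss ?y b \<le> quad_form (minv (K b)) (xv \<omega>) + b powr (2 * \<nu>) * quad_form \<Omega> \<beta>0"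
    by (rule rss_upper[OF b xv_carrier \<beta>0])
  have 4: "quad_form (minv (K a)) (xv \<omega>) - fitted a (xv \<omega>) \<le> rss ?y a"
    by (rule rss_lower[OF ab(1) xv_carrier \<beta>0])
  show ?thesis using up lo 1 2 3 4 f0 \<Omega>0 unfolding E_def[symmetric] by (simp add: abs_le_iff)
qed

text \<open>Four exceptional events: concentration of the inverse form at \<alpha>0, the cosine
  energy, the sine energy, and the fit. The number 1728 is twice 864, and 2 n bounds the inverse
  form divided by \<theta>0 in the high-frequency remainder, as u \<le> 1.\<close>

lemma rss_uniform:
  fixes u r W a b :: real
  assumes d: "CARD('d) \<le> 3" and ab: "0 < a" "a \<le> \<alpha>0" "\<alpha>0 \<le> b" and u: "0 < u" "u \<le> 1"
    and r: "0 \<le> r" and W: "1 \<le> W" and p: "0 < p" and \<beta>0: "\<beta>0 \<in> carrier_vec p"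
  defines "\<Lambda> \<equiv> (1 + (\<alpha>0 / a) powr (2 * \<nu> + CARD('d)) + (b / \<alpha>0) powr (2 * \<nu> + CARD('d))) *
    (2 * max 1 ((\<nu> + CARD('d) / 2) * b\<^sup>2))"
  shows "\<exists>B\<in>sets M. measure M B \<le> 2 * exp (- (n * u\<^sup>2 / 16)) + 9 * exp (- r) \<and>
    (\<forall>\<omega>\<in>space M - B. \<forall>\<alpha>\<in>{a..b}. \<bar>rss (D *\<^sub>v \<beta>0 + xv \<omega>) \<alpha> - n * \<theta>0\<bar> \<le>
       \<theta>0 * (n * u + \<Lambda> * (1728 * C * W * r + 2 * n / W\<^sup>2) + 4 * p * r) + b powr (2 * \<nu>) * quad_form \<Omega> \<beta>0)"
proof -
  interpret prob_space M by (rule prob)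
  let ?Q = "\<lambda>\<omega>. quad_form (minv (K \<alpha>0)) (xv \<omega>)"
  define B1 where "B1 = {\<omega>\<in>space M. \<bar>?Q \<omega> / \<theta>0 - n\<bar> \<ge> n * u}"
  define B2 where "B2 = {\<omega>\<in>space M. partial_energy W (cos_vec n s) \<omega> \<ge> 864 * \<theta>0 * C * W * r}"
  define B3 where "B3 = {\<omega>\<in>space M. partial_energy W (sin_vec n s) \<omega> \<ge> 864 * \<theta>0 * C * W * r}"
  define B4 where "B4 = {\<omega>\<in>space M. fitted a (xv \<omega>) \<ge> 4 * \<theta>0 * p * r}"
  note q = quad_minv_concentration[OF u]
  note e = partial_energy_trig[OF d W r]
  note f = fitted_tail[OF ab(1,2) r p]
  note [measurable] = q(2) e(3,4) f(2)
  have B: "B1 \<in> sets M" "B2 \<in> sets M" "B3 \<in> sets M" "B4 \<in> sets M"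
    unfolding B1_def B2_def B3_def B4_def by measurable
  have \<Lambda>: "0 \<le> \<Lambda>" by (simp add: \<Lambda>_def)
  have "measure M (B1 \<union> B2 \<union> B3 \<union> B4) \<le> measure M B1 + measure M B2 + measure M B3 + measure M B4"
    using measure_Un_le[of "B1 \<union> B2 \<union> B3" M B4] measure_Un_le[of "B1 \<union> B2" M B3]
      measure_Un_le[of B1 M B2] B by simp
  also have "\<dots> \<le> 2 * exp (- (n * u\<^sup>2 / 16)) + 9 * exp (- r)"
    using q(1) e(1,2) f(1) by (simp add: B1_def B2_def B3_def B4_def)
  finally have m: "measure M (B1 \<union> B2 \<union> B3 \<union> B4) \<le> 2 * exp (- (n * u\<^sup>2 / 16)) + 9 * exp (- r)" .
  have "\<bar>rss (D *\<^sub>v \<beta>0 + xv \<omega>) \<alpha> - n * \<theta>0\<bar> \<le>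
       \<theta>0 * (n * u + \<Lambda> * (1728 * C * W * r + 2 * n / W\<^sup>2) + 4 * p * r) + b powr (2 * \<nu>) * quad_form \<Omega> \<beta>0"
    if \<omega>: "\<omega> \<in> space M - (B1 \<union> B2 \<union> B3 \<union> B4)" and \<alpha>: "\<alpha> \<in> {a..b}" for \<omega> \<alpha>
  proof -
    have 1: "\<bar>?Q \<omega> / \<theta>0 - n\<bar> < n * u" using \<omega> by (auto simp: B1_def)
    have 2: "partial_energy W (cos_vec n s) \<omega> < 864 * \<theta>0 * C * W * r" "partial_energy W (sin_vec n s) \<omega> < 864 * \<theta>0 * C * W * r"
      "fitted a (xv \<omega>) < 4 * \<theta>0 * p * r" using \<omega> by (auto simp: B2_def B3_def B4_def)
    have "\<bar>?Q \<omega> - n * \<theta>0\<bar> = \<theta>0 * \<bar>?Q \<omega> / \<theta>0 - n\<bar>"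
      using \<theta>0_pos by (simp add: abs_mult_pos' right_diff_distrib mult.commute)
    then have 3: "\<bar>?Q \<omega> - n * \<theta>0\<bar> \<le> \<theta>0 * (n * u)" using 1 \<theta>0_pos by simp
    have "n * u \<le> real n * 1" using u by (intro mult_left_mono) auto
    then have "\<theta>0 * (n * u) \<le> \<theta>0 * n" using \<theta>0_pos by (intro mult_left_mono) auto
    with 3 have "?Q \<omega> \<le> 2 * n * \<theta>0" by (simp add: abs_le_iff mult.commute)
    then have "?Q \<omega> / W\<^sup>2 \<le> 2 * n * \<theta>0 / W\<^sup>2" by (rule divide_right_mono) simp
    moreover have "low_energy \<alpha>0 W (weights \<omega>) \<le> \<theta>0 * (1728 * C * W * r)"
      using low_energy_le[of W \<omega>] 2(1,2) by (simp add: mult_ac)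
    ultimately have "low_energy \<alpha>0 W (weights \<omega>) + ?Q \<omega> / W\<^sup>2 \<le> \<theta>0 * (1728 * C * W * r + 2 * n / W\<^sup>2)"
      by (simp add: distrib_left mult_ac)
    then have 4: "\<Lambda> * (low_energy \<alpha>0 W (weights \<omega>) + ?Q \<omega> / W\<^sup>2) \<le> \<Lambda> * (\<theta>0 * (1728 * C * W * r + 2 * n / W\<^sup>2))"
      by (rule mult_left_mono[OF _ \<Lambda>])
    have 5: "\<bar>rss (D *\<^sub>v \<beta>0 + xv \<omega>) \<alpha> - ?Q \<omega>\<bar> \<le>
      \<Lambda> * (low_energy \<alpha>0 W (weights \<omega>) + ?Q \<omega> / W\<^sup>2) + fitted a (xv \<omega>) + b powr (2 * \<nu>) * quad_form \<Omega> \<beta>0"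
      unfolding \<Lambda>_def by (rule rss_diff_le[OF ab \<alpha> \<beta>0]) (use W in simp)
    have "\<theta>0 * (n * u + \<Lambda> * (1728 * C * W * r + 2 * n / W\<^sup>2) + 4 * p * r) =
      \<theta>0 * (n * u) + \<Lambda> * (\<theta>0 * (1728 * C * W * r + 2 * n / W\<^sup>2)) + 4 * \<theta>0 * p * r"
      by (simp add: algebra_simps)
    then show ?thesis using 2(3) 3 4 5 by linarith
  qed
  then show ?thesis using B m by (intro bexI[of _ "B1 \<union> B2 \<union> B3 \<union> B4"]) auto
qed

end

section \<open>Almost sure control along a sequence of designs\<close>

locale infill_regression =
  fixes T \<nu> \<sigma>0 \<alpha>0 \<theta>0 :: real and p :: nat and m :: "nat \<Rightarrow> real ^ 'd \<Rightarrow> real"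
    and \<beta>0 :: "real Matrix.vec" and \<Omega> :: "real Matrix.mat" and s :: "nat \<Rightarrow> nat \<Rightarrow> real ^ 'd"
    and M :: "'a measure" and X :: "real ^ 'd \<Rightarrow> 'a \<Rightarrow> real"
  assumes d: "CARD('d) \<le> 3" and T: "0 < T" and \<nu>: "0 < \<nu>" and p: "1 \<le> p" and \<sigma>0: "0 < \<sigma>0" and \<alpha>0: "0 < \<alpha>0"
    and \<beta>0: "\<beta>0 \<in> carrier_vec p" and \<theta>0: "\<theta>0 = \<sigma>0\<^sup>2 * \<alpha>0 powr (2 * \<nu>)"
    and gp: "centered_gp M (cube T) X (\<lambda>t u. \<sigma>0\<^sup>2 * matern \<nu> \<alpha>0 (t - u))"
    and s_cube: "\<And>n i. i < n \<Longrightarrow> s n i \<in> cube T" and inj: "\<And>n. inj_on (s n) {..<n}"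
    and \<Omega>: "sym_psd p \<Omega>" and rank: "\<And>n. p \<le> n \<Longrightarrow> vec_space.rank n (design_mat p m (s n) n) = p"
begin

definition obs :: "nat \<Rightarrow> 'a \<Rightarrow> real Matrix.vec" where
  "obs n \<omega> = design_mat p m (s n) n *\<^sub>v \<beta>0 + Matrix.vec n (\<lambda>i. X (s n i) \<omega>)"

abbreviation "\<delta> n \<equiv> real n powr (- 1 / 2) * ln (real n)"

abbreviation "dof n \<equiv> real n - real p"

lemma design_at: "p \<le> n \<Longrightarrow> design n p m \<Omega> \<nu> (s n)"
  by unfold_locales (use \<nu> inj \<Omega> rank in auto)

lemma obs_carrier: "obs n \<omega> \<in> carrier_vec n"
  unfolding obs_def using \<beta>0 by (intro add_carrier_vec mult_mat_vec_carrier[of _ n p]) (auto simp: design_mat_def)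

lemma \<theta>0_pos: "0 < \<theta>0" using \<sigma>0 \<alpha>0 by (simp add: \<theta>0)

text \<open>The evaluation bound holds with one constant for all n and all designs in the cube, so a
  single \<open>C\<close> is obtained before n is fixed.\<close>

lemma sampled_process_at:
  obtains C where "\<And>n. p \<le> n \<Longrightarrow> sampled_process n p m \<Omega> \<nu> (s n) M X T \<sigma>0 \<alpha>0 \<theta>0 C"
proof -
  obtain C where "0 < C" "\<And>n (s :: nat \<Rightarrow> real ^ 'd) v \<omega>. (\<forall>i<n. s i \<in> cube T) \<Longrightarrow> v \<in> carrier_vec n \<Longrightarrow>
      trig_power n s v \<omega> * spec_dens \<nu> \<alpha>0 \<omega> \<le> C * quad_form (scaled_corr_mat \<nu> s n \<alpha>0) v"
    using trig_poly_evaluation_bound[OF less_imp_le[OF T] \<nu> \<alpha>0, where ?'d = 'd] by blast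
  then have "sampled_process n p m \<Omega> \<nu> (s n) M X T \<sigma>0 \<alpha>0 \<theta>0 C" if "p \<le> n" for n
    by unfold_locales (use \<nu> inj \<Omega> rank that gp s_cube \<sigma>0 \<alpha>0 \<theta>0 in auto)
  then show ?thesis by (rule that)
qed

text \<open>Borel-Cantelli with exceptional probabilities of order 1 / n^2. Uniformity in \<alpha>
  is already inside the exceptional sets, so the range may grow with n as long as the comparison
  factor stays of order n^(1/8).\<close>

lemma rss_uniform_AE:
  assumes ab: "\<forall>\<^sub>F n in sequentially. 0 < a n \<and> a n \<le> \<alpha>0 \<and> \<alpha>0 \<le> b n"
    and growth: "\<forall>\<^sub>F n in sequentially.
      (1 + (\<alpha>0 / a n) powr (2 * \<nu> + CARD('d)) + (b n / \<alpha>0) powr (2 * \<nu> + CARD('d))) *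
      (2 * max 1 ((\<nu> + CARD('d) / 2) * (b n)\<^sup>2)) \<le> G * real n powr (1 / 8)"
  shows "AE \<omega> in M. \<forall>\<^sub>F n in sequentially. \<forall>\<alpha>\<in>{a n..b n}.
    \<bar>design.rss n p m \<Omega> \<nu> (s n) (obs n \<omega>) \<alpha> - n * \<theta>0\<bar> \<le> \<theta>0 * (sqrt n * ln n)"
proof -
  obtain C where sampled: "\<And>n. p \<le> n \<Longrightarrow> sampled_process n p m \<Omega> \<nu> (s n) M X T \<sigma>0 \<alpha>0 \<theta>0 C"
    using sampled_process_at by blast
  define \<Lambda> where "\<Lambda> n = (1 + (\<alpha>0 / a n) powr (2 * \<nu> + CARD('d)) + (b n / \<alpha>0) powr (2 * \<nu> + CARD('d))) *
      (2 * max 1 ((\<nu> + CARD('d) / 2) * (b n)\<^sup>2))" for n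
  note \<theta> = \<theta>0_pos
  \<comment> \<open>Makes n u^2 / 16 equal to 2 ln n, so that concentration fails with probability
    at most 2 / n^2; the choice of \<open>r\<close> below gives 9 / n^2 for the other three
    events.\<close>
  define u where "u n = sqrt (32 * ln (real n) / real n)" for n :: nat
  \<comment> \<open>Balances W against n / W^2: both are n^(1/3), and after the comparison factor
    and a logarithm still below sqrt n.\<close>
  define W where "W n = real n powr (1 / 3)" for n :: nat
  define r where "r n = 2 * ln (real n)" for n :: nat
  define A where "A = quad_form \<Omega> \<beta>0"
  have A: "0 \<le> A" using \<Omega> \<beta>0 by (auto simp: A_def sym_psd_def)
  define bad where "bad n B \<longleftrightarrow> B \<in> sets M \<and> measure M B \<le> 11 * (1 / real n ^ 2) \<and>
    (\<forall>\<omega>\<in>space M - B. \<forall>\<alpha>\<in>{a n..b n}.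
    \<bar>design.rss n p m \<Omega> \<nu> (s n) (obs n \<omega>) \<alpha> - n * \<theta>0\<bar> \<le> \<theta>0 * (sqrt n * ln n))" for n B
  have ev1: "\<forall>\<^sub>F n :: nat in sequentially. 0 < u n \<and> u n \<le> 1"
    unfolding u_def by (intro eventually_conj; real_asymp)
  have u2: "n * (u n)\<^sup>2 = 32 * ln n" if "n \<ge> 1" for n :: nat
    using that by (simp add: u_def)
  have ev2: "\<forall>\<^sub>F n :: nat in sequentially. \<theta>0 * (n * u n + (G * n powr (1/8)) * (1728 * C * W n * r n + 2 * n / (W n)\<^sup>2) +
      4 * p * r n) + (\<alpha>0 powr (2 * \<nu>) * (G * n powr (1/8))) * A \<le> \<theta>0 * (sqrt n * ln n)"
  proof -
    let ?g = "\<lambda>n :: nat. sqrt (real n) * ln (real n)"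
    let ?f1 = "\<lambda>n :: nat. real n powr (1/8) * (real n powr (1/3) * (2 * ln (real n)))"
    let ?f2 = "\<lambda>n :: nat. real n powr (1/8) * (real n / (real n powr (1/3))\<^sup>2)"
    let ?f3 = "\<lambda>n :: nat. 2 * ln (real n)" and ?f4 = "\<lambda>n :: nat. real n powr (1/8)"
    have o: "?f1 \<in> o(?g)" "?f2 \<in> o(?g)" "?f3 \<in> o(?g)" "?f4 \<in> o(?g)" by real_asymp+
    have cm: "(\<lambda>n. c * f n) \<in> o(?g)" if "f \<in> o(?g)" for c and f :: "nat \<Rightarrow> real"
      using that by (cases "c = 0") simp_all
    have s: "(\<lambda>n. (\<theta>0 * G * 1728 * C) * ?f1 n + (\<theta>0 * G * 2) * ?f2 n + (\<theta>0 * 4 * p) * ?f3 n +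
      (\<alpha>0 powr (2 * \<nu>) * G * A) * ?f4 n) \<in> o(?g)"
      by (intro sum_in_smallo cm o)
    \<comment> \<open>The concentration error, of order sqrt (n * ln n), dominates and is granted
      half of the allowance; all other terms share the second half.\<close>
    have u: "\<forall>\<^sub>F n :: nat in sequentially. n * sqrt (32 * ln (real n) / real n) \<le> 1 / 2 * ?g n" by real_asymp
    have "0 < \<theta>0 / 2" using \<theta> by simp
    from u landau_o.smallD[OF s this] eventually_ge_at_top[of 1] show ?thesis
    proof eventually_elim
      case (elim n)
      have 1: "\<theta>0 * (n * u n) \<le> \<theta>0 * (1 / 2 * ?g n)" using elim(1) \<theta> unfolding u_def by (intro mult_left_mono) auto
      have g: "norm (?g n) = ?g n" using elim(3) by simp
      define H where "H = (\<theta>0 * G * 1728 * C) * ?f1 n + (\<theta>0 * G * 2) * ?f2 n + (\<theta>0 * 4 * p) * ?f3 n +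
        (\<alpha>0 powr (2 * \<nu>) * G * A) * ?f4 n"
      have "\<bar>H\<bar> \<le> \<theta>0 / 2 * ?g n" using elim(2) unfolding g H_def by simp
      then have 2: "H \<le> \<theta>0 / 2 * ?g n" by linarith
      have "\<theta>0 * (n * u n + (G * n powr (1/8)) * (1728 * C * W n * r n + 2 * n / (W n)\<^sup>2) +
          4 * p * r n) + (\<alpha>0 powr (2 * \<nu>) * (G * n powr (1/8))) * A = \<theta>0 * (n * u n) + H"
        by (simp add: H_def W_def r_def distrib_left mult_ac)
      also have "\<dots> \<le> \<theta>0 * (1 / 2 * ?g n) + \<theta>0 / 2 * ?g n" using 1 2 by (rule add_mono)
      also have "\<dots> = \<theta>0 * ?g n" by simp
      finally show ?case .
    qed
  qed
  have ev: "\<forall>\<^sub>F n in sequentially. \<exists>B. bad n B"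
    using ev1 ev2 ab growth eventually_ge_at_top[of "max 1 p"]
  proof eventually_elim
    case (elim n)
    then have n: "1 \<le> n" "p \<le> n" by auto
    then interpret sampled_process n p m \<Omega> \<nu> "s n" M X T \<sigma>0 \<alpha>0 \<theta>0 C by (intro sampled)
    have W: "1 \<le> W n" using n by (simp add: W_def ge_one_powr_ge_zero)
    have r: "0 \<le> r n" using n by (simp add: r_def)
    have p0: "0 < p" using p by simp
    have e: "0 < a n" "a n \<le> \<alpha>0" "\<alpha>0 \<le> b n" "0 < u n" "u n \<le> 1" using elim by auto
    note R = rss_uniform[OF d e r W p0 \<beta>0, folded \<Lambda>_def]
    obtain B where B: "B \<in> sets M" "measure M B \<le> 2 * exp (- (n * (u n)\<^sup>2 / 16)) + 9 * exp (- r n)"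
      and *: "\<And>\<omega> \<alpha>. \<omega> \<in> space M - B \<Longrightarrow> \<alpha> \<in> {a n..b n} \<Longrightarrow> \<bar>rss (D *\<^sub>v \<beta>0 + xv \<omega>) \<alpha> - n * \<theta>0\<bar> \<le>
       \<theta>0 * (n * u n + \<Lambda> n * (1728 * C * W n * r n + 2 * n / (W n)\<^sup>2) + 4 * p * r n) + b n powr (2 * \<nu>) * quad_form \<Omega> \<beta>0"
      using R by (elim bexE conjE) blast
    have \<Lambda>': "\<Lambda> n \<le> G * real n powr (1/8)" using elim by (simp add: \<Lambda>_def)
    have "b n powr (2 * \<nu>) = \<alpha>0 powr (2 * \<nu>) * (b n / \<alpha>0) powr (2 * \<nu>)"
      using elim \<alpha>0 by (simp add: powr_divide)
    also have "\<dots> \<le> \<alpha>0 powr (2 * \<nu>) * (b n / \<alpha>0) powr (2 * \<nu> + CARD('d))"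
      using elim \<alpha>0 by (intro mult_left_mono powr_mono) auto
    also have "\<dots> \<le> \<alpha>0 powr (2 * \<nu>) * \<Lambda> n"
    proof (intro mult_left_mono)
      have "(b n / \<alpha>0) powr (2 * \<nu> + CARD('d)) * 1 \<le> \<Lambda> n"
        unfolding \<Lambda>_def by (intro mult_mono) auto
      then show "(b n / \<alpha>0) powr (2 * \<nu> + CARD('d)) \<le> \<Lambda> n" by simp
    qed simp
    also have "\<dots> \<le> \<alpha>0 powr (2 * \<nu>) * (G * real n powr (1/8))" using \<Lambda>' by (intro mult_left_mono) auto
    finally have bb: "b n powr (2 * \<nu>) * A \<le> (\<alpha>0 powr (2 * \<nu>) * (G * real n powr (1/8))) * A"
      using A by (rule mult_right_mono)
    have "\<theta>0 * (n * u n + \<Lambda> n * (1728 * C * W n * r n + 2 * n / (W n)\<^sup>2) + 4 * p * r n) \<le>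
      \<theta>0 * (n * u n + (G * n powr (1/8)) * (1728 * C * W n * r n + 2 * n / (W n)\<^sup>2) + 4 * p * r n)"
      using \<theta> \<Lambda>' C W r by (intro mult_left_mono add_mono mult_right_mono add_nonneg_nonneg) auto
    with bb elim have fin: "\<theta>0 * (n * u n + \<Lambda> n * (1728 * C * W n * r n + 2 * n / (W n)\<^sup>2) + 4 * p * r n) + b n powr (2 * \<nu>) * A
        \<le> \<theta>0 * (sqrt n * ln n)" by linarith
    have "exp (- (n * (u n)\<^sup>2 / 16)) = 1 / real n ^ 2" "exp (- r n) = 1 / real n ^ 2"
      using n unfolding u2[OF n(1)] r_def by (simp_all add: exp_minus exp_double inverse_eq_divide)
    then have mB: "measure M B \<le> 11 * (1 / real n ^ 2)" using B(2) by simp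
    have "bad n B" unfolding bad_def
    proof (intro conjI ballI)
      fix \<omega> \<alpha> assume "\<omega> \<in> space M - B" "\<alpha> \<in> {a n..b n}"
      from *[OF this] fin show "\<bar>rss (obs n \<omega>) \<alpha> - n * \<theta>0\<bar> \<le> \<theta>0 * (sqrt n * ln n)"
        by (simp add: A_def xv_def obs_def)
    qed (use B mB in auto)
    then show ?case by blast
  qed
  then obtain N where N: "\<And>n. n \<ge> N \<Longrightarrow> \<exists>B. bad n B" by (auto simp: eventually_sequentially)
  \<comment> \<open>Below \<open>N\<close> no exceptional set has been constructed; the empty set
    keeps the whole sequence measurable.\<close>
  define B where "B n = (if n \<ge> N then SOME B. bad n B else {})" for n
  have B: "bad n (B n)" if "n \<ge> N" for n
    using someI_ex[OF N[OF that]] that by (simp add: B_def)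
  have "prob_space M" using gp by (simp add: centered_gp_def gaussian_process_def)
  then interpret prob_space M .
  have "AE \<omega> in M. \<forall>\<^sub>F n in sequentially. \<omega> \<in> space M - B n"
  proof (rule borel_cantelli_AE1)
    show "B n \<in> sets M" for n using B[of n] by (cases "n \<ge> N") (auto simp: bad_def B_def)
    show "emeasure M (B n) < \<infinity>" for n by (simp add: emeasure_eq_measure)
    show "summable (\<lambda>n. measure M (B n))"
    proof (rule summable_comparison_test_ev)
      show "summable (\<lambda>n. 11 * (1 / real n ^ 2))"
        by (intro summable_mult inverse_power_summable[of 2, where ?'a = real, simplified inverse_eq_divide]) simp
      show "\<forall>\<^sub>F n in sequentially. norm (measure M (B n)) \<le> 11 * (1 / real n ^ 2)"
        using eventually_ge_at_top[of N] by eventually_elim (use B in \<open>auto simp: bad_def\<close>)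
    qed
  qed
  then show ?thesis
  proof (rule AE_mp, intro AE_I2 impI)
    fix \<omega> assume "\<forall>\<^sub>F n in sequentially. \<omega> \<in> space M - B n"
    with eventually_ge_at_top[of N] show "\<forall>\<^sub>F n in sequentially. \<forall>\<alpha>\<in>{a n..b n}.
    \<bar>design.rss n p m \<Omega> \<nu> (s n) (obs n \<omega>) \<alpha> - n * \<theta>0\<bar> \<le> \<theta>0 * (sqrt n * ln n)"
    proof eventually_elim
      case (elim n)
      with B[of n] show ?case unfolding bad_def by blast
    qed
  qed
qed

end

section \<open>Inverse gamma kernels\<close>

text \<open>The difference of the two sides has derivative (w - 1) (2 - w) / (2 w), which on (0, 2]
  has the sign of w - 1 or vanishes, so its minimum is the value 0 at w = 1.\<close>

lemma ln_le_minus_square: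
  fixes w :: real
  assumes "0 < w" "w \<le> 2"
  shows "(w - 1)\<^sup>2 / 4 \<le> w - 1 - ln w"
proof -
  define g where "g w = w - 1 - ln w - (w - 1)\<^sup>2 / 4" for w :: real
  have d: "(g has_real_derivative (w - 1) * (2 - w) / (2 * w)) (at w)" if "0 < w" for w
    unfolding g_def using that
    by (auto intro!: derivative_eq_intros simp: field_simps power2_eq_square)
  have "g 1 \<le> g w"
  proof (cases "1 \<le> w")
    case True
    show ?thesis
    proof (rule DERIV_nonneg_imp_nondecreasing[OF True])
      fix x assume "1 \<le> x" "x \<le> w"
      then show "\<exists>y. (g has_real_derivative y) (at x) \<and> 0 \<le> y"
        using assms by (intro exI[of _ "(x - 1) * (2 - x) / (2 * x)"] conjI d divide_nonneg_nonneg mult_nonneg_nonneg) auto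
    qed
  next
    case False
    show ?thesis
    proof (rule DERIV_nonpos_imp_nonincreasing[of w 1 g])
      fix x assume "w \<le> x" "x \<le> 1"
      then show "\<exists>y. (g has_real_derivative y) (at x) \<and> y \<le> 0"
        using assms by (intro exI[of _ "(x - 1) * (2 - x) / (2 * x)"] conjI d divide_nonpos_nonneg mult_nonpos_nonneg) auto
    qed (use False in simp)
  qed
  then show ?thesis by (simp add: g_def)
qed

text \<open>For large w a quadratic lower bound is false, since w - 1 - ln w grows only
  linearly.\<close>

lemma ln_le_minus_linear:
  fixes w :: real
  assumes "2 \<le> w"
  shows "(w - 1) / 4 \<le> w - 1 - ln w"
proof -
  have "ln (w / 2) \<le> w / 2 - 1" using assms by (intro ln_le_minus_one) auto
  then have "ln w \<le> w / 2 - 1 + ln 2" using assms by (simp add: ln_div)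
  moreover have "ln 2 \<le> (3 / 4 :: real)" using ln_le_minus_square[of 2] by simp
  ultimately show ?thesis using assms by (simp add: field_simps)
qed

text \<open>\<open>e\<close> will be the relative centring error and \<open>y\<close> a lower bound
  for the distance from 1. The condition 4 |e| \<le> y makes the second factor nonnegative, so the
  bound may be evaluated at \<open>y\<close> instead of the actual distance.\<close>

lemma perturbed_entropy_lower:
  fixes w e y :: real
  assumes w: "0 < w" and y: "y \<le> \<bar>w - 1\<bar>" "y \<le> 1" "4 * \<bar>e\<bar> \<le> y"
  shows "y * (y / 4 - \<bar>e\<bar>) \<le> w - 1 - ln w + e * (w - 1)"
proof -
  have e: "- (\<bar>e\<bar> * \<bar>w - 1\<bar>) \<le> e * (w - 1)" by (metis abs_ge_minus_self abs_mult minus_le_iff)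
  have y0: "0 \<le> y" using y by (smt (verit) abs_ge_zero)
  show ?thesis
  proof (cases "w \<le> 2")
    case True
    have "y * (y / 4 - \<bar>e\<bar>) \<le> \<bar>w - 1\<bar> * (\<bar>w - 1\<bar> / 4 - \<bar>e\<bar>)"
      using y y0 by (intro mult_mono) auto
    also have "\<dots> = (w - 1)\<^sup>2 / 4 - \<bar>e\<bar> * \<bar>w - 1\<bar>"
      by (simp add: right_diff_distrib power2_eq_square mult.commute flip: abs_mult)
    also have "\<dots> \<le> w - 1 - ln w + e * (w - 1)" using ln_le_minus_square[OF w True] e by simp
    finally show ?thesis .
  next
    case False
    have "y * (y / 4 - \<bar>e\<bar>) \<le> (w - 1) * (1 / 4 - \<bar>e\<bar>)"
      using y y0 False by (intro mult_mono) auto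
    also have "\<dots> = (w - 1) / 4 - \<bar>e\<bar> * \<bar>w - 1\<bar>" using False by (simp add: algebra_simps)
    also have "\<dots> \<le> w - 1 - ln w + e * (w - 1)" using ln_le_minus_linear[of w] False e by argo
    finally show ?thesis .
  qed
qed

section \<open>The inverse gamma kernel in \<theta>\<close>

definition kern :: "real \<Rightarrow> real \<Rightarrow> real \<Rightarrow> real" where
  "kern N S \<theta> = \<theta> powr (- (N / 2)) * exp (- S / (2 * \<theta>))"

lemma kern_nonneg [simp]: "0 \<le> kern N S \<theta>" by (simp add: kern_def)

lemma kern_pos: "0 < \<theta> \<Longrightarrow> 0 < kern N S \<theta>" by (simp add: kern_def)

lemma kern_measurable [measurable]: "kern N S \<in> borel_measurable borel"
  unfolding kern_def by measurable

text \<open>With w = \<theta>0 / \<theta> the logarithm of the ratio is - N/2 times w - 1 - ln w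
  plus a linear term whose slope is the relative centring error.\<close>

lemma kern_ratio:
  assumes "0 < N" "0 < \<theta>0" "0 < \<theta>"
  shows "kern N S \<theta> = kern N S \<theta>0 *
    exp (- (N / 2 * (\<theta>0 / \<theta> - 1 - ln (\<theta>0 / \<theta>) + (S / (N * \<theta>0) - 1) * (\<theta>0 / \<theta> - 1))))"
proof -
  have "- (N / 2) * ln \<theta> + - S / (2 * \<theta>) = - (N / 2) * ln \<theta>0 + - S / (2 * \<theta>0) +
    - (N / 2 * (\<theta>0 / \<theta> - 1 - ln (\<theta>0 / \<theta>) + (S / (N * \<theta>0) - 1) * (\<theta>0 / \<theta> - 1)))"
    using assms by (simp add: ln_div field_simps)
  then show ?thesis using assms unfolding kern_def powr_def by (simp flip: exp_add)
qed

text \<open>The kernel peaks at \<theta> = S / N; the bound is ln x \<le> x - 1 at x = S / (N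
  \<theta>).\<close>

lemma kern_le_max:
  assumes N: "0 < N" and S: "0 < S" and \<theta>: "0 < \<theta>"
  shows "kern N S \<theta> \<le> (N / S) powr (N / 2) * exp (- (N / 2))"
proof -
  have "ln (S / (N * \<theta>)) \<le> S / (N * \<theta>) - 1" using assms by (intro ln_le_minus_one) auto
  then have "N / 2 * ln (S / (N * \<theta>)) \<le> N / 2 * (S / (N * \<theta>) - 1)" using N by (intro mult_left_mono) auto
  then have "- (N / 2) * ln \<theta> + - S / (2 * \<theta>) \<le> N / 2 * ln (N / S) + - (N / 2)"
    using assms by (simp add: ln_div ln_mult right_diff_distrib distrib_left)
  then show ?thesis using assms unfolding kern_def powr_def by (simp flip: exp_add)
qed

text \<open>To the right of \<theta>0 the exponential factor only grows, and over a relative step 1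
  / N the power loses at most exp (- 1/2).\<close>

lemma kern_lower:
  assumes N: "1 \<le> N" and \<theta>0: "0 < \<theta>0" and S: "0 \<le> S" and \<theta>: "\<theta>0 \<le> \<theta>" "\<theta> \<le> \<theta>0 * (1 + 1 / N)"
  shows "kern N S \<theta>0 * exp (- (1 / 2)) \<le> kern N S \<theta>"
proof -
  have "ln (\<theta> / \<theta>0) \<le> \<theta> / \<theta>0 - 1" using \<theta>0 \<theta> by (intro ln_le_minus_one) auto
  also have "\<dots> \<le> 1 / N" using \<theta> \<theta>0 by (simp add: field_simps)
  finally have "N / 2 * ln (\<theta> / \<theta>0) \<le> N / 2 * (1 / N)" using N by (intro mult_left_mono) auto
  then have 1: "- (N / 2) * ln \<theta>0 + - (1 / 2) \<le> - (N / 2) * ln \<theta>" using N \<theta>0 \<theta> by (simp add: ln_div right_diff_distrib)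
  have "S / (2 * \<theta>) \<le> S / (2 * \<theta>0)" using S \<theta>0 \<theta> by (intro divide_left_mono) auto
  with 1 show ?thesis using \<theta>0 \<theta> unfolding kern_def powr_def by (simp flip: exp_add)
qed

text \<open>A relative distance above 7 \<delta> for \<theta> becomes at least 13/2 \<delta> for w =
  \<theta>0 / \<theta>, as \<delta> \<le> 1/100. Since 13/8 - 11/10 = 21/40, the entropy bound gives
  13/2 * 21/40 \<ge> 3 times \<delta>^2. Outside (\<theta>0 / 2, 2 \<theta>0) the distance is at
  least 1/2 and the rate is linear in N.\<close>

lemma kern_upper:
  assumes \<theta>0: "0 < \<theta>0" and N: "0 < N" and \<delta>: "0 < \<delta>" "\<delta> \<le> 1 / 100"
    and S: "\<bar>S - N * \<theta>0\<bar> \<le> 11 / 10 * \<delta> * (N * \<theta>0)" and \<theta>: "0 < \<theta>"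
  shows "\<bar>\<theta> / \<theta>0 - 1\<bar> > 7 * \<delta> \<Longrightarrow> kern N S \<theta> \<le> kern N S \<theta>0 * exp (- (3 / 2 * N * \<delta>\<^sup>2))"
    "\<theta> \<notin> {\<theta>0 / 2<..<2 * \<theta>0} \<Longrightarrow> kern N S \<theta> \<le> kern N S \<theta>0 * exp (- (N / 64))"
proof -
  define e where "e = S / (N * \<theta>0) - 1"
  have "e = (S - N * \<theta>0) / (N * \<theta>0)" using N \<theta>0 by (simp add: e_def diff_divide_distrib)
  then have "\<bar>e\<bar> = \<bar>S - N * \<theta>0\<bar> / (N * \<theta>0)" using N \<theta>0 by simp
  then have e: "\<bar>e\<bar> \<le> 11 / 10 * \<delta>" using S N \<theta>0 by (simp add: pos_divide_le_eq)
  define w where "w = \<theta>0 / \<theta>"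
  have w: "0 < w" using \<theta> \<theta>0 by (simp add: w_def)
  have red: "kern N S \<theta> \<le> kern N S \<theta>0 * exp (- (N / 2 * z))"
    if "z \<le> w - 1 - ln w + e * (w - 1)" for z
  proof -
    have "N / 2 * z \<le> N / 2 * (w - 1 - ln w + e * (w - 1))" using that N by (intro mult_left_mono) auto
    then show ?thesis
      unfolding kern_ratio[OF N \<theta>0 \<theta>] w_def[symmetric] e_def[symmetric]
      by (intro mult_left_mono) auto
  qed
  show "kern N S \<theta> \<le> kern N S \<theta>0 * exp (- (3 / 2 * N * \<delta>\<^sup>2))" if t: "\<bar>\<theta> / \<theta>0 - 1\<bar> > 7 * \<delta>"
  proof -
    have 1: "13 / 2 * \<delta> \<le> \<bar>w - 1\<bar>"
    proof (cases "\<theta>0 \<le> \<theta>")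
      case True
      then have "1 \<le> \<theta> / \<theta>0" using \<theta>0 by simp
      with t have "1 + 7 * \<delta> \<le> \<theta> / \<theta>0" by simp
      then have "\<theta>0 * (1 + 7 * \<delta>) \<le> \<theta>" using \<theta>0 by (simp add: pos_le_divide_eq mult.commute)
      then have "w \<le> \<theta>0 / (\<theta>0 * (1 + 7 * \<delta>))" unfolding w_def using \<theta>0 \<delta> \<theta> by (intro divide_left_mono) auto
      then have "w \<le> 1 / (1 + 7 * \<delta>)" using \<theta>0 by simp
      moreover have "1 / (1 + 7 * \<delta>) \<le> 1 - 13 / 2 * \<delta>"
      proof -
        have "\<delta> * (13 / 2 * 7 * \<delta>) \<le> \<delta> * (1 / 2)" using \<delta> by (intro mult_left_mono) auto
        then have "1 \<le> (1 - 13 / 2 * \<delta>) * (1 + 7 * \<delta>)" by (simp add: algebra_simps)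
        then show ?thesis using \<delta> by (simp add: pos_divide_le_eq)
      qed
      ultimately show ?thesis by linarith
    next
      case False
      then have t1: "\<theta> / \<theta>0 < 1" using \<theta>0 by simp
      with t have "7 * \<delta> < 1 - \<theta> / \<theta>0" by simp
      \<comment> \<open>By w + 1 / w \<ge> 2: left of \<theta>0 the reciprocal deviates at least as
        much as the ratio itself.\<close>
      moreover have "1 - \<theta> / \<theta>0 \<le> w - 1"
      proof -
        have "2 \<le> z + 1 / z" if "0 < z" for z :: real
        proof -
          have "0 \<le> (z - 1)\<^sup>2 / z" using that by simp
          then show ?thesis using that by (simp add: power2_diff field_simps power2_eq_square)
        qed
        from this[of w] show ?thesis using w by (simp add: w_def)
      qed
      ultimately show ?thesis using \<delta> by linarith
    qed
    have "3 * \<delta>\<^sup>2 \<le> 13 / 2 * \<delta> * (13 / 2 * \<delta> / 4 - \<bar>e\<bar>)"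
    proof -
      have "13 / 2 * \<delta> * (21 / 40 * \<delta>) \<le> 13 / 2 * \<delta> * (13 / 2 * \<delta> / 4 - \<bar>e\<bar>)"
        using e \<delta> by (intro mult_left_mono) auto
      moreover have "3 * \<delta>\<^sup>2 \<le> 13 / 2 * \<delta> * (21 / 40 * \<delta>)" by (simp add: power2_eq_square)
      ultimately show ?thesis by linarith
    qed
    also have "\<dots> \<le> w - 1 - ln w + e * (w - 1)"
      by (rule perturbed_entropy_lower[OF w 1]) (use e \<delta> in auto)
    finally have "kern N S \<theta> \<le> kern N S \<theta>0 * exp (- (N / 2 * (3 * \<delta>\<^sup>2)))" by (rule red)
    then show ?thesis by (simp add: mult_ac)
  qed
  show "kern N S \<theta> \<le> kern N S \<theta>0 * exp (- (N / 64))" if t: "\<theta> \<notin> {\<theta>0 / 2<..<2 * \<theta>0}"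
  proof -
    have 1: "1 / 2 \<le> \<bar>w - 1\<bar>"
    proof (cases "\<theta> \<le> \<theta>0 / 2")
      case True
      then have "2 \<le> w" using \<theta> by (simp add: w_def field_simps)
      then show ?thesis by simp
    next
      case False
      with t have "w \<le> 1 / 2" using \<theta> by (simp add: w_def field_simps)
      then show ?thesis by simp
    qed
    have "1 / 32 \<le> 1 / 2 * (1 / 2 / 4 - \<bar>e\<bar>)" using e \<delta> by simp
    also have "\<dots> \<le> w - 1 - ln w + e * (w - 1)"
      by (rule perturbed_entropy_lower[OF w 1]) (use e \<delta> in auto)
    finally have "kern N S \<theta> \<le> kern N S \<theta>0 * exp (- (N / 2 * (1 / 32)))" by (rule red)
    then show ?thesis by simp
  qed
qed

text \<open>Bounds the normaliser below by the interval of length \<theta>0 / N to the right of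
  \<theta>0, where the kernel and the prior stay comparable to their values at \<theta>0.\<close>

lemma kern_prior_mass:
  assumes \<theta>0: "0 < \<theta>0" and N: "1 \<le> N" and S: "0 \<le> S" and c: "0 \<le> c"
    and low: "\<And>\<theta>. \<theta> \<in> {\<theta>0..\<theta>0 * (1 + 1 / N)} \<Longrightarrow> c \<le> pr \<theta>"
  shows "ennreal (kern N S \<theta>0 * exp (- (1 / 2)) * c * (\<theta>0 / N)) \<le>
    (\<integral>\<^sup>+\<theta>. indicator {0<..} \<theta> * ennreal (kern N S \<theta> * pr \<theta>) \<partial>lborel)"
proof -
  define L where "L = kern N S \<theta>0 * exp (- (1 / 2)) * c"
  have L: "0 \<le> L" using c by (simp add: L_def)
  have "\<theta>0 * (1 + 1 / N) - \<theta>0 = \<theta>0 / N" using N by (simp add: field_simps)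
  moreover have "\<theta>0 \<le> \<theta>0 * (1 + 1 / N)" using \<theta>0 N by simp
  ultimately have "emeasure lborel {\<theta>0..\<theta>0 * (1 + 1 / N)} = ennreal (\<theta>0 / N)" by simp
  then have "ennreal (L * (\<theta>0 / N)) = (\<integral>\<^sup>+\<theta>. ennreal L * indicator {\<theta>0..\<theta>0 * (1 + 1 / N)} \<theta> \<partial>lborel)"
    using L by (simp add: nn_integral_cmult_indicator del: times_divide_eq_right) (rule ennreal_mult', simp)
  also have "\<dots> \<le> (\<integral>\<^sup>+\<theta>. indicator {0<..} \<theta> * ennreal (kern N S \<theta> * pr \<theta>) \<partial>lborel)"
  proof (rule nn_integral_mono)
    fix \<theta>
    show "ennreal L * indicator {\<theta>0..\<theta>0 * (1 + 1 / N)} \<theta> \<le> indicator {0<..} \<theta> * ennreal (kern N S \<theta> * pr \<theta>)"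
    proof (cases "\<theta> \<in> {\<theta>0..\<theta>0 * (1 + 1 / N)}")
      case True
      have "L \<le> kern N S \<theta> * pr \<theta>"
        unfolding L_def using True low[OF True] c
        by (intro mult_mono kern_lower[OF N \<theta>0 S]) auto
      moreover have "0 < \<theta>" using True \<theta>0 by simp
      ultimately show ?thesis using True by (simp add: ennreal_leI)
    qed simp
  qed
  finally show ?thesis by (simp add: L_def)
qed

text \<open>The bad set is split at (\<theta>0 / 2, 2 \<theta>0). Inside, the prior is bounded by
  \<open>R\<close> times its value at \<theta>0 and the kernel has dropped by exp (- 3/2 N
  \<delta>^2). Outside, only the total mass of the prior is available, but the kernel is
  exponentially small in N; hence \<open>pr \<theta>0\<close> cancels in the first term and remains
  in the second.\<close>

lemma kern_contraction:
  assumes \<theta>0: "0 < \<theta>0" and N: "1 \<le> N" and \<delta>: "0 < \<delta>" "\<delta> \<le> 1 / 100"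
    and S: "\<bar>S - N * \<theta>0\<bar> \<le> 11 / 10 * \<delta> * (N * \<theta>0)"
    and pr0: "\<And>\<theta>. 0 < \<theta> \<Longrightarrow> 0 \<le> pr \<theta>"
    and prm: "(\<lambda>\<theta>. indicator {0<..} \<theta> * ennreal (pr \<theta>)) \<in> borel_measurable borel"
    and pr1: "(\<integral>\<^sup>+\<theta>. indicator {0<..} \<theta> * ennreal (pr \<theta>) \<partial>lborel) \<le> 1"
    and prt: "0 < pr \<theta>0" and \<rho>: "0 < \<rho>" and R: "0 \<le> R"
    and low: "\<And>\<theta>. \<theta> \<in> {\<theta>0..\<theta>0 * (1 + 1 / N)} \<Longrightarrow> \<rho> * pr \<theta>0 \<le> pr \<theta>"
    and up: "\<And>\<theta>. \<theta> \<in> {\<theta>0 / 2<..<2 * \<theta>0} \<Longrightarrow> pr \<theta> \<le> R * pr \<theta>0"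
  shows "(\<integral>\<^sup>+\<theta>. indicator {\<theta>. 0 < \<theta> \<and> \<bar>\<theta> / \<theta>0 - 1\<bar> > 7 * \<delta>} \<theta> * ennreal (kern N S \<theta> * pr \<theta>) \<partial>lborel) \<le>
    ennreal ((exp (- (3 / 2 * N * \<delta>\<^sup>2)) * R * (3 / 2 * \<theta>0) + exp (- (N / 64)) / pr \<theta>0) * (N * exp (1 / 2) / (\<theta>0 * \<rho>))) *
    (\<integral>\<^sup>+\<theta>. indicator {0<..} \<theta> * ennreal (kern N S \<theta> * pr \<theta>) \<partial>lborel)"
proof -
  let ?B = "{\<theta>. 0 < \<theta> \<and> \<bar>\<theta> / \<theta>0 - 1\<bar> > 7 * \<delta>}" and ?I = "{\<theta>0 / 2<..<2 * \<theta>0}"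
  define k where "k = kern N S \<theta>0"
  have k: "0 < k" unfolding k_def by (rule kern_pos[OF \<theta>0])
  have N0: "0 < N" using N by simp
  define A1 where "A1 = k * exp (- (3 / 2 * N * \<delta>\<^sup>2)) * (R * pr \<theta>0)"
  define A2 where "A2 = k * exp (- (N / 64))"
  have A: "0 \<le> A1" "0 \<le> A2" using k R prt by (auto simp: A1_def A2_def)
  have "(\<integral>\<^sup>+\<theta>. indicator ?B \<theta> * ennreal (kern N S \<theta> * pr \<theta>) \<partial>lborel) \<le>
     (\<integral>\<^sup>+\<theta>. ennreal A1 * indicator ?I \<theta> + ennreal A2 * (indicator {0<..} \<theta> * ennreal (pr \<theta>)) \<partial>lborel)"
  proof (rule nn_integral_mono)
    fix \<theta>
    show "indicator ?B \<theta> * ennreal (kern N S \<theta> * pr \<theta>) \<le>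
      ennreal A1 * indicator ?I \<theta> + ennreal A2 * (indicator {0<..} \<theta> * ennreal (pr \<theta>))"
    proof (cases "\<theta> \<in> ?B")
      case True
      then have \<theta>: "0 < \<theta>" "\<bar>\<theta> / \<theta>0 - 1\<bar> > 7 * \<delta>" by auto
      note u = kern_upper[OF \<theta>0 N0 \<delta> S \<theta>(1)]
      show ?thesis
      proof (cases "\<theta> \<in> ?I")
        case I: True
        have "kern N S \<theta> * pr \<theta> \<le> A1"
          unfolding A1_def k_def using u(1)[OF \<theta>(2)] up[OF I] pr0[OF \<theta>(1)] by (intro mult_mono) auto
        then have "ennreal (kern N S \<theta> * pr \<theta>) \<le> ennreal A1" by (rule ennreal_leI)
        then show ?thesis using True I by (simp add: add_increasing2)
      next
        case I: False
        have "kern N S \<theta> * pr \<theta> \<le> A2 * pr \<theta>"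
          unfolding A2_def k_def using u(2)[OF I] pr0[OF \<theta>(1)] by (intro mult_right_mono) auto
        then have "ennreal (kern N S \<theta> * pr \<theta>) \<le> ennreal A2 * ennreal (pr \<theta>)"
          using A by (simp add: ennreal_leI flip: ennreal_mult')
        then show ?thesis using True I \<theta>(1) by simp
      qed
    qed simp
  qed
  also have "\<dots> = ennreal A1 * emeasure lborel ?I + ennreal A2 * (\<integral>\<^sup>+\<theta>. indicator {0<..} \<theta> * ennreal (pr \<theta>) \<partial>lborel)"
    using prm by (subst nn_integral_add) (auto simp: nn_integral_cmult nn_integral_cmult_indicator)
  also have "\<dots> \<le> ennreal A1 * ennreal (3 / 2 * \<theta>0) + ennreal A2 * 1"
    using \<theta>0 by (intro add_mono mult_left_mono pr1) auto
  also have "\<dots> = ennreal (A1 * (3 / 2 * \<theta>0) + A2)"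
    using A \<theta>0 by (simp only: mult_1_right) (simp add: ennreal_mult'[OF A(1)] ennreal_plus del: times_divide_eq_right times_divide_eq_left)
  also have "A1 * (3 / 2 * \<theta>0) + A2 =
     ((exp (- (3 / 2 * N * \<delta>\<^sup>2)) * R * (3 / 2 * \<theta>0) + exp (- (N / 64)) / pr \<theta>0) * (N * exp (1 / 2) / (\<theta>0 * \<rho>))) *
     (k * exp (- (1 / 2)) * (\<rho> * pr \<theta>0) * (\<theta>0 / N))" (is "_ = ?\<eta> * ?L")
    using N0 \<theta>0 \<rho> prt by (simp add: A1_def A2_def field_simps exp_minus)
  also have "ennreal (?\<eta> * ?L) = ennreal ?\<eta> * ennreal ?L"
    using N0 \<theta>0 \<rho> prt R by (intro ennreal_mult') auto
  also have "\<dots> \<le> ennreal ?\<eta> * (\<integral>\<^sup>+\<theta>. indicator {0<..} \<theta> * ennreal (kern N S \<theta> * pr \<theta>) \<partial>lborel)"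
    unfolding k_def
  proof (intro mult_left_mono kern_prior_mass[OF \<theta>0 N _ _ low])
    have "11 / 10 * \<delta> * (N * \<theta>0) \<le> 1 * (N * \<theta>0)" using \<delta> N0 \<theta>0 by (intro mult_right_mono) auto
    then show "0 \<le> S" using S abs_ge_minus_self[of "S - N * \<theta>0"] by linarith
  qed (use \<rho> prt in auto)
  finally show ?thesis .
qed

section \<open>Normalised densities and joint measurability\<close>

lemma prob_space_density_proportional:
  assumes f: "f \<in> borel_measurable borel" and Z: "(\<integral>\<^sup>+x. f x \<partial>lborel) \<noteq> 0" "(\<integral>\<^sup>+x. f x \<partial>lborel) \<noteq> \<infinity>"
  shows "prob_space (density_proportional f)"
proof (rule prob_spaceI)
  note [measurable] = f
  have "emeasure (density_proportional f) (space (density_proportional f)) =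
      (\<integral>\<^sup>+x. f x / (\<integral>\<^sup>+z. f z \<partial>lborel) \<partial>lborel)"
    unfolding density_proportional_def by (subst emeasure_density) auto
  also have "\<dots> = (\<integral>\<^sup>+x. f x \<partial>lborel) / (\<integral>\<^sup>+z. f z \<partial>lborel)"
    by (rule nn_integral_divide) simp
  also have "\<dots> = 1" using Z by (intro ennreal_divide_self) (auto simp: top.not_eq_extremum)
  finally show "emeasure (density_proportional f) (space (density_proportional f)) = 1" .
qed

lemma measure_density_proportional_le:
  assumes f: "f \<in> borel_measurable borel" and Z: "(\<integral>\<^sup>+x. f x \<partial>lborel) \<noteq> 0" "(\<integral>\<^sup>+x. f x \<partial>lborel) \<noteq> \<infinity>"
    and B: "B \<in> sets borel" and \<epsilon>: "0 \<le> \<epsilon>"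
    and le: "(\<integral>\<^sup>+x. f x * indicator B x \<partial>lborel) \<le> ennreal \<epsilon> * (\<integral>\<^sup>+x. f x \<partial>lborel)"
  shows "measure (density_proportional f) B \<le> \<epsilon>"
proof -
  note [measurable] = f B
  let ?Z = "\<integral>\<^sup>+x. f x \<partial>lborel"
  have "emeasure (density_proportional f) B = (\<integral>\<^sup>+x. f x / ?Z * indicator B x \<partial>lborel)"
    unfolding density_proportional_def by (subst emeasure_density) auto
  also have "\<dots> = (\<integral>\<^sup>+x. (f x * indicator B x) / ?Z \<partial>lborel)"
    by (intro nn_integral_cong) (auto simp: indicator_def)
  also have "\<dots> = (\<integral>\<^sup>+x. f x * indicator B x \<partial>lborel) / ?Z"
    by (rule nn_integral_divide) simp
  also have "\<dots> \<le> (ennreal \<epsilon> * ?Z) / ?Z" using le by (rule divide_right_mono_ennreal)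
  also have "\<dots> = ennreal \<epsilon>" using Z by (simp add: ennreal_mult_divide_eq)
  finally show ?thesis using \<epsilon> unfolding measure_def by (simp add: enn2real_leI)
qed

text \<open>Rounding \<alpha> to multiples of 1 / (k + 1) leaves countably many measurable pieces,
  and continuity in \<alpha> recovers the function in the limit. Rounding upwards keeps the argument
  positive.\<close>

lemma caratheodory_measurable:
  fixes f :: "real \<Rightarrow> real \<Rightarrow> real"
  assumes m: "\<And>\<alpha>. 0 < \<alpha> \<Longrightarrow> continuous_on {0<..} (\<lambda>\<theta>. f \<theta> \<alpha>)"
    and c: "\<And>\<theta>. 0 < \<theta> \<Longrightarrow> continuous_on {0<..} (f \<theta>)"
  shows "(\<lambda>(\<theta>, \<alpha>). indicator ({0<..} \<times> {0<..}) (\<theta>, \<alpha>) * f \<theta> \<alpha>) \<in> borel_measurable borel"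
proof -
  define h where "h k = (\<lambda>(\<theta>, \<alpha>). indicator ({0<..} \<times> {0<..}) (\<theta>, \<alpha>) * f \<theta> (real_of_int \<lceil>real (Suc k) * \<alpha>\<rceil> / real (Suc k)))" for k
  have "(\<lambda>z. indicator ({0<..} \<times> {0<..}) z * f (fst z) (snd z)) \<in> borel_measurable (borel :: (real \<times> real) measure)"
  proof (rule borel_measurable_LIMSEQ_real)
    fix k
    have m': "(\<lambda>z. indicator ({0<..} \<times> {0<..}) z * f (fst z) (real_of_int j / real (Suc k))) \<in> borel_measurable (borel :: (real \<times> real) measure)"
      (is "?g j \<in> _") if "0 < j" for j :: int
    proof -
      have "(\<lambda>\<theta>. indicator {0<..} \<theta> *\<^sub>R f \<theta> (real_of_int j / real (Suc k))) \<in> borel_measurable borel"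
        using m[of "real_of_int j / real (Suc k)"] that
        by (intro borel_measurable_continuous_on_indicator) auto
      then have "(\<lambda>z. indicator {0<..} (fst z) *\<^sub>R f (fst z) (real_of_int j / real (Suc k))) \<in> borel_measurable (borel :: (real \<times> real) measure)"
        by (subst borel_prod[symmetric], rule measurable_compose[OF measurable_fst])
      moreover have "(\<lambda>z. indicator {0<..} (snd z) :: real) \<in> borel_measurable (borel :: (real \<times> real) measure)"
        unfolding borel_prod[symmetric] by measurable
      ultimately have "(\<lambda>z. indicator {0<..} (snd z) * (indicator {0<..} (fst z) *\<^sub>R f (fst z) (real_of_int j / real (Suc k)))) \<in> borel_measurable (borel :: (real \<times> real) measure)"
        by (intro borel_measurable_times)
      also have "(\<lambda>z. indicator {0<..} (snd z) * (indicator {0<..} (fst z) *\<^sub>R f (fst z) (real_of_int j / real (Suc k)))) = ?g j"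
        by (auto simp: indicator_def split: if_splits)
      finally show ?thesis .
    qed
    define G where "G j z = (if 0 < j then indicator ({0<..} \<times> {0<..}) z * f (fst z) (real_of_int j / real (Suc k)) else 0)" for j :: int and z :: "real \<times> real"
    have "G j \<in> borel_measurable borel" for j using m' by (cases "0 < j") (simp_all add: G_def[abs_def])
    moreover have "(\<lambda>z :: real \<times> real. \<lceil>real (Suc k) * snd z\<rceil>) \<in> borel \<rightarrow>\<^sub>M count_space UNIV"
      unfolding borel_prod[symmetric] by measurable
    ultimately have "(\<lambda>z. G \<lceil>real (Suc k) * snd z\<rceil> z) \<in> borel_measurable borel"
      by (rule measurable_compose_countable)
    also have "(\<lambda>z. G \<lceil>real (Suc k) * snd z\<rceil> z) = h k"
      by (auto simp: G_def h_def fun_eq_iff indicator_def)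
    finally show "h k \<in> borel_measurable borel" .
  next
    fix z :: "real \<times> real"
    obtain \<theta> \<alpha> where z: "z = (\<theta>, \<alpha>)" by (cases z)
    show "(\<lambda>k. h k z) \<longlonglongrightarrow> indicator ({0<..} \<times> {0<..}) z * f (fst z) (snd z)"
    proof (cases "0 < \<theta> \<and> 0 < \<alpha>")
      case True
      have lim: "(\<lambda>k. real_of_int \<lceil>real (Suc k) * \<alpha>\<rceil> / real (Suc k)) \<longlonglongrightarrow> \<alpha>"
      proof (rule tendsto_sandwich[of "\<lambda>_. \<alpha>" _ _ "\<lambda>k. \<alpha> + 1 / real (Suc k)"])
        show "(\<lambda>k. \<alpha> + 1 / real (Suc k)) \<longlonglongrightarrow> \<alpha>"
          using tendsto_add[OF tendsto_const LIMSEQ_inverse_real_of_nat, of \<alpha>] by (simp add: inverse_eq_divide)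
        have "\<alpha> \<le> real_of_int \<lceil>real (Suc k) * \<alpha>\<rceil> / real (Suc k)" for k
          using le_of_int_ceiling[of "real (Suc k) * \<alpha>"] by (simp add: pos_le_divide_eq mult.commute del: of_nat_Suc)
        then show "\<forall>\<^sub>F k in sequentially. \<alpha> \<le> real_of_int \<lceil>real (Suc k) * \<alpha>\<rceil> / real (Suc k)" by simp
        have "real_of_int \<lceil>real (Suc k) * \<alpha>\<rceil> / real (Suc k) \<le> \<alpha> + 1 / real (Suc k)" for k
        proof -
          have "real_of_int \<lceil>real (Suc k) * \<alpha>\<rceil> \<le> real (Suc k) * \<alpha> + 1" by (rule of_int_ceiling_le_add_one)
          then have "real_of_int \<lceil>real (Suc k) * \<alpha>\<rceil> / real (Suc k) \<le> (real (Suc k) * \<alpha> + 1) / real (Suc k)"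
            by (rule divide_right_mono) simp
          also have "\<dots> = \<alpha> + 1 / real (Suc k)" by (simp add: add_divide_distrib del: of_nat_Suc)
          finally show ?thesis .
        qed
        then show "\<forall>\<^sub>F k in sequentially. real_of_int \<lceil>real (Suc k) * \<alpha>\<rceil> / real (Suc k) \<le> \<alpha> + 1 / real (Suc k)" by simp
      qed simp
      have "isCont (f \<theta>) \<alpha>" using c[of \<theta>] True by (simp add: continuous_on_eq_continuous_at)
      from isCont_tendsto_compose[OF this lim] show ?thesis using True by (simp add: h_def z)
    qed (auto simp: h_def z)
  qed
  then show ?thesis unfolding split_beta prod.collapse .
qed

section \<open>Likelihood bounds for a fixed design\<close>

text \<open>The correlation matrix of the design with \<open>t\<close> added is positive definite.
  Its form at the vector formed by the negative prediction weights followed by 1 is the Kriging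
  variance.\<close>

lemma kriging_variance_pos:
  fixes s :: "nat \<Rightarrow> real ^ 'd"
  assumes \<nu>: "0 < \<nu>" and \<alpha>: "0 < \<alpha>" and inj: "inj_on s {..<n}" and t: "t \<notin> s ` {..<n}"
  shows "quad_form (minv (corr_mat \<nu> s n \<alpha>)) (corr_vec \<nu> s n \<alpha> t) < 1"
proof -
  let ?R = "corr_mat \<nu> s n \<alpha>" and ?r = "corr_vec \<nu> s n \<alpha> t"
  define s' where "s' = s(n := t)"
  have inj': "inj_on s' {..<Suc n}"
    using inj t unfolding inj_on_def s'_def by (auto simp: less_Suc_eq)
  have spdR: "spd k (corr_mat \<nu> u k \<alpha>)" if "inj_on u {..<k}" for u :: "nat \<Rightarrow> real ^ 'd" and k
  proof -
    have "corr_mat \<nu> u k \<alpha> = \<alpha> powr (2 * \<nu>) \<cdot>\<^sub>m scaled_corr_mat \<nu> u k \<alpha>"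
      using \<alpha> unfolding scaled_corr_mat_def by (intro eq_matI) (auto simp: powr_minus field_simps)
    then show ?thesis using spd_smult[OF spd_scaled_corr_mat[OF \<nu> \<alpha> that], of "\<alpha> powr (2 * \<nu>)"] \<alpha> by simp
  qed
  note R = spdR[OF inj] and R' = spdR[OF inj']
  have r: "?r \<in> carrier_vec n" by (simp add: corr_vec_def)
  define x where "x = (-1) \<cdot>\<^sub>v (minv ?R *\<^sub>v ?r)"
  have mr: "minv ?R *\<^sub>v ?r \<in> carrier_vec n" using spd_minv(1)[OF R] r by simp
  have x: "x \<in> carrier_vec n" using mr by (simp add: x_def)
  have b: "Matrix.mat n n (\<lambda>ij. corr_mat \<nu> s' (Suc n) \<alpha> $$ ij) = ?R"
    by (intro eq_matI) (auto simp: corr_mat_def s'_def)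
  have v: "Matrix.vec n (\<lambda>i. corr_mat \<nu> s' (Suc n) \<alpha> $$ (i, n)) = ?r"
    by (intro eq_vecI) (auto simp: corr_mat_def corr_vec_def s'_def)
  have o: "corr_mat \<nu> s' (Suc n) \<alpha> $$ (n, n) = 1" by (simp add: corr_mat_def matern_def)
  have "extend_vec n x 1 \<in> carrier_vec (Suc n)" by (simp add: extend_vec_def)
  moreover have "extend_vec n x 1 \<noteq> 0\<^sub>v (Suc n)"
  proof
    assume "extend_vec n x 1 = 0\<^sub>v (Suc n)"
    then have "vec_index (extend_vec n x 1) n = vec_index (0\<^sub>v (Suc n)) n" by simp
    then show False by (simp add: extend_vec_def)
  qed
  ultimately have "0 < quad_form (corr_mat \<nu> s' (Suc n) \<alpha>) (extend_vec n x 1)" by (rule spdD(3)[OF R'])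
  also have "\<dots> = quad_form ?R x + 2 * sprod x ?r + 1"
    by (simp add: quad_form_extend_vec[OF spdD(1,2)[OF R'] x] b v o)
  also have "quad_form ?R x = quad_form (minv ?R) ?r"
    unfolding x_def using quad_form_smult_vec[OF spdD(1)[OF R] mr, of "-1"] quad_form_minv_conv[OF R r] by simp
  also have "sprod x ?r = - quad_form (minv ?R) ?r"
    unfolding x_def using smult_scalar_prod_distrib[OF mr r, of "-1"] comm_scalar_prod[OF mr r]
    by (simp add: quad_form_def)
  finally show ?thesis by simp
qed

text \<open>Guarantees a point of the cube outside every finite design; over the empty set the
  supremum would be minus infinity.\<close>

lemma infinite_cube:
  assumes "0 < T"
  shows "infinite (cube T :: (real ^ 'd) set)"
proof -
  have "inj_on (\<lambda>c. \<chi> i. c :: real ^ 'd) {0..T}" by (rule inj_onI) (simp add: vec_eq_iff fun_eq_iff)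
  moreover have "infinite {0..T}" using assms by (rule infinite_Icc)
  moreover have "(\<lambda>c. \<chi> i. c :: real ^ 'd) ` {0..T} \<subseteq> cube T" by (auto simp: cube_def)
  ultimately show ?thesis by (meson finite_imageD finite_subset)
qed

section \<open>Reduction of the predictive variance, and tails of the likelihood in \<alpha>\<close>

context design
begin

text \<open>The predictive variance is a positive factor times the variance parameter, so the ratio
  is the same at every new point. Positivity comes from the Kriging part; the regression part is
  nonnegative.\<close>

lemma pred_var_dev_eq:
  assumes \<theta>: "0 < \<theta>" and \<theta>0: "0 < \<theta>0" and \<alpha>: "0 < \<alpha>" and T: "0 < T"
  shows "pred_var_dev p m \<Omega> \<nu> T \<theta>0 s n \<theta> \<alpha> = ereal \<bar>\<theta> / \<theta>0 - 1\<bar>"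
proof -
  have "pred_var p m \<Omega> \<nu> s n (\<theta> / \<alpha> powr (2 * \<nu>)) \<alpha> t / pred_var p m \<Omega> \<nu> s n (\<theta>0 / \<alpha> powr (2 * \<nu>)) \<alpha> t = \<theta> / \<theta>0"
    if t: "t \<in> cube T - s ` {..<n}" for t
  proof -
    define q where "q = quad_form (minv (corr_mat \<nu> s n \<alpha>)) (corr_vec \<nu> s n \<alpha> t)"
    define h where "h = quad_form (minv (gls_mat p m \<Omega> \<nu> s n \<alpha>))
      (reg_vec p m t - transpose_mat D *\<^sub>v (minv (corr_mat \<nu> s n \<alpha>) *\<^sub>v corr_vec \<nu> s n \<alpha> t))"
    have q: "q < 1" unfolding q_def by (rule kriging_variance_pos[OF \<nu> \<alpha> inj_s]) (use t in auto)
    have "spd p (gls_mat p m \<Omega> \<nu> s n \<alpha>)"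
      using spd_gls[OF spd_corr_mat[OF \<alpha>] D_carrier \<Omega> D_inj] by (simp add: gls_def gls_mat_def)
    then have "0 \<le> h" unfolding h_def
      by (intro spdD(4)[OF spd_minv_spd])
         (use D_carrier spd_minv(1)[OF spd_corr_mat[OF \<alpha>]] in \<open>auto simp: reg_vec_def corr_vec_def\<close>)
    with q have "0 < 1 - q + h" by simp
    moreover have "pred_var p m \<Omega> \<nu> s n v \<alpha> t = v * (1 - q + h)" for v
      by (simp add: pred_var_def q_def h_def Let_def distrib_left)
    ultimately show ?thesis using \<alpha> by simp
  qed
  moreover have "cube T - s ` {..<n} \<noteq> {}"
  proof
    assume "cube T - s ` {..<n} = {}"
    then have "cube T \<subseteq> s ` {..<n}" by blast
    then have "finite (cube T :: (real ^ 'd) set)" by (rule finite_subset) simp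
    then show False using infinite_cube[OF T, where ?'d = 'd] by simp
  qed
  ultimately show ?thesis unfolding pred_var_dev_def by (simp cong: SUP_cong_simp)
qed

lemma lik_const_le:
  assumes \<alpha>: "0 < \<alpha>" and \<beta>: "0 < \<beta>" and a: "0 < a" "0 < c"
    and K: "mdet (K \<beta>) \<le> a * mdet (K \<alpha>)"
    and i: "mdet (info \<beta>) \<le> c * mdet (info \<alpha>)"
  shows "lik_const \<alpha> \<le> (a * c) powr (1 / 2) * lik_const \<beta>"
proof -
  note p = spd_det_pos[OF spd_K[OF \<alpha>]] spd_det_pos[OF spd_K[OF \<beta>]] spd_det_pos[OF spd_info[OF \<alpha>]] spd_det_pos[OF spd_info[OF \<beta>]]
  have h: "x powr (- (1 / 2)) \<le> c powr (1 / 2) * y powr (- (1 / 2))"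
    if "0 < x" "0 < y" "0 < c" "y \<le> c * x" for x y c :: real
  proof -
    have "y powr (1 / 2) \<le> (c * x) powr (1 / 2)" using that by (intro powr_mono2) auto
    then show ?thesis using that by (simp add: powr_mult powr_minus field_simps)
  qed
  have "lik_const \<alpha> \<le> (a powr (1 / 2) * mdet (K \<beta>) powr (- (1 / 2))) * (c powr (1 / 2) * mdet (info \<beta>) powr (- (1 / 2)))"
    unfolding lik_const_def using h[OF p(1,2) a(1) K] h[OF p(3,4) a(2) i] by (intro mult_mono) auto
  also have "\<dots> = (a * c) powr (1 / 2) * lik_const \<beta>"
    using a by (simp add: lik_const_def powr_mult)
  finally show ?thesis .
qed

text \<open>Towards smaller \<alpha> the covariance determinant acts in the favourable direction, so
  the loss is a power with exponent proportional to p, from the regression directions.\<close>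

lemma lik_const_low:
  assumes "0 < \<alpha>" "\<alpha> \<le> \<beta>"
  shows "lik_const \<alpha> \<le> (\<beta> / \<alpha>) powr ((\<nu> + real CARD('d) / 2) * p) * lik_const \<beta>"
proof -
  have "lik_const \<alpha> \<le> (1 * (\<beta> / \<alpha>) powr ((2 * \<nu> + real CARD('d)) * p)) powr (1 / 2) * lik_const \<beta>"
    by (rule lik_const_le) (use assms det_K_mono(1)[OF assms] det_info_mono(2)[OF assms] in auto)
  then show ?thesis using assms by (simp add: powr_powr algebra_simps add_divide_distrib)
qed

text \<open>Towards larger \<alpha> the roles are exchanged: the precision determinant is
  favourable, and the covariance determinant loses with exponent proportional to n.\<close>

lemma lik_const_high:
  assumes "0 < \<beta>" "\<beta> \<le> \<alpha>"
  shows "lik_const \<alpha> \<le> (\<alpha> / \<beta>) powr ((\<nu> + real CARD('d) / 2) * n) * lik_const \<beta>"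
proof -
  have "lik_const \<alpha> \<le> ((\<alpha> / \<beta>) powr ((2 * \<nu> + real CARD('d)) * n) * 1) powr (1 / 2) * lik_const \<beta>"
    by (rule lik_const_le) (use assms det_K_mono(2)[OF assms] det_info_mono(1)[OF assms] in auto)
  then show ?thesis using assms by (simp add: powr_powr algebra_simps add_divide_distrib)
qed

text \<open>With q = \<nu> + d/2 the loss is q p in the normalising constant and q (n - p) in the
  peak of the kernel. The sum q n is the exponent in the lower prior tail condition.\<close>

lemma lik_low_tail:
  assumes \<alpha>: "0 < \<alpha>" "\<alpha> \<le> lo" and \<theta>: "0 < \<theta>" and y: "y \<in> carrier_vec n"
    and S: "0 < S" "S \<le> rss y lo" and N: "N = real n - real p" "0 < N"
  shows "lik_const \<alpha> * kern N (rss y \<alpha>) \<theta> \<le>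
    (lo / \<alpha>) powr ((\<nu> + real CARD('d) / 2) * n) * (lik_const lo * ((N / S) powr (N / 2) * exp (- (N / 2))))"
proof -
  define L where "L = (lo / \<alpha>) powr (2 * \<nu> + real CARD('d))"
  have lo: "0 < lo" using \<alpha> by simp
  have L: "0 < L" using \<alpha> lo by (simp add: L_def)
  have SL: "S \<le> L * rss y \<alpha>" using rss_mono(2)[OF \<alpha> y] S by (simp add: L_def)
  then have r: "0 < rss y \<alpha>" using S L by (smt (verit) mult_nonneg_nonpos)
  have "kern N (rss y \<alpha>) \<theta> \<le> (N / rss y \<alpha>) powr (N / 2) * exp (- (N / 2))"
    by (rule kern_le_max[OF N(2) r \<theta>])
  also have "\<dots> \<le> (L * (N / S)) powr (N / 2) * exp (- (N / 2))"
  proof (intro mult_right_mono powr_mono2)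
    have "N * S \<le> N * (L * rss y \<alpha>)" using SL N by simp
    then show "N / rss y \<alpha> \<le> L * (N / S)" using S r by (simp add: field_simps)
  qed (use N r in auto)
  also have "\<dots> = L powr (N / 2) * ((N / S) powr (N / 2) * exp (- (N / 2)))"
    using L N(2) S by (subst powr_mult) (simp_all add: mult.assoc)
  finally have k: "kern N (rss y \<alpha>) \<theta> \<le> L powr (N / 2) * ((N / S) powr (N / 2) * exp (- (N / 2)))" .
  have "lik_const \<alpha> * kern N (rss y \<alpha>) \<theta> \<le>
      ((lo / \<alpha>) powr ((\<nu> + real CARD('d) / 2) * p) * lik_const lo) * (L powr (N / 2) * ((N / S) powr (N / 2) * exp (- (N / 2))))"
    using lik_const_low[OF \<alpha>] k lik_const_pos[OF lo] by (intro mult_mono) auto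
  also have "\<dots> = ((lo / \<alpha>) powr ((\<nu> + real CARD('d) / 2) * p) * L powr (N / 2)) * (lik_const lo * ((N / S) powr (N / 2) * exp (- (N / 2))))"
    by (simp add: mult_ac)
  also have "(lo / \<alpha>) powr ((\<nu> + real CARD('d) / 2) * p) * L powr (N / 2) = (lo / \<alpha>) powr ((\<nu> + real CARD('d) / 2) * n)"
  proof -
    have "(\<nu> + real CARD('d) / 2) * p + (2 * \<nu> + real CARD('d)) * (N / 2) = (\<nu> + real CARD('d) / 2) * n"
      unfolding N(1) by (simp add: field_simps)
    then show ?thesis unfolding L_def powr_powr powr_add[symmetric] by simp
  qed
  finally show ?thesis .
qed

text \<open>The peak of the kernel decreases as \<open>rss\<close> grows, so only the normalising
  constant loses, again with the exponent of the prior tail condition.\<close>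

lemma lik_high_tail:
  assumes \<alpha>: "0 < hi" "hi \<le> \<alpha>" and \<theta>: "0 < \<theta>" and y: "y \<in> carrier_vec n"
    and S: "0 < S" "S \<le> rss y hi" and N: "N = real n - real p" "0 < N"
  shows "lik_const \<alpha> * kern N (rss y \<alpha>) \<theta> \<le>
    (\<alpha> / hi) powr ((\<nu> + real CARD('d) / 2) * n) * (lik_const hi * ((N / S) powr (N / 2) * exp (- (N / 2))))"
proof -
  have r: "S \<le> rss y \<alpha>" using rss_mono(1)[OF \<alpha> y] S by simp
  have "kern N (rss y \<alpha>) \<theta> \<le> (N / rss y \<alpha>) powr (N / 2) * exp (- (N / 2))"
    by (rule kern_le_max) (use N r S \<theta> in auto)
  also have "\<dots> \<le> (N / S) powr (N / 2) * exp (- (N / 2))"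
    using N r S by (intro mult_right_mono powr_mono2 divide_left_mono) auto
  finally have "lik_const \<alpha> * kern N (rss y \<alpha>) \<theta> \<le>
     ((\<alpha> / hi) powr ((\<nu> + real CARD('d) / 2) * n) * lik_const hi) * ((N / S) powr (N / 2) * exp (- (N / 2)))"
    using lik_const_high[OF \<alpha>] lik_const_pos[OF \<alpha>(1)] by (intro mult_mono) auto
  then show ?thesis by (simp add: mult_ac)
qed

text \<open>Measurability of \<open>rss\<close> and of the determinants as functions of \<alpha> is
  drawn from their monotonicity on the positive half line.\<close>

lemma measurable_on_pos:
  fixes f :: "real \<Rightarrow> real"
  assumes "mono_on {0<..} f"
  shows "(\<lambda>\<alpha>. if 0 < \<alpha> then f \<alpha> else 0) \<in> borel_measurable borel"
proof -
  have "(\<lambda>\<alpha>. indicator {0<..} \<alpha> *\<^sub>R f \<alpha>) \<in> borel_measurable borel"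
    using borel_measurable_mono_on_fnc[OF assms] by (subst (asm) borel_measurable_restrict_space_iff) auto
  also have "(\<lambda>\<alpha>. indicator {0<..} \<alpha> *\<^sub>R f \<alpha>) = (\<lambda>\<alpha>. if 0 < \<alpha> then f \<alpha> else 0)" by (auto simp: indicator_def)
  finally show ?thesis .
qed

lemma rss_borel:
  assumes "y \<in> carrier_vec n"
  shows "(\<lambda>\<alpha>. if 0 < \<alpha> then rss y \<alpha> else 0) \<in> borel_measurable borel"
  by (rule measurable_on_pos) (use rss_mono(1)[OF _ _ assms] in \<open>auto simp: mono_on_def\<close>)

lemma lik_const_borel: "(\<lambda>\<alpha>. if 0 < \<alpha> then lik_const \<alpha> else 0) \<in> borel_measurable borel"
proof -
  have "(\<lambda>\<alpha>. if 0 < \<alpha> then - mdet (K \<alpha>) else 0) \<in> borel_measurable borel"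
    by (rule measurable_on_pos) (use det_K_mono(1) in \<open>auto simp: mono_on_def\<close>)
  moreover have "(\<lambda>\<alpha>. if 0 < \<alpha> then mdet (info \<alpha>) else 0) \<in> borel_measurable borel"
    by (rule measurable_on_pos) (use det_info_mono(1) in \<open>auto simp: mono_on_def\<close>)
  ultimately have "(\<lambda>\<alpha>. if 0 < \<alpha> then (- (if 0 < \<alpha> then - mdet (K \<alpha>) else 0)) powr (- (1 / 2)) *
      (if 0 < \<alpha> then mdet (info \<alpha>) else 0) powr (- (1 / 2)) else 0) \<in> borel_measurable borel"
    by measurable
  also have "(\<lambda>\<alpha>. if 0 < \<alpha> then (- (if 0 < \<alpha> then - mdet (K \<alpha>) else 0)) powr (- (1 / 2)) *
      (if 0 < \<alpha> then mdet (info \<alpha>) else 0) powr (- (1 / 2)) else 0) = (\<lambda>\<alpha>. if 0 < \<alpha> then lik_const \<alpha> else 0)"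
    by (auto simp: lik_const_def)
  finally show ?thesis .
qed

lemma exp_restricted_loglik_kern:
  assumes "0 < \<alpha>" "0 < \<theta>" "y \<in> carrier_vec n"
  shows "exp (restricted_loglik p m \<Omega> \<nu> s n y (\<theta> / \<alpha> powr (2 * \<nu>)) \<alpha>) =
    lik_const \<alpha> * kern (real n - real p) (rss y \<alpha>) \<theta>"
  using exp_restricted_loglik[OF assms] by (simp add: kern_def)

end

context sampled_process
begin

text \<open>The bound through \<open>det_K_mono\<close> would cost exactly the power of \<open>b\<close> that the upper prior
  tail gains, so the logarithm of the determinant ratio is bounded by a trace instead.\<close>

lemma det_K_trace_bound:
  assumes d: "CARD('d) \<le> 3" and b: "\<alpha>0 \<le> b" and W: "1 \<le> W"
  defines "L \<equiv> (b / \<alpha>0) powr (2 * \<nu> + CARD('d))"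
  shows "mdet (K \<alpha>0) \<le> exp (2 * max 1 ((\<nu> + CARD('d) / 2) * b\<^sup>2) * (L * (432 * C * W + n / W\<^sup>2))) *
    mdet (K b)"
proof -
  have b0: "0 < b" using \<alpha>0 b by simp
  have W0: "0 < W" using W by simp
  note Kb = spd_K[OF b0] and K0 = spd_K[OF \<alpha>0]
  have L: "0 < L" using \<alpha>0 b0 by (simp add: L_def)
  define c where "c = 2 * max 1 ((\<nu> + CARD('d) / 2) * b\<^sup>2)"
  have c: "0 < c" by (simp add: c_def)
  \<comment> \<open>In the frame of \<open>K b\<close> the log-determinant ratio is at most a sum of
    n form differences between \<open>K \<alpha>0\<close> and \<open>K b\<close>.\<close>
  obtain U where U: "U \<in> carrier_mat n n"
    and q: "\<And>y. y \<in> carrier_vec n \<Longrightarrow> quad_form (minv (K b)) y = (\<Sum>k<n. (sprod (Matrix.col U k) y)\<^sup>2)"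
    and one: "\<And>k. k < n \<Longrightarrow> quad_form (K b) (Matrix.col U k) = 1"
    and det: "\<And>A. spd n A \<Longrightarrow> mdet A \<le> mdet (K b) * exp (\<Sum>k<n. quad_form A (Matrix.col U k) - 1)"
    by (rule orthonormal_frame[OF Kb]) blast
  have cU: "Matrix.col U k \<in> carrier_vec n" if "k < n" for k using U that by simp
  let ?f = "\<lambda>k \<xi>. indicator (freq_box W) \<xi> * (trig_power n s (Matrix.col U k) \<xi> * spec_dens \<nu> \<alpha>0 \<xi> / (1 + (norm \<xi>)\<^sup>2))"
  let ?g = "\<lambda>\<xi>::real ^ 'd. ennreal (1 / (1 + (norm \<xi>)\<^sup>2)) * indicator {\<omega>. \<forall>b\<in>Basis. \<bar>\<omega> \<bullet> b\<bar> \<le> W} \<xi>"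
  \<comment> \<open>Summed over the frame, the squared moduli are the inverse forms at the cosine
    and sine vectors, so the evaluation bound controls the n low-frequency energies together by 2 C
    L instead of one by one.\<close>
  have pt: "(\<Sum>k<n. trig_power n s (Matrix.col U k) \<xi>) * spec_dens \<nu> \<alpha>0 \<xi> \<le> 2 * C * L" for \<xi>
  proof -
    have f: "0 < spec_dens \<nu> \<alpha>0 \<xi>" by (rule spec_dens_pos[OF \<nu> \<alpha>0])
    have le: "quad_form (minv (K b)) w \<le> L * (C / spec_dens \<nu> \<alpha>0 \<xi>)"
      if w: "w \<in> carrier_vec n" and e: "\<And>v. v \<in> carrier_vec n \<Longrightarrow> (sprod v w)\<^sup>2 \<le> trig_power n s v \<xi>" for w
    proof -
      have "quad_form (minv (K b)) w \<le> L * quad_form (minv (K \<alpha>0)) w"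
        by (rule quad_form_minv_antimono[OF K0 Kb L _ w])
           (use scaled_corr_mat_loewner(2)[OF \<nu> \<alpha>0 b] in \<open>auto simp: L_def\<close>)
      also have "\<dots> \<le> L * (C / spec_dens \<nu> \<alpha>0 \<xi>)"
        using quad_minv_le_of_eval[OF w e] L by (intro mult_left_mono) auto
      finally show ?thesis .
    qed
    have "(\<Sum>k<n. trig_power n s (Matrix.col U k) \<xi>) =
       quad_form (minv (K b)) (cos_vec n s \<xi>) + quad_form (minv (K b)) (sin_vec n s \<xi>)"
      unfolding q[OF cos_sin_vec_carrier(1)] q[OF cos_sin_vec_carrier(2)] sum.distrib[symmetric]
      by (intro sum.cong refl cmod_trig_poly_sprod cU) simp
    also have "\<dots> \<le> L * (C / spec_dens \<nu> \<alpha>0 \<xi>) + L * (C / spec_dens \<nu> \<alpha>0 \<xi>)"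
      by (intro add_mono le) (auto simp: cmod_trig_poly_sprod)
    finally have "(\<Sum>k<n. trig_power n s (Matrix.col U k) \<xi>) * spec_dens \<nu> \<alpha>0 \<xi> \<le>
        (L * (C / spec_dens \<nu> \<alpha>0 \<xi>) + L * (C / spec_dens \<nu> \<alpha>0 \<xi>)) * spec_dens \<nu> \<alpha>0 \<xi>"
      using f by (intro mult_right_mono) auto
    also have "\<dots> = 2 * C * L" using f by (simp add: field_simps)
    finally show ?thesis .
  qed
  have "(\<Sum>k<n. low_energy \<alpha>0 W (Matrix.col U k)) = (LINT \<xi>|lborel. (\<Sum>k<n. ?f k \<xi>))"
    unfolding low_energy_def using integrable_low_energy[OF \<alpha>0 cU]
    by (intro Bochner_Integration.integral_sum[symmetric]) auto
  also have "\<dots> \<le> 2 * C * L * (216 * W)"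
  proof (rule integral_real_bounded)
    have "(\<integral>\<^sup>+\<xi>. ennreal (\<Sum>k<n. ?f k \<xi>) \<partial>lborel) \<le> (\<integral>\<^sup>+\<xi>. ennreal (2 * C * L) * ?g \<xi> \<partial>lborel)"
    proof (rule nn_integral_mono)
      fix \<xi> :: "real ^ 'd"
      have "(\<Sum>k<n. ?f k \<xi>) = indicator (freq_box W) \<xi> * ((\<Sum>k<n. trig_power n s (Matrix.col U k) \<xi>) * spec_dens \<nu> \<alpha>0 \<xi> / (1 + (norm \<xi>)\<^sup>2))"
        by (simp add: sum_distrib_left sum_distrib_right sum_divide_distrib)
      also have "\<dots> \<le> indicator (freq_box W) \<xi> * (2 * C * L / (1 + (norm \<xi>)\<^sup>2))"
        using pt[of \<xi>] by (intro mult_left_mono divide_right_mono) auto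
      finally have "ennreal (\<Sum>k<n. ?f k \<xi>) \<le> ennreal (indicator (freq_box W) \<xi> * (2 * C * L / (1 + (norm \<xi>)\<^sup>2)))"
        by (rule ennreal_leI)
      also have "\<dots> = ennreal (2 * C * L) * ?g \<xi>"
        using C L by (auto simp: freq_box_def indicator_def simp flip: ennreal_mult')
      finally show "ennreal (\<Sum>k<n. ?f k \<xi>) \<le> ennreal (2 * C * L) * ?g \<xi>" .
    qed
    also have "\<dots> = ennreal (2 * C * L) * (\<integral>\<^sup>+\<xi>. ?g \<xi> \<partial>lborel)"
      by (rule nn_integral_cmult)
         (use freq_box_measurable[of W, where ?'a = "real ^ 'd"] in \<open>simp add: freq_box_def\<close>)
    also have "\<dots> \<le> ennreal (2 * C * L) * ennreal (216 * W)"
      by (intro mult_left_mono nn_integral_cube_inverse_quadratic) (use d W in auto)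
    also have "\<dots> = ennreal (2 * C * L * (216 * W))"
      by (rule ennreal_mult'[symmetric]) (use C L in simp)
    finally show "(\<integral>\<^sup>+\<xi>. ennreal (\<Sum>k<n. ?f k \<xi>) \<partial>lborel) \<le> ennreal (2 * C * L * (216 * W))" .
  qed (use C L W in simp)
  finally have le: "(\<Sum>k<n. low_energy \<alpha>0 W (Matrix.col U k)) \<le> 2 * C * L * (216 * W)" .
  \<comment> \<open>Each form difference is split at the frequency W; the high-frequency remainder
    costs L / W^2 per direction.\<close>
  have "(\<Sum>k<n. quad_form (K \<alpha>0) (Matrix.col U k) - 1) \<le> (\<Sum>k<n. c * 1 * (low_energy \<alpha>0 W (Matrix.col U k) + L / W\<^sup>2))"
  proof (rule sum_mono)
    fix k assume "k \<in> {..<n}"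
    then have k: "k < n" by simp
    have "quad_form (K \<alpha>0) (Matrix.col U k) - 1 \<le> c * 1 * (low_energy \<alpha>0 W (Matrix.col U k) + quad_form (K \<alpha>0) (Matrix.col U k) / W\<^sup>2)"
      using quad_form_diff_le[OF \<alpha>0 b \<alpha>0 cU[OF k] W0, of 1] unfolding one[OF k] c_def by simp
    also have "\<dots> \<le> c * 1 * (low_energy \<alpha>0 W (Matrix.col U k) + L / W\<^sup>2)"
      using scaled_corr_mat_loewner(2)[OF \<nu> \<alpha>0 b cU[OF k], of s] one[OF k] c
      by (intro mult_left_mono add_left_mono divide_right_mono) (auto simp: L_def)
    finally show "quad_form (K \<alpha>0) (Matrix.col U k) - 1 \<le> c * 1 * (low_energy \<alpha>0 W (Matrix.col U k) + L / W\<^sup>2)" .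
  qed
  also have "\<dots> = c * ((\<Sum>k<n. low_energy \<alpha>0 W (Matrix.col U k)) + n * (L / W\<^sup>2))"
    by (simp add: sum.distrib flip: sum_distrib_left)
  also have "\<dots> \<le> c * (2 * C * L * (216 * W) + n * (L / W\<^sup>2))" using le c by (intro mult_left_mono add_right_mono) auto
  also have "\<dots> = c * (L * (432 * C * W + n / W\<^sup>2))" by (simp add: distrib_left mult_ac)
  finally have "exp (\<Sum>k<n. quad_form (K \<alpha>0) (Matrix.col U k) - 1) \<le> exp (c * (L * (432 * C * W + n / W\<^sup>2)))" by simp
  then have "mdet (K b) * exp (\<Sum>k<n. quad_form (K \<alpha>0) (Matrix.col U k) - 1) \<le> mdet (K b) * exp (c * (L * (432 * C * W + n / W\<^sup>2)))"
    using spd_det_pos[OF Kb] by (intro mult_left_mono) auto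
  with det[OF K0] show ?thesis by (simp add: c_def mult.commute)
qed

end

section \<open>Posterior mass for a fixed design\<close>

lemma prior_cond_measurable:
  assumes "prior_cond p \<Omega> \<theta>0 pr" "0 < \<alpha>"
  shows "continuous_on {0<..} (\<lambda>\<theta>. pr \<theta> \<alpha>)"
    "(\<lambda>\<theta>. indicator {0<..} \<theta> * ennreal (pr \<theta> \<alpha>)) \<in> borel_measurable borel"
    "(\<integral>\<^sup>+\<theta>. indicator {0<..} \<theta> * ennreal (pr \<theta> \<alpha>) \<partial>lborel) = 1"
proof -
  show c: "continuous_on {0<..} (\<lambda>\<theta>. pr \<theta> \<alpha>)"
    using assms unfolding prior_cond_def
    by (intro continuous_at_imp_continuous_on ballI field_differentiable_imp_continuous_at) auto
  have "(\<lambda>\<theta>. indicator {0<..} \<theta> *\<^sub>R pr \<theta> \<alpha>) \<in> borel_measurable borel"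
    by (rule borel_measurable_continuous_on_indicator[OF _ c]) simp
  then have "(\<lambda>\<theta>. ennreal (indicator {0<..} \<theta> *\<^sub>R pr \<theta> \<alpha>)) \<in> borel_measurable borel" by measurable
  also have "(\<lambda>\<theta>. ennreal (indicator {0<..} \<theta> *\<^sub>R pr \<theta> \<alpha>)) = (\<lambda>\<theta>. indicator {0<..} \<theta> * ennreal (pr \<theta> \<alpha>))"
    by (auto simp: indicator_def)
  finally show "(\<lambda>\<theta>. indicator {0<..} \<theta> * ennreal (pr \<theta> \<alpha>)) \<in> borel_measurable borel" .
  show "(\<integral>\<^sup>+\<theta>. indicator {0<..} \<theta> * ennreal (pr \<theta> \<alpha>) \<partial>lborel) = 1"
    using assms unfolding prior_cond_def by (simp add: mult.commute)
qed

text \<open>A kernel below \<open>c\<close> has mass at most \<open>c\<close> under a proper prior;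
  this makes the normalisers finite.\<close>

lemma kern_prior_mass_le:
  assumes pc: "prior_cond p \<Omega> \<theta>0 pr" and \<alpha>: "0 < \<alpha>" and c: "0 \<le> c"
    and le: "\<And>\<theta>. 0 < \<theta> \<Longrightarrow> k \<theta> \<le> c"
  shows "(\<integral>\<^sup>+\<theta>. indicator {0<..} \<theta> * ennreal (k \<theta> * pr \<theta> \<alpha>) \<partial>lborel) \<le> ennreal c"
proof -
  note pm = prior_cond_measurable[OF pc \<alpha>]
  have "(\<integral>\<^sup>+\<theta>. indicator {0<..} \<theta> * ennreal (k \<theta> * pr \<theta> \<alpha>) \<partial>lborel) \<le>
      (\<integral>\<^sup>+\<theta>. ennreal c * (indicator {0<..} \<theta> * ennreal (pr \<theta> \<alpha>)) \<partial>lborel)"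
  proof (rule nn_integral_mono)
    fix \<theta>
    show "indicator {0<..} \<theta> * ennreal (k \<theta> * pr \<theta> \<alpha>) \<le> ennreal c * (indicator {0<..} \<theta> * ennreal (pr \<theta> \<alpha>))"
    proof (cases "0 < \<theta>")
      case True
      have "0 \<le> pr \<theta> \<alpha>" using pc \<alpha> True by (simp add: prior_cond_def)
      then have "k \<theta> * pr \<theta> \<alpha> \<le> c * pr \<theta> \<alpha>" using le[OF True] by (rule mult_right_mono[rotated])
      then have "ennreal (k \<theta> * pr \<theta> \<alpha>) \<le> ennreal c * ennreal (pr \<theta> \<alpha>)"
        using c by (simp add: ennreal_leI flip: ennreal_mult')
      then show ?thesis using True by simp
    qed simp
  qed
  also have "\<dots> = ennreal c" using pm by (subst nn_integral_cmult) auto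
  finally show ?thesis .
qed

context design
begin

text \<open>\<open>lik_const \<alpha>\<close> cancels between the bad mass and the normaliser, so
  the contraction of the kernel carries over. The normaliser has to be neither 0 nor infinite, since
  \<open>density_proportional\<close> is a probability measure only then.\<close>

lemma posterior_given_alpha_bound:
  fixes \<alpha> \<theta>0 T \<delta> \<rho> R :: real
  assumes n: "p < n" and y: "y \<in> carrier_vec n" and \<alpha>: "0 < \<alpha>" and \<theta>0: "0 < \<theta>0" and T: "0 < T"
    and pc: "prior_cond p \<Omega> \<theta>0 pr" and \<delta>: "0 < \<delta>" "\<delta> \<le> 1 / 100"
    and S: "\<bar>rss y \<alpha> - (real n - real p) * \<theta>0\<bar> \<le> 11 / 10 * \<delta> * ((real n - real p) * \<theta>0)"
    and \<rho>: "0 < \<rho>" and R: "0 \<le> R"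
    and low: "\<And>\<theta>. \<theta> \<in> {\<theta>0..\<theta>0 * (1 + 1 / (real n - real p))} \<Longrightarrow> \<rho> * pr \<theta>0 \<alpha> \<le> pr \<theta> \<alpha>"
    and up: "\<And>\<theta>. \<theta> \<in> {\<theta>0 / 2<..<2 * \<theta>0} \<Longrightarrow> pr \<theta> \<alpha> \<le> R * pr \<theta>0 \<alpha>"
  shows "prob_space (posterior_given_alpha p m \<Omega> \<nu> pr s n y \<alpha>)"
    "measure (posterior_given_alpha p m \<Omega> \<nu> pr s n y \<alpha>)
      {\<theta>. 0 < \<theta> \<and> pred_var_dev p m \<Omega> \<nu> T \<theta>0 s n \<theta> \<alpha> > ereal (7 * \<delta>)} \<le>
     (exp (- (3 / 2 * (real n - real p) * \<delta>\<^sup>2)) * R * (3 / 2 * \<theta>0) + exp (- ((real n - real p) / 64)) / pr \<theta>0 \<alpha>) *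
       ((real n - real p) * exp (1 / 2) / (\<theta>0 * \<rho>))" (is "_ \<le> ?\<eta>")
proof -
  define N where "N = real n - real p"
  have N: "1 \<le> N" using n by (simp add: N_def)
  define l where "l = lik_const \<alpha>"
  have l: "0 < l" unfolding l_def by (rule lik_const_pos[OF \<alpha>])
  define g where "g \<theta> = indicator {0<..} \<theta> * ennreal (kern N (rss y \<alpha>) \<theta> * pr \<theta> \<alpha>)" for \<theta>
  define f where "f \<theta> = indicator {0<..} \<theta> *
       ennreal (exp (restricted_loglik p m \<Omega> \<nu> s n y (\<theta> / \<alpha> powr (2 * \<nu>)) \<alpha>) * pr \<theta> \<alpha>)" for \<theta>
  note pm = prior_cond_measurable[OF pc \<alpha>]
  have prt: "0 < pr \<theta>0 \<alpha>" and pr0: "\<And>\<theta>. 0 < \<theta> \<Longrightarrow> 0 \<le> pr \<theta> \<alpha>" using pc \<alpha> by (auto simp: prior_cond_def)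
  have fg: "f = (\<lambda>\<theta>. ennreal l * g \<theta>)"
  proof
    fix \<theta>
    show "f \<theta> = ennreal l * g \<theta>"
    proof (cases "0 < \<theta>")
      case True
      then show ?thesis using pr0[OF True] l
        by (simp add: f_def g_def exp_restricted_loglik_kern[OF \<alpha> True y] l_def[symmetric] N_def[symmetric] mult.assoc flip: ennreal_mult')
    qed (simp add: f_def g_def)
  qed
  have post: "posterior_given_alpha p m \<Omega> \<nu> pr s n y \<alpha> = density_proportional f"
    by (simp add: posterior_given_alpha_def f_def[abs_def])
  have gm[measurable]: "g \<in> borel_measurable borel"
  proof -
    note [measurable] = pm(2)
    have "g = (\<lambda>\<theta>. ennreal (kern N (rss y \<alpha>) \<theta>) * (indicator {0<..} \<theta> * ennreal (pr \<theta> \<alpha>)))"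
      by (auto simp: g_def fun_eq_iff indicator_def ennreal_mult')
    then show ?thesis by simp
  qed
  have fm: "f \<in> borel_measurable borel" unfolding fg by measurable
  have Zf: "(\<integral>\<^sup>+\<theta>. f \<theta> \<partial>lborel) = ennreal l * (\<integral>\<^sup>+\<theta>. g \<theta> \<partial>lborel)"
    unfolding fg by (rule nn_integral_cmult) simp
  have S0: "0 < rss y \<alpha>"
  proof -
    have "11 / 10 * \<delta> * (N * \<theta>0) \<le> 1 / 2 * (N * \<theta>0)" using \<delta> N \<theta>0 by (intro mult_right_mono) auto
    moreover have "0 < N * \<theta>0" using N \<theta>0 by simp
    ultimately show ?thesis using S abs_ge_minus_self[of "rss y \<alpha> - N * \<theta>0"] unfolding N_def by linarith
  qed
  have "0 < ennreal (kern N (rss y \<alpha>) \<theta>0 * exp (- (1 / 2)) * (\<rho> * pr \<theta>0 \<alpha>) * (\<theta>0 / N))"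
    using kern_pos[OF \<theta>0] \<rho> prt \<theta>0 N by simp
  also have "\<dots> \<le> (\<integral>\<^sup>+\<theta>. g \<theta> \<partial>lborel)"
    unfolding g_def by (rule kern_prior_mass[OF \<theta>0 N]) (use S0 \<rho> prt low in \<open>auto simp: N_def\<close>)
  finally have Z0: "(\<integral>\<^sup>+\<theta>. f \<theta> \<partial>lborel) \<noteq> 0" using l unfolding Zf by auto
  have "(\<integral>\<^sup>+\<theta>. g \<theta> \<partial>lborel) \<le> ennreal ((N / rss y \<alpha>) powr (N / 2) * exp (- (N / 2)))"
    unfolding g_def by (rule kern_prior_mass_le[OF pc \<alpha>]) (use N S0 in \<open>auto intro!: kern_le_max\<close>)
  then have Z1: "(\<integral>\<^sup>+\<theta>. f \<theta> \<partial>lborel) \<noteq> \<infinity>"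
    unfolding Zf by (auto simp: ennreal_mult_eq_top_iff top_unique)
  show "prob_space (posterior_given_alpha p m \<Omega> \<nu> pr s n y \<alpha>)"
    unfolding post by (rule prob_space_density_proportional[OF fm Z0 Z1])
  let ?B = "{\<theta>. 0 < \<theta> \<and> \<bar>\<theta> / \<theta>0 - 1\<bar> > 7 * \<delta>}"
  have B: "{\<theta>. 0 < \<theta> \<and> pred_var_dev p m \<Omega> \<nu> T \<theta>0 s n \<theta> \<alpha> > ereal (7 * \<delta>)} = ?B"
    using pred_var_dev_eq[OF _ \<theta>0 \<alpha> T] by auto
  have Bm: "?B \<in> sets borel" by measurable
  show "measure (posterior_given_alpha p m \<Omega> \<nu> pr s n y \<alpha>)
      {\<theta>. 0 < \<theta> \<and> pred_var_dev p m \<Omega> \<nu> T \<theta>0 s n \<theta> \<alpha> > ereal (7 * \<delta>)} \<le> ?\<eta>"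
    unfolding post B
  proof (rule measure_density_proportional_le[OF fm Z0 Z1 Bm])
    show "0 \<le> ?\<eta>" using N R \<theta>0 \<rho> prt unfolding N_def[symmetric]
      by (intro mult_nonneg_nonneg add_nonneg_nonneg divide_nonneg_nonneg) auto
    have "(\<integral>\<^sup>+\<theta>. f \<theta> * indicator ?B \<theta> \<partial>lborel) = (\<integral>\<^sup>+\<theta>. ennreal l * (indicator ?B \<theta> * ennreal (kern N (rss y \<alpha>) \<theta> * pr \<theta> \<alpha>)) \<partial>lborel)"
      unfolding fg g_def by (intro nn_integral_cong) (auto simp: indicator_def)
    also have "\<dots> = ennreal l * (\<integral>\<^sup>+\<theta>. indicator ?B \<theta> * ennreal (kern N (rss y \<alpha>) \<theta> * pr \<theta> \<alpha>) \<partial>lborel)"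
    proof (rule nn_integral_cmult)
      have "(\<lambda>\<theta>. indicator ?B \<theta> * ennreal (kern N (rss y \<alpha>) \<theta> * pr \<theta> \<alpha>)) = (\<lambda>\<theta>. indicator ?B \<theta> * g \<theta>)"
        by (auto simp: g_def fun_eq_iff indicator_def)
      moreover have "(\<lambda>\<theta>. indicator ?B \<theta> * g \<theta>) \<in> borel_measurable lborel" using Bm by measurable
      ultimately show "(\<lambda>\<theta>. indicator ?B \<theta> * ennreal (kern N (rss y \<alpha>) \<theta> * pr \<theta> \<alpha>)) \<in> borel_measurable lborel" by simp
    qed
    also have "\<dots> \<le> ennreal l * (ennreal ?\<eta> * (\<integral>\<^sup>+\<theta>. g \<theta> \<partial>lborel))"
      unfolding g_def N_def
      by (intro mult_left_mono kern_contraction[OF \<theta>0 _ \<delta> S pr0 pm(2) _ prt \<rho> R low up])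
         (use N pm(3) in \<open>auto simp: N_def\<close>)
    also have "\<dots> = ennreal ?\<eta> * (\<integral>\<^sup>+\<theta>. f \<theta> \<partial>lborel)" unfolding Zf by (simp add: mult_ac)
    finally show "(\<integral>\<^sup>+\<theta>. f \<theta> * indicator ?B \<theta> \<partial>lborel) \<le> ennreal ?\<eta> * (\<integral>\<^sup>+\<theta>. f \<theta> \<partial>lborel)" .
  qed
qed

end

context design
begin

text \<open>The \<alpha>-axis is cut at lo and hi. In between, the contraction for given \<alpha> is
  uniform and can be integrated. On each tail the whole likelihood is bounded by its value at the
  end of the range times a power of \<alpha>, which the prior tail integrates; the result is
  compared with the mass near the true parameters, \<alpha> in [\<alpha>0, \<alpha>1] and \<theta>
  in [\<theta>0, \<theta>0 (1 + 1 / N)].\<close>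

lemma posterior_bound:
  fixes lo hi \<alpha>0 \<alpha>1 \<theta>0 T \<delta> \<rho> R V c1 c2 t_lo t_hi tr :: real
  assumes n: "p < n" and y: "y \<in> carrier_vec n" and \<theta>0: "0 < \<theta>0" and T: "0 < T"
    and pc: "prior_cond p \<Omega> \<theta>0 pr"
    and pa: "\<And>\<alpha>. 0 < \<alpha> \<Longrightarrow> 0 \<le> pa \<alpha>" "continuous_on {0<..} pa" "(\<integral>\<^sup>+\<alpha>\<in>{0<..}. ennreal (pa \<alpha>) \<partial>lborel) = 1"
    and \<alpha>: "0 < lo" "lo \<le> \<alpha>0" "\<alpha>0 < \<alpha>1" "\<alpha>1 \<le> hi" and \<delta>: "0 < \<delta>" "\<delta> \<le> 1 / 100"
    and S: "\<And>\<alpha>. \<alpha> \<in> {lo..hi} \<Longrightarrow> \<bar>rss y \<alpha> - (real n - real p) * \<theta>0\<bar> \<le> 11 / 10 * \<delta> * ((real n - real p) * \<theta>0)"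
    and \<rho>: "0 < \<rho>" and R: "0 \<le> R" and V: "\<And>\<alpha>. \<alpha> \<in> {lo..hi} \<Longrightarrow> 1 / pr \<theta>0 \<alpha> \<le> V"
    and low: "\<And>\<theta> \<alpha>. \<alpha> \<in> {lo..hi} \<Longrightarrow> \<theta> \<in> {\<theta>0..\<theta>0 * (1 + 1 / (real n - real p))} \<Longrightarrow> \<rho> * pr \<theta>0 \<alpha> \<le> pr \<theta> \<alpha>"
    and up: "\<And>\<theta> \<alpha>. \<alpha> \<in> {lo..hi} \<Longrightarrow> \<theta> \<in> {\<theta>0 / 2<..<2 * \<theta>0} \<Longrightarrow> pr \<theta> \<alpha> \<le> R * pr \<theta>0 \<alpha>"
    and c: "0 < c1" "0 < c2" "\<And>\<alpha>. \<alpha> \<in> {\<alpha>0..\<alpha>1} \<Longrightarrow> c1 \<le> pa \<alpha>" "\<And>\<alpha>. \<alpha> \<in> {\<alpha>0..\<alpha>1} \<Longrightarrow> c2 \<le> pr \<theta>0 \<alpha>"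
    and t: "0 \<le> t_lo" "0 \<le> t_hi"
      "(\<integral>\<^sup>+\<alpha>\<in>{0<..lo}. ennreal (\<alpha> powr (- real n * (\<nu> + real CARD('d) / 2)) * pa \<alpha>) \<partial>lborel) \<le> ennreal t_lo"
      "(\<integral>\<^sup>+\<alpha>\<in>{hi..}. ennreal (\<alpha> powr (real n * (\<nu> + real CARD('d) / 2)) * pa \<alpha>) \<partial>lborel) \<le> ennreal t_hi"
    and tr: "mdet (K \<alpha>0) \<le> exp tr * mdet (K hi)"
  defines "N \<equiv> real n - real p" and "q \<equiv> \<nu> + real CARD('d) / 2"
  shows "prob_space (posterior p m \<Omega> \<nu> pr pa s n y)"
    "measure (posterior p m \<Omega> \<nu> pr pa s n y)
      {(\<theta>, \<alpha>). 0 < \<theta> \<and> 0 < \<alpha> \<and> pred_var_dev p m \<Omega> \<nu> T \<theta>0 s n \<theta> \<alpha> > ereal (7 * \<delta>)} \<le>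
     (exp (- (3 / 2 * N * \<delta>\<^sup>2)) * R * (3 / 2 * \<theta>0) + exp (- (N / 64)) * V) * (N * exp (1 / 2) / (\<theta>0 * \<rho>)) +
     (lo powr (q * n) * t_lo * (\<alpha>1 / lo) powr (q * p) + hi powr (- (q * n)) * t_hi * exp (tr / 2)) * exp (2 * \<delta> * N) *
       (N * exp (1 / 2) / (c1 * c2 * \<rho> * \<theta>0 * (\<alpha>1 - \<alpha>0)))" (is "_ \<le> ?\<eta> + ?\<tau>")
proof -
  let ?g = "\<lambda>\<alpha> \<theta>. ennreal (kern N (rss y \<alpha>) \<theta> * pr \<theta> \<alpha>)"
  let ?G = "N * exp (1 / 2) / (c1 * c2 * \<rho> * \<theta>0 * (\<alpha>1 - \<alpha>0))"
  have N: "1 \<le> N" using n by (simp add: N_def)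
  have Ne: "N = real n - real p" by (simp add: N_def)
  have q: "0 < q" using \<nu> by (simp add: q_def add_pos_nonneg)
  have \<alpha>0: "0 < \<alpha>0" and hi: "0 < hi" "lo \<le> hi" using \<alpha> by auto
  have pr0: "0 \<le> pr \<theta> \<alpha>" if "0 < \<theta>" "0 < \<alpha>" for \<theta> \<alpha> using pc that by (auto simp: prior_cond_def)
  have prt: "0 < pr \<theta>0 \<alpha>" if "0 < \<alpha>" for \<alpha> using pc that by (auto simp: prior_cond_def)
  define J where "J \<alpha> = (\<integral>\<^sup>+\<theta>. indicator {0<..} \<theta> * ?g \<alpha> \<theta> \<partial>lborel)" for \<alpha>
  define f where "f = (\<lambda>(\<theta>, \<alpha>). indicator ({0<..} \<times> {0<..}) (\<theta>, \<alpha>) *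
       ennreal (exp (restricted_loglik p m \<Omega> \<nu> s n y (\<theta> / \<alpha> powr (2 * \<nu>)) \<alpha>) * pr \<theta> \<alpha> * pa \<alpha>))"
  have post: "posterior p m \<Omega> \<nu> pr pa s n y = density_proportional f"
    by (simp add: posterior_def f_def)
  let ?B = "{(\<theta>, \<alpha>). 0 < \<theta> \<and> 0 < \<alpha> \<and> \<bar>\<theta> / \<theta>0 - 1\<bar> > 7 * \<delta>} :: (real \<times> real) set"
  let ?B1 = "{\<theta>. 0 < \<theta> \<and> \<bar>\<theta> / \<theta>0 - 1\<bar> > 7 * \<delta>}"
  have B: "{(\<theta>, \<alpha>). 0 < \<theta> \<and> 0 < \<alpha> \<and> pred_var_dev p m \<Omega> \<nu> T \<theta>0 s n \<theta> \<alpha> > ereal (7 * \<delta>)} = ?B"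
    using pred_var_dev_eq[OF _ \<theta>0 _ T] by auto
  have Bm[measurable]: "?B \<in> sets (borel \<Otimes>\<^sub>M borel)"
  proof -
    have "?B = {z \<in> space (borel \<Otimes>\<^sub>M borel). 0 < fst z \<and> 0 < snd z \<and> \<bar>fst z / \<theta>0 - 1\<bar> > 7 * \<delta>}"
      by (auto simp: space_pair_measure)
    also have "\<dots> \<in> sets (borel \<Otimes>\<^sub>M borel)" by measurable
    finally show ?thesis .
  qed
  define pa' where "pa' \<alpha> = indicator {0<..} \<alpha> *\<^sub>R pa \<alpha>" for \<alpha>
  have pam[measurable]: "pa' \<in> borel_measurable borel"
    unfolding pa'_def[abs_def] by (rule borel_measurable_continuous_on_indicator[OF _ pa(2)]) simp
  \<comment> \<open>\<open>rss\<close> and \<open>lik_const\<close> are measurable by monotonicity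
    in \<alpha>, the prior for \<theta> jointly by separate continuity.\<close>
  have fm[measurable]: "f \<in> borel_measurable (borel \<Otimes>\<^sub>M borel)"
  proof -
    define r' where "r' \<alpha> = (if 0 < \<alpha> then rss y \<alpha> else 0)" for \<alpha>
    define l' where "l' \<alpha> = (if 0 < \<alpha> then lik_const \<alpha> else 0)" for \<alpha>
    have [measurable]: "r' \<in> borel_measurable borel" "l' \<in> borel_measurable borel"
      unfolding r'_def[abs_def] l'_def[abs_def] by (rule rss_borel[OF y] lik_const_borel)+
    have "continuous_on {0<..} (pr \<theta>)" if "0 < \<theta>" for \<theta> using pc that by (auto simp: prior_cond_def)
    then have prm[measurable]: "(\<lambda>(\<theta>, \<alpha>). indicator ({0<..} \<times> {0<..}) (\<theta>, \<alpha>) * pr \<theta> \<alpha>) \<in> borel_measurable (borel \<Otimes>\<^sub>M borel)"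
      unfolding borel_prod by (intro caratheodory_measurable prior_cond_measurable(1)[OF pc])
    have "f = (\<lambda>z. ennreal ((l' (snd z) * (fst z powr (- (N / 2)) * exp (- r' (snd z) / (2 * fst z)))) *
        (case z of (\<theta>, \<alpha>) \<Rightarrow> indicator ({0<..} \<times> {0<..}) (\<theta>, \<alpha>) * pr \<theta> \<alpha>) * pa' (snd z)))"
    proof
      fix z :: "real \<times> real"
      obtain \<theta> \<alpha> where z: "z = (\<theta>, \<alpha>)" by (cases z)
      show "f z = ennreal ((l' (snd z) * (fst z powr (- (N / 2)) * exp (- r' (snd z) / (2 * fst z)))) *
        (case z of (\<theta>, \<alpha>) \<Rightarrow> indicator ({0<..} \<times> {0<..}) (\<theta>, \<alpha>) * pr \<theta> \<alpha>) * pa' (snd z))"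
      proof (cases "0 < \<theta> \<and> 0 < \<alpha>")
        case True
        then show ?thesis
          using exp_restricted_loglik_kern[of \<alpha> \<theta> y] y
          by (simp add: z f_def r'_def l'_def pa'_def kern_def N_def)
      qed (auto simp: z f_def)
    qed
    then show ?thesis by simp
  qed
  have fm': "f \<in> borel_measurable borel" using fm by (simp add: borel_prod)
  define H where "H \<alpha> = (\<integral>\<^sup>+\<theta>. f (\<theta>, \<alpha>) \<partial>lborel)" for \<alpha>
  define Hb where "Hb \<alpha> = (\<integral>\<^sup>+\<theta>. f (\<theta>, \<alpha>) * indicator ?B (\<theta>, \<alpha>) \<partial>lborel)" for \<alpha>
  have Hm[measurable]: "H \<in> borel_measurable borel" unfolding H_def[abs_def] by measurable
  have fub: "(\<integral>\<^sup>+z. h z \<partial>lborel) = (\<integral>\<^sup>+\<alpha>. \<integral>\<^sup>+\<theta>. h (\<theta>, \<alpha>) \<partial>lborel \<partial>lborel)"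
    if "h \<in> borel_measurable (borel \<Otimes>\<^sub>M borel)" for h :: "real \<times> real \<Rightarrow> ennreal"
  proof -
    have "h \<in> borel_measurable (lborel \<Otimes>\<^sub>M lborel)" using that by simp
    from lborel_pair.nn_integral_snd[OF this] show ?thesis unfolding lborel_prod by (rule sym)
  qed
  have Z: "(\<integral>\<^sup>+z. f z \<partial>lborel) = (\<integral>\<^sup>+\<alpha>. H \<alpha> \<partial>lborel)" unfolding H_def by (rule fub[OF fm])
  have Zb: "(\<integral>\<^sup>+z. f z * indicator ?B z \<partial>lborel) = (\<integral>\<^sup>+\<alpha>. Hb \<alpha> \<partial>lborel)"
    unfolding Hb_def by (rule fub) measurable
  have H0: "H \<alpha> = 0" "Hb \<alpha> = 0" if "\<not> 0 < \<alpha>" for \<alpha> using that by (auto simp: H_def Hb_def f_def)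
  have HbH: "Hb \<alpha> \<le> H \<alpha>" for \<alpha>
    unfolding H_def Hb_def by (intro nn_integral_mono) (auto simp: indicator_def)
  have fe: "f (\<theta>, \<alpha>) = ennreal (lik_const \<alpha> * pa \<alpha>) * (indicator {0<..} \<theta> * ?g \<alpha> \<theta>)"
    if a: "0 < \<alpha>" for \<theta> \<alpha> :: real
  proof (cases "0 < \<theta>")
    case True
    have "ennreal (lik_const \<alpha> * kern N (rss y \<alpha>) \<theta> * pr \<theta> \<alpha> * pa \<alpha>) =
        ennreal ((lik_const \<alpha> * pa \<alpha>) * (kern N (rss y \<alpha>) \<theta> * pr \<theta> \<alpha>))" by (simp add: mult_ac)
    also have "\<dots> = ennreal (lik_const \<alpha> * pa \<alpha>) * ?g \<alpha> \<theta>"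
      by (rule ennreal_mult') (use lik_const_pos[OF a] pa(1)[OF a] in simp)
    finally show ?thesis using True a
      by (simp add: f_def exp_restricted_loglik_kern[OF a True y] N_def)
  qed (simp add: f_def)
  have gm: "(\<lambda>\<theta>. indicator {0<..} \<theta> * ?g \<alpha> \<theta>) \<in> borel_measurable borel"
    and gbm: "(\<lambda>\<theta>. indicator ?B1 \<theta> * ?g \<alpha> \<theta>) \<in> borel_measurable borel"
    if a: "0 < \<alpha>" for \<alpha>
  proof -
    note [measurable] = prior_cond_measurable(2)[OF pc a]
    have 1: "(\<lambda>\<theta>. indicator {0<..} \<theta> * ?g \<alpha> \<theta>) =
       (\<lambda>\<theta>. ennreal (kern N (rss y \<alpha>) \<theta>) * (indicator {0<..} \<theta> * ennreal (pr \<theta> \<alpha>)))"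
      by (rule ext) (simp only: ennreal_mult'[OF kern_nonneg] mult.left_commute)
    show g: "(\<lambda>\<theta>. indicator {0<..} \<theta> * ?g \<alpha> \<theta>) \<in> borel_measurable borel"
      unfolding 1 by measurable
    have 2: "(\<lambda>\<theta>. indicator ?B1 \<theta> * ?g \<alpha> \<theta>) =
      (\<lambda>\<theta>. indicator ?B1 \<theta> * (indicator {0<..} \<theta> * ?g \<alpha> \<theta>))"
      by (auto simp: fun_eq_iff indicator_def)
    note g[measurable]
    show "(\<lambda>\<theta>. indicator ?B1 \<theta> * ?g \<alpha> \<theta>) \<in> borel_measurable borel"
      unfolding 2 by measurable
  qed
  have HJ: "H \<alpha> = ennreal (lik_const \<alpha> * pa \<alpha>) * J \<alpha>" if a: "0 < \<alpha>" for \<alpha>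
    unfolding H_def J_def fe[OF a] by (rule nn_integral_cmult) (use gm[OF a] in simp)
  have HbJ: "Hb \<alpha> = ennreal (lik_const \<alpha> * pa \<alpha>) * (\<integral>\<^sup>+\<theta>. indicator ?B1 \<theta> * ?g \<alpha> \<theta> \<partial>lborel)"
    if a: "0 < \<alpha>" for \<alpha>
  proof -
    have "Hb \<alpha> = (\<integral>\<^sup>+\<theta>. ennreal (lik_const \<alpha> * pa \<alpha>) * (indicator ?B1 \<theta> * ?g \<alpha> \<theta>) \<partial>lborel)"
      unfolding Hb_def fe[OF a] by (intro nn_integral_cong) (use a in \<open>auto simp: indicator_def\<close>)
    also have "\<dots> = ennreal (lik_const \<alpha> * pa \<alpha>) * (\<integral>\<^sup>+\<theta>. indicator ?B1 \<theta> * ?g \<alpha> \<theta> \<partial>lborel)"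
      by (rule nn_integral_cmult) (use gbm[OF a] in simp)
    finally show ?thesis .
  qed
  define S1 where "S1 = N * \<theta>0 * (1 - 11 / 10 * \<delta>)"
  have S1: "0 < S1" using N \<theta>0 \<delta> by (simp add: S1_def)
  have SS: "S1 \<le> rss y \<alpha>" "rss y \<alpha> \<le> N * \<theta>0 * (1 + 11 / 10 * \<delta>)" if "\<alpha> \<in> {lo..hi}" for \<alpha>
  proof -
    have "\<bar>rss y \<alpha> - N * \<theta>0\<bar> \<le> N * \<theta>0 * (11 / 10 * \<delta>)" using S[OF that] by (simp add: N_def mult_ac)
    then show "S1 \<le> rss y \<alpha>" "rss y \<alpha> \<le> N * \<theta>0 * (1 + 11 / 10 * \<delta>)"
      unfolding S1_def right_diff_distrib distrib_left mult_1_right by linarith+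
  qed
  \<comment> \<open>Lower bound, over the whole range, for the kernel at \<theta>0; \<open>E\<close>
    is the matching upper bound for its peak, and they differ by no more than exp (2 \<delta>
    N).\<close>
  define k0 where "k0 = \<theta>0 powr (- (N / 2)) * exp (- (N / 2 * (1 + 11 / 10 * \<delta>)))"
  have k0: "0 < k0" using \<theta>0 by (simp add: k0_def)
  define E where "E = (N / S1) powr (N / 2) * exp (- (N / 2))"
  have E0: "0 \<le> E" by (simp add: E_def)
  \<comment> \<open>The exponent comes out as 11/10 + 11/20 times \<delta> N and is rounded up to
    2.\<close>
  have E: "E \<le> k0 * exp (2 * \<delta> * N)"
  proof -
    have x: "0 < 1 - 11 / 10 * \<delta>" using \<delta> by simp
    have "1 / (1 - 11 / 10 * \<delta>) \<le> exp (22 / 10 * \<delta>)"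
    proof -
      have "\<delta> * (242 / 100 * \<delta>) \<le> \<delta> * (11 / 10)" using \<delta> by (intro mult_left_mono) auto
      then have "1 \<le> (1 + 22 / 10 * \<delta>) * (1 - 11 / 10 * \<delta>)" by (simp add: algebra_simps)
      also have "\<dots> \<le> exp (22 / 10 * \<delta>) * (1 - 11 / 10 * \<delta>)"
        using exp_ge_add_one_self[of "22 / 10 * \<delta>"] x by (intro mult_right_mono) auto
      finally show ?thesis using x by (simp add: pos_divide_le_eq)
    qed
    then have "(1 / (1 - 11 / 10 * \<delta>)) powr (N / 2) \<le> exp (22 / 10 * \<delta>) powr (N / 2)"
      using x N by (intro powr_mono2) auto
    also have "\<dots> = exp (11 / 10 * \<delta> * N)" by (simp add: powr_def mult_ac)
    finally have a: "(1 / (1 - 11 / 10 * \<delta>)) powr (N / 2) \<le> exp (11 / 10 * \<delta> * N)" .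
    have "N / S1 = (1 / \<theta>0) * (1 / (1 - 11 / 10 * \<delta>))" using N by (simp add: S1_def)
    then have "(N / S1) powr (N / 2) = (1 / \<theta>0) powr (N / 2) * (1 / (1 - 11 / 10 * \<delta>)) powr (N / 2)"
      using x \<theta>0 by (simp only: powr_mult)
    also have "(1 / \<theta>0) powr (N / 2) = \<theta>0 powr (- (N / 2))" using \<theta>0 by (simp add: powr_minus_divide powr_divide)
    also have "\<theta>0 powr (- (N / 2)) * (1 / (1 - 11 / 10 * \<delta>)) powr (N / 2) \<le> \<theta>0 powr (- (N / 2)) * exp (11 / 10 * \<delta> * N)"
      by (rule mult_left_mono[OF a]) simp
    finally have "E \<le> \<theta>0 powr (- (N / 2)) * exp (11 / 10 * \<delta> * N) * exp (- (N / 2))"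
      unfolding E_def by (rule mult_right_mono) simp
    also have "\<dots> = \<theta>0 powr (- (N / 2)) * exp (11 / 10 * \<delta> * N + - (N / 2))" by (simp only: mult.assoc exp_add)
    also have "\<dots> \<le> \<theta>0 powr (- (N / 2)) * exp (- (N / 2 * (1 + 11 / 10 * \<delta>)) + 2 * \<delta> * N)"
      using N \<delta> by (intro mult_left_mono) (auto simp: algebra_simps)
    also have "\<dots> = k0 * exp (2 * \<delta> * N)" by (simp only: k0_def exp_add mult.assoc)
    finally show ?thesis .
  qed
  define X where "X = c1 * c2 * k0 * exp (- (1 / 2)) * \<rho> * (\<theta>0 / N) * (\<alpha>1 - \<alpha>0)"
  have X: "0 < X" using c k0 \<rho> \<theta>0 N \<alpha> by (simp add: X_def)
  \<comment> \<open>Lower bound for the normaliser, with a free lower bound \<open>l\<close> for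
    \<open>lik_const\<close> near \<alpha>0, because the two tails supply different ones.\<close>
  have Zlow: "ennreal (l * X) \<le> (\<integral>\<^sup>+z. f z \<partial>lborel)"
    if l: "0 \<le> l" "\<And>\<alpha>. \<alpha> \<in> {\<alpha>0..\<alpha>1} \<Longrightarrow> l \<le> lik_const \<alpha>" for l
  proof -
    define Y where "Y = l * c1 * (k0 * exp (- (1 / 2)) * (\<rho> * c2) * (\<theta>0 / N))"
    have Y: "0 \<le> Y" using l c k0 \<rho> \<theta>0 N by (simp add: Y_def)
    have "l * X = Y * (\<alpha>1 - \<alpha>0)" by (simp add: X_def Y_def)
    then have "ennreal (l * X) = ennreal Y * emeasure lborel {\<alpha>0..\<alpha>1}" using \<alpha> Y by (simp add: ennreal_mult')
    also have "\<dots> = (\<integral>\<^sup>+\<alpha>. ennreal Y * indicator {\<alpha>0..\<alpha>1} \<alpha> \<partial>lborel)" by (simp add: nn_integral_cmult_indicator)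
    also have "\<dots> \<le> (\<integral>\<^sup>+\<alpha>. H \<alpha> \<partial>lborel)"
    proof (rule nn_integral_mono)
      fix \<alpha>
      show "ennreal Y * indicator {\<alpha>0..\<alpha>1} \<alpha> \<le> H \<alpha>"
      proof (cases "\<alpha> \<in> {\<alpha>0..\<alpha>1}")
        case True
        then have a: "0 < \<alpha>" "\<alpha> \<in> {lo..hi}" using \<alpha> by auto
        have "k0 \<le> kern N (rss y \<alpha>) \<theta>0"
        proof -
          have "rss y \<alpha> / (2 * \<theta>0) \<le> N * \<theta>0 * (1 + 11 / 10 * \<delta>) / (2 * \<theta>0)"
            using SS(2)[OF a(2)] \<theta>0 by (intro divide_right_mono) auto
          also have "\<dots> = N / 2 * (1 + 11 / 10 * \<delta>)" using \<theta>0 by simp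
          finally show ?thesis unfolding k0_def kern_def by (intro mult_left_mono) auto
        qed
        then have "Y \<le> (lik_const \<alpha> * pa \<alpha>) * (kern N (rss y \<alpha>) \<theta>0 * exp (- (1 / 2)) * (\<rho> * pr \<theta>0 \<alpha>) * (\<theta>0 / N))"
          unfolding Y_def using l(1) l(2)[OF True] c(1,2) c(3,4)[OF True] k0 \<rho> \<theta>0 N
          by (intro mult_mono mult_nonneg_nonneg) auto
        then have "ennreal Y \<le> ennreal (lik_const \<alpha> * pa \<alpha>) * ennreal (kern N (rss y \<alpha>) \<theta>0 * exp (- (1 / 2)) * (\<rho> * pr \<theta>0 \<alpha>) * (\<theta>0 / N))"
          using lik_const_pos[OF a(1)] pa(1)[OF a(1)] by (simp only: ennreal_mult'[symmetric] ennreal_leI mult_nonneg_nonneg less_imp_le)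
        also have "\<dots> \<le> ennreal (lik_const \<alpha> * pa \<alpha>) * J \<alpha>"
          unfolding J_def
          by (intro mult_left_mono kern_prior_mass[OF \<theta>0 N])
             (use SS(1)[OF a(2)] S1 \<rho> prt[OF a(1)] low[OF a(2)] in \<open>auto simp: N_def\<close>)
        also have "\<dots> = H \<alpha>" by (rule HJ[OF a(1), symmetric])
        finally show ?thesis using True by simp
      qed simp
    qed
    finally show ?thesis unfolding Z .
  qed
  have lo_hi: "lo \<in> {lo..hi}" "hi \<in> {lo..hi}" using hi by auto
  have tail: "H \<alpha> \<le> ennreal c0 * ennreal (pa \<alpha>)"
    if a: "0 < \<alpha>" and c0: "0 \<le> c0" "\<And>\<theta>. 0 < \<theta> \<Longrightarrow> lik_const \<alpha> * kern N (rss y \<alpha>) \<theta> \<le> c0" for \<alpha> c0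
  proof -
    have l: "0 < lik_const \<alpha>" by (rule lik_const_pos[OF a])
    have "J \<alpha> \<le> ennreal (c0 / lik_const \<alpha>)"
      unfolding J_def by (rule kern_prior_mass_le[OF pc a]) (use c0 l in \<open>auto simp: pos_le_divide_eq mult.commute\<close>)
    then have "H \<alpha> \<le> ennreal (lik_const \<alpha> * pa \<alpha>) * ennreal (c0 / lik_const \<alpha>)"
      unfolding HJ[OF a] by (rule mult_left_mono) simp
    also have "\<dots> = ennreal (lik_const \<alpha> * pa \<alpha> * (c0 / lik_const \<alpha>))"
      by (rule ennreal_mult'[symmetric]) (use l pa(1)[OF a] in simp)
    also have "lik_const \<alpha> * pa \<alpha> * (c0 / lik_const \<alpha>) = c0 * pa \<alpha>" using l by simp
    also have "ennreal (c0 * pa \<alpha>) = ennreal c0 * ennreal (pa \<alpha>)" by (rule ennreal_mult'[OF c0(1)])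
    finally show ?thesis .
  qed
  \<comment> \<open>The constants left when the powers of lo / \<alpha> and \<alpha> / hi are
    separated into a power of the end point and the power of \<alpha> in the prior tail
    integral.\<close>
  define Alo where "Alo = lo powr (q * n) * (lik_const lo * E)"
  define Ahi where "Ahi = hi powr (- (q * n)) * (lik_const hi * E)"
  note lpos = lik_const_pos[OF \<alpha>(1)] lik_const_pos[OF hi(1)]
  have A0: "0 \<le> Alo" "0 \<le> Ahi" using lpos E0 by (auto simp: Alo_def Ahi_def)
  define glo where "glo \<alpha> = ennreal (\<alpha> powr (- real n * q) * pa \<alpha>) * indicator {0<..lo} \<alpha>" for \<alpha>
  define ghi where "ghi \<alpha> = ennreal (\<alpha> powr (real n * q) * pa \<alpha>) * indicator {hi..} \<alpha>" for \<alpha>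
  have ghm: "glo \<in> borel_measurable borel" "ghi \<in> borel_measurable borel"
  proof -
    have "glo = (\<lambda>\<alpha>. ennreal (\<alpha> powr (- real n * q) * pa' \<alpha>) * indicator {0<..lo} \<alpha>)"
      "ghi = (\<lambda>\<alpha>. ennreal (\<alpha> powr (real n * q) * pa' \<alpha>) * indicator {hi..} \<alpha>)"
      using hi by (auto simp: glo_def ghi_def pa'_def fun_eq_iff indicator_def)
    then show "glo \<in> borel_measurable borel" "ghi \<in> borel_measurable borel" by simp_all
  qed
  note [measurable] = ghm
  have Hlo: "H \<alpha> \<le> ennreal Alo * glo \<alpha>" if a: "0 < \<alpha>" "\<alpha> \<le> lo" for \<alpha>
  proof -
    have "H \<alpha> \<le> ennreal ((lo / \<alpha>) powr (q * n) * (lik_const lo * E)) * ennreal (pa \<alpha>)"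
      unfolding E_def q_def
      by (rule tail[OF a(1)], use lpos in simp)
         (rule lik_low_tail[OF a _ y S1 SS(1)[OF lo_hi(1)] Ne], use N in auto)
    also have "(lo / \<alpha>) powr (q * n) * (lik_const lo * E) = Alo * \<alpha> powr (- real n * q)"
      using a \<alpha> by (simp add: Alo_def powr_divide powr_minus_divide mult.commute)
    also have "ennreal (Alo * \<alpha> powr (- real n * q)) * ennreal (pa \<alpha>) = ennreal Alo * glo \<alpha>"
      using a A0 pa(1)[OF a(1)] by (simp add: glo_def ennreal_mult' ennreal_mult'' mult_ac)
    finally show ?thesis .
  qed
  have Hhi: "H \<alpha> \<le> ennreal Ahi * ghi \<alpha>" if a: "hi \<le> \<alpha>" for \<alpha>
  proof -
    have a0: "0 < \<alpha>" using a hi by simp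
    have "H \<alpha> \<le> ennreal ((\<alpha> / hi) powr (q * n) * (lik_const hi * E)) * ennreal (pa \<alpha>)"
      unfolding E_def q_def
      by (rule tail[OF a0], use lpos in simp)
         (rule lik_high_tail[OF hi(1) a _ y S1 SS(1)[OF lo_hi(2)] Ne], use N in auto)
    also have "(\<alpha> / hi) powr (q * n) * (lik_const hi * E) = Ahi * \<alpha> powr (real n * q)"
      using a0 hi by (simp add: Ahi_def powr_divide powr_minus_divide mult.commute)
    also have "ennreal (Ahi * \<alpha> powr (real n * q)) * ennreal (pa \<alpha>) = ennreal Ahi * ghi \<alpha>"
      using a A0 pa(1)[OF a0] by (simp add: ghi_def ennreal_mult' ennreal_mult'' mult_ac)
    finally show ?thesis .
  qed
  have Glo: "(\<integral>\<^sup>+\<alpha>. ennreal Alo * glo \<alpha> \<partial>lborel) \<le> ennreal (Alo * t_lo)"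
  proof -
    have "(\<integral>\<^sup>+\<alpha>. ennreal Alo * glo \<alpha> \<partial>lborel) = ennreal Alo * (\<integral>\<^sup>+\<alpha>. glo \<alpha> \<partial>lborel)" by (rule nn_integral_cmult) simp
    also have "\<dots> \<le> ennreal Alo * ennreal t_lo" unfolding glo_def q_def by (intro mult_left_mono t) simp
    finally show ?thesis using A0 by (simp add: ennreal_mult')
  qed
  have Ghi: "(\<integral>\<^sup>+\<alpha>. ennreal Ahi * ghi \<alpha> \<partial>lborel) \<le> ennreal (Ahi * t_hi)"
  proof -
    have "(\<integral>\<^sup>+\<alpha>. ennreal Ahi * ghi \<alpha> \<partial>lborel) = ennreal Ahi * (\<integral>\<^sup>+\<alpha>. ghi \<alpha> \<partial>lborel)" by (rule nn_integral_cmult) simp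
    also have "\<dots> \<le> ennreal Ahi * ennreal t_hi" unfolding ghi_def q_def by (intro mult_left_mono t) simp
    finally show ?thesis using A0 by (simp add: ennreal_mult')
  qed
  have Z0: "(\<integral>\<^sup>+z. f z \<partial>lborel) \<noteq> 0"
  proof -
    define l where "l = lik_const lo / (\<alpha>1 / lo) powr (q * p)"
    have l: "0 < l" using lpos \<alpha> by (simp add: l_def)
    have "l \<le> lik_const \<alpha>" if "\<alpha> \<in> {\<alpha>0..\<alpha>1}" for \<alpha>
    proof -
      have "lik_const lo \<le> (\<alpha> / lo) powr (q * p) * lik_const \<alpha>"
        unfolding q_def by (rule lik_const_low) (use \<alpha> that in auto)
      also have "\<dots> \<le> (\<alpha>1 / lo) powr (q * p) * lik_const \<alpha>"
        using \<alpha> that q lik_const_pos[of \<alpha>] by (intro mult_right_mono powr_mono2 divide_right_mono) auto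
      finally show ?thesis unfolding l_def using \<alpha> by (simp add: pos_divide_le_eq mult.commute)
    qed
    then have "ennreal (l * X) \<le> (\<integral>\<^sup>+z. f z \<partial>lborel)" using l by (intro Zlow) auto
    then have "0 < (\<integral>\<^sup>+z. f z \<partial>lborel)" by (rule less_le_trans[rotated]) (use l X in simp)
    then show ?thesis by simp
  qed
  \<comment> \<open>Finiteness: in the middle the normalising constant and the kernel are bounded
    and the prior for \<alpha> is proper; the two tails are finite by the prior tail bounds.\<close>
  have Z1: "(\<integral>\<^sup>+z. f z \<partial>lborel) \<noteq> \<infinity>"
  proof -
    define Am where "Am = (hi / lo) powr (q * p) * lik_const hi * E"
    have Am: "0 \<le> Am" using lpos E0 by (simp add: Am_def)
    have "(\<integral>\<^sup>+\<alpha>. H \<alpha> \<partial>lborel) \<le> (\<integral>\<^sup>+\<alpha>. ennreal Am * (ennreal (pa \<alpha>) * indicator {0<..} \<alpha>) + (ennreal Alo * glo \<alpha> + ennreal Ahi * ghi \<alpha>) \<partial>lborel)"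
    proof (rule nn_integral_mono)
      fix \<alpha>
      consider "\<alpha> \<le> 0" | "0 < \<alpha>" "\<alpha> \<le> lo" | "hi \<le> \<alpha>" | "lo < \<alpha>" "\<alpha> < hi" by linarith
      then show "H \<alpha> \<le> ennreal Am * (ennreal (pa \<alpha>) * indicator {0<..} \<alpha>) + (ennreal Alo * glo \<alpha> + ennreal Ahi * ghi \<alpha>)"
      proof cases
        case 1 then show ?thesis using H0 by simp
      next
        case 2 then show ?thesis using Hlo[of \<alpha>] by (simp add: add_increasing add_increasing2)
      next
        case 3 then show ?thesis using Hhi[of \<alpha>] by (simp add: add_increasing)
      next
        case 4
        then have a: "0 < \<alpha>" "\<alpha> \<in> {lo..hi}" using \<alpha> by auto
        have "lik_const \<alpha> \<le> (hi / \<alpha>) powr (q * p) * lik_const hi"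
          unfolding q_def by (rule lik_const_low) (use a in auto)
        also have "\<dots> \<le> (hi / lo) powr (q * p) * lik_const hi"
          using a \<alpha> q lpos by (intro mult_right_mono powr_mono2 divide_left_mono) auto
        finally have l: "lik_const \<alpha> \<le> (hi / lo) powr (q * p) * lik_const hi" .
        have "kern N (rss y \<alpha>) \<theta> \<le> E" if "0 < \<theta>" for \<theta>
        proof -
          have "kern N (rss y \<alpha>) \<theta> \<le> (N / rss y \<alpha>) powr (N / 2) * exp (- (N / 2))"
            by (rule kern_le_max) (use N SS(1)[OF a(2)] S1 that in auto)
          also have "\<dots> \<le> E" unfolding E_def using N SS(1)[OF a(2)] S1
            by (intro mult_right_mono powr_mono2 divide_left_mono) auto
          finally show ?thesis .
        qed
        with l have "lik_const \<alpha> * kern N (rss y \<alpha>) \<theta> \<le> Am" if "0 < \<theta>" for \<theta>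
          unfolding Am_def using that lpos by (intro mult_mono) auto
        then have "H \<alpha> \<le> ennreal Am * ennreal (pa \<alpha>)" by (rule tail[OF a(1) Am])
        then show ?thesis using a by (simp add: add_increasing2)
      qed
    qed
    also have "\<dots> = ennreal Am * (\<integral>\<^sup>+\<alpha>. ennreal (pa \<alpha>) * indicator {0<..} \<alpha> \<partial>lborel) + ((\<integral>\<^sup>+\<alpha>. ennreal Alo * glo \<alpha> \<partial>lborel) + (\<integral>\<^sup>+\<alpha>. ennreal Ahi * ghi \<alpha> \<partial>lborel))"
    proof -
      have "(\<lambda>\<alpha>. ennreal (pa \<alpha>) * indicator {0<..} \<alpha>) = (\<lambda>\<alpha>. ennreal (pa' \<alpha>))" by (auto simp: pa'_def indicator_def)
      then have [measurable]: "(\<lambda>\<alpha>. ennreal (pa \<alpha>) * indicator {0<..} \<alpha>) \<in> borel_measurable borel" by simp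
      show ?thesis by (subst nn_integral_add; simp add: nn_integral_add nn_integral_cmult)
    qed
    also have "\<dots> \<le> ennreal Am + (ennreal (Alo * t_lo) + ennreal (Ahi * t_hi))"
      using Glo Ghi by (simp add: pa(3) add_mono)
    also have "\<dots> < \<infinity>" by simp
    finally show ?thesis unfolding Z by simp
  qed
  show "prob_space (posterior p m \<Omega> \<nu> pr pa s n y)"
    unfolding post by (rule prob_space_density_proportional[OF fm' Z0 Z1])
  have \<eta>0: "0 \<le> ?\<eta>"
  proof -
    have "0 \<le> V" by (rule order_trans[OF _ V[OF lo_hi(1)]]) (use prt[OF \<alpha>(1)] in simp)
    then show ?thesis using N R \<theta>0 \<rho> by (intro mult_nonneg_nonneg add_nonneg_nonneg divide_nonneg_nonneg) auto
  qed
  have mid: "Hb \<alpha> \<le> ennreal ?\<eta> * H \<alpha>" if a: "\<alpha> \<in> {lo..hi}" for \<alpha>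
  proof -
    have a0: "0 < \<alpha>" using a \<alpha> by simp
    have "Hb \<alpha> \<le> ennreal (lik_const \<alpha> * pa \<alpha>) * (ennreal ((exp (- (3 / 2 * N * \<delta>\<^sup>2)) * R * (3 / 2 * \<theta>0) + exp (- (N / 64)) / pr \<theta>0 \<alpha>) * (N * exp (1 / 2) / (\<theta>0 * \<rho>))) * J \<alpha>)"
      unfolding HbJ[OF a0] J_def
      by (intro mult_left_mono kern_contraction[where pr = "\<lambda>\<theta>. pr \<theta> \<alpha>", OF \<theta>0 N \<delta> S[OF a, folded N_def] _ _ _ prt[OF a0] \<rho> R])
         (use prior_cond_measurable[OF pc a0] pr0[OF _ a0] low[OF a] up[OF a] in \<open>auto simp: N_def\<close>)
    also have "\<dots> \<le> ennreal (lik_const \<alpha> * pa \<alpha>) * (ennreal ?\<eta> * J \<alpha>)"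
    proof (intro mult_left_mono mult_right_mono ennreal_leI add_left_mono)
      have "exp (- (N / 64)) * (1 / pr \<theta>0 \<alpha>) \<le> exp (- (N / 64)) * V" using V[OF a] by (intro mult_left_mono) auto
      then show "exp (- (N / 64)) / pr \<theta>0 \<alpha> \<le> exp (- (N / 64)) * V" by simp
    qed (use N \<theta>0 \<rho> in auto)
    also have "\<dots> = ennreal ?\<eta> * H \<alpha>" unfolding HJ[OF a0] by (simp add: mult_ac)
    finally show ?thesis .
  qed
  \<comment> \<open>Common scheme for both tails: \<open>w\<close> is the power of the end point,
    \<open>l\<close> the likelihood constant there, and \<open>b\<close> the cost of moving that
    constant to the neighbourhood of \<alpha>0.\<close>
  have tails: "ennreal (A * t) \<le> ennreal (B * exp (2 * \<delta> * N) * ?G) * (\<integral>\<^sup>+z. f z \<partial>lborel)"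
    if A: "A = w * (l * E)" and w: "0 \<le> w" "0 \<le> t" and l: "0 < l" and b: "0 < b" "\<And>\<alpha>. \<alpha> \<in> {\<alpha>0..\<alpha>1} \<Longrightarrow> l \<le> b * lik_const \<alpha>"
      and B: "B = w * t * b" for A t B w l b
  proof -
    have "l / b \<le> lik_const \<alpha>" if "\<alpha> \<in> {\<alpha>0..\<alpha>1}" for \<alpha>
      using b(2)[OF that] b(1) by (simp add: pos_divide_le_eq mult.commute)
    then have z: "ennreal (l / b * X) \<le> (\<integral>\<^sup>+z. f z \<partial>lborel)" using l b by (intro Zlow) auto
    have "A * t \<le> w * (l * (k0 * exp (2 * \<delta> * N))) * t"
      unfolding A using w l E by (intro mult_right_mono mult_left_mono) auto
    also have "\<dots> = (B * exp (2 * \<delta> * N) * ?G) * (l / b * X)"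
      unfolding B X_def using b c \<rho> \<theta>0 N \<alpha> by (simp add: exp_minus field_simps)
    finally have "ennreal (A * t) \<le> ennreal ((B * exp (2 * \<delta> * N) * ?G) * (l / b * X))"
      by (rule ennreal_leI)
    also have "\<dots> = ennreal (B * exp (2 * \<delta> * N) * ?G) * ennreal (l / b * X)"
      by (rule ennreal_mult') (use w b c \<rho> \<theta>0 N \<alpha> in \<open>simp add: B\<close>)
    also have "\<dots> \<le> ennreal (B * exp (2 * \<delta> * N) * ?G) * (\<integral>\<^sup>+z. f z \<partial>lborel)"
      by (rule mult_left_mono[OF z]) simp
    finally show ?thesis .
  qed
  define Blo where "Blo = lo powr (q * n) * t_lo * (\<alpha>1 / lo) powr (q * p)"
  define Bhi where "Bhi = hi powr (- (q * n)) * t_hi * exp (tr / 2)"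
  define G where "G = ?G"
  have G: "0 \<le> G" using N c \<rho> \<theta>0 \<alpha> by (simp add: G_def)
  have B0: "0 \<le> Blo" "0 \<le> Bhi" using t by (auto simp: Blo_def Bhi_def)
  have Tlo: "ennreal (Alo * t_lo) \<le> ennreal (Blo * exp (2 * \<delta> * N) * G) * (\<integral>\<^sup>+z. f z \<partial>lborel)"
    unfolding G_def
  proof (rule tails[OF Alo_def _ t(1) lpos(1) _ _ Blo_def])
    show "lik_const lo \<le> (\<alpha>1 / lo) powr (q * p) * lik_const \<alpha>" if "\<alpha> \<in> {\<alpha>0..\<alpha>1}" for \<alpha>
    proof -
      have "lik_const lo \<le> (\<alpha> / lo) powr (q * p) * lik_const \<alpha>"
        unfolding q_def by (rule lik_const_low) (use \<alpha> that in auto)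
      also have "\<dots> \<le> (\<alpha>1 / lo) powr (q * p) * lik_const \<alpha>"
        using \<alpha> that q lik_const_pos[of \<alpha>] by (intro mult_right_mono powr_mono2 divide_right_mono) auto
      finally show ?thesis .
    qed
  qed (use \<alpha> in auto)
  \<comment> \<open>The covariance determinant is moved from hi to \<alpha>0 by the trace bound exp
    tr; \<open>lik_const\<close> contains the determinant to the power -1/2, hence exp (tr /
    2).\<close>
  have Thi: "ennreal (Ahi * t_hi) \<le> ennreal (Bhi * exp (2 * \<delta> * N) * G) * (\<integral>\<^sup>+z. f z \<partial>lborel)"
    unfolding G_def
  proof (rule tails[OF Ahi_def _ t(2) lpos(2) _ _ Bhi_def])
    show "lik_const hi \<le> exp (tr / 2) * lik_const \<alpha>" if a: "\<alpha> \<in> {\<alpha>0..\<alpha>1}" for \<alpha>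
    proof -
      have "lik_const hi \<le> (exp tr * 1) powr (1 / 2) * lik_const \<alpha>"
      proof (rule lik_const_le[OF hi(1)])
        show "mdet (K \<alpha>) \<le> exp tr * mdet (K hi)"
          using det_K_mono(1)[OF \<alpha>0, of \<alpha>] a tr by simp
        show "mdet (info \<alpha>) \<le> 1 * mdet (info hi)"
          using det_info_mono(1)[of \<alpha> hi] a \<alpha> \<alpha>0 by simp
      qed (use a \<alpha>0 in auto)
      then show ?thesis by (simp add: powr_def)
    qed
  qed auto
  have \<tau>: "?\<tau> = Blo * exp (2 * \<delta> * N) * G + Bhi * exp (2 * \<delta> * N) * G"
    unfolding G_def[symmetric] Blo_def[symmetric] Bhi_def[symmetric] by (simp only: distrib_right)
  have BG: "0 \<le> Blo * exp (2 * \<delta> * N) * G" "0 \<le> Bhi * exp (2 * \<delta> * N) * G"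
    using B0 G by simp_all
  show "measure (posterior p m \<Omega> \<nu> pr pa s n y)
      {(\<theta>, \<alpha>). 0 < \<theta> \<and> 0 < \<alpha> \<and> pred_var_dev p m \<Omega> \<nu> T \<theta>0 s n \<theta> \<alpha> > ereal (7 * \<delta>)} \<le> ?\<eta> + ?\<tau>"
    unfolding post B
  proof (rule measure_density_proportional_le[OF fm' Z0 Z1])
    show "?B \<in> sets borel" using Bm by (simp only: borel_prod)
    show "0 \<le> ?\<eta> + ?\<tau>" unfolding \<tau> by (rule add_nonneg_nonneg[OF \<eta>0 add_nonneg_nonneg[OF BG]])
    have "(\<integral>\<^sup>+\<alpha>. Hb \<alpha> \<partial>lborel) \<le> (\<integral>\<^sup>+\<alpha>. ennreal ?\<eta> * H \<alpha> + (ennreal Alo * glo \<alpha> + ennreal Ahi * ghi \<alpha>) \<partial>lborel)"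
    proof (rule nn_integral_mono)
      fix \<alpha>
      consider "\<alpha> \<le> 0" | "0 < \<alpha>" "\<alpha> < lo" | "hi < \<alpha>" | "lo \<le> \<alpha>" "\<alpha> \<le> hi" by linarith
      then show "Hb \<alpha> \<le> ennreal ?\<eta> * H \<alpha> + (ennreal Alo * glo \<alpha> + ennreal Ahi * ghi \<alpha>)"
      proof cases
        case 1 then show ?thesis using H0 by simp
      next
        case 2 then show ?thesis using order_trans[OF HbH Hlo[of \<alpha>]] by (simp add: add_increasing add_increasing2)
      next
        case 3 then show ?thesis using order_trans[OF HbH Hhi[of \<alpha>]] by (simp add: add_increasing)
      next
        case 4 then show ?thesis using mid[of \<alpha>] by (simp add: add_increasing2)
      qed
    qed
    also have "\<dots> = ennreal ?\<eta> * (\<integral>\<^sup>+\<alpha>. H \<alpha> \<partial>lborel) + ((\<integral>\<^sup>+\<alpha>. ennreal Alo * glo \<alpha> \<partial>lborel) + (\<integral>\<^sup>+\<alpha>. ennreal Ahi * ghi \<alpha> \<partial>lborel))"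
      by (subst nn_integral_add; simp add: nn_integral_add nn_integral_cmult)
    also have "\<dots> \<le> ennreal ?\<eta> * (\<integral>\<^sup>+z. f z \<partial>lborel) + (ennreal (Blo * exp (2 * \<delta> * N) * G) * (\<integral>\<^sup>+z. f z \<partial>lborel) +
        ennreal (Bhi * exp (2 * \<delta> * N) * G) * (\<integral>\<^sup>+z. f z \<partial>lborel))"
      using order_trans[OF Glo Tlo] order_trans[OF Ghi Thi] unfolding Z by (intro add_mono order_refl)
    also have "\<dots> = (ennreal ?\<eta> + (ennreal (Blo * exp (2 * \<delta> * N) * G) + ennreal (Bhi * exp (2 * \<delta> * N) * G))) * (\<integral>\<^sup>+z. f z \<partial>lborel)"
      by (simp only: distrib_right)
    also have "ennreal ?\<eta> + (ennreal (Blo * exp (2 * \<delta> * N) * G) + ennreal (Bhi * exp (2 * \<delta> * N) * G)) = ennreal (?\<eta> + ?\<tau>)"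
      unfolding \<tau> by (simp only: ennreal_plus[OF \<eta>0 add_nonneg_nonneg[OF BG]] ennreal_plus[OF BG])
    finally show "(\<integral>\<^sup>+z. f z * indicator ?B z \<partial>lborel) \<le> ennreal (?\<eta> + ?\<tau>) * (\<integral>\<^sup>+z. f z \<partial>lborel)"
      unfolding Zb .
  qed
qed

end

section \<open>Posterior contraction\<close>

text \<open>The factor 11/10 is the slack that absorbs the passage from n to n - p degrees of
  freedom.\<close>

lemma threshold_asymp:
  fixes p :: nat
  shows "\<forall>\<^sub>F n in sequentially. 0 < real n powr (- 1 / 2) * ln (real n)"
    "\<forall>\<^sub>F n in sequentially. real n powr (- 1 / 2) * ln (real n) \<le> 1 / 100"
    "\<forall>\<^sub>F n in sequentially. sqrt (real n) * ln (real n) + real p \<le>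
       11 / 10 * (real n powr (- 1 / 2) * ln (real n)) * (real n - real p)"
  by real_asymp+

text \<open>The drop is exp (- 3/2 (ln n)^2) up to a factor tending to 1, smaller than every power
  of n.\<close>

lemma contraction_rate:
  fixes p :: nat and c :: real
  shows "(\<lambda>n. exp (- (3 / 2 * (real n - real p) * (real n powr (- 1 / 2) * ln (real n))\<^sup>2)) * (real n - real p)) \<longlonglongrightarrow> 0"
    "(\<lambda>n. exp (- (3 / 2 * (real n - real p) * (real n powr (- 1 / 2) * ln (real n))\<^sup>2)) * real n * (real n - real p)) \<longlonglongrightarrow> 0"
    "(\<lambda>n. exp (- ((real n - real p) / 64)) * (real n - real p)) \<longlonglongrightarrow> 0"
  by real_asymp+

lemma contraction_rate2:
  fixes p :: nat and c :: real
  assumes "0 < c" "c < 1"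
  shows "(\<lambda>n. exp (- ((real n - real p) / 64)) * exp (real n powr c) * (real n - real p)) \<longlonglongrightarrow> 0"
  using assms by real_asymp

text \<open>In the exponent, n ln n dominates sqrt n * ln n from the fluctuation of the kernel and n
  / 2 from the determinant ratio.\<close>

lemma tail_rate:
  fixes p :: nat and a b :: real
  assumes "0 < a"
  shows "(\<lambda>n. exp (- (a * real n * ln (real n)) + b * ln (real n)) *
      exp (2 * (real n powr (- 1 / 2) * ln (real n)) * (real n - real p)) * (real n - real p)) \<longlonglongrightarrow> 0"
    "(\<lambda>n. exp (- (a * real n * ln (real n)) + real n / 2) *
      exp (2 * (real n powr (- 1 / 2) * ln (real n)) * (real n - real p)) * (real n - real p)) \<longlonglongrightarrow> 0"
  using assms by real_asymp+

text \<open>Crude consequences of the minima. For d \<ge> 1 the first entry has 2 d + 0.94 \<ge> 2.9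
  and a second factor of at least 2 (2 \<nu> + d), which gives the bound 1/10; the entry 0.01 gives
  1/200.\<close>

lemma kappa_bounds:
  fixes d \<nu> :: real
  assumes d: "1 \<le> d" and \<nu>: "0 < \<nu>"
  shows "0 < kappa_lo d \<nu>" "0 < kappa_hi d \<nu>" "kappa_hi d \<nu> \<le> 1 / 200"
    "(2 * \<nu> + d) * kappa_lo d \<nu> \<le> 1 / 10" "(2 * \<nu> + d) * kappa_hi d \<nu> \<le> 1 / 10"
proof -
  have e: "0 < 2 * \<nu> + d" using d \<nu> by simp
  have pos: "0 < (2 * d + 0.94) * (8 * \<nu> + 3 * d - 0.9)" "0 < (2 * d + 0.94) * (8 * \<nu> + 5 * d + 0.9)"
    using d \<nu> by (intro mult_pos_pos; simp)+
  show "0 < kappa_lo d \<nu>" "0 < kappa_hi d \<nu>" using pos d \<nu> unfolding kappa_lo_def kappa_hi_def by auto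
  show "kappa_hi d \<nu> \<le> 1 / 200" unfolding kappa_hi_def by simp
  have "2.9 * (2 * (2 * \<nu> + d)) \<le> (2 * d + 0.94) * (8 * \<nu> + 3 * d - 0.9)"
    using d \<nu> by (intro mult_mono) auto
  then have "0.9 / ((2 * d + 0.94) * (8 * \<nu> + 3 * d - 0.9)) \<le> 0.9 / (2.9 * (2 * (2 * \<nu> + d)))"
    using pos e by (intro divide_left_mono) auto
  moreover have "kappa_lo d \<nu> \<le> 1 / 2 * (0.9 / ((2 * d + 0.94) * (8 * \<nu> + 3 * d - 0.9)))"
    unfolding kappa_lo_def by (intro mult_left_mono Min_le) auto
  ultimately have "kappa_lo d \<nu> \<le> 1 / 2 * (0.9 / (2.9 * (2 * (2 * \<nu> + d))))" by linarith
  then have "(2 * \<nu> + d) * kappa_lo d \<nu> \<le> (2 * \<nu> + d) * (1 / 2 * (0.9 / (2.9 * (2 * (2 * \<nu> + d)))))"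
    using e by (intro mult_left_mono) auto
  also have "\<dots> \<le> 1 / 10" using e by (simp add: field_simps)
  finally show "(2 * \<nu> + d) * kappa_lo d \<nu> \<le> 1 / 10" .
  have "2.9 * (2 * (2 * \<nu> + d)) \<le> (2 * d + 0.94) * (8 * \<nu> + 5 * d + 0.9)"
    using d \<nu> by (intro mult_mono) auto
  then have "0.9 / ((2 * d + 0.94) * (8 * \<nu> + 5 * d + 0.9)) \<le> 0.9 / (2.9 * (2 * (2 * \<nu> + d)))"
    using pos e by (intro divide_left_mono) auto
  moreover have "kappa_hi d \<nu> \<le> 1 / 2 * (0.9 / ((2 * d + 0.94) * (8 * \<nu> + 5 * d + 0.9)))"
    unfolding kappa_hi_def by (intro mult_left_mono Min_le) auto
  ultimately have "kappa_hi d \<nu> \<le> 1 / 2 * (0.9 / (2.9 * (2 * (2 * \<nu> + d))))" by linarith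
  then have "(2 * \<nu> + d) * kappa_hi d \<nu> \<le> (2 * \<nu> + d) * (1 / 2 * (0.9 / (2.9 * (2 * (2 * \<nu> + d)))))"
    using e by (intro mult_left_mono) auto
  also have "\<dots> \<le> 1 / 10" using e by (simp add: field_simps)
  finally show "(2 * \<nu> + d) * kappa_hi d \<nu> \<le> 1 / 10" .
qed

lemma alpha_range_eventually:
  fixes d \<nu> c :: real
  assumes d: "1 \<le> d" and \<nu>: "0 < \<nu>" and c: "0 < c"
  shows "\<forall>\<^sub>F n in sequentially. 0 < alpha_lo d \<nu> n \<and> alpha_lo d \<nu> n \<le> c \<and> c \<le> alpha_hi d \<nu> n"
proof -
  note k = kappa_bounds(1,2)[OF d \<nu>]
  have "\<forall>\<^sub>F n in sequentially. real n powr (- kappa_lo d \<nu>) < c"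
    by (rule order_tendstoD(2)[OF _ c]) (use k in real_asymp)
  moreover have "filterlim (\<lambda>n. real n powr kappa_hi d \<nu>) at_top sequentially" using k by real_asymp
  then have "\<forall>\<^sub>F n in sequentially. c \<le> real n powr kappa_hi d \<nu>" by (simp add: filterlim_at_top)
  ultimately show ?thesis using eventually_gt_at_top[of 0]
    by eventually_elim (auto simp: alpha_lo_def alpha_hi_def)
qed

text \<open>Each power of an end point is at most of order n^(1/10), the square of the upper end at
  most n^(1/100), and 1/10 + 1/100 < 1/8.\<close>

lemma alpha_range_growth:
  fixes d \<nu> \<alpha>0 :: real
  assumes d: "1 \<le> d" and \<nu>: "0 < \<nu>" and \<alpha>0: "0 < \<alpha>0"
  shows "\<forall>\<^sub>F n in sequentially.
      (1 + (\<alpha>0 / alpha_lo d \<nu> n) powr (2 * \<nu> + d) + (alpha_hi d \<nu> n / \<alpha>0) powr (2 * \<nu> + d)) *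
      (2 * max 1 ((\<nu> + d / 2) * (alpha_hi d \<nu> n)\<^sup>2)) \<le>
      ((1 + \<alpha>0 powr (2 * \<nu> + d) + \<alpha>0 powr (- (2 * \<nu> + d))) * (2 * (1 + (\<nu> + d / 2)))) * real n powr (1 / 8)"
  using eventually_ge_at_top[of 1]
proof eventually_elim
  case (elim n)
  define e where "e = 2 * \<nu> + d"
  define q where "q = \<nu> + d / 2"
  have q: "0 < q" using d \<nu> by (simp add: q_def)
  note k = kappa_bounds[OF d \<nu>, folded e_def]
  have n: "1 \<le> real n" using elim by simp
  have 1: "1 \<le> real n powr (1 / 10)" using n by (simp add: ge_one_powr_ge_zero)
  have 2: "(\<alpha>0 / alpha_lo d \<nu> n) powr e \<le> \<alpha>0 powr e * real n powr (1 / 10)"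
  proof -
    have "(\<alpha>0 / alpha_lo d \<nu> n) powr e = \<alpha>0 powr e * real n powr (e * kappa_lo d \<nu>)"
      using n \<alpha>0 by (simp add: alpha_lo_def powr_mult powr_powr powr_minus_divide mult.commute)
    also have "\<dots> \<le> \<alpha>0 powr e * real n powr (1 / 10)" using k n by (intro mult_left_mono powr_mono) auto
    finally show ?thesis .
  qed
  have 3: "(alpha_hi d \<nu> n / \<alpha>0) powr e \<le> \<alpha>0 powr (- e) * real n powr (1 / 10)"
  proof -
    have "(alpha_hi d \<nu> n / \<alpha>0) powr e = \<alpha>0 powr (- e) * real n powr (e * kappa_hi d \<nu>)"
      using n \<alpha>0 by (simp add: alpha_hi_def powr_divide powr_powr powr_minus_divide mult.commute)
    also have "\<dots> \<le> \<alpha>0 powr (- e) * real n powr (1 / 10)" using k n by (intro mult_left_mono powr_mono) auto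
    finally show ?thesis .
  qed
  have A: "1 + (\<alpha>0 / alpha_lo d \<nu> n) powr e + (alpha_hi d \<nu> n / \<alpha>0) powr e \<le> (1 + \<alpha>0 powr e + \<alpha>0 powr (- e)) * real n powr (1 / 10)"
    using 1 2 3 unfolding distrib_right by linarith
  have "(alpha_hi d \<nu> n)\<^sup>2 = real n powr (2 * kappa_hi d \<nu>)"
    using n by (simp add: alpha_hi_def power2_eq_square flip: powr_add)
  also have "\<dots> \<le> real n powr (1 / 100)" using k n by (intro powr_mono) auto
  finally have "q * (alpha_hi d \<nu> n)\<^sup>2 \<le> q * real n powr (1 / 100)" using q by (intro mult_left_mono) auto
  moreover have "1 \<le> real n powr (1 / 100)" using n by (simp add: ge_one_powr_ge_zero)
  moreover have "0 \<le> q * real n powr (1 / 100)" using q by simp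
  ultimately have B: "2 * max 1 (q * (alpha_hi d \<nu> n)\<^sup>2) \<le> 2 * (1 + q) * real n powr (1 / 100)"
    by (simp add: max_def distrib_left distrib_right)
  have "(1 + (\<alpha>0 / alpha_lo d \<nu> n) powr e + (alpha_hi d \<nu> n / \<alpha>0) powr e) * (2 * max 1 (q * (alpha_hi d \<nu> n)\<^sup>2)) \<le>
    ((1 + \<alpha>0 powr e + \<alpha>0 powr (- e)) * real n powr (1 / 10)) * (2 * (1 + q) * real n powr (1 / 100))"
    by (rule mult_mono[OF A B]) auto
  also have "\<dots> = ((1 + \<alpha>0 powr e + \<alpha>0 powr (- e)) * (2 * (1 + q))) * (real n powr (1 / 10) * real n powr (1 / 100))"
    by (simp add: mult_ac)
  also have "real n powr (1 / 10) * real n powr (1 / 100) = real n powr (11 / 100)" by (simp flip: powr_add)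
  also have "((1 + \<alpha>0 powr e + \<alpha>0 powr (- e)) * (2 * (1 + q))) * real n powr (11 / 100) \<le>
     ((1 + \<alpha>0 powr e + \<alpha>0 powr (- e)) * (2 * (1 + q))) * real n powr (1 / 8)"
    using q n by (intro mult_left_mono powr_mono mult_nonneg_nonneg add_nonneg_nonneg) auto
  finally show ?case unfolding e_def q_def .
qed

text \<open>With W = n^(1/3) the trace exponent is of order n^(11/24). The bound exp n is generous,
  but harmless against the gain exp (- e n ln n), e > 0, in the upper tail.\<close>

lemma (in infill_regression) det_ratio_eventually:
  assumes b: "\<forall>\<^sub>F n in sequentially. \<alpha>0 \<le> b n"
    and growth: "\<forall>\<^sub>F n in sequentially.
      (b n / \<alpha>0) powr (2 * \<nu> + CARD('d)) * (2 * max 1 ((\<nu> + CARD('d) / 2) * (b n)\<^sup>2)) \<le> G * real n powr (1 / 8)"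
  shows "\<forall>\<^sub>F n in sequentially. mdet (scaled_corr_mat \<nu> (s n) n \<alpha>0) \<le>
    exp (real n) * mdet (scaled_corr_mat \<nu> (s n) n (b n))"
proof -
  obtain C where sampled: "\<And>n. p \<le> n \<Longrightarrow> sampled_process n p m \<Omega> \<nu> (s n) M X T \<sigma>0 \<alpha>0 \<theta>0 C"
    using sampled_process_at by blast
  define W where "W n = real n powr (1 / 3)" for n :: nat
  have ev: "\<forall>\<^sub>F n in sequentially. (G * real n powr (1 / 8)) * (432 * C * W n + n / (W n)\<^sup>2) \<le> real n"
  proof -
    have "(\<lambda>n. G * (432 * C) * (real n powr (1 / 8) * real n powr (1 / 3) / real n) +
        G * (real n powr (1 / 8) * (real n / (real n powr (1 / 3))\<^sup>2) / real n)) \<longlonglongrightarrow> G * (432 * C) * 0 + G * 0"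
      by (intro tendsto_add tendsto_mult tendsto_const) real_asymp+
    then have "(\<lambda>n. G * (432 * C) * (real n powr (1 / 8) * real n powr (1 / 3) / real n) +
        G * (real n powr (1 / 8) * (real n / (real n powr (1 / 3))\<^sup>2) / real n)) \<longlonglongrightarrow> 0" by simp
    then have "\<forall>\<^sub>F n in sequentially. G * (432 * C) * (real n powr (1 / 8) * real n powr (1 / 3) / real n) +
        G * (real n powr (1 / 8) * (real n / (real n powr (1 / 3))\<^sup>2) / real n) < 1"
      by (rule order_tendstoD) simp
    then show ?thesis using eventually_ge_at_top[of 1]
    proof eventually_elim
      case (elim n)
      have "(G * real n powr (1 / 8)) * (432 * C * W n + n / (W n)\<^sup>2) = real n * (G * (432 * C) * (real n powr (1 / 8) * real n powr (1 / 3) / real n) +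
        G * (real n powr (1 / 8) * (real n / (real n powr (1 / 3))\<^sup>2) / real n))"
        using elim(2) by (simp add: W_def distrib_left mult_ac)
      also have "\<dots> \<le> real n * 1" using elim(1) by (intro mult_left_mono) auto
      finally show ?case by simp
    qed
  qed
  show ?thesis
    using b growth ev eventually_ge_at_top[of "max 1 p"]
  proof eventually_elim
    case (elim n)
    then have n: "1 \<le> n" "p \<le> n" by auto
    then interpret sampled_process n p m \<Omega> \<nu> "s n" M X T \<sigma>0 \<alpha>0 \<theta>0 C by (intro sampled)
    have W: "1 \<le> W n" using n by (simp add: W_def ge_one_powr_ge_zero)
    define L where "L = (b n / \<alpha>0) powr (2 * \<nu> + CARD('d))"
    define c where "c = 2 * max 1 ((\<nu> + CARD('d) / 2) * (b n)\<^sup>2)"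
    have "c * (L * (432 * C * W n + n / (W n)\<^sup>2)) = (L * c) * (432 * C * W n + n / (W n)\<^sup>2)" by simp
    also have "\<dots> \<le> (G * real n powr (1 / 8)) * (432 * C * W n + n / (W n)\<^sup>2)"
      using elim(2) C W by (intro mult_right_mono) (auto simp: L_def c_def)
    also have "\<dots> \<le> real n" by (rule elim)
    finally have "exp (c * (L * (432 * C * W n + n / (W n)\<^sup>2))) * mdet (K (b n)) \<le> exp (real n) * mdet (K (b n))"
      using spd_det_pos[OF spd_K[of "b n"]] elim(1) \<alpha>0 by (intro mult_right_mono) auto
    with det_K_trace_bound[OF d elim(1) W] show ?case unfolding L_def c_def by linarith
  qed
qed

text \<open>No positivity of \<open>h\<close> is needed: where \<open>h\<close> vanishes it has a minimum, so its derivative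
  vanishes too.\<close>

lemma nonneg_log_derivative_lower:
  fixes h :: "real \<Rightarrow> real"
  assumes "a < x" "x \<le> y" "y < b"
    and h: "\<And>t. t \<in> {a<..<b} \<Longrightarrow> 0 \<le> h t" "\<And>t. t \<in> {a<..<b} \<Longrightarrow> h field_differentiable (at t)"
    and L: "\<And>t. t \<in> {a<..<b} \<Longrightarrow> \<bar>deriv (\<lambda>t. ln (h t)) t\<bar> \<le> L"
  shows "exp (- (L * (y - x))) * h x \<le> h y"
proof -
  \<comment> \<open>Integrating factor: the bound on the logarithmic derivative makes h t * exp (L
    (t - x)) nondecreasing.\<close>
  have "h x * exp (L * (x - x)) \<le> h y * exp (L * (y - x))"
  proof (rule DERIV_nonneg_imp_nondecreasing[OF assms(2)])
    fix t assume "x \<le> t" "t \<le> y"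
    then have t: "t \<in> {a<..<b}" using assms by auto
    have d: "(h has_real_derivative deriv h t) (at t)"
      using h(2)[OF t] by (simp add: DERIV_deriv_iff_field_differentiable)
    have "- (L * h t) \<le> deriv h t"
    proof (cases "h t = 0")
      case True
      have "deriv h t = 0"
      proof (rule DERIV_local_min[OF d])
        show "0 < min (t - a) (b - t)" using t by auto
        show "\<forall>y. \<bar>t - y\<bar> < min (t - a) (b - t) \<longrightarrow> h t \<le> h y" using h(1) True by (auto simp: abs_less_iff)
      qed
      then show ?thesis using True by simp
    next
      case False
      then have p: "0 < h t" using h(1)[OF t] by simp
      have "((\<lambda>t. ln (h t)) has_real_derivative inverse (h t) * deriv h t) (at t)"
        using d p by (auto intro!: derivative_eq_intros simp: field_simps)
      then have e: "deriv (\<lambda>t. ln (h t)) t = deriv h t / h t" by (simp add: DERIV_imp_deriv field_simps)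
      have "- L \<le> deriv h t / h t" using L[OF t] unfolding e abs_le_iff by linarith
      then show ?thesis using p by (simp add: pos_le_divide_eq)
    qed
    then have "0 \<le> (deriv h t + h t * L) * exp (L * (t - x))" by (intro mult_nonneg_nonneg) (auto simp: mult.commute)
    moreover have "((\<lambda>t. h t * exp (L * (t - x))) has_real_derivative (deriv h t + h t * L) * exp (L * (t - x))) (at t)"
      using d by (auto intro!: derivative_eq_intros simp: algebra_simps)
    ultimately show "\<exists>y. ((\<lambda>t. h t * exp (L * (t - x))) has_real_derivative y) (at t) \<and> 0 \<le> y" by blast
  qed
  then have "exp (- (L * (y - x))) * h x \<le> exp (- (L * (y - x))) * (h y * exp (L * (y - x)))"
    by (intro mult_left_mono) auto
  also have "\<dots> = h y" by (simp add: exp_minus)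
  finally show ?thesis .
qed

section \<open>Almost sure contraction\<close>

context infill_regression
begin

text \<open>Recentres from n to the n - p degrees of freedom of the kernel; the shift p \<theta>0 is
  of lower order than the fluctuation.\<close>

lemma rss_eventually:
  assumes ab: "\<forall>\<^sub>F n in sequentially. 0 < a n \<and> a n \<le> \<alpha>0 \<and> \<alpha>0 \<le> b n"
    and growth: "\<forall>\<^sub>F n in sequentially.
      (1 + (\<alpha>0 / a n) powr (2 * \<nu> + CARD('d)) + (b n / \<alpha>0) powr (2 * \<nu> + CARD('d))) *
      (2 * max 1 ((\<nu> + CARD('d) / 2) * (b n)\<^sup>2)) \<le> G * real n powr (1 / 8)"
  shows "AE \<omega> in M. \<forall>\<^sub>F n in sequentially. \<forall>\<alpha>\<in>{a n..b n}.
    \<bar>design.rss n p m \<Omega> \<nu> (s n) (obs n \<omega>) \<alpha> - dof n * \<theta>0\<bar>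
      \<le> 11 / 10 * \<delta> n * (dof n * \<theta>0)"
proof -
  show ?thesis
  proof (rule AE_mp[OF rss_uniform_AE[OF ab growth]], intro AE_I2 impI)
  fix \<omega>
  assume "\<forall>\<^sub>F n in sequentially. \<forall>\<alpha>\<in>{a n..b n}.
    \<bar>design.rss n p m \<Omega> \<nu> (s n) (obs n \<omega>) \<alpha> - n * \<theta>0\<bar>
      \<le> \<theta>0 * (sqrt n * ln n)"
  with threshold_asymp(3)[of p] show "\<forall>\<^sub>F n in sequentially. \<forall>\<alpha>\<in>{a n..b n}.
    \<bar>design.rss n p m \<Omega> \<nu> (s n) (obs n \<omega>) \<alpha> - dof n * \<theta>0\<bar>
      \<le> 11 / 10 * \<delta> n * (dof n * \<theta>0)"
  proof eventually_elim
    case (elim n)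
    show ?case
    proof
      fix \<alpha> assume "\<alpha> \<in> {a n..b n}"
      define r where "r = design.rss n p m \<Omega> \<nu> (s n) (obs n \<omega>) \<alpha>"
      have 1: "\<bar>r - n * \<theta>0\<bar> \<le> \<theta>0 * (sqrt n * ln n)"
        using elim(2) \<open>\<alpha> \<in> {a n..b n}\<close> unfolding r_def by blast
      have "\<bar>r - dof n * \<theta>0\<bar> \<le> \<bar>r - n * \<theta>0\<bar> + real p * \<theta>0"
        using \<theta>0_pos abs_triangle_ineq[of "r - n * \<theta>0" "real p * \<theta>0"] unfolding left_diff_distrib by simp
      also have "\<dots> \<le> \<theta>0 * (sqrt n * ln n + real p)" using 1 by (simp add: distrib_left mult.commute)
      also have "\<dots> \<le> \<theta>0 * (11 / 10 * \<delta> n * dof n)" using elim(1) \<theta>0_pos by (intro mult_left_mono) auto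
      finally show "\<bar>r - dof n * \<theta>0\<bar> \<le> 11 / 10 * \<delta> n * (dof n * \<theta>0)" by (simp add: mult_ac)
    qed
  qed
  qed
qed

text \<open>For fixed \<alpha> the range and the comparison factor do not vary with n. The constants
  \<open>R\<close> and \<rho> come from continuity of the prior near \<theta>0 and its positivity
  there.\<close>

lemma given_alpha_contraction:
  assumes pc: "prior_cond p \<Omega> \<theta>0 pr" and \<alpha>: "0 < \<alpha>"
  shows "AE \<omega> in M.
    (\<forall>\<^sub>F n in sequentially. prob_space (posterior_given_alpha p m \<Omega> \<nu> pr (s n) n (obs n \<omega>) \<alpha>)) \<and>
    (\<lambda>n. measure (posterior_given_alpha p m \<Omega> \<nu> pr (s n) n (obs n \<omega>) \<alpha>)
      {\<theta>. 0 < \<theta> \<and> pred_var_dev p m \<Omega> \<nu> T \<theta>0 (s n) n \<theta> \<alpha> > ereal (7 * \<delta> n)}) \<longlonglongrightarrow> 0"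
    (is "AE \<omega> in M. (\<forall>\<^sub>F n in sequentially. prob_space (?P n \<omega>)) \<and> (\<lambda>n. measure (?P n \<omega>) (?B n)) \<longlonglongrightarrow> 0")
proof -
  \<comment> \<open>The range must contain \<alpha>0, where concentration is known, as well as the
    given \<alpha>.\<close>
  define a b where "a = min \<alpha> \<alpha>0" and "b = max \<alpha> \<alpha>0"
  have ab: "0 < a" "a \<le> \<alpha>0" "\<alpha>0 \<le> b" "\<alpha> \<in> {a..b}" using \<alpha> \<alpha>0 by (auto simp: a_def b_def)
  define G where "G = (1 + (\<alpha>0 / a) powr (2 * \<nu> + CARD('d)) + (b / \<alpha>0) powr (2 * \<nu> + CARD('d))) *
      (2 * max 1 ((\<nu> + CARD('d) / 2) * b\<^sup>2))"
  have G: "0 \<le> G" by (simp add: G_def)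
  have growth: "\<forall>\<^sub>F n in sequentially. G \<le> G * real n powr (1 / 8)"
    using eventually_ge_at_top[of 1]
  proof eventually_elim
    case (elim n)
    then have "1 \<le> real n powr (1 / 8)" by (simp add: ge_one_powr_ge_zero)
    with G show ?case by (simp add: mult_le_cancel_left1)
  qed
  have ev: "\<forall>\<^sub>F n :: nat in sequentially. 0 < a \<and> a \<le> \<alpha>0 \<and> \<alpha>0 \<le> b" using ab by simp
  define h where "h \<theta> = pr \<theta> \<alpha>" for \<theta>
  have h0: "0 < h \<theta>0" using pc \<alpha> by (simp add: h_def prior_cond_def)
  have hc: "continuous_on {0<..} h" unfolding h_def[abs_def] by (rule prior_cond_measurable(1)[OF pc \<alpha>])
  obtain R where R: "0 \<le> R" "\<And>\<theta>. \<theta> \<in> {\<theta>0 / 2<..<2 * \<theta>0} \<Longrightarrow> h \<theta> \<le> R * h \<theta>0"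
  proof -
    have "continuous_on {\<theta>0 / 2..2 * \<theta>0} h" by (rule continuous_on_subset[OF hc]) (use \<theta>0_pos in auto)
    then have "compact (h ` {\<theta>0 / 2..2 * \<theta>0})" by (intro compact_continuous_image) auto
    then have "bounded (h ` {\<theta>0 / 2..2 * \<theta>0})" by (rule compact_imp_bounded)
    then obtain B where B: "\<And>\<theta>. \<theta> \<in> {\<theta>0 / 2..2 * \<theta>0} \<Longrightarrow> \<bar>h \<theta>\<bar> \<le> B" unfolding bounded_iff real_norm_def by blast
    show ?thesis
    proof (rule that[of "B / h \<theta>0"])
      show "0 \<le> B / h \<theta>0" using B[of \<theta>0] \<theta>0_pos h0 by auto
      show "h \<theta> \<le> B / h \<theta>0 * h \<theta>0" if "\<theta> \<in> {\<theta>0 / 2<..<2 * \<theta>0}" for \<theta> using B[of \<theta>] that h0 by auto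
    qed
  qed
  have "isCont h \<theta>0" using hc \<theta>0_pos by (simp add: continuous_on_eq_continuous_at)
  then have "\<forall>\<^sub>F \<theta> in at \<theta>0. h \<theta>0 / 2 < h \<theta>" unfolding isCont_def by (rule order_tendstoD) (use h0 in simp)
  then obtain \<epsilon> where \<epsilon>: "0 < \<epsilon>" "\<And>\<theta>. \<theta> \<noteq> \<theta>0 \<Longrightarrow> dist \<theta> \<theta>0 < \<epsilon> \<Longrightarrow> h \<theta>0 / 2 < h \<theta>"
    by (auto simp: eventually_at)
  have hl: "1 / 2 * h \<theta>0 \<le> h \<theta>" if "\<bar>\<theta> - \<theta>0\<bar> < \<epsilon>" for \<theta>
    using \<epsilon>(2)[of \<theta>] that h0 by (cases "\<theta> = \<theta>0") (auto simp: dist_real_def)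
  \<comment> \<open>The interval that bounds the normaliser eventually lies where the prior keeps at
    least half its value at \<theta>0.\<close>
  have ev2: "\<forall>\<^sub>F n in sequentially. \<theta>0 / dof n < \<epsilon>"
    by (rule order_tendstoD(2)[OF _ \<epsilon>(1)]) real_asymp
  define bnd where "bnd n = (exp (- (3 / 2 * dof n * (\<delta> n)\<^sup>2)) * R * (3 / 2 * \<theta>0) + exp (- (dof n / 64)) / pr \<theta>0 \<alpha>) *
       (dof n * exp (1 / 2) / (\<theta>0 * (1 / 2)))" for n
  have bnd: "bnd \<longlonglongrightarrow> 0"
  proof -
    have e: "bnd = (\<lambda>n. R * (3 / 2 * \<theta>0) * exp (1 / 2) / (\<theta>0 * (1 / 2)) * (exp (- (3 / 2 * dof n * (\<delta> n)\<^sup>2)) * dof n) +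
       1 / pr \<theta>0 \<alpha> * exp (1 / 2) / (\<theta>0 * (1 / 2)) * (exp (- (dof n / 64)) * dof n))"
    proof
      have id: "(x * R' * t + y / w) * (N * e / z) = R' * t * e / z * (x * N) + 1 / w * e / z * (y * N)" for x y z t w N e R' :: real
        by (simp add: algebra_simps add_divide_distrib)
      show "bnd n = R * (3 / 2 * \<theta>0) * exp (1 / 2) / (\<theta>0 * (1 / 2)) * (exp (- (3 / 2 * dof n * (\<delta> n)\<^sup>2)) * dof n) +
        1 / pr \<theta>0 \<alpha> * exp (1 / 2) / (\<theta>0 * (1 / 2)) * (exp (- (dof n / 64)) * dof n)" for n
        unfolding bnd_def by (rule id)
    qed
    have "bnd \<longlonglongrightarrow> R * (3 / 2 * \<theta>0) * exp (1 / 2) / (\<theta>0 * (1 / 2)) * 0 + 1 / pr \<theta>0 \<alpha> * exp (1 / 2) / (\<theta>0 * (1 / 2)) * 0"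
      unfolding e by (intro tendsto_add tendsto_mult_left contraction_rate)
    then show ?thesis by simp
  qed
  show ?thesis
    using rss_eventually[OF ev growth[unfolded G_def]]
  proof (rule AE_mp, intro AE_I2 impI)
    fix \<omega>
    assume "\<forall>\<^sub>F n in sequentially. \<forall>\<alpha>\<in>{a..b}.
      \<bar>design.rss n p m \<Omega> \<nu> (s n) (obs n \<omega>) \<alpha> - dof n * \<theta>0\<bar> \<le> 11 / 10 * \<delta> n * (dof n * \<theta>0)"
    with threshold_asymp(1,2) ev2 eventually_gt_at_top[of p]
    have main: "\<forall>\<^sub>F n in sequentially. prob_space (?P n \<omega>) \<and>
       measure (?P n \<omega>) (?B n) \<le> bnd n"
    proof eventually_elim
      case (elim n)
      then interpret design n p m \<Omega> \<nu> "s n" by (intro design_at) simp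
      have S: "\<bar>rss (obs n \<omega>) \<alpha> - dof n * \<theta>0\<bar> \<le> 11 / 10 * \<delta> n * (dof n * \<theta>0)"
        using elim(5) ab(4) by blast
      have low: "1 / 2 * pr \<theta>0 \<alpha> \<le> pr \<theta> \<alpha>" if "\<theta> \<in> {\<theta>0..\<theta>0 * (1 + 1 / dof n)}" for \<theta>
      proof -
        have "\<theta> - \<theta>0 \<le> \<theta>0 / dof n" using that by (simp add: distrib_left)
        then show ?thesis using hl[of \<theta>] elim(3) that unfolding h_def by auto
      qed
      have up: "pr \<theta> \<alpha> \<le> R * pr \<theta>0 \<alpha>" if "\<theta> \<in> {\<theta>0 / 2<..<2 * \<theta>0}" for \<theta>
        using R(2)[OF that] by (simp add: h_def)
      show ?case unfolding bnd_def
        using posterior_given_alpha_bound[OF elim(4) obs_carrier \<alpha> \<theta>0_pos T pc elim(1,2) S _ R(1) low up] by simp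
    qed
    have "(\<lambda>n. measure (?P n \<omega>) (?B n)) \<longlonglongrightarrow> 0"
      by (rule tendsto_sandwich[OF _ _ tendsto_const bnd])
         (use main in \<open>auto elim: eventually_mono\<close>)
    with main show "(\<forall>\<^sub>F n in sequentially. prob_space (?P n \<omega>)) \<and>
      (\<lambda>n. measure (?P n \<omega>) (?B n)) \<longlonglongrightarrow> 0"
      by (auto elim: eventually_mono)
  qed
qed

text \<open>On the range between \<open>alpha_lo\<close> and \<open>alpha_hi\<close> the growth
  condition supplies R = n^C2, \<rho> = exp (-1) and V = exp (n^C3) uniformly. The tails contribute
  exp (- e n ln n), with e the gap between q times kappa and the exponent of the prior tail.\<close>

lemma posterior_contraction:
  assumes pc: "prior_cond p \<Omega> \<theta>0 pr" and pg: "prior_growth_cond (real CARD('d)) \<nu> \<theta>0 pr"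
    and pt: "prior_tail_cond (real CARD('d)) \<nu> \<theta>0 \<alpha>0 pr pa"
  shows "AE \<omega> in M.
    (\<forall>\<^sub>F n in sequentially. prob_space (posterior p m \<Omega> \<nu> pr pa (s n) n (obs n \<omega>))) \<and>
    (\<lambda>n. measure (posterior p m \<Omega> \<nu> pr pa (s n) n (obs n \<omega>))
      {(\<theta>, \<alpha>). 0 < \<theta> \<and> 0 < \<alpha> \<and> pred_var_dev p m \<Omega> \<nu> T \<theta>0 (s n) n \<theta> \<alpha> > ereal (7 * \<delta> n)}) \<longlonglongrightarrow> 0"
    (is "AE \<omega> in M. (\<forall>\<^sub>F n in sequentially. prob_space (?P n \<omega>)) \<and> (\<lambda>n. measure (?P n \<omega>) (?B n)) \<longlonglongrightarrow> 0")
proof -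
  let ?d = "real CARD('d)"
  have d1: "1 \<le> ?d" by (simp add: Suc_le_eq)
  define lo hi q where "lo = alpha_lo ?d \<nu>" and "hi = alpha_hi ?d \<nu>" and "q = \<nu> + ?d / 2"
  have q: "0 < q" using \<nu> by (simp add: q_def add_pos_nonneg)
  obtain C1 C2 C3 where C: "0 < C1" "0 < C2" "0 < C3" "C1 + C2 < 1 / 2" "C3 < 1"
    and growth: "\<forall>\<^sub>F n in sequentially.
          (SUP \<alpha>\<in>{lo n..hi n}. SUP \<theta>\<in>{\<theta>0 / 2<..<2 * \<theta>0}. ereal \<bar>deriv (\<lambda>t. ln (pr t \<alpha>)) \<theta>\<bar>) \<le> ereal (real n powr C1) \<and>
          (SUP \<alpha>\<in>{lo n..hi n}. SUP \<theta>\<in>{\<theta>0 / 2<..<2 * \<theta>0}. ereal (pr \<theta> \<alpha> / pr \<theta>0 \<alpha>)) \<le> ereal (real n powr C2) \<and>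
          (INF \<alpha>\<in>{lo n..hi n}. ereal (ln (pr \<theta>0 \<alpha>))) \<ge> ereal (- (real n powr C3))"
    using pg unfolding prior_growth_cond_def lo_def hi_def by blast
  obtain k_lo k_hi where k: "0 < k_lo" "k_lo < q * kappa_lo ?d \<nu>" "0 < k_hi" "k_hi < q * kappa_hi ?d \<nu>"
    and tails: "\<forall>\<^sub>F n in sequentially.
          max (\<integral>\<^sup>+\<alpha>\<in>{0<..lo n}. ennreal (\<alpha> powr (- real n * (\<nu> + ?d / 2)) * pa \<alpha>) \<partial>lborel)
              (\<integral>\<^sup>+\<alpha>\<in>{0<..lo n}. ennreal (\<alpha> powr (- real n * (\<nu> + ?d / 2)) * pr \<theta>0 \<alpha> * pa \<alpha>) \<partial>lborel)
            \<le> ennreal (exp (k_lo * real n * ln (real n))) \<and>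
          max (\<integral>\<^sup>+\<alpha>\<in>{hi n..}. ennreal (\<alpha> powr (real n * (\<nu> + ?d / 2)) * pa \<alpha>) \<partial>lborel)
              (\<integral>\<^sup>+\<alpha>\<in>{hi n..}. ennreal (\<alpha> powr (real n * (\<nu> + ?d / 2)) * pr \<theta>0 \<alpha> * pa \<alpha>) \<partial>lborel)
            \<le> ennreal (exp (k_hi * real n * ln (real n)))"
    and pa: "\<And>\<alpha>. 0 < \<alpha> \<Longrightarrow> 0 \<le> pa \<alpha>" "continuous_on {0<..} pa" "(\<integral>\<^sup>+\<alpha>\<in>{0<..}. ennreal (pa \<alpha>) \<partial>lborel) = 1" "0 < pa \<alpha>0"
    using pt unfolding prior_tail_cond_def lo_def hi_def q_def by blast
  have pr\<theta>: "0 < pr \<theta>0 \<alpha>" if "0 < \<alpha>" for \<alpha> using pc that by (simp add: prior_cond_def)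
  obtain \<epsilon> where \<epsilon>: "0 < \<epsilon>" "\<And>\<alpha>. \<bar>\<alpha> - \<alpha>0\<bar> < \<epsilon> \<Longrightarrow> pa \<alpha>0 / 2 \<le> pa \<alpha> \<and> pr \<theta>0 \<alpha>0 / 2 \<le> pr \<theta>0 \<alpha>"
  proof -
    have "continuous_on {0<..} (pr \<theta>0)" using pc \<theta>0_pos by (auto simp: prior_cond_def)
    then have "isCont pa \<alpha>0" "isCont (pr \<theta>0) \<alpha>0" using pa(2) \<alpha>0 by (auto simp: continuous_on_eq_continuous_at)
    then have "\<forall>\<^sub>F \<alpha> in at \<alpha>0. pa \<alpha>0 / 2 < pa \<alpha>" "\<forall>\<^sub>F \<alpha> in at \<alpha>0. pr \<theta>0 \<alpha>0 / 2 < pr \<theta>0 \<alpha>"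
      using pa(4) pr\<theta>[OF \<alpha>0] unfolding isCont_def by (auto intro!: order_tendstoD simp del: less_divide_eq_numeral1 divide_less_eq_numeral1)
    then have "\<forall>\<^sub>F \<alpha> in at \<alpha>0. pa \<alpha>0 / 2 < pa \<alpha> \<and> pr \<theta>0 \<alpha>0 / 2 < pr \<theta>0 \<alpha>" by (rule eventually_conj)
    then obtain \<epsilon> where \<epsilon>: "0 < \<epsilon>" "\<And>\<alpha>. \<alpha> \<noteq> \<alpha>0 \<Longrightarrow> dist \<alpha> \<alpha>0 < \<epsilon> \<Longrightarrow> pa \<alpha>0 / 2 < pa \<alpha> \<and> pr \<theta>0 \<alpha>0 / 2 < pr \<theta>0 \<alpha>"
      by (auto simp: eventually_at)
    show ?thesis
    proof (rule that[OF \<epsilon>(1)])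
      fix \<alpha> assume "\<bar>\<alpha> - \<alpha>0\<bar> < \<epsilon>"
      then show "pa \<alpha>0 / 2 \<le> pa \<alpha> \<and> pr \<theta>0 \<alpha>0 / 2 \<le> pr \<theta>0 \<alpha>"
        using \<epsilon>(2)[of \<alpha>] pa(4) pr\<theta>[OF \<alpha>0] by (cases "\<alpha> = \<alpha>0") (auto simp: dist_real_def)
    qed
  qed
  \<comment> \<open>On [\<alpha>0, \<alpha>1] the prior for \<alpha> and the prior at \<theta>0 keep
    at least half their values at \<alpha>0; this interval carries the lower bound for the
    normaliser.\<close>
  define \<alpha>1 where "\<alpha>1 = \<alpha>0 + \<epsilon> / 2"
  have \<alpha>1: "\<alpha>0 < \<alpha>1" "0 < \<alpha>1" using \<epsilon> \<alpha>0 by (auto simp: \<alpha>1_def)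
  have near: "pa \<alpha>0 / 2 \<le> pa \<alpha>" "pr \<theta>0 \<alpha>0 / 2 \<le> pr \<theta>0 \<alpha>" if "\<alpha> \<in> {\<alpha>0..\<alpha>1}" for \<alpha>
    using \<epsilon>(2)[of \<alpha>] that \<epsilon>(1) by (auto simp: \<alpha>1_def)
  define G where "G = (1 + \<alpha>0 powr (2 * \<nu> + ?d) + \<alpha>0 powr (- (2 * \<nu> + ?d))) * (2 * (1 + (\<nu> + ?d / 2)))"
  have range0: "\<forall>\<^sub>F n in sequentially. 0 < lo n \<and> lo n \<le> \<alpha>0 \<and> \<alpha>0 \<le> hi n"
    and range1: "\<forall>\<^sub>F n in sequentially. 0 < lo n \<and> lo n \<le> \<alpha>1 \<and> \<alpha>1 \<le> hi n"
    unfolding lo_def hi_def by (intro alpha_range_eventually d1 \<nu> \<alpha>0 \<alpha>1)+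
  have gr: "\<forall>\<^sub>F n in sequentially. (1 + (\<alpha>0 / lo n) powr (2 * \<nu> + ?d) + (hi n / \<alpha>0) powr (2 * \<nu> + ?d)) *
      (2 * max 1 ((\<nu> + ?d / 2) * (hi n)\<^sup>2)) \<le> G * real n powr (1 / 8)"
    unfolding G_def lo_def hi_def by (rule alpha_range_growth[OF d1 \<nu> \<alpha>0])
  have gr2: "\<forall>\<^sub>F n in sequentially. (hi n / \<alpha>0) powr (2 * \<nu> + ?d) *
      (2 * max 1 ((\<nu> + ?d / 2) * (hi n)\<^sup>2)) \<le> G * real n powr (1 / 8)"
    using gr
  proof eventually_elim
    case (elim n)
    have "(hi n / \<alpha>0) powr (2 * \<nu> + ?d) * (2 * max 1 ((\<nu> + ?d / 2) * (hi n)\<^sup>2)) \<le>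
      (1 + (\<alpha>0 / lo n) powr (2 * \<nu> + ?d) + (hi n / \<alpha>0) powr (2 * \<nu> + ?d)) * (2 * max 1 ((\<nu> + ?d / 2) * (hi n)\<^sup>2))"
      by (intro mult_right_mono) auto
    with elim show ?case by linarith
  qed
  have hi0: "\<forall>\<^sub>F n in sequentially. \<alpha>0 \<le> hi n" using range0 by (auto elim: eventually_mono)
  note det = det_ratio_eventually[OF hi0 gr2]
  \<comment> \<open>As C1 < 1, the logarithm of the prior falls by at most 1 over an interval of
    length \<theta>0 / (n - p), which gives \<rho> = exp (-1).\<close>
  have ev1: "\<forall>\<^sub>F n in sequentially. real n powr C1 * (\<theta>0 / dof n) \<le> 1"
  proof -
    have "(\<lambda>n. \<theta>0 * (real n powr C1 / dof n)) \<longlonglongrightarrow> \<theta>0 * 0"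
      using C by (intro tendsto_mult tendsto_const) real_asymp
    then have "\<forall>\<^sub>F n in sequentially. \<theta>0 * (real n powr C1 / dof n) < 1" by (intro order_tendstoD) auto
    then show ?thesis by eventually_elim (simp add: mult_ac)
  qed
  define c1 c2 \<rho> where "c1 = pa \<alpha>0 / 2" and "c2 = pr \<theta>0 \<alpha>0 / 2" and "\<rho> = exp (- 1 :: real)"
  have c: "0 < c1" "0 < c2" "0 < \<rho>" using pa(4) pr\<theta>[OF \<alpha>0] by (auto simp: c1_def c2_def \<rho>_def)
  define t_lo t_hi where "t_lo n = exp (k_lo * real n * ln (real n))" and "t_hi n = exp (k_hi * real n * ln (real n))" for n :: nat
  define bnd where "bnd n = (exp (- (3 / 2 * dof n * (\<delta> n)\<^sup>2)) * real n powr C2 * (3 / 2 * \<theta>0) + exp (- (dof n / 64)) * exp (real n powr C3)) *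
       (dof n * exp (1 / 2) / (\<theta>0 * \<rho>)) +
     (lo n powr (q * n) * t_lo n * (\<alpha>1 / lo n) powr (q * p) + hi n powr (- (q * n)) * t_hi n * exp (real n / 2)) * exp (2 * \<delta> n * dof n) *
       (dof n * exp (1 / 2) / (c1 * c2 * \<rho> * \<theta>0 * (\<alpha>1 - \<alpha>0)))" for n
  have bnd: "bnd \<longlonglongrightarrow> 0"
  proof -
    define A where "A = exp (1 / 2) / (\<theta>0 * \<rho>)"
    define B where "B = exp (1 / 2) / (c1 * c2 * \<rho> * \<theta>0 * (\<alpha>1 - \<alpha>0))"
    \<comment> \<open>The strict inequalities in the tail condition leave these positive
      rates.\<close>
    define e_lo where "e_lo = q * kappa_lo ?d \<nu> - k_lo"
    define e_hi where "e_hi = q * kappa_hi ?d \<nu> - k_hi"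
    have e: "0 < e_lo" "0 < e_hi" using k by (auto simp: e_lo_def e_hi_def)
    define f1 where "f1 n = exp (- (3 / 2 * dof n * (\<delta> n)\<^sup>2)) * real n * dof n" for n
    define f2 where "f2 n = exp (- (dof n / 64)) * exp (real n powr C3) * dof n" for n
    define f3 where "f3 n = exp (- (e_lo * real n * ln (real n)) + q * p * kappa_lo ?d \<nu> * ln (real n)) *
      exp (2 * \<delta> n * dof n) * dof n" for n
    define f4 where "f4 n = exp (- (e_hi * real n * ln (real n)) + real n / 2) *
      exp (2 * \<delta> n * dof n) * dof n" for n
    have lim: "(\<lambda>n. 3 / 2 * \<theta>0 * A * f1 n + A * f2 n + (\<alpha>1 powr (q * p) * B * f3 n + B * f4 n)) \<longlonglongrightarrow> 3 / 2 * \<theta>0 * A * 0 + A * 0 + (\<alpha>1 powr (q * p) * B * 0 + B * 0)"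
      unfolding f1_def f2_def f3_def f4_def
      by (intro tendsto_add tendsto_mult_left contraction_rate(2) contraction_rate2 tail_rate C e)
    have AB: "0 \<le> A" "0 \<le> B" using \<theta>0_pos c \<alpha>1 by (auto simp: A_def B_def)
    have le: "\<forall>\<^sub>F n in sequentially. bnd n \<le> 3 / 2 * \<theta>0 * A * f1 n + A * f2 n + (\<alpha>1 powr (q * p) * B * f3 n + B * f4 n)"
      using eventually_gt_at_top[of p]
    proof eventually_elim
      case (elim n)
      then have n: "1 \<le> real n" "0 < dof n" using p by auto
      have l1: "lo n powr (q * n) * t_lo n = exp (- (e_lo * real n * ln (real n)))"
        using n by (simp add: lo_def alpha_lo_def t_lo_def e_lo_def powr_def algebra_simps flip: exp_add)
      have l2: "(\<alpha>1 / lo n) powr (q * p) = \<alpha>1 powr (q * p) * exp (q * p * kappa_lo ?d \<nu> * ln (real n))"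
      proof -
        have "\<alpha>1 / lo n = \<alpha>1 * real n powr kappa_lo ?d \<nu>" using n by (simp add: lo_def alpha_lo_def powr_minus_divide)
        then show ?thesis using n \<alpha>1 by (simp add: powr_mult powr_powr) (simp add: powr_def mult_ac)
      qed
      have h1: "hi n powr (- (q * n)) * t_hi n = exp (- (e_hi * real n * ln (real n)))"
        using n by (simp add: hi_def alpha_hi_def t_hi_def e_hi_def powr_def algebra_simps flip: exp_add)
      have f3: "\<alpha>1 powr (q * p) * B * f3 n = lo n powr (q * n) * t_lo n * (\<alpha>1 / lo n) powr (q * p) * exp (2 * \<delta> n * dof n) * dof n * B"
        unfolding l1 l2 f3_def exp_add by (simp only: mult_ac)
      have f4: "B * f4 n = hi n powr (- (q * n)) * t_hi n * exp (real n / 2) * exp (2 * \<delta> n * dof n) * dof n * B"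
        unfolding h1 f4_def exp_add by (simp only: mult_ac)
      \<comment> \<open>The prior ratio is rounded up to a full power of n, which the drop of the
        kernel absorbs.\<close>
      have "real n powr C2 \<le> real n powr 1" using n C by (intro powr_mono) auto
      then have "exp (- (3 / 2 * dof n * (\<delta> n)\<^sup>2)) * real n powr C2 * dof n \<le> f1 n"
        unfolding f1_def using n by (intro mult_right_mono mult_left_mono) auto
      then have f1: "3 / 2 * \<theta>0 * A * (exp (- (3 / 2 * dof n * (\<delta> n)\<^sup>2)) * real n powr C2 * dof n) \<le> 3 / 2 * \<theta>0 * A * f1 n"
        using AB \<theta>0_pos by (intro mult_left_mono) auto
      have "bnd n = 3 / 2 * \<theta>0 * A * (exp (- (3 / 2 * dof n * (\<delta> n)\<^sup>2)) * real n powr C2 * dof n) +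
        A * f2 n + (\<alpha>1 powr (q * p) * B * f3 n + B * f4 n)"
      proof -
        have id: "(x * R' * t + y * w) * (N * e / z) + (u + v) * g * (N * e / z') =
          t * (e / z) * (x * R' * N) + e / z * (y * w * N) + (u * g * N * (e / z') + v * g * N * (e / z'))"
          for x y z z' t w N e u v g R' :: real by (simp add: algebra_simps add_divide_distrib)
        show ?thesis unfolding f3 f4 unfolding bnd_def f2_def A_def B_def by (rule id)
      qed
      with f1 show ?case by linarith
    qed
    have "\<forall>\<^sub>F n in sequentially. 0 \<le> bnd n"
      using eventually_gt_at_top[of p]
      by eventually_elim (use c \<theta>0_pos \<alpha>1 in \<open>auto simp: bnd_def t_lo_def t_hi_def intro!: add_nonneg_nonneg mult_nonneg_nonneg divide_nonneg_nonneg\<close>)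
    from tendsto_sandwich[OF this le tendsto_const] lim show ?thesis by simp
  qed
  show ?thesis
    using rss_eventually[OF range0 gr]
  proof (rule AE_mp, intro AE_I2 impI)
    fix \<omega>
    assume "\<forall>\<^sub>F n in sequentially. \<forall>\<alpha>\<in>{lo n..hi n}.
      \<bar>design.rss n p m \<Omega> \<nu> (s n) (obs n \<omega>) \<alpha> - dof n * \<theta>0\<bar> \<le> 11 / 10 * \<delta> n * (dof n * \<theta>0)"
    with threshold_asymp(1,2) ev1 eventually_gt_at_top[of "p + 1"] growth tails range0 range1 det
    have main: "\<forall>\<^sub>F n in sequentially. prob_space (?P n \<omega>) \<and>
       measure (?P n \<omega>) (?B n) \<le> bnd n"
    proof eventually_elim
      case (elim n)
      have pn: "p < n" using elim(4) by simp
      then interpret design n p m \<Omega> \<nu> "s n" by (intro design_at) simp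
      have S: "\<bar>rss (obs n \<omega>) \<alpha> - dof n * \<theta>0\<bar> \<le> 11 / 10 * \<delta> n * (dof n * \<theta>0)"
        if "\<alpha> \<in> {lo n..hi n}" for \<alpha> using elim(10) that by blast
      have rng: "0 < lo n" "lo n \<le> \<alpha>0" "\<alpha>1 \<le> hi n" using elim(7,8) by auto
      have der: "\<bar>deriv (\<lambda>t. ln (pr t \<alpha>)) \<theta>\<bar> \<le> real n powr C1" and ratio: "pr \<theta> \<alpha> / pr \<theta>0 \<alpha> \<le> real n powr C2"
        if "\<alpha> \<in> {lo n..hi n}" "\<theta> \<in> {\<theta>0 / 2<..<2 * \<theta>0}" for \<alpha> \<theta>
        using elim(5) that unfolding SUP_le_iff by auto
      have V: "1 / pr \<theta>0 \<alpha> \<le> exp (real n powr C3)" if a: "\<alpha> \<in> {lo n..hi n}" for \<alpha>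
      proof -
        have p0: "0 < pr \<theta>0 \<alpha>" by (rule pr\<theta>) (use a rng in auto)
        have "ereal (- (real n powr C3)) \<le> ereal (ln (pr \<theta>0 \<alpha>))"
          using elim(5) a unfolding le_INF_iff by blast
        then have "- ln (pr \<theta>0 \<alpha>) \<le> real n powr C3" by simp
        then have "exp (- ln (pr \<theta>0 \<alpha>)) \<le> exp (real n powr C3)" by simp
        then show ?thesis using p0 by (simp add: exp_minus inverse_eq_divide)
      qed
      \<comment> \<open>The derivative bound holds on the open interval (\<theta>0 / 2, 2
        \<theta>0), which contains the interval bounding the normaliser once n - p > 1.\<close>
      have low: "\<rho> * pr \<theta>0 \<alpha> \<le> pr \<theta> \<alpha>"
        if a: "\<alpha> \<in> {lo n..hi n}" and t: "\<theta> \<in> {\<theta>0..\<theta>0 * (1 + 1 / dof n)}" for \<theta> \<alpha>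
      proof -
        have a0: "0 < \<alpha>" using a rng by auto
        have dt: "\<theta> - \<theta>0 \<le> \<theta>0 / dof n" using t by (simp add: distrib_left)
        have N: "1 < dof n" using elim(4) by simp
        have "\<theta>0 / dof n < \<theta>0 / 1" using N \<theta>0_pos by (intro divide_strict_left_mono) auto
        then have t2: "\<theta> < 2 * \<theta>0" using dt by simp
        have "real n powr C1 * (\<theta> - \<theta>0) \<le> real n powr C1 * (\<theta>0 / dof n)"
          using dt by (intro mult_left_mono) auto
        also have "\<dots> \<le> 1" by (rule elim)
        finally have "\<rho> \<le> exp (- (real n powr C1 * (\<theta> - \<theta>0)))" by (simp add: \<rho>_def)
        then have "\<rho> * pr \<theta>0 \<alpha> \<le> exp (- (real n powr C1 * (\<theta> - \<theta>0))) * pr \<theta>0 \<alpha>"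
          using pr\<theta>[OF a0] by (intro mult_right_mono) auto
        also have "\<dots> \<le> pr \<theta> \<alpha>"
        proof (rule nonneg_log_derivative_lower[where a = "\<theta>0 / 2" and b = "2 * \<theta>0" and h = "\<lambda>t. pr t \<alpha>"])
          show "0 \<le> pr u \<alpha>" "(\<lambda>t. pr t \<alpha>) field_differentiable at u" if "u \<in> {\<theta>0 / 2<..<2 * \<theta>0}" for u
            using pc a0 that \<theta>0_pos by (auto simp: prior_cond_def)
        qed (use t t2 \<theta>0_pos der[OF a] in auto)
        finally show ?thesis .
      qed
      have up: "pr \<theta> \<alpha> \<le> real n powr C2 * pr \<theta>0 \<alpha>" if "\<alpha> \<in> {lo n..hi n}" "\<theta> \<in> {\<theta>0 / 2<..<2 * \<theta>0}" for \<theta> \<alpha>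
        using ratio[OF that] pr\<theta>[of \<alpha>] that rng by (simp add: pos_divide_le_eq)
      have tl: "(\<integral>\<^sup>+\<alpha>\<in>{0<..lo n}. ennreal (\<alpha> powr (- real n * (\<nu> + ?d / 2)) * pa \<alpha>) \<partial>lborel) \<le> ennreal (t_lo n)"
        "(\<integral>\<^sup>+\<alpha>\<in>{hi n..}. ennreal (\<alpha> powr (real n * (\<nu> + ?d / 2)) * pa \<alpha>) \<partial>lborel) \<le> ennreal (t_hi n)"
        using elim(6) unfolding t_lo_def t_hi_def by auto
      have t0: "0 \<le> t_lo n" "0 \<le> t_hi n" by (simp_all add: t_lo_def t_hi_def)
      note b = posterior_bound[OF pn obs_carrier \<theta>0_pos T pc pa(1-3) rng(1,2) \<alpha>1(1) rng(3) elim(1,2) S c(3) _ V low up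
          c(1,2) near(1)[folded c1_def] near(2)[folded c2_def] t0 tl elim(9), folded q_def]
      show ?case unfolding bnd_def using b by simp
    qed
    have "(\<lambda>n. measure (?P n \<omega>) (?B n)) \<longlonglongrightarrow> 0"
      by (rule tendsto_sandwich[OF _ _ tendsto_const bnd])
         (use main in \<open>auto elim: eventually_mono\<close>)
    with main show "(\<forall>\<^sub>F n in sequentially. prob_space (?P n \<omega>)) \<and>
      (\<lambda>n. measure (?P n \<omega>) (?B n)) \<longlonglongrightarrow> 0"
      by (auto elim: eventually_mono)
  qed
qed

end

text \<open>Besides the convergence, each part asserts that the posterior is eventually a
  probability measure, which excludes a degenerate normaliser in
  \<open>density_proportional\<close>. Both parts become the contraction results once
  \<open>obs\<close> is recognised, entry by entry, as regression mean plus noise.\<close>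

theorem theorem4:
  fixes T \<nu> \<sigma>0 \<alpha>0 \<theta>0 :: real
    and p :: nat
    and m :: "nat \<Rightarrow> real ^ 'd \<Rightarrow> real"
    and \<beta>0 :: "real Matrix.vec"
    and \<Omega> :: "real Matrix.mat"
    and prior_th :: "real \<Rightarrow> real \<Rightarrow> real"
    and prior_al :: "real \<Rightarrow> real"
    and s :: "nat \<Rightarrow> nat \<Rightarrow> real ^ 'd"
    and M :: "'a measure"
    and X Y :: "real ^ 'd \<Rightarrow> 'a \<Rightarrow> real"
    and obs :: "nat \<Rightarrow> 'a \<Rightarrow> real Matrix.vec"
  assumes "CARD('d) \<in> {1, 2, 3}" and "0 < T" and "0 < \<nu>" and "1 \<le> p"
    and "0 < \<sigma>0" and "0 < \<alpha>0" and "\<beta>0 \<in> carrier_vec p"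
    and "\<theta>0 = \<sigma>0\<^sup>2 * \<alpha>0 powr (2 * \<nu>)"
    and "centered_gp M (cube T) X (\<lambda>t u. \<sigma>0\<^sup>2 * matern \<nu> \<alpha>0 (t - u))"
    and "\<And>t \<omega>. t \<in> cube T \<Longrightarrow> Y t \<omega> = scalar_prod (reg_vec p m t) \<beta>0 + X t \<omega>"
    and "\<And>n i. i < n \<Longrightarrow> s n i \<in> cube T" and "\<And>n. inj_on (s n) {..<n}"
    and "\<And>n \<omega>. obs n \<omega> = Matrix.vec n (\<lambda>i. Y (s n i) \<omega>)"
  shows
    "(regressor_cond p m \<nu> T s \<and> prior_cond p \<Omega> \<theta>0 prior_th \<longrightarrow>
     (\<forall>\<alpha>>0. AE \<omega> in M.
       (\<forall>\<^sub>F n in sequentially.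
          prob_space (posterior_given_alpha p m \<Omega> \<nu> prior_th (s n) n (obs n \<omega>) \<alpha>)) \<and>
       (\<lambda>n. measure (posterior_given_alpha p m \<Omega> \<nu> prior_th (s n) n (obs n \<omega>) \<alpha>)
          {\<theta>. 0 < \<theta> \<and> pred_var_dev p m \<Omega> \<nu> T \<theta>0 (s n) n \<theta> \<alpha>
                        > ereal (7 * real n powr (- 1 / 2) * ln (real n))})
       \<longlonglongrightarrow> 0)) \<and>
     (regressor_cond p m \<nu> T s \<and> prior_cond p \<Omega> \<theta>0 prior_th \<and>
     prior_growth_cond (real CARD('d)) \<nu> \<theta>0 prior_th \<and>
     prior_tail_cond (real CARD('d)) \<nu> \<theta>0 \<alpha>0 prior_th prior_al \<longrightarrow>
     (AE \<omega> in M.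
       (\<forall>\<^sub>F n in sequentially.
          prob_space (posterior p m \<Omega> \<nu> prior_th prior_al (s n) n (obs n \<omega>))) \<and>
       (\<lambda>n. measure (posterior p m \<Omega> \<nu> prior_th prior_al (s n) n (obs n \<omega>))
          {(\<theta>, \<alpha>). 0 < \<theta> \<and> 0 < \<alpha> \<and> pred_var_dev p m \<Omega> \<nu> T \<theta>0 (s n) n \<theta> \<alpha>
                        > ereal (7 * real n powr (- 1 / 2) * ln (real n))})
       \<longlonglongrightarrow> 0))"
  (is "(_ \<longrightarrow> (\<forall>\<alpha>>0. ?i' \<alpha>)) \<and> (_ \<longrightarrow> ?ii)")
proof -
  have main: "infill_regression T \<nu> \<sigma>0 \<alpha>0 \<theta>0 p m \<beta>0 \<Omega> s M X"
    if "regressor_cond p m \<nu> T s" "prior_cond p \<Omega> \<theta>0 prior_th"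
    by unfold_locales (use assms that in \<open>auto simp: regressor_cond_def prior_cond_def\<close>)
  have obs: "obs = infill_regression.obs p m \<beta>0 s X"
    if "infill_regression T \<nu> \<sigma>0 \<alpha>0 \<theta>0 p m \<beta>0 \<Omega> s M X"
  proof (intro ext)
    fix n \<omega>
    show "obs n \<omega> = infill_regression.obs p m \<beta>0 s X n \<omega>"
      unfolding infill_regression.obs_def[OF that] assms(13) using assms(7,10,11)
      by (intro eq_vecI) (auto simp: design_mat_def reg_vec_def scalar_prod_def)
  qed
  have 1: "\<forall>\<alpha>>0. ?i' \<alpha>" if "regressor_cond p m \<nu> T s \<and> prior_cond p \<Omega> \<theta>0 prior_th"
  proof (intro allI impI)
    fix \<alpha> :: real assume "0 < \<alpha>"
    from that have pc: "prior_cond p \<Omega> \<theta>0 prior_th" and I: "infill_regression T \<nu> \<sigma>0 \<alpha>0 \<theta>0 p m \<beta>0 \<Omega> s M X"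
      using main by auto
    show "?i' \<alpha>"
      using infill_regression.given_alpha_contraction[OF I pc \<open>0 < \<alpha>\<close>] by (simp only: obs[OF I] mult.assoc)
  qed
  have 2: ?ii if "regressor_cond p m \<nu> T s \<and> prior_cond p \<Omega> \<theta>0 prior_th \<and>
     prior_growth_cond (real CARD('d)) \<nu> \<theta>0 prior_th \<and>
     prior_tail_cond (real CARD('d)) \<nu> \<theta>0 \<alpha>0 prior_th prior_al"
  proof -
    from that have I: "infill_regression T \<nu> \<sigma>0 \<alpha>0 \<theta>0 p m \<beta>0 \<Omega> s M X" using main by auto
    show ?thesis
      using infill_regression.posterior_contraction[OF I, of prior_th prior_al] that by (simp only: obs[OF I] mult.assoc)
  qed
  from 1 2 show ?thesis by blast
qed

end
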